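(* For $1\le p_1<p<p_2\le+\infty$, \[ W^{1,p}(K)=\big(W^{1,p_1}(K),W^{1,p_2}(K)\big)_{\theta,p}, \] where $\theta\in(0,1)$ is such that \[ \frac1p=\frac{1-\theta}{p_1}+\frac{\theta}{p_2}. \]
   Context: Vicsek set. In $\mathbb R^2$ let $q_1=(-\sqrt2/2,\sqrt2/2)$, $q_2=(\sqrt2/2,\sqrt2/2)$, $q_3=(\sqrt2/2,-\sqrt2/2)$, $q_4=(-\sqrt2/2,-\sqrt2/2)$, $q_5=(0,0)$ and $\psi_i(z)=\frac13(z-q_i)+q_i$, $1\le i\le5$. $K$ is the unique non-empty compact set with $K=\bigcup_{i=1}^5\psi_i(K)$. Cable systems. $V_0=\{q_1,\dots,q_5\}$, $\bar V_0$ is the union of the four segments (edges) $[q_5,q_i]$, $1\le i\le4$; $V_{n+1}=\bigcup_i\psi_i(V_n)$, $\bar V_{n+1}=\bigcup_i\psi_i(\bar V_n)$. The edges of $\bar V_n$ are the images of the edges of $\bar V_0$ under the maps $\psi_{i_1}\circ\cdots\circ\psi_{i_n}$; they have length $3^{-n}$, and $\bar V_n$ is a tree with vertex set $V_n$. Vertices $u,v\in V_n$ are adjacent if they are joined by an edge of $\bar V_n$, denoted $\mathbf e(u,v)$. The skeleton is $\mathcal S=\bigcup_n\bar V_n$, which is dense in $K$. $d$ is the geodesic distance: for $x,y\in\bar V_n$, $d(x,y)$ is the length of the path in $\bar V_n$ from $x$ to $y$, extended by continuity to $K\times K$. For adjacent $u,v$ one writes $u\le v$ if $d(q_5,u)<d(q_5,v)$.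 $B(x,r)=\{y\in K:d(x,y)\le r\}$. $\mu$ is the Borel probability measure on $K$ with $\mu(\psi_{i_1}\circ\cdots\circ\psi_{i_n}(K))=5^{-n}$; $d_h=\log5/\log3$. $\nu$ is the ($\sigma$-finite) Lebesgue (length) measure on $\mathcal S$: $\nu(\mathbf e)=3^{-n}$ for every edge $\mathbf e$ of $\bar V_n$. Sobolev spaces. For $1<p<\infty$ put $\alpha_p=1-\frac1p+\frac{d_h}p$ and \[\|f\|_{W^{1,p}(K)}=\limsup_{r\to0^+}\frac1{r^{\alpha_p}}\Big(\int_K\int_{B(x,r)}\frac{|f(y)-f(x)|^p}{\mu(B(x,r))}d\mu(y)d\mu(x)\Big)^{1/p};\] $W^{1,p}(K)$ is the set of $f\in L^p(K,\mu)$ for which this is finite; its elements have continuous representatives and $W^{1,p}(K)$ is regarded as a subspace of $C(K)$. $W^{1,\infty}(K)$ is the set of Lipschitz functions on $(K,d)$ with seminorm $\|f\|_{W^{1,\infty}(K)}=\sup_{x\ne y}|f(x)-f(y)|/d(x,y)$. $W^{1,1}(K)$ is the set of $f\in C(K)$ for which there is $g\in L^1(\mathcal S,\nu)$ (then unique) with $f(v)-f(u)=\int_{\mathbf e(u,v)}g\,d\nu$ for every $n$ and all adjacent $u,v\in V_n$ with $u\le v$; its seminorm is $\|f\|_{W^{1,1}(K)}=\int_{\mathcal S}|g|\,d\nu$. Interpolation ($K$-method for seminormed spaces). For $f\in X_0+X_1$, $t>0$, $K(f,t)=\inf\{\|f_0\|_{X_0}+t\|f_1\|_{X_1}: f=f_0+f_1\}$;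 for $0<\theta<1$, $1\le q<\infty$, $(X_0,X_1)_{\theta,q}$ is the set of $f\in X_0+X_1$ with finite seminorm $\big(\int_0^\infty(t^{-\theta}K(f,t))^q\frac{dt}t\big)^{1/q}$. Here $X_0=W^{1,p_1}(K)$ and $X_1=W^{1,p_2}(K)$ with the seminorms above. Equality of the spaces is understood in the usual sense of interpolation theory: same functions, with equivalent seminorms. *)

theory Defs
  imports "HOL-Probability.Probability"
begin

section \<open>The Vicsek set and its cable systems\<close>

definition q :: "nat \<Rightarrow> real \<times> real" where
  "q i = [(- sqrt 2 / 2, sqrt 2 / 2), (sqrt 2 / 2, sqrt 2 / 2), (sqrt 2 / 2, - sqrt 2 / 2),
          (- sqrt 2 / 2, - sqrt 2 / 2), (0, 0)] ! (i - 1)"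

definition psi :: "nat \<Rightarrow> real \<times> real \<Rightarrow> real \<times> real" where
  "psi i z = (1 / 3) *\<^sub>R (z - q i) + q i"

definition vicsek :: "(real \<times> real) set" where
  "vicsek = (THE K. compact K \<and> K \<noteq> {} \<and> K = (\<Union>i\<in>{1..5}. psi i ` K))"

definition words :: "nat \<Rightarrow> nat list set" where
  "words n = {w. length w = n \<and> set w \<subseteq> {1..5}}"

text \<open>For \<open>w = [i\<^sub>1, \<dots>, i\<^sub>n]\<close> this is \<open>psi i\<^sub>1 \<circ> \<dots> \<circ> psi i\<^sub>n\<close>.\<close>

definition psi_word :: "nat list \<Rightarrow> real \<times> real \<Rightarrow> real \<times> real" where
  "psi_word w = foldr (\<lambda>i g. psi i \<circ> g) w id"

primrec V :: "nat \<Rightarrow> (real \<times> real) set" where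
  "V 0 = q ` {1..5}"
| "V (Suc n) = (\<Union>i\<in>{1..5}. psi i ` V n)"

primrec Vbar :: "nat \<Rightarrow> (real \<times> real) set" where
  "Vbar 0 = (\<Union>i\<in>{1..4}. closed_segment (q 5) (q i))"
| "Vbar (Suc n) = (\<Union>i\<in>{1..5}. psi i ` Vbar n)"

definition edges :: "nat \<Rightarrow> (real \<times> real) set set" where
  "edges n = {psi_word w ` closed_segment (q 5) (q i) | w i. w \<in> words n \<and> i \<in> {1..4}}"

text \<open>The edge \<open>\<^bold>e(u,v)\<close> joining adjacent vertices \<open>u\<close>, \<open>v\<close> is \<^term>\<open>closed_segment u v\<close>.\<close>

definition adjacent :: "nat \<Rightarrow> real \<times> real \<Rightarrow> real \<times> real \<Rightarrow> bool" where
  "adjacent n u v \<longleftrightarrow> u \<in> V n \<and> v \<in> V n \<and> closed_segment u v \<in> edges n"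

definition skeleton :: "(real \<times> real) set" where
  "skeleton = (\<Union>n. Vbar n)"

section \<open>Geodesic distance\<close>

definition curve_length :: "(real \<Rightarrow> 'a::metric_space) \<Rightarrow> ennreal" where
  "curve_length g =
     (SUP ts \<in> {ts. sorted ts \<and> set ts \<subseteq> {0..1}}.
        \<Sum>i<length ts - 1. ennreal (dist (g (ts ! i)) (g (ts ! Suc i))))"

text \<open>As \<^term>\<open>Vbar n\<close> is a tree, the path in it from \<open>x\<close> to \<open>y \<noteq> x\<close> is an arc which is unique up
  to reparametrization, and since the sets \<^term>\<open>Vbar n\<close> increase with \<open>n\<close>, the value below does
  not depend on \<open>n\<close>. The case \<open>x = y\<close> is separate because \<^const>\<open>arc\<close> demands injectivity.\<close>

definition skeleton_dist :: "real \<times> real \<Rightarrow> real \<times> real \<Rightarrow> real" where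
  "skeleton_dist x y =
     (if x = y then 0
      else enn2real (THE l. \<exists>n g. x \<in> Vbar n \<and> y \<in> Vbar n \<and> arc g \<and> path_image g \<subseteq> Vbar n \<and>
                                  pathstart g = x \<and> pathfinish g = y \<and> l = curve_length g))"

text \<open>The extension by continuity to \<open>K \<times> K\<close>. At points of \<open>skeleton \<times> skeleton\<close> the limit is
  \<^const>\<open>skeleton_dist\<close> itself, because the latter is continuous.\<close>

definition vdist :: "real \<times> real \<Rightarrow> real \<times> real \<Rightarrow> real" where
  "vdist x y = Lim (at (x, y) within skeleton \<times> skeleton) (\<lambda>(a, b). skeleton_dist a b)"

definition vball :: "real \<times> real \<Rightarrow> real \<Rightarrow> (real \<times> real) set" where
  "vball x r = {y \<in> vicsek. vdist x y \<le> r}"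

section \<open>Measures\<close>

definition vmu :: "(real \<times> real) measure" where
  "vmu = (THE M. sets M = sets (restrict_space borel vicsek) \<and> prob_space M \<and>
                 (\<forall>n. \<forall>w\<in>words n. emeasure M (psi_word w ` vicsek) = ennreal (1 / 5 ^ n)))"

text \<open>The values on all edges of all levels determine the length measure on the Borel sets of the
  skeleton: the edges of each cable system are subdivided by those of the next one.\<close>

definition vnu :: "(real \<times> real) measure" where
  "vnu = (THE M. sets M = sets (restrict_space borel skeleton) \<and> sigma_finite_measure M \<and>
                 (\<forall>n. \<forall>e\<in>edges n. emeasure M e = ennreal (1 / 3 ^ n)))"

section \<open>Sobolev spaces\<close>

text \<open>The spaces consist of functions on \<^const>\<open>vicsek\<close>, represented by functions on the whole
  plane whose values outside \<^const>\<open>vicsek\<close> are arbitrary: every condition and every seminorm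
  below depends on the restriction to \<^const>\<open>vicsek\<close> only. Seminorms take values in
  \<^typ>\<open>ennreal\<close>.\<close>

definition ennpowr :: "ennreal \<Rightarrow> real \<Rightarrow> ennreal" where
  "ennpowr x a = (if x = \<top> then \<top> else ennreal (enn2real x powr a))"

definition dim_h :: real where
  "dim_h = ln 5 / ln 3"

definition alpha :: "real \<Rightarrow> real" where
  "alpha p = 1 - 1 / p + dim_h / p"

definition Lp_vicsek :: "real \<Rightarrow> (real \<times> real \<Rightarrow> real) set" where
  "Lp_vicsek p = {f. f \<in> borel_measurable vmu \<and> integrable vmu (\<lambda>x. \<bar>f x\<bar> powr p)}"

definition sobolev_seminorm_p :: "real \<Rightarrow> (real \<times> real \<Rightarrow> real) \<Rightarrow> ennreal" where
  "sobolev_seminorm_p p f =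
     Limsup (at_right 0) (\<lambda>r. ennreal (1 / r powr alpha p) *
       ennpowr (\<integral>\<^sup>+x. (\<integral>\<^sup>+y\<in>vball x r. ennreal (\<bar>f y - f x\<bar> powr p) / emeasure vmu (vball x r) \<partial>vmu)
                  \<partial>vmu) (1 / p))"

text \<open>For \<open>1 < p < \<infinity>\<close> the space is regarded as a subspace of \<open>C(K)\<close>, that is, its elements are
  taken to be the continuous representatives.\<close>

definition sobolev_p :: "real \<Rightarrow> (real \<times> real \<Rightarrow> real) set" where
  "sobolev_p p = {f \<in> Lp_vicsek p. continuous_on vicsek f \<and> sobolev_seminorm_p p f < \<top>}"

definition sobolev_inf :: "(real \<times> real \<Rightarrow> real) set" where
  "sobolev_inf = {f. \<exists>L. \<forall>x\<in>vicsek. \<forall>y\<in>vicsek. \<bar>f x - f y\<bar> \<le> L * vdist x y}"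

definition sobolev_seminorm_inf :: "(real \<times> real \<Rightarrow> real) \<Rightarrow> ennreal" where
  "sobolev_seminorm_inf f =
     (SUP (x, y) \<in> {(x, y). x \<in> vicsek \<and> y \<in> vicsek \<and> x \<noteq> y}. ennreal (\<bar>f x - f y\<bar> / vdist x y))"

definition is_gradient :: "(real \<times> real \<Rightarrow> real) \<Rightarrow> (real \<times> real \<Rightarrow> real) \<Rightarrow> bool" where
  "is_gradient f g \<longleftrightarrow> integrable vnu g \<and>
     (\<forall>n u v. adjacent n u v \<and> vdist (q 5) u < vdist (q 5) v \<longrightarrow>
        f v - f u = (LINT x:closed_segment u v|vnu. g x))"

definition sobolev_1 :: "(real \<times> real \<Rightarrow> real) set" where
  "sobolev_1 = {f. continuous_on vicsek f \<and> (\<exists>g. is_gradient f g)}"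

text \<open>The gradient is unique up to \<^const>\<open>vnu\<close>-null sets.\<close>

definition sobolev_seminorm_1 :: "(real \<times> real \<Rightarrow> real) \<Rightarrow> ennreal" where
  "sobolev_seminorm_1 f = (THE l. \<exists>g. is_gradient f g \<and> l = (\<integral>\<^sup>+x. ennreal \<bar>g x\<bar> \<partial>vnu))"

definition W1 :: "ereal \<Rightarrow> (real \<times> real \<Rightarrow> real) set" where
  "W1 p = (if p = 1 then sobolev_1 else if p = \<infinity> then sobolev_inf
           else sobolev_p (real_of_ereal p))"

definition W1_seminorm :: "ereal \<Rightarrow> (real \<times> real \<Rightarrow> real) \<Rightarrow> ennreal" where
  "W1_seminorm p = (if p = 1 then sobolev_seminorm_1 else if p = \<infinity> then sobolev_seminorm_inf
                    else sobolev_seminorm_p (real_of_ereal p))"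

section \<open>Real interpolation of seminormed spaces of functions\<close>

text \<open>A couple of seminormed spaces \<open>(X0, N0)\<close>, \<open>(X1, N1)\<close> is given by sets of functions and the
  seminorms on them. Requiring \<open>f = f0 + f1\<close> on the whole domain is harmless for the
  spaces above, as they allow arbitrary values outside \<^const>\<open>vicsek\<close>.\<close>

definition sum_space :: "('a \<Rightarrow> real) set \<Rightarrow> ('a \<Rightarrow> real) set \<Rightarrow> ('a \<Rightarrow> real) set" where
  "sum_space X0 X1 = {(\<lambda>x. f0 x + f1 x) | f0 f1. f0 \<in> X0 \<and> f1 \<in> X1}"

definition K_functional ::
  "('a \<Rightarrow> real) set \<Rightarrow> (('a \<Rightarrow> real) \<Rightarrow> ennreal) \<Rightarrow> ('a \<Rightarrow> real) set \<Rightarrow> (('a \<Rightarrow> real) \<Rightarrow> ennreal) \<Rightarrow>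
   ('a \<Rightarrow> real) \<Rightarrow> real \<Rightarrow> ennreal" where
  "K_functional X0 N0 X1 N1 f t =
     Inf {N0 f0 + ennreal t * N1 f1 | f0 f1. f0 \<in> X0 \<and> f1 \<in> X1 \<and> f = (\<lambda>x. f0 x + f1 x)}"

definition interp_seminorm ::
  "('a \<Rightarrow> real) set \<Rightarrow> (('a \<Rightarrow> real) \<Rightarrow> ennreal) \<Rightarrow> ('a \<Rightarrow> real) set \<Rightarrow> (('a \<Rightarrow> real) \<Rightarrow> ennreal) \<Rightarrow>
   real \<Rightarrow> real \<Rightarrow> ('a \<Rightarrow> real) \<Rightarrow> ennreal" where
  "interp_seminorm X0 N0 X1 N1 \<theta> s f =
     ennpowr (\<integral>\<^sup>+t\<in>{0<..}. ennpowr (ennreal (t powr (- \<theta>)) * K_functional X0 N0 X1 N1 f t) s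
                * ennreal (1 / t) \<partial>lborel) (1 / s)"

definition interp_space ::
  "('a \<Rightarrow> real) set \<Rightarrow> (('a \<Rightarrow> real) \<Rightarrow> ennreal) \<Rightarrow> ('a \<Rightarrow> real) set \<Rightarrow> (('a \<Rightarrow> real) \<Rightarrow> ennreal) \<Rightarrow>
   real \<Rightarrow> real \<Rightarrow> ('a \<Rightarrow> real) set" where
  "interp_space X0 N0 X1 N1 \<theta> s =
     {f \<in> sum_space X0 X1. interp_seminorm X0 N0 X1 N1 \<theta> s f < \<top>}"

text \<open>Same elements, equivalent seminorms.\<close>

definition equal_seminormed_spaces ::
  "('a \<Rightarrow> real) set \<Rightarrow> (('a \<Rightarrow> real) \<Rightarrow> ennreal) \<Rightarrow> ('a \<Rightarrow> real) set \<Rightarrow> (('a \<Rightarrow> real) \<Rightarrow> ennreal) \<Rightarrow>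
   bool" where
  "equal_seminormed_spaces X N Y M \<longleftrightarrow>
     X = Y \<and> (\<exists>C::real. C > 0 \<and> (\<forall>f\<in>X. N f \<le> ennreal C * M f \<and> M f \<le> ennreal C * N f))"

end

theory Submission
 imports Defs
begin

text \<open>The Sobolev seminorm of order \<open>p > 1\<close> is equivalent to the supremum over \<open>n\<close> of the discrete
\<open>p\<close>-energies of the increments along the edges of level \<open>n\<close>. If these are bounded, the difference
quotients form a martingale on each edge which is bounded in \<open>L\<^sup>p\<close>; strict convexity of
\<open>sqrt (1 + x\<^sup>2)\<close> makes it Cauchy in \<open>L\<^sup>1\<close>, and its limit is a gradient. Conversely, as the
cable systems are trees, each function in \<open>L\<^sup>p\<close> on the skeleton is a gradient. So the problem is the
interpolation of Lebesgue spaces: \<open>f\<close> is split by cutting its gradient at the value \<open>T t\<close> of its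
decreasing rearrangement, and Hardy's inequality, in the form of geometric sums over dyadic scales,
bounds the interpolation seminorm. The converse bound is the weak type inequality for both parts.\<close>

text \<open>The objects of the statement are given by descriptions or limits, so the attractor, the
  path length, the extended distance and both measures must first be shown to exist and to be
  unique. Explicit models do this: the closure of the vertices, a sum over cells of retracted points
  in place of paths, the image of a Bernoulli measure, the increasing limit of lengths in the cable
  systems. The length measure is infinite, so gradients for p > 1 are only locally integrable;
  existence and uniqueness are therefore treated edge by edge. The end points p1 = 1 and p2 =
  infinity need no lifting of their own: the large part of a gradient in L^p is dominated by it,
  hence stays in L^p with p > 1 and is lifted there, and the small part is reached by subtraction.
  Cutting at the level exceeded on a set of measure at most t^a, where 1/a = 1/p1 - 1/p2, gives the
  two parts norms of order t^\<theta> and t^(\<theta> - 1), which balances the two terms of the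
  K-functional.\<close>

abbreviation "K == vicsek"
abbreviation "pw == psi_word"
abbreviation "ind == indicator"

section \<open>The attractor and its cells\<close>

text \<open>The corner antipodal to \<open>q i\<close>. It enters because the cell \<open>i\<close>
  is attached to the central cell at the image of its own corner \<open>opp i\<close>, as
  \<open>psi_touch\<close> shows.\<close>

definition opp :: "nat => nat" where
 "opp i = (if i = 5 then 5 else if i <= 2 then i + 2 else i - 2)"

lemma idx4: "i : {1..4::nat} \<longleftrightarrow> i = 1 \<or> i = 2 \<or> i = 3 \<or> i = 4" by auto

lemma idx5: "i : {1..5::nat} \<longleftrightarrow> i = 1 \<or> i = 2 \<or> i = 3 \<or> i = 4 \<or> i = 5" by auto

lemma set5: "{1..5::nat} = {1, 2, 3, 4, 5}" and set4: "{1..4::nat} = {1, 2, 3, 4}" by auto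

lemma q_simps:
 "q 1 = (- sqrt 2 / 2, sqrt 2 / 2)" "q (Suc 0) = (- sqrt 2 / 2, sqrt 2 / 2)"
 "q 2 = (sqrt 2 / 2, sqrt 2 / 2)" "q 3 = (sqrt 2 / 2, - sqrt 2 / 2)"
 "q 4 = (- sqrt 2 / 2, - sqrt 2 / 2)" "q 5 = (0, 0)" by (simp_all add: q_def)

lemma q5: "q 5 = 0" by (simp add: q_simps zero_prod_def)

lemma opp_simps [simp]: "opp 1 = 3" "opp (Suc 0) = 3" "opp 2 = 4" "opp 3 = 1" "opp 4 = 2" "opp 5 = 5"
 by (simp_all add: opp_def)

lemma opp_mem: "i : {1..5} ==> opp i : {1..5}" "i : {1..4} ==> opp i : {1..4}" by (auto simp: opp_def)

lemma q_opp: "i : {1..5} ==> q (opp i) = - q i" unfolding idx5 by (elim disjE) (simp_all add: q_simps)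

lemma opp_neq: "i : {1..4} ==> opp i ~= i" by (auto simp: opp_def)

lemma inner_q_q:
 assumes "i : {1..5}" "j : {1..5}"
 shows "q i \<bullet> q j = (if i = 5 \<or> j = 5 then 0 else if i = j then 1 else if i = opp j then -1 else 0)"
 using assms unfolding idx5 by (elim disjE) (simp_all add: q_simps inner_prod_def)

lemma norm_q: "i : {1..4} ==> norm (q i) = 1" using inner_q_q[of i i] by (auto simp: norm_eq_sqrt_inner)

lemma inj_q: "inj_on q {1..5}"
proof (rule inj_onI)
 fix i j assume "i : {1..5::nat}" "j : {1..5::nat}" "q i = q j"
 thus "i = j" using inner_q_q[of i j] inner_q_q[of i i] inner_q_q[of j j] by (auto split: if_splits)
qed

lemma psi_eq: "psi i z = (1/3) *\<^sub>R z + (2/3) *\<^sub>R q i" by (simp add: psi_def algebra_simps flip: scaleR_left_distrib)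

lemma psi_q: "psi i (q i) = q i" by (simp add: psi_def)

lemma psi_5: "psi 5 z = (1/3) *\<^sub>R z" by (simp add: psi_eq q5)

lemma psi_touch: "i : {1..5} ==> psi 5 (q i) = psi i (q (opp i))"
 by (simp add: psi_eq q5 q_opp flip: scaleR_minus_left scaleR_left_distrib)

lemma psi_diff: "psi i x - psi i y = (1/3) *\<^sub>R (x - y)" by (simp add: psi_eq algebra_simps)

lemma dist_psi: "dist (psi i x) (psi i y) = dist x y / 3" by (simp add: dist_norm psi_diff)

lemma psi_inject [simp]: "psi i x = psi i y \<longleftrightarrow> x = y"
 using dist_psi[of i x y] by (metis dist_eq_0_iff divide_eq_0_iff zero_neq_numeral)

lemma inj_psi: "inj (psi i)" by (auto intro: injI)

lemma continuous_on_psi [continuous_intros]: "continuous_on A f ==> continuous_on A (%x. psi i (f x))"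
 unfolding psi_eq by (intro continuous_intros)

section \<open>Words and compositions of the contractions\<close>

lemma psi_word_Nil [simp]: "pw [] = id" by (simp add: psi_word_def)

lemma psi_word_Cons: "pw (i # w) = psi i \<circ> pw w" by (simp add: psi_word_def)

lemma psi_word_append: "pw (v @ w) = pw v \<circ> pw w"
 by (induction v) (simp_all add: psi_word_Cons comp_assoc)

lemma psi_word_snoc: "pw (w @ [i]) x = pw w (psi i x)" by (simp add: psi_word_append psi_word_Cons)

lemma psi_word_diff: "pw w x - pw w y = (1 / 3 ^ length w) *\<^sub>R (x - y)"
 by (induction w) (simp_all add: psi_word_Cons psi_diff)

lemma dist_psi_word: "dist (pw w x) (pw w y) = dist x y / 3 ^ length w"
 by (simp add: dist_norm psi_word_diff)

lemma psi_word_affine: "pw w x = pw w 0 + (1 / 3 ^ length w) *\<^sub>R x"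
 using psi_word_diff[of w x 0] by (simp add: algebra_simps)

lemma psi_word_inject [simp]: "pw w x = pw w y \<longleftrightarrow> x = y"
 using dist_psi_word[of w x y] by (metis dist_eq_0_iff divide_eq_0_iff power_not_zero zero_neq_numeral)

lemma continuous_on_psi_word [continuous_intros]:
 "continuous_on A f ==> continuous_on A (%x. pw w (f x))" by (subst psi_word_affine) (intro continuous_intros)

lemma words_0 [simp]: "words 0 = {[]}" by (auto simp: words_def)

lemma words_Suc: "words (Suc n) = (%(i, w). i # w) ` ({1..5} \<times> words n)"
 unfolding words_def by (auto simp: length_Suc_conv image_iff)

lemma UN_words_Suc: "(UN u:words (Suc n). F u) = (UN i:{1..5}. UN w:words n. F (i # w))" by (auto simp: words_Suc)

lemma words_SucE:
 assumes "v : words (Suc n)"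
 obtains i w where "v = i # w" "i : {1..5}" "w : words n" using assms by (cases v) (auto simp: words_def)

lemma append_in_words: "length v = m ==> v @ w : words (m + n) \<longleftrightarrow> v : words m & w : words n" by (auto simp: words_def)

lemma snoc_in_words: "w @ [i] : words (Suc n) \<longleftrightarrow> w : words n & i : {1..5}" by (auto simp: words_def)

lemma words_length: "w : words n ==> length w = n" by (simp add: words_def)

lemma words_add: "words (m + n) = (%(v, w). v @ w) ` (words m \<times> words n)"
proof -
 have "u : (%(v, w). v @ w) ` (words m \<times> words n)" if "u : words (m + n)" for u
 proof
  show "u = (case (take m u, drop m u) of (v, w) => v @ w)" by simp
  show "(take m u, drop m u) : words m \<times> words n"
   using that set_take_subset[of m u] set_drop_subset[of m u] by (auto simp: words_def)
 qed
 thus ?thesis by (auto simp: append_in_words words_length)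
qed

lemma inj_append_words: "inj_on (%(v, w). v @ w) (words m \<times> B)"
 by (auto simp: inj_on_def words_length append_eq_append_conv)

lemma finite_words [simp]: "finite (words n)" by (induction n) (simp_all add: words_Suc)

lemma sum_words_add: "(SUM u:words (m + n). f u) = (SUM v:words m. SUM w:words n. f (v @ w))"
 unfolding words_add by (subst sum.reindex[OF inj_append_words]) (simp add: sum.cartesian_product case_prod_beta)

lemma sum_words_Cons: "(SUM u:words (Suc n). f u) = (SUM i:{1..5}. SUM w:words n. f (i # w))"
proof -
 have "inj_on (%(i, w). i # w) ({1..5::nat} \<times> words n)" by (auto simp: inj_on_def)
 thus ?thesis unfolding words_Suc by (subst sum.reindex) (simp_all add: sum.cartesian_product case_prod_beta)
qed

lemma words_1: "words (Suc 0) = (%i. [i]) ` {1..5}" by (auto simp: words_Suc)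

lemma sum_words_snoc: "(SUM u:words (Suc n). f u) = (SUM w:words n. SUM i:{1..5}. f (w @ [i]))"
proof -
 have "inj_on (%i. [i]) {1..5::nat}" by (auto simp: inj_on_def)
 thus ?thesis using sum_words_add[of f n 1] by (simp add: words_1 sum.reindex)
qed

lemma sum5: "(SUM i:{1..5::nat}. f i) = f 1 + f 2 + f 3 + f 4 + f 5" by (simp add: numeral_eq_Suc add.assoc)

lemma sum4: "(SUM i:{1..4::nat}. f i) = f 1 + f 2 + f 3 + f 4" by (simp add: numeral_eq_Suc add.assoc)

lemma V_eq: "V n = (UN w:words n. pw w ` q ` {1..5})"
proof (induction n)
 case (Suc n)
 show ?case unfolding V.simps Suc UN_words_Suc by (simp add: image_UN psi_word_Cons image_comp)
qed simp

lemma Vbar_eq: "Vbar n = (UN w:words n. pw w ` Vbar 0)"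
proof (induction n)
 case (Suc n)
 show ?case unfolding Vbar.simps(2) Suc UN_words_Suc by (simp add: image_UN psi_word_Cons image_comp)
qed simp

text \<open>The convex hull of the corners, which all five maps preserve. It contains the attractor,
  so cells can be separated by the coordinates of squares.\<close>

definition sqr :: "(real \<times> real) set" where
 "sqr = {z. \<bar>fst z\<bar> <= sqrt 2 / 2 & abs (snd z) <= sqrt 2 / 2}"

lemma closed_sqr: "closed sqr"
proof -
 have "sqr = {z. \<bar>fst z\<bar> <= sqrt 2 / 2} Int {z. \<bar>snd z\<bar> <= sqrt 2 / 2}" by (auto simp: sqr_def)
 also have "closed ..." by (intro closed_Int closed_Collect_le continuous_intros)
 finally show ?thesis .
qed

lemma norm_sqr: "z : sqr ==> norm z <= 1"
proof -
 assume z: "z : sqr"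
 have "(fst z)\<^sup>2 <= (sqrt 2 / 2)\<^sup>2" "(snd z)\<^sup>2 <= (sqrt 2 / 2)\<^sup>2"
  using z by (auto simp: sqr_def intro!: abs_le_square_iff[THEN iffD1])
 hence "(fst z)\<^sup>2 + (snd z)\<^sup>2 <= 1" by (simp add: power_divide)
 thus ?thesis by (simp add: norm_prod_def)
qed

lemma q_in_sqr: "i : {1..5} ==> q i : sqr" unfolding idx5 by (elim disjE) (simp_all add: q_simps sqr_def)

lemma psi_sqr: assumes "i : {1..5}" "z : sqr" shows "psi i z : sqr"
proof -
 have "fst (psi i z) = (1/3) * fst z + (2/3) * fst (q i)"
   "snd (psi i z) = (1/3) * snd z + (2/3) * snd (q i)" by (simp_all add: psi_eq)
 moreover have "abs (fst z) <= sqrt 2 / 2" "abs (snd z) <= sqrt 2 / 2"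
   "abs (fst (q i)) <= sqrt 2 / 2" "abs (snd (q i)) <= sqrt 2 / 2" using assms(2) q_in_sqr[OF assms(1)] by (auto simp: sqr_def)
 ultimately have "abs (fst (psi i z)) <= sqrt 2 / 2" "abs (snd (psi i z)) <= sqrt 2 / 2" by linarith+
 thus ?thesis by (simp add: sqr_def)
qed

section \<open>Existence and uniqueness of the attractor\<close>

lemma V_mono: "V n <= V (Suc n)"
proof (induction n)
 case 0
 have "q i : psi i ` q ` {1..5}" if "i : {1..5}" for i using that psi_q[of i] by (metis image_eqI)
 thus ?case by auto
next
 case (Suc n)
 thus ?case unfolding V.simps(2)[of n] V.simps(2)[of "Suc n"] by (intro UN_mono image_mono) auto
qed

lemma V_mono': "m <= n ==> V m <= V n" by (rule lift_Suc_mono_le[of V]) (use V_mono in auto)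

text \<open>A concrete candidate for the attractor: invariance of the increasing union of the
  \<open>V n\<close> passes to its closure, since the five maps commute with closures.\<close>

definition attr :: "(real \<times> real) set" where "attr = closure (\<Union>n. V n)"

lemma V_sqr: "V n <= sqr"
proof (induction n)
 case 0
 show ?case unfolding V.simps using q_in_sqr by blast
next
 case (Suc n)
 thus ?case unfolding V.simps using psi_sqr by blast
qed

lemma compact_attr: "compact attr"
proof -
 have "attr <= sqr" unfolding attr_def by (rule closure_minimal) (use V_sqr closed_sqr in auto)
 moreover have "bounded sqr" unfolding bounded_iff using norm_sqr by blast
 ultimately show ?thesis unfolding attr_def by (simp add: compact_eq_bounded_closed bounded_subset)
qed

lemma psi_closure: "psi i ` closure A = closure (psi i ` A)"
proof -
 have "psi i ` B = (+) ((2/3) *\<^sub>R q i) ` ((*\<^sub>R) (1/3) ` B)" for B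
  unfolding image_comp by (auto simp: psi_eq algebra_simps)
 thus ?thesis by (simp add: closure_translation closure_scaleR)
qed

lemma closure_finite_UN: "finite I ==> closure (UN i:I. F i) = (UN i:I. closure (F i))"
 by (induction rule: finite_induct) (simp_all add: closure_Un)

lemma attr_fixed: "attr = (UN i:{1..5}. psi i ` attr)"
proof -
 have "(UN i:{1..5}. psi i ` attr) = (UN i:{1..5}. closure (psi i ` (\<Union>n. V n)))" by (simp add: attr_def psi_closure)
 also have "... = closure (UN i:{1..5}. psi i ` (\<Union>n. V n))" by (subst closure_finite_UN) simp_all
 also have "(UN i:{1..5}. psi i ` (\<Union>n. V n)) = (\<Union>n. V (Suc n))" by auto
 also have "... = (\<Union>n. V n)" using V_mono by blast
 finally show ?thesis by (simp add: attr_def)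
qed

lemma fixed_words:
 assumes "L = (UN i:{1..5}. psi i ` L)" shows "L = (UN w:words n. pw w ` L)"
proof (induction n)
 case (Suc n)
 have "L = (UN i:{1..5}. psi i ` (UN w:words n. pw w ` L))" using assms Suc by metis
 also have "... = (UN w:words (Suc n). pw w ` L)"
  unfolding UN_words_Suc by (simp add: image_UN psi_word_Cons image_comp)
 finally show ?case .
qed simp

text \<open>Points of \<open>L\<close> are images under words of length \<open>n\<close>, hence
  within B/3^n of images of one fixed point of \<open>M\<close>. Used in both directions, this
  identifies any two non-empty compact fixed sets.\<close>

lemma fixed_subset:
 assumes "compact L" "L = (UN i:{1..5}. psi i ` L)" and "compact M" "M ~= {}" "M = (UN i:{1..5}. psi i ` M)" shows "L <= M"
proof
 fix x assume x: "x : L"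
 obtain y0 where y0: "y0 : M" using assms(4) by blast
 obtain B where B: "!!z. z : L ==> dist z y0 <= B"
  using compact_imp_bounded[OF assms(1)] unfolding bounded_any_center[of _ y0] by (metis dist_commute)
 have "x : closure M" unfolding closure_approachable
 proof (intro allI impI)
  fix e :: real assume e: "e > 0"
  obtain n where n: "B / 3 ^ n < e"
  proof -
   have "(%n. B / 3 ^ n) \<longlonglongrightarrow> 0" by real_asymp
   hence "eventually (%n. B / 3 ^ n < e) sequentially" using e by (rule order_tendstoD)
   thus ?thesis using that by (auto simp: eventually_sequentially)
  qed
  obtain w y where w: "w : words n" "y : L" "x = pw w y" using fixed_words[OF assms(2), of n] x by blast
  have "pw w y0 : M" using fixed_words[OF assms(5), of n] y0 w(1) by blast
  moreover have "dist (pw w y0) x < e"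
  proof -
   have "dist (pw w y0) x = dist y y0 / 3 ^ n" using w by (simp add: dist_psi_word words_length dist_commute)
   also have "... <= B / 3 ^ n" using B[OF w(2)] by (simp add: divide_right_mono)
   finally show ?thesis using n by linarith
  qed
  ultimately show "EX y:M. dist y x < e" by blast
 qed
 thus "x : M" using assms(3) by (simp add: compact_imp_closed)
qed

lemma attr_nonempty: "attr ~= {}"
proof -
 have "q 1 : V 0" by simp
 thus ?thesis unfolding attr_def using closure_subset by blast
qed

lemma vicsek_attr: "K = attr" unfolding vicsek_def
proof (rule the_equality)
 show "compact attr & attr ~= {} & attr = (UN i:{1..5}. psi i ` attr)"
  by (intro conjI compact_attr attr_nonempty attr_fixed)
 fix L assume L: "compact L & L ~= {} & L = (UN i:{1..5}. psi i ` L)"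
 show "L = attr"
 proof
  show "L <= attr"
   by (rule fixed_subset[OF conjunct1[OF L] conjunct2[OF conjunct2[OF L]] compact_attr attr_nonempty attr_fixed])
  show "attr <= L" by (rule fixed_subset[OF compact_attr attr_fixed conjunct1[OF L] conjunct1[OF conjunct2[OF L]]
      conjunct2[OF conjunct2[OF L]]])
 qed
qed

lemma compact_vicsek: "compact K" and vicsek_nonempty: "K ~= {}"
 and vicsek_fixed: "K = (UN i:{1..5}. psi i ` K)"
 unfolding vicsek_attr by (fact compact_attr, fact attr_nonempty, fact attr_fixed)

lemma vicsek_sqr: "K <= sqr"
 unfolding vicsek_attr attr_def by (rule closure_minimal) (use V_sqr closed_sqr in auto)

lemma vicsek_words: "K = (UN w:words n. pw w ` K)" by (rule fixed_words[OF vicsek_fixed])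

lemma psi_vicsek: "i : {1..5} ==> x : K ==> psi i x : K" using vicsek_fixed by blast

lemma psi_word_vicsek: "w : words n ==> x : K ==> pw w x : K" using vicsek_words[of n] by blast

lemma vicsekE:
 assumes "x : K" obtains i y where "i : {1..5}" "y : K" "x = psi i y" using assms vicsek_fixed by blast

lemma vicsek_wordE:
 assumes "x : K" obtains w y where "w : words n" "y : K" "x = pw w y"
 using assms vicsek_words[of n] by blast

lemma V_vicsek: "V n <= K" unfolding vicsek_attr attr_def by (rule order_trans[OF _ closure_subset]) auto

lemma q_vicsek: "i : {1..5} ==> q i : K" using V_vicsek[of 0] by auto

lemma norm_vicsek: "x : K ==> norm x <= 1" using norm_sqr vicsek_sqr by blast

lemma dist_vicsek: "x : K ==> y : K ==> dist x y <= 2"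
 using norm_vicsek[of x] norm_vicsek[of y] norm_triangle_ineq4[of x y] by (simp add: dist_norm)

lemma closed_cell: "closed (pw w ` K)"
 by (intro compact_imp_closed compact_continuous_image compact_vicsek continuous_on_psi_word continuous_on_id)

section \<open>Separation of the five cells\<close>

lemma psi_coord:
 "i = 5 ==> z : sqr ==> \<bar>fst (psi i z)\<bar> <= sqrt 2 / 6 & abs (snd (psi i z)) <= sqrt 2 / 6"
 "i = 1 ==> z : sqr ==> fst (psi i z) <= - sqrt 2 / 6 & snd (psi i z) \<ge> sqrt 2 / 6"
 "i = 2 ==> z : sqr ==> fst (psi i z) \<ge> sqrt 2 / 6 & snd (psi i z) \<ge> sqrt 2 / 6"
 "i = 3 ==> z : sqr ==> fst (psi i z) \<ge> sqrt 2 / 6 & snd (psi i z) <= - sqrt 2 / 6"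
 "i = 4 ==> z : sqr ==> fst (psi i z) <= - sqrt 2 / 6 & snd (psi i z) <= - sqrt 2 / 6"
 by (auto simp: psi_eq q_simps sqr_def)

text \<open>Two different corner squares lie on opposite sides of the middle third in at least one
  coordinate, and this strip has width sqrt 2 / 3.\<close>

lemma corner_cells_dist:
 assumes "i : {1..4}" "j : {1..4}" "i ~= j" "x : sqr" "y : sqr" shows "dist (psi i x) (psi j y) \<ge> sqrt 2 / 3"
proof -
 have "fst (psi i x) <= - sqrt 2 / 6 & sqrt 2 / 6 <= fst (psi j y) \<or>
    fst (psi j y) <= - sqrt 2 / 6 & sqrt 2 / 6 <= fst (psi i x) \<or>
    snd (psi i x) <= - sqrt 2 / 6 & sqrt 2 / 6 <= snd (psi j y) \<or>
    snd (psi j y) <= - sqrt 2 / 6 & sqrt 2 / 6 <= snd (psi i x)"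
  using assms(1-3) psi_coord[OF _ assms(4), of i] psi_coord[OF _ assms(5), of j] unfolding idx4
  by (elim disjE) simp_all
 hence "abs (fst (psi i x) - fst (psi j y)) \<ge> sqrt 2 / 3 \<or> \<bar>snd (psi i x) - snd (psi j y)\<bar> \<ge> sqrt 2 / 3"
  by (elim disjE) (auto simp: abs_if)
 thus ?thesis using dist_fst_le[of "psi i x" "psi j y"] dist_snd_le[of "psi i x" "psi j y"]
  by (auto simp: dist_real_def)
qed

text \<open>Seen from their common point, the central square and a corner square lie in opposite
  quadrants, so the angle is never acute. By \<open>dist_obtuse\<close> the touching point is then
  no farther from either point than they are from each other.\<close>

lemma touch_inner:
 assumes "i : {1..4}" "x : sqr" "y : sqr" shows "(psi 5 x - psi 5 (q i)) \<bullet> (psi i y - psi 5 (q i)) <= 0"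
proof -
 have x: "abs (fst x) <= sqrt 2 / 2" "abs (snd x) <= sqrt 2 / 2" and y: "abs (fst y) <= sqrt 2 / 2" "abs (snd y) <= sqrt 2 / 2"
  using assms by (auto simp: sqr_def)
 have "psi 5 x - psi 5 (q i) = (1/3) *\<^sub>R (x - q i)" "psi i y - psi 5 (q i) = (1/3) *\<^sub>R (y + q i)"
  using assms(1) psi_diff[of 5 x "q i"] psi_diff[of i y "q (opp i)"] psi_touch[of i] q_opp[of i] by auto
 moreover have "(x - q i) \<bullet> (y + q i) <= 0"
 proof -
  have *: "(a - c) * (b + c) <= 0" if "abs a <= abs c" "abs b <= abs c" for a b c :: real
  proof (cases "c \<ge> 0")
   case True
   thus ?thesis using that by (intro mult_nonpos_nonneg) linarith+
  next
   case False
   thus ?thesis using that by (intro mult_nonneg_nonpos) linarith+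
  qed
  have "abs (fst (q i)) = sqrt 2 / 2" "abs (snd (q i)) = sqrt 2 / 2" using assms(1) unfolding idx4 by (auto simp: q_simps)
  thus ?thesis using *[of "fst x" "fst (q i)" "fst y"] *[of "snd x" "snd (q i)" "snd y"] x y
   by (simp add: inner_prod_def)
 qed
 ultimately show ?thesis by simp
qed

lemma dist_obtuse:
 fixes u v c :: "'a::real_inner"
 assumes "(u - c) \<bullet> (v - c) <= 0" shows "(dist u c)\<^sup>2 + (dist v c)\<^sup>2 <= (dist u v)\<^sup>2"
proof -
 have "(norm (u - v))\<^sup>2 = (norm (u - c))\<^sup>2 - 2 * ((u - c) \<bullet> (v - c)) + (norm (v - c))\<^sup>2"
  by (simp add: power2_norm_eq_inner inner_diff_left inner_diff_right inner_commute)
 thus ?thesis using assms by (simp add: dist_norm)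
qed

lemma touch_dist:
 assumes "i : {1..4}" "x : sqr" "y : sqr" shows "dist (psi 5 x) (psi 5 (q i)) <= dist (psi 5 x) (psi i y)"
  and "dist (psi i y) (psi 5 (q i)) <= dist (psi 5 x) (psi i y)"
proof -
 note * = dist_obtuse[OF touch_inner[OF assms]]
 show "dist (psi 5 x) (psi 5 (q i)) <= dist (psi 5 x) (psi i y)"
  by (rule power2_le_imp_le) (use * zero_le_power2[of "dist (psi i y) (psi 5 (q i))"]
     zero_le_power2[of "dist (psi 5 x) (psi 5 (q i))"] in \<open>linarith, simp\<close>)
 show "dist (psi i y) (psi 5 (q i)) <= dist (psi 5 x) (psi i y)"
  by (rule power2_le_imp_le) (use * zero_le_power2[of "dist (psi i y) (psi 5 (q i))"]
     zero_le_power2[of "dist (psi 5 x) (psi 5 (q i))"] in \<open>linarith, simp\<close>)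
qed

lemma cells_disjoint:
 assumes "i : {1..4}" "j : {1..4}" "i ~= j" "x : K" "y : K" shows "psi i x ~= psi j y"
proof -
 have "sqrt 2 / 3 <= dist (psi i x) (psi j y)" using assms vicsek_sqr by (intro corner_cells_dist) auto
 moreover have "sqrt 2 > (0::real)" by simp
 ultimately show ?thesis by (smt (verit) dist_self divide_pos_pos)
qed

lemma cells_meet_5:
 assumes "i : {1..4}" "x : K" "y : K" "psi 5 x = psi i y" shows "x = q i" "y = q (opp i)"
proof -
 have *: "dist (psi 5 x) (psi 5 (q i)) <= dist (psi 5 x) (psi i y)" using assms vicsek_sqr by (intro touch_dist) auto
 thus "x = q i" using assms by simp
 hence "psi i y = psi i (q (opp i))" using assms psi_touch[of i] by auto
 thus "y = q (opp i)" by simp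
qed

text \<open>In some coordinate the corner lies at distance sqrt 2 / 2 from the origin, on a side
  where the cell \<open>i\<close> reaches at most sqrt 2 / 6.\<close>

lemma corner_dist:
 assumes "a : {1..4}" "i : {1..5}" "i ~= a" "x : sqr" shows "dist (psi i x) (q a) \<ge> sqrt 2 / 3"
proof -
 have "fst (psi i x) <= sqrt 2 / 6 & sqrt 2 / 2 <= fst (q a) \<or>
    fst (q a) <= - sqrt 2 / 2 & - sqrt 2 / 6 <= fst (psi i x) \<or>
    snd (psi i x) <= sqrt 2 / 6 & sqrt 2 / 2 <= snd (q a) \<or>
    snd (q a) <= - sqrt 2 / 2 & - sqrt 2 / 6 <= snd (psi i x)"
 proof -
  \<comment> \<open>Writing sqrt 2 as 6 c turns the coordinate bounds into linear arithmetic in a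
    positive unknown.\<close>
  obtain c :: real where c: "sqrt 2 = 6 * c" "c > 0" using that[of "sqrt 2 / 6"] by simp
  show ?thesis using assms(1-3) psi_coord[OF _ assms(4), of i] c(2) unfolding idx4 idx5 c(1)
   by (elim disjE) (auto simp: q_simps c(1) abs_le_iff)
 qed
 hence "abs (fst (psi i x) - fst (q a)) \<ge> sqrt 2 / 3 \<or> \<bar>snd (psi i x) - snd (q a)\<bar> \<ge> sqrt 2 / 3"
  by (elim disjE) (auto simp: abs_if)
 thus ?thesis using dist_fst_le[of "psi i x" "q a"] dist_snd_le[of "psi i x" "q a"] by (auto simp: dist_real_def)
qed

lemma corner_psi:
 assumes "a : {1..4}" "i : {1..5}" "x : K" "psi i x = q a" shows "i = a" "x = q a"
proof -
 show "i = a"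
 proof (rule ccontr)
  assume "i ~= a"
  hence "sqrt 2 / 3 <= dist (psi i x) (q a)" using assms vicsek_sqr by (intro corner_dist) auto
  moreover have "sqrt 2 > (0::real)" by simp
  ultimately show False using assms(4) by simp
 qed
 thus "x = q a" using assms(4) psi_q[of a] by (metis psi_inject)
qed

section \<open>Zooming into cells\<close>

text \<open>The path to a point in the cell \<open>i \<noteq> j\<close> leaves the cell \<open>j\<close> at the image of the corner
 \<open>exit j i\<close>; accordingly \<open>zoom j\<close> is the retraction onto the cell \<open>j\<close> followed by
 the inverse of \<open>psi j\<close>.\<close>

definition exit :: "nat => nat => nat" where
 "exit j i = (if j = 5 then i else opp j)"

definition zoom :: "nat => real \<times> real => real \<times> real" where
 "zoom j x = (if x : psi j ` K then 3 *\<^sub>R x - 2 *\<^sub>R q j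
       else q (exit j (SOME i. i : {1..5} & x : psi i ` K)))"

lemma exit_mem: "j : {1..5} ==> i : {1..5} ==> i ~= j ==> exit j i : {1..4}" by (auto simp: exit_def opp_def)

lemma zoom_same: "y : K ==> zoom j (psi j y) = y"
 by (simp add: zoom_def psi_eq algebra_simps flip: scaleR_left_distrib)

text \<open>The branches of \<open>zoom\<close> agree: a point that also lies in the cell
  \<open>j\<close> is the touching point, and otherwise the index found by \<open>SOME\<close> is
  irrelevant, because \<open>exit j\<close> is constant for j other than 5 and distinct corner cells
  are disjoint.\<close>

lemma zoom_other:
 assumes "i : {1..5}" "j : {1..5}" "i ~= j" "y : K" shows "zoom j (psi i y) = q (exit j i)"
proof (cases "psi i y : psi j ` K")
 case True
 then obtain y' where y': "y' : K" "psi i y = psi j y'" by blast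
 have "i = 5 \<or> j = 5" using cells_disjoint[of i j y y'] assms y' by fastforce
 hence "y' = q (exit j i)"
 proof
  assume "i = 5"
  thus ?thesis using cells_meet_5(2)[of j y y'] assms y' by (auto simp: exit_def)
 next
  assume "j = 5"
  thus ?thesis using cells_meet_5(1)[of i y' y] assms y' by (auto simp: exit_def)
 qed
 thus ?thesis using zoom_same[OF y'(1), of j] y'(2) by simp
next
 case False
 define i' where "i' = (SOME i'. i' : {1..5} & psi i y : psi i' ` K)"
 have i': "i' : {1..5} & psi i y : psi i' ` K" unfolding i'_def by (rule someI[of _ i]) (use assms in auto)
 have "exit j i' = exit j i"
 proof (cases "j = 5")
  case True
  hence "i : {1..4}" "i' : {1..4}" using assms i' False by (cases "i' = 5"; auto)+
  thus ?thesis using cells_disjoint[of i i' y] i' assms(4) by fastforce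
 qed (simp add: exit_def)
 thus ?thesis using False by (simp add: zoom_def i'_def)
qed

lemma zoom_vicsek: assumes "j : {1..5}" "x : K" shows "zoom j x : K"
proof -
 obtain i y where "i : {1..5}" "y : K" "x = psi i y" using assms(2) by (rule vicsekE)
 moreover from this have "exit j i : {1..5}" if "i ~= j" using exit_mem[of j i] assms that by auto
 ultimately show ?thesis using assms by (cases "i = j") (auto simp: zoom_same zoom_other intro!: q_vicsek)
qed

lemma zoom_eq_noncorner:
 assumes "j : {1..5}" "x : K" "zoom j x ~: q ` {1..4}" shows "x = psi j (zoom j x)"
proof -
 obtain i y where *: "i : {1..5}" "y : K" "x = psi i y" using assms(2) by (rule vicsekE)
 have "i = j"
 proof (rule ccontr)
  assume "i ~= j"
  hence "zoom j x = q (exit j i)" "exit j i : {1..4}" using zoom_other[of i j y] exit_mem[of j i] * assms(1) by auto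
  thus False using assms(3) by simp
 qed
 thus ?thesis using * by (simp add: zoom_same)
qed

lemma continuous_on_zoom:
 assumes j: "j : {1..5}" shows "continuous_on K (zoom j)"
proof -
 have cells: "K = (UN i:{1..5}. psi i ` K)" by (rule vicsek_fixed)
 have "continuous_on (UN i:{1..5}. psi i ` K) (zoom j)"
 proof (rule continuous_on_closed_Union)
  fix i :: nat assume i: "i : {1..5}"
  show "closed (psi i ` K)"
   by (intro compact_imp_closed compact_continuous_image compact_vicsek continuous_intros)
  show "continuous_on (psi i ` K) (zoom j)"
  proof (cases "i = j")
   case True
   have "continuous_on (psi i ` K) (%x. 3 *\<^sub>R x - 2 *\<^sub>R q j)" by (intro continuous_intros)
   thus ?thesis by (rule continuous_on_eq) (use True in \<open>auto simp: zoom_def\<close>)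
  next
   case False
   have "continuous_on (psi i ` K) (%x. q (exit j i))" by (intro continuous_intros)
   thus ?thesis by (rule continuous_on_eq) (use False i j zoom_other in auto)
  qed
 qed auto
 thus ?thesis using cells by simp
qed

text \<open>Only the retraction onto the cell of \<open>x\<close> keeps \<open>x\<close>; each of
  the others yields a touching point with the central cell, and together these are all four of them.
  In differences the constants cancel, so increments split over the cells.\<close>

lemma zoom_decomp:
 fixes f :: "real \<times> real => 'a::ab_group_add"
 assumes "x : K" shows "(SUM j:{1..5}. f (psi j (zoom j x))) = f x + (SUM j:{1..4}. f (psi 5 (q j)))"
proof -
 obtain i y where *: "i : {1..5}" "y : K" "x = psi i y" using assms by (rule vicsekE)
 have same: "psi i (zoom i x) = x" using * by (simp add: zoom_same)
 have other: "f (psi j (zoom j x)) = (if j = 5 then f (psi 5 (q i)) else f (psi 5 (q j)))"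
  if "j : {1..5}" "j ~= i" for j using zoom_other[of i j y] that * psi_touch[of j] by (auto simp: exit_def)
 have "(SUM j:{1..5}. f (psi j (zoom j x)))
  = (SUM j:{1..5}. if j = i then f x else if j = 5 then f (psi 5 (q i)) else f (psi 5 (q j)))"
  by (rule sum.cong) (use same other in auto)
 also have "... = f x + (SUM j:{1..4}. f (psi 5 (q j)))"
  using *(1) unfolding idx5 sum5 sum4 by (elim disjE) (simp_all add: algebra_simps)
 finally show ?thesis .
qed

lemma zoom_decomp_diff:
 fixes f :: "real \<times> real => 'a::ab_group_add"
 assumes "x : K" "y : K" shows "f x - f y = (SUM j:{1..5}. f (psi j (zoom j x)) - f (psi j (zoom j y)))"
 using zoom_decomp[OF assms(1), of f] zoom_decomp[OF assms(2), of f] by (simp add: sum_subtractf)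

section \<open>Retractions onto cells of arbitrary level\<close>

primrec zoomw :: "nat list => real \<times> real => real \<times> real" where
 "zoomw [] x = x"
| "zoomw (j # w) x = zoomw w (zoom j x)"

lemma zoomw_vicsek: "w : words n ==> x : K ==> zoomw w x : K"
 by (induction w arbitrary: n x) (auto simp: words_def zoom_vicsek)

lemma continuous_on_zoomw: "w : words n ==> continuous_on K (zoomw w)"
proof (induction w arbitrary: n)
 case (Cons j w)
 obtain m where m: "w : words m" "j : {1..5}" using Cons.prems by (auto simp: words_def)
 have "continuous_on K (zoomw w \<circ> zoom j)" by (rule continuous_on_compose[OF continuous_on_zoom[OF m(2)]])
   (rule continuous_on_subset[OF Cons.IH[OF m(1)]], use zoom_vicsek m in auto)
 thus ?case by (simp add: comp_def)
qed simp

lemma zoomw_psi_word: "w : words n ==> y : K ==> zoomw w (pw w y) = y"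
proof (induction w arbitrary: n)
 case (Cons j w)
 then obtain m where "w : words m" by (auto simp: words_def)
 thus ?case using Cons by (simp add: psi_word_Cons zoom_same psi_word_vicsek)
qed simp

lemma corner_psi_word:
 "a : {1..4} ==> w : words n ==> x : K ==> pw w x = q a ==> x = q a"
proof (induction w arbitrary: n)
 case (Cons j w)
 then obtain m where "w : words m" "j : {1..5}" by (auto simp: words_def)
 thus ?case using Cons.IH[of m] Cons.prems corner_psi(2)[of a j "pw w x"] 
  by (simp add: psi_word_Cons psi_word_vicsek)
qed simp

text \<open>Retraction sends everything outside the cell to corners, so a value that is not a corner
  certifies that the point lies in the cell. This later recovers a point from its coordinate on an
  edge.\<close>

lemma zoomw_eq_noncorner:
 "w : words n ==> x : K ==> zoomw w x ~: q ` {1..4} ==> x = pw w (zoomw w x)"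
proof (induction w arbitrary: n x)
 case (Cons j w)
 then obtain m where m: "w : words m" "j : {1..5}" by (auto simp: words_def)
 have *: "zoom j x = pw w (zoomw (j # w) x)"
  using Cons.IH[OF m(1), of "zoom j x"] Cons.prems zoom_vicsek[OF m(2)] by simp
 have "zoom j x ~: q ` {1..4}"
 proof
  assume "zoom j x : q ` {1..4}"
  then obtain a where a: "a : {1..4}" "zoom j x = q a" by blast
  have "zoomw (j # w) x = q a" by (rule corner_psi_word[OF a(1) m(1)])
    (use * a zoomw_vicsek[OF m(1) q_vicsek, of a] in simp_all)
  thus False using Cons.prems a(1) by blast
 qed
 hence "x = psi j (zoom j x)" by (rule zoom_eq_noncorner[OF m(2) Cons.prems(2)])
 also have "... = pw (j # w) (zoomw (j # w) x)" by (simp only: psi_word_Cons comp_apply *[symmetric])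
 finally show ?case .
qed simp

text \<open>Paths from \<open>w\<close> into another cell of the same level leave \<open>w\<close>
  through one point, so the whole cell \<open>v\<close> collapses to one corner. The intersections
  of cells, those of edges and the injectivity of the centres all rest on this.\<close>

lemma zoomw_other_const:
 "v : words n ==> w : words n ==> v ~= w ==> EX a:{1..4}. ALL y:K. zoomw w (pw v y) = q a"
proof (induction n arbitrary: v w)
 case (Suc n)
 obtain i v' j w' where vw: "v = i # v'" "w = j # w'" "i : {1..5}" "j : {1..5}" "v' : words n" "w' : words n"
  using words_SucE[OF Suc.prems(1)] words_SucE[OF Suc.prems(2)] by metis
 show ?case
 proof (cases "i = j")
  case True
  then obtain a where "a : {1..4}" "ALL y:K. zoomw w' (pw v' y) = q a"
   using Suc.IH[OF vw(5,6)] Suc.prems(3) vw by auto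
  thus ?thesis using vw True by (auto simp: psi_word_Cons zoom_same psi_word_vicsek)
 next
  case False
  have *: "zoomw w (pw v y) = zoomw w' (q (exit j i))" if "y : K" for y
   using vw False that zoom_other[of i j "pw v' y"] by (auto simp: psi_word_Cons psi_word_vicsek)
  \<comment> \<open>Corners stay corners under further retractions, so the constant produced by the
    first differing letter survives the remaining zooms.\<close>
  have corner: "EX b:{1..4}. zoomw u (q a) = q b" if "a : {1..4}" "u : words m" for a u m using that
  proof (induction u arbitrary: a m)
   case (Cons k u)
   then obtain m' where m: "u : words m'" "k : {1..5}" by (auto simp: words_def)
   show ?case
   proof (cases "k = a")
    case True
    thus ?thesis using Cons.IH[OF Cons.prems(1) m(1)] zoom_same[OF q_vicsek, of a a] Cons.prems(1)
     by (auto simp: psi_q)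
   next
    case False
    hence "zoom k (q a) = q (exit k a)" "exit k a : {1..4}"
     using zoom_other[of a k "q a"] Cons.prems m q_vicsek[of a] exit_mem[of k a] by (auto simp: psi_q)
    thus ?thesis using Cons.IH[OF _ m(1)] by simp
   qed
  qed auto
  have "exit j i : {1..4}" using exit_mem[of j i] vw False by auto
  then obtain b where "b : {1..4}" "zoomw w' (q (exit j i)) = q b" using corner vw(6) by blast
  thus ?thesis using * by auto
 qed
qed simp

section \<open>The tree metric on the cable systems\<close>

text \<open>The l^1 norm for the orthonormal basis \<open>q 1\<close>, \<open>q 2\<close>. As
  \<open>q 3\<close> and \<open>q 4\<close> are their negatives, it gives the path length between
  two points of the star \<open>Vbar 0\<close>.\<close>

definition ell :: "real \<times> real => real" where
 "ell v = abs (v \<bullet> q 1) + abs (v \<bullet> q 2)"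

text \<open>Each cell contributes the length of the part of the path inside it, measured between the
  retracted end points. This is meaningful on all of \<open>K\<close> without any path;
  \<open>skeleton_dist_eq\<close> identifies it with arc length on \<open>Vbar n\<close>.\<close>

definition tdist :: "nat => real \<times> real => real \<times> real => real" where
 "tdist n x y = (SUM w:words n. ell (zoomw w x - zoomw w y)) / 3 ^ n"

lemma ell_nonneg: "0 <= ell v" and ell_zero [simp]: "ell 0 = 0" and ell_minus: "ell (- v) = ell v"
 by (simp_all add: ell_def)

lemma ell_triangle: "ell (u + v) <= ell u + ell v" by (simp add: ell_def inner_add_left)

lemma norm_eq_q: "(norm v)\<^sup>2 = (v \<bullet> q 1)\<^sup>2 + (v \<bullet> q 2)\<^sup>2"
proof -
 have "v \<bullet> q 1 = (snd v - fst v) * (sqrt 2 / 2)" "v \<bullet> q 2 = (snd v + fst v) * (sqrt 2 / 2)"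
  by (simp_all add: q_simps inner_prod_def algebra_simps add_divide_distrib)
 hence "(v \<bullet> q 1)\<^sup>2 + (v \<bullet> q 2)\<^sup>2 = ((snd v - fst v)\<^sup>2 + (snd v + fst v)\<^sup>2) * (sqrt 2 / 2)\<^sup>2"
  by (simp only: power_mult_distrib) (simp only: distrib_right)
 also have "... = ((snd v - fst v)\<^sup>2 + (snd v + fst v)\<^sup>2) / 2" by (simp add: power_divide)
 also have "... = (fst v)\<^sup>2 + (snd v)\<^sup>2" by (simp add: power2_eq_square algebra_simps)
 finally show ?thesis by (simp add: norm_prod_def)
qed

lemma norm_le_ell: "norm v <= ell v"
proof (rule power2_le_imp_le)
 show "(norm v)\<^sup>2 <= (ell v)\<^sup>2" by (simp add: norm_eq_q ell_def power2_sum)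
qed (rule ell_nonneg)

lemma ell_le_norm: "ell v <= 2 * norm v"
proof -
 have "abs (v \<bullet> q 1) <= norm v" "abs (v \<bullet> q 2) <= norm v"
  using Cauchy_Schwarz_ineq2[of v "q 1"] Cauchy_Schwarz_ineq2[of v "q 2"] norm_q[of 1] norm_q[of 2] by auto
 thus ?thesis by (simp add: ell_def)
qed

lemma ell_q_q:
 assumes "i : {1..5}" "j : {1..5}" "i ~= j" shows "ell (q i - q j) = (if i = 5 \<or> j = 5 then 1 else 2)"
 using assms unfolding idx5 by (elim disjE) (simp_all add: ell_def q_simps inner_prod_def)

lemma tdist_0: "tdist 0 x y = ell (x - y)" by (simp add: tdist_def)

lemma tdist_Suc: "tdist (Suc n) x y = (SUM j:{1..5}. tdist n (zoom j x) (zoom j y)) / 3"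
 unfolding tdist_def sum_words_Cons by (simp add: sum_divide_distrib field_simps)

lemma tdist_nonneg: "0 <= tdist n x y" by (simp add: tdist_def sum_nonneg ell_nonneg)

lemma tdist_self [simp]: "tdist n x x = 0" by (simp add: tdist_def)

lemma tdist_commute: "tdist n x y = tdist n y x" unfolding tdist_def by (metis ell_minus minus_diff_eq)

lemma tdist_triangle: "tdist n x z <= tdist n x y + tdist n y z"
proof -
 have "(SUM w:words n. ell (zoomw w x - zoomw w z))
   <= (SUM w:words n. ell (zoomw w x - zoomw w y) + ell (zoomw w y - zoomw w z))"
  by (rule sum_mono) (metis ell_triangle diff_add_cancel add_diff_eq)
 thus ?thesis
  unfolding tdist_def add_divide_distrib[symmetric] sum.distrib[symmetric] by (simp add: divide_right_mono)
qed

text \<open>The identity function decomposes over the retractions, so the induction step is the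
  triangle inequality in the plane.\<close>

lemma dist_le_tdist: "x : K ==> y : K ==> dist x y <= tdist n x y"
proof (induction n arbitrary: x y)
 case 0
 thus ?case by (simp add: tdist_0 dist_norm norm_le_ell)
next
 case (Suc n)
 have "dist x y = norm (SUM j:{1..5}. (1/3) *\<^sub>R (zoom j x - zoom j y))"
  using zoom_decomp_diff[OF Suc.prems, of "%x. x"] by (simp add: psi_diff dist_norm)
 also have "... <= (SUM j:{1..5}. norm ((1/3) *\<^sub>R (zoom j x - zoom j y)))" by (rule norm_sum)
 also have "... = (SUM j:{1..5}. dist (zoom j x) (zoom j y) / 3)" by (simp add: dist_norm)
 also have "... <= (SUM j:{1..5}. tdist n (zoom j x) (zoom j y) / 3)"
  by (intro sum_mono divide_right_mono Suc.IH zoom_vicsek Suc.prems) auto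
 finally show ?case by (simp add: tdist_Suc sum_divide_distrib)
qed

lemma tdist_psi_same:
 assumes "i : {1..5}" "x : K" "y : K" shows "tdist (Suc n) (psi i x) (psi i y) = tdist n x y / 3"
proof -
 have "(SUM j:{1..5}. tdist n (zoom j (psi i x)) (zoom j (psi i y))) = (SUM j:{1..5}. if j = i then tdist n x y else 0)"
  by (rule sum.cong) (use assms zoom_other in \<open>auto simp: zoom_same\<close>)
 thus ?thesis using assms(1) by (simp add: tdist_Suc)
qed

lemma tdist_psi_word:
 "w : words m ==> x : K ==> y : K ==>
  tdist (m + n) (pw w x) (pw w y) = tdist n x y / 3 ^ m"
proof (induction w arbitrary: m)
 case (Cons j w)
 then obtain k where k: "m = Suc k" "w : words k" "j : {1..5}" by (auto simp: words_def)
 thus ?case using Cons by (simp add: psi_word_Cons tdist_psi_same psi_word_vicsek)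
qed (simp add: words_def)

text \<open>Only the two cells on the way see different retracted points; every other cell collapses
  both points to the same corner.\<close>

lemma tdist_psi_touch:
 assumes i: "i : {1..4}" and "x : K" "y : K"
 shows "tdist (Suc n) (psi 5 x) (psi i y) = (tdist n x (q i) + tdist n (q (opp i)) y) / 3"
proof -
 have "tdist n (zoom j (psi 5 x)) (zoom j (psi i y))
   = (if j = 5 then tdist n x (q i) else if j = i then tdist n (q (opp i)) y else 0)" if "j : {1..5}" for j
 proof -
  consider "j = 5" | "j = i" | "j ~= 5" "j ~= i" by blast
  thus ?thesis
  proof cases
   case 1
   thus ?thesis using zoom_same[OF assms(2), of 5] zoom_other[of i 5 y] assms by (auto simp: exit_def)
  next
   case 2
   thus ?thesis using zoom_same[OF assms(3), of i] zoom_other[of 5 i x] assms by (auto simp: exit_def)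
  next
   case 3
   thus ?thesis using zoom_other[of i j y] zoom_other[of 5 j x] assms that by (auto simp: exit_def)
  qed
 qed
 hence "(SUM j:{1..5}. tdist n (zoom j (psi 5 x)) (zoom j (psi i y)))
  = (SUM j:{1..5}. if j = 5 then tdist n x (q i) else if j = i then tdist n (q (opp i)) y else 0)"
  by (intro sum.cong) auto
 also have "... = tdist n x (q i) + tdist n (q (opp i)) y" using i unfolding idx4 sum5 by (elim disjE) simp_all
 finally show ?thesis by (simp add: tdist_Suc)
qed

lemma tdist_psi_far:
 assumes i: "i : {1..4}" and j: "j : {1..4}" "i ~= j" and "x : K" "y : K"
 shows "tdist (Suc n) (psi i x) (psi j y)
  = (tdist n x (q (opp i)) + tdist n (q i) (q j) + tdist n (q (opp j)) y) / 3"
proof -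
 have "tdist n (zoom k (psi i x)) (zoom k (psi j y))
   = (if k = i then tdist n x (q (opp i)) else if k = 5 then tdist n (q i) (q j)
    else if k = j then tdist n (q (opp j)) y else 0)" if "k : {1..5}" for k
 proof -
  consider "k = i" | "k = 5" | "k = j" | "k ~= i" "k ~= 5" "k ~= j" by blast
  thus ?thesis
  proof cases
   case 1
   thus ?thesis using zoom_same[of x i] zoom_other[of j i y] assms by (auto simp: exit_def)
  next
   case 2
   thus ?thesis using zoom_other[of i 5 x] zoom_other[of j 5 y] assms by (auto simp: exit_def)
  next
   case 3
   thus ?thesis using zoom_same[of y j] zoom_other[of i j x] assms by (auto simp: exit_def)
  next
   case 4
   thus ?thesis using zoom_other[of i k x] zoom_other[of j k y] assms that by (auto simp: exit_def)
  qed
 qed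
 hence "(SUM k:{1..5}. tdist n (zoom k (psi i x)) (zoom k (psi j y)))
  = (SUM k:{1..5}. if k = i then tdist n x (q (opp i)) else if k = 5 then tdist n (q i) (q j)
    else if k = j then tdist n (q (opp j)) y else 0)" by (intro sum.cong) auto
 also have "... = tdist n x (q (opp i)) + tdist n (q i) (q j) + tdist n (q (opp j)) y"
  using i j unfolding idx4 sum5 by (elim disjE) simp_all
 finally show ?thesis by (simp add: tdist_Suc)
qed

text \<open>The values reproduce themselves: a spoke gives (1 + 2) / 3 = 1 and a path between two
  outer corners (2 + 2 + 2) / 3 = 2.\<close>

lemma tdist_corners:
 "i : {1..5} ==> j : {1..5} ==> i ~= j ==> tdist n (q i) (q j) = (if i = 5 \<or> j = 5 then 1 else 2)"
proof (induction n arbitrary: i j)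
 case 0
 show ?case unfolding tdist_0 by (rule ell_q_q[OF 0])
next
 case (Suc n)
 have 5: "tdist (Suc n) (q 5) (q i) = 1" if i: "i : {1..4}" for i
 proof -
  have "tdist (Suc n) (psi 5 (q 5)) (psi i (q i)) = (tdist n (q 5) (q i) + tdist n (q (opp i)) (q i)) / 3"
   using i by (intro tdist_psi_touch q_vicsek) auto
  also have "... = (1 + 2) / 3" using Suc.IH[of 5 i] Suc.IH[of "opp i" i] i opp_mem[of i] opp_neq[of i] by auto
  finally show ?thesis by (simp add: psi_q)
 qed
 have far: "tdist (Suc n) (q i) (q j) = 2" if ij: "i : {1..4}" "j : {1..4}" "i ~= j" for i j
 proof -
  have "tdist (Suc n) (psi i (q i)) (psi j (q j))
    = (tdist n (q i) (q (opp i)) + tdist n (q i) (q j) + tdist n (q (opp j)) (q j)) / 3"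
   using ij by (intro tdist_psi_far q_vicsek) auto
  also have "... = (2 + 2 + 2) / 3"
   using Suc.IH[of i "opp i"] Suc.IH[of i j] Suc.IH[of "opp j" j] ij opp_mem[of i] opp_mem[of j]
    opp_neq[of i] opp_neq[of j] by auto
  finally show ?thesis by (simp add: psi_q)
 qed
 have "i = 5 \<or> i : {1..4}" "j = 5 \<or> j : {1..4}" using Suc.prems by auto
 thus ?case using 5[of i] 5[of j] far[of i j] Suc.prems tdist_commute by auto
qed

section \<open>Comparison of the tree metric with the Euclidean metric\<close>

lemma ell_sqr: "x : sqr ==> ell x <= 1"
proof -
 assume x: "x : sqr"
 have s: "sqrt 2 * sqrt 2 = (2::real)" by simp
 have "x \<bullet> q 1 = (snd x - fst x) * (sqrt 2 / 2)" "x \<bullet> q 2 = (snd x + fst x) * (sqrt 2 / 2)"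
  by (simp_all add: q_simps inner_prod_def algebra_simps add_divide_distrib)
 hence "ell x = (abs (snd x - fst x) + abs (snd x + fst x)) * (sqrt 2 / 2)"
  by (simp only: ell_def abs_mult) (simp add: distrib_right)
 also have "... <= sqrt 2 * (sqrt 2 / 2)"
 proof (rule mult_right_mono)
  show "abs (snd x - fst x) + abs (snd x + fst x) <= sqrt 2" using x unfolding sqr_def by (auto simp: abs_if split: if_splits)
 qed simp
 also have "... = 1" using s by simp
 finally show ?thesis .
qed

lemma tdist_corner_le_2: "x : K ==> a : {1..4} ==> tdist n x (q a) <= 2"
proof (induction n arbitrary: x a)
 case 0
 have "ell (x - q a) <= ell x + ell (q a)" using ell_triangle[of x "- q a"] by (simp add: ell_minus)
 thus ?case using ell_sqr[of x] ell_sqr[of "q a"] q_in_sqr[of a] 0 vicsek_sqr by (force simp: tdist_0)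
next
 case (Suc n)
 obtain i y where *: "i : {1..5}" "y : K" "x = psi i y" using Suc.prems(1) by (rule vicsekE)
 have qa: "q a = psi a (q a)" "q a : K" using Suc.prems(2) by (auto simp: psi_q q_vicsek)
 have IH: "tdist n y (q b) <= 2" if "b : {1..4}" for b using Suc.IH[OF *(2) that] .
 have oo: "tdist n (q (opp a)) (q a) <= 2" using Suc.IH[OF q_vicsek, of "opp a" a] opp_mem[of a] Suc.prems(2) by auto
 consider "i = a" | "i = 5" | "i : {1..4}" "i ~= a" using * by force
 hence "tdist (Suc n) (psi i y) (psi a (q a)) <= 2"
 proof cases
  case 1
  thus ?thesis using tdist_psi_same[OF *(1) *(2) qa(2), of n] IH[OF Suc.prems(2)] by simp
 next
  case 2
  thus ?thesis using tdist_psi_touch[OF Suc.prems(2) *(2) qa(2), of n] IH[OF Suc.prems(2)] oo by simp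
 next
  case 3
  have "tdist n (q i) (q a) <= 2" using Suc.IH[OF q_vicsek, of i a] 3 Suc.prems(2) by auto
  moreover have "tdist n y (q (opp i)) <= 2" using IH opp_mem(2)[OF 3(1)] by blast
  ultimately show ?thesis using tdist_psi_far[OF 3(1) Suc.prems(2) 3(2) *(2) qa(2), of n] oo by simp
 qed
 thus ?case using * qa by simp
qed

lemma sqrt2_bounds: "sqrt 2 > (1.4::real)" "sqrt 2 < (1.5::real)"
 by (rule real_less_rsqrt, simp add: power2_eq_square, rule real_less_lsqrt, simp_all add: power2_eq_square)

text \<open>In the cell at the corner both sides scale by 1/3. From any other cell the distance is
  at least sqrt 2 / 3, and 5 sqrt 2 / 3 exceeds the bound 2 of
  \<open>tdist_corner_le_2\<close>.\<close>

lemma tdist_corner_le: "x : K ==> a : {1..4} ==> tdist n x (q a) <= 5 * dist x (q a)"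
proof (induction n arbitrary: x a)
 case 0
 have "ell (x - q a) <= 2 * norm (x - q a)" by (rule ell_le_norm)
 moreover have "norm (x - q a) \<ge> 0" by simp
 ultimately show ?case unfolding tdist_0 dist_norm by linarith
next
 case (Suc n)
 obtain i y where *: "i : {1..5}" "y : K" "x = psi i y" using Suc.prems(1) by (rule vicsekE)
 show ?case
 proof (cases "i = a")
  case True
  have "tdist (Suc n) (psi a y) (psi a (q a)) = tdist n y (q a) / 3"
   using * Suc.prems True by (intro tdist_psi_same q_vicsek) auto
  moreover have "dist (psi a y) (psi a (q a)) = dist y (q a) / 3" by (rule dist_psi)
  ultimately show ?thesis using Suc.IH[OF *(2) Suc.prems(2)] * True by (simp add: psi_q)
 next
  case False
  have "y : sqr" using *(2) vicsek_sqr by blast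
  hence "sqrt 2 / 3 <= dist x (q a)" using corner_dist[OF Suc.prems(2) *(1) False] * by simp
  thus ?thesis using tdist_corner_le_2[OF Suc.prems, of "Suc n"] sqrt2_bounds by linarith
 qed
qed

text \<open>The factor 10 comes from touching cells: two corner estimates with factor 5, a scale
  factor 3 each, and the final division by 3. For separated cells 4 <= 10 sqrt 2 / 3. Uniformity in
  \<open>n\<close> is what makes the extension to \<open>K\<close> possible.\<close>

lemma tdist_le: "x : K ==> y : K ==> tdist n x y <= 10 * dist x y"
proof (induction n arbitrary: x y)
 case 0
 have "ell (x - y) <= 2 * norm (x - y)" by (rule ell_le_norm)
 moreover have "norm (x - y) \<ge> 0" by simp
 ultimately show ?case unfolding tdist_0 dist_norm by linarith
next
 case (Suc n)
 obtain i x' where *: "i : {1..5}" "x' : K" "x = psi i x'" using Suc.prems(1) by (rule vicsekE)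
 obtain j y' where **: "j : {1..5}" "y' : K" "y = psi j y'" using Suc.prems(2) by (rule vicsekE)
 have touch: "tdist (Suc n) (psi 5 u) (psi a v) <= 10 * dist (psi 5 u) (psi a v)"
  if "a : {1..4}" "u : K" "v : K" for a u v
 proof -
  have "tdist n u (q a) <= 5 * dist u (q a)" using that by (intro tdist_corner_le)
  moreover have "tdist n (q (opp a)) v <= 5 * dist v (q (opp a))"
   using tdist_corner_le[OF that(3) opp_mem(2)[OF that(1)], of n] by (simp add: tdist_commute)
  moreover have "dist u (q a) / 3 <= dist (psi 5 u) (psi a v)" "dist v (q (opp a)) / 3 <= dist (psi 5 u) (psi a v)"
  proof -
   have uv: "u : sqr" "v : sqr" using that vicsek_sqr by auto
   show "dist u (q a) / 3 <= dist (psi 5 u) (psi a v)" using touch_dist(1)[OF that(1) uv] by (simp only: dist_psi)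
   have "psi 5 (q a) = psi a (q (opp a))" using that(1) by (intro psi_touch) auto
   thus "dist v (q (opp a)) / 3 <= dist (psi 5 u) (psi a v)"
    using touch_dist(2)[OF that(1) uv] by (simp only: dist_psi)
  qed
  ultimately have "tdist n u (q a) <= 15 * dist (psi 5 u) (psi a v)"
   "tdist n (q (opp a)) v <= 15 * dist (psi 5 u) (psi a v)" by auto
  thus ?thesis unfolding tdist_psi_touch[OF that] by (simp add: field_simps)
 qed
 consider "i = j" | "i = 5" "j : {1..4}" | "i : {1..4}" "j = 5" | "i : {1..4}" "j : {1..4}" "i ~= j"
  using *(1) **(1) by force
 thus ?case
 proof cases
  case 1
  have "tdist (Suc n) (psi i x') (psi i y') = tdist n x' y' / 3" using * ** by (intro tdist_psi_same) auto
  moreover have "dist (psi i x') (psi i y') = dist x' y' / 3" by (rule dist_psi)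
  ultimately show ?thesis using Suc.IH[OF *(2) **(2)] * ** 1 by simp
 next
  case 2
  thus ?thesis using touch[of j x' y'] * ** by simp
 next
  case 3
  thus ?thesis using touch[of i y' x'] * ** by (simp add: tdist_commute dist_commute)
 next
  case 4
  have "sqrt 2 / 3 <= dist x y" using corner_cells_dist[OF 4, of x' y'] * ** vicsek_sqr by auto
  moreover have "tdist (Suc n) x y <= 4"
   using tdist_triangle[of "Suc n" x y "q 1"] tdist_corner_le_2[OF Suc.prems(1), of 1 "Suc n"]
    tdist_corner_le_2[OF Suc.prems(2), of 1 "Suc n"] tdist_commute[of "Suc n" y "q 1"] by auto
  ultimately show ?thesis using sqrt2_bounds by linarith
 qed
qed

section \<open>Orientation of the edges\<close>

text \<open>\<open>entry e w\<close> is the corner (or the centre) through which a path from \<open>q e\<close> enters the cell \<open>w\<close>.\<close>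

primrec entry :: "nat => nat list => nat" where
 "entry e [] = e"
| "entry e (j # w) = entry (if j = e \<or> j = 5 then e else opp j) w"

lemma entry_append: "entry e (v @ w) = entry (entry e v) w" by (induction v arbitrary: e) auto

lemma entry_mem: "e : {1..5} ==> w : words n ==> entry e w : {1..5}"
proof (induction w arbitrary: e n)
 case (Cons j w)
 then obtain k where k: "w : words k" "j : {1..5}" by (auto simp: words_def)
 thus ?case using Cons.IH[OF _ k(1), of e] Cons.IH[OF _ k(1), of "opp j"] opp_mem(1)[of j] Cons.prems by auto
qed simp

text \<open>Negative exactly for the spoke through which the path from \<open>q 5\<close> enters the
  cell; it turns the fixed orientation from centre to corner into the orientation away from the
  root.\<close>

definition esgn :: "nat list => nat => real" where
 "esgn w i = (if i = entry 5 w then -1 else 1)"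

lemma esgn_sq [simp]: "esgn w i * esgn w i = 1" and abs_esgn [simp]: "abs (esgn w i) = 1" by (simp_all add: esgn_def)

text \<open>The middle third of a spoke belongs to the corner cell and runs from its corner to its
  centre, whence the single change of sign.\<close>

lemma esgn_split:
 assumes "i : {1..4}" "w : words n"
 shows "esgn (w @ [5]) i = esgn w i" "esgn (w @ [i]) (opp i) = - esgn w i" "esgn (w @ [i]) i = esgn w i"
 using assms opp_neq[of i] by (auto simp: esgn_def entry_append)

text \<open>Every path from \<open>q e\<close> into the cell \<open>j\<close> passes through one
  entry point; the length up to there is common to all targets in the cell.\<close>

lemma tdist_corner_psi:
 assumes e: "e : {1..5}" and j: "j : {1..5}" and z: "z : K"
 shows "tdist (Suc n) (q e) (psi j z) = tdist (Suc n) (q e) (psi j (q (entry e [j])))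
  + tdist n (q (entry e [j])) z / 3"
proof -
 have qe: "q e = psi e (q e)" "q e : K" using e by (auto simp: psi_q q_vicsek)
 have c: "tdist (Suc n) (q e) (psi j y) = c + tdist n (q (entry e [j])) y / 3"
  if "c = (if j = e then 0 else if j = 5 then tdist n (q e) (q (opp e))
    else if e = 5 then tdist n (q 5) (q j) else tdist n (q e) (q (opp e)) + tdist n (q e) (q j)) / 3" "y : K" for c y
 proof -
  consider "j = e" | "j = 5" "e : {1..4}" | "e = 5" "j : {1..4}" | "e : {1..4}" "j : {1..4}" "e ~= j"
   using e j by force
  thus ?thesis
  proof cases
   case 1
   thus ?thesis using tdist_psi_same[OF e qe(2) that(2), of n] that qe by simp
  next
   case 2
   thus ?thesis using tdist_psi_touch[OF 2(2) that(2) qe(2), of n] that qe(1)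
    by (simp add: tdist_commute add_divide_distrib)
  next
   case 3
   thus ?thesis using tdist_psi_touch[OF 3(2) qe(2) that(2), of n] that qe(1)
    by (simp add: tdist_commute add_divide_distrib)
  next
   case 4
   thus ?thesis using tdist_psi_far[OF 4 qe(2) that(2), of n] that qe(1)
    by (auto simp: tdist_commute add_divide_distrib)
  qed
 qed
 have "q (entry e [j]) : K" using entry_mem[OF e, of "[j]" 1] j by (intro q_vicsek) (auto simp: words_def)
 thus ?thesis using c[OF refl z] c[OF refl, of "q (entry e [j])"] by simp
qed

lemma tdist_root:
 "e : {1..5} ==> w : words m ==> z : K ==>
  tdist (m + n) (q e) (pw w z) = tdist (m + n) (q e) (pw w (q (entry e w))) + tdist n (q (entry e w)) z / 3 ^ m"
proof (induction w arbitrary: e m)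
 case (Cons j w)
 then obtain k where k: "m = Suc k" "w : words k" "j : {1..5}" by (auto simp: words_def)
 let ?e = "entry e [j]"
 have e': "?e : {1..5}" using entry_mem[OF Cons.prems(1), of "[j]" 1] k by (auto simp: words_def)
 have ent: "entry e (j # w) = entry ?e w" by simp
 have en: "q (entry ?e w) : K" using entry_mem[OF e' k(2)] by (rule q_vicsek)
 have A: "tdist (m + n) (q e) (pw (j # w) y) = tdist (m + n) (q e) (psi j (q ?e)) + tdist (k + n) (q ?e) (pw w y) / 3"
  if "y : K" for y using tdist_corner_psi[OF Cons.prems(1) k(3) psi_word_vicsek[OF k(2) that], of "k + n"]
  by (simp add: k(1) psi_word_Cons)
 show ?case using A[OF Cons.prems(3)] A[OF en] Cons.IH[OF e' k(2) Cons.prems(3)]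
  by (simp only: ent k(1) power_Suc) (simp add: field_simps)
qed (simp add: words_def)

text \<open>Up to a common constant both distances are star distances from the entry point, with
  values 0, 1, 2; moving from centre to corner shortens the path only towards the entry
  corner.\<close>

lemma tdist_orient:
 assumes "w : words n" "i : {1..4}"
 shows "tdist n (q 5) (pw w (q i)) - tdist n (q 5) (pw w (q 5)) = esgn w i / 3 ^ n"
proof -
 let ?e = "entry 5 w"
 have e: "?e : {1..5}" using entry_mem[OF _ assms(1), of 5] by auto
 have "tdist n (q 5) (pw w (q i)) - tdist n (q 5) (pw w (q 5))
   = (tdist 0 (q ?e) (q i) - tdist 0 (q ?e) (q 5)) / 3 ^ n"
  using tdist_root[of 5 w n "q i" 0] tdist_root[of 5 w n "q 5" 0] assms q_vicsek[of i] q_vicsek[of 5]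
  by (simp add: diff_divide_distrib)
 also have "tdist 0 (q ?e) (q i) - tdist 0 (q ?e) (q 5) = esgn w i"
  using tdist_corners[of ?e i 0] tdist_corners[of ?e 5 0] e assms(2) by (auto simp: esgn_def)
 finally show ?thesis .
qed

section \<open>Lengths of arcs in the cable systems\<close>

lemma Vbar0_iff: "z : Vbar 0 \<longleftrightarrow> (EX i:{1..4}. EX c:{0..1}. z = c *\<^sub>R q i)"
proof
 assume "z : Vbar 0"
 then obtain i where "i : {1..4}" "z : closed_segment (q 5) (q i)" unfolding Vbar.simps by blast
 thus "EX i:{1..4}. EX c:{0..1}. z = c *\<^sub>R q i" by (intro bexI[of _ i]) (auto simp: closed_segment_def q5)
next
 assume "EX i:{1..4}. EX c:{0..1}. z = c *\<^sub>R q i"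
 then obtain i c where "i : {1..4}" "c : {0..1}" "z = c *\<^sub>R q i" by blast
 hence "z : closed_segment (q 5) (q i)" by (auto simp: closed_segment_def q5)
 with \<open>i : {1..4}\<close> show "z : Vbar 0" unfolding Vbar.simps by blast
qed

lemma psi_word_in_V: "w : words n ==> i : {1..5} ==> pw w (q i) : V n" unfolding V_eq by (rule UN_I) auto

lemma q_Vbar0: "i : {1..5} ==> q i : Vbar 0"
proof -
 assume i: "i : {1..5}"
 show ?thesis
 proof (cases "i = 5")
  case True
  have "q 5 = 0 *\<^sub>R q 1" by (simp add: q5)
  thus ?thesis unfolding Vbar0_iff True by (intro bexI[of _ 1] bexI[of _ 0]) auto
 next
  case False
  thus ?thesis unfolding Vbar0_iff using i by (intro bexI[of _ i] bexI[of _ 1]) auto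
 qed
qed

lemma Vbar0_psi: "z : Vbar 0 ==> z : Vbar (Suc 0)"
proof -
 assume "z : Vbar 0"
 then obtain i c where ic: "i : {1..4}" "c : {0..1}" "z = c *\<^sub>R q i" unfolding Vbar0_iff by blast
 have mem: "d *\<^sub>R q k : Vbar 0" if "k : {1..4}" "0 <= d" "d <= 1" for d k
  unfolding Vbar0_iff using that by (intro bexI[of _ k] bexI[of _ d]) auto
 consider "c <= 1/3" | "1/3 <= c" "c <= 2/3" | "2/3 <= c" by linarith
 hence "EX k:{1..5}. EX y:Vbar 0. z = psi k y"
 proof cases
  case 1
  thus ?thesis using ic by (intro bexI[of _ 5] bexI[of _ "(3 * c) *\<^sub>R q i"] mem) (auto simp: psi_5)
 next
  case 2
  have "z = psi i ((2 - 3 * c) *\<^sub>R q (opp i))"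
  proof -
   have "(3 * c - 2) / 3 + 2 / 3 = c" by (simp add: field_simps)
   thus ?thesis using ic by (simp add: psi_eq q_opp flip: scaleR_left_distrib scaleR_minus_left)
  qed
  thus ?thesis using ic 2 opp_mem(2)[OF ic(1)] by (intro bexI[of _ i] bexI[of _ "(2 - 3 * c) *\<^sub>R q (opp i)"] mem) auto
 next
  case 3
  have "z = psi i ((3 * c - 2) *\<^sub>R q i)"
  proof -
   have "(3 * c - 2) / 3 + 2 / 3 = c" by (simp add: field_simps)
   thus ?thesis using ic by (simp add: psi_eq flip: scaleR_left_distrib)
  qed
  thus ?thesis using ic 3 by (intro bexI[of _ i] bexI[of _ "(3 * c - 2) *\<^sub>R q i"] mem) auto
 qed
 thus ?thesis by (auto simp del: Vbar.simps(1))
qed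

lemma Vbar_mono: "Vbar n <= Vbar (Suc n)"
proof (induction n)
 case 0
 show ?case using Vbar0_psi by blast
next
 case (Suc n)
 thus ?case unfolding Vbar.simps(2)[of n] Vbar.simps(2)[of "Suc n"] by (intro UN_mono image_mono) auto
qed

lemma Vbar_mono': "m <= n ==> Vbar m <= Vbar n" by (rule lift_Suc_mono_le[of Vbar]) (use Vbar_mono in auto)

lemma V_Vbar: "V n <= Vbar n" unfolding V_eq Vbar_eq[of n] using q_Vbar0 by blast

lemma closed_Vbar: "closed (Vbar n)"
proof (induction n)
 case 0
 show ?case by (auto intro!: closed_UN)
next
 case (Suc n)
 have "closed (psi i ` Vbar n)" for i
 proof -
  have "psi i ` Vbar n = (+) ((2/3) *\<^sub>R q i) ` ((*\<^sub>R) (1/3) ` Vbar n)"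
   unfolding image_comp by (auto simp: psi_eq algebra_simps)
  thus ?thesis using Suc by (simp add: closed_translation closed_scaling)
 qed
 thus ?case by (auto intro!: closed_UN)
qed

lemma vicsek_closure: "K = closure (\<Union>n. V n)" by (simp add: vicsek_attr attr_def)

lemma power3_small: assumes "e > (0::real)" obtains n where "C / 3 ^ n < e"
proof -
 have "(%n. C / 3 ^ n) \<longlonglongrightarrow> 0" by real_asymp
 hence "eventually (%n. C / 3 ^ n < e) sequentially" using assms by (rule order_tendstoD)
 thus ?thesis using that by (auto simp: eventually_sequentially)
qed

text \<open>A point of a cable stays on the cables of all higher levels, where the nearest centre of
  a cell is within 3^(-m).\<close>

lemma Vbar_vicsek: "Vbar n <= K"
proof
 fix z assume z: "z : Vbar n"
 show "z : K" unfolding vicsek_closure closure_approachable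
 proof (intro allI impI)
  fix e :: real assume "e > 0"
  then obtain m where m: "1 / 3 ^ m < e" by (rule power3_small)
  have "(1::real) / 3 ^ max m n <= 1 / 3 ^ m" by (intro divide_left_mono power_increasing) auto
  hence me: "1 / 3 ^ max m n < e" using m by linarith
  have "z : Vbar (max m n)" using z Vbar_mono'[of n "max m n"] by auto
  then obtain w x where w: "w : words (max m n)" "x : Vbar 0" "z = pw w x"
   unfolding Vbar_eq[of "max m n"] by blast
  then obtain i c where ic: "i : {1..4}" "c : {0..1}" "x = c *\<^sub>R q i" unfolding Vbar0_iff by blast
  have "pw w (q 5) : V (max m n)" using w by (auto intro: psi_word_in_V)
  moreover have "dist (pw w (q 5)) z = c / 3 ^ max m n"
   unfolding w(3) dist_psi_word words_length[OF w(1)] using ic norm_q[OF ic(1)] by (simp add: q5)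
  moreover have "c / 3 ^ max m n <= 1 / 3 ^ max m n" using ic by (auto intro: divide_right_mono)
  ultimately show "EX y:\<Union> (range V). dist y z < e" using me by (intro bexI[of _ "pw w (q 5)"]) auto
 qed
qed

lemma skeleton_vicsek: "skeleton <= K" unfolding skeleton_def using Vbar_vicsek by blast

lemma zoom_Vbar: assumes "j : {1..5}" "x : Vbar (Suc n)" shows "zoom j x : Vbar n"
proof -
 obtain i y where iy: "i : {1..5}" "y : Vbar n" "x = psi i y" using assms(2) by auto
 have y: "y : K" using iy Vbar_vicsek by blast
 show ?thesis
 proof (cases "i = j")
  case True
  thus ?thesis using iy y by (simp add: zoom_same)
 next
  case False
  hence "zoom j x = q (exit j i)" "exit j i : {1..4}" using iy y assms zoom_other exit_mem by auto
  moreover have "q (exit j i) : Vbar n" using q_Vbar0[of "exit j i"] Vbar_mono'[of 0 n] calculation(2)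
   by (auto simp del: Vbar.simps)
  ultimately show ?thesis by simp
 qed
qed

lemma zoomw_Vbar: "w : words n ==> x : Vbar n ==> zoomw w x : Vbar 0"
proof (induction w arbitrary: n x)
 case (Cons j w)
 then obtain k where k: "n = Suc k" "w : words k" "j : {1..5}" by (auto simp: words_def)
 thus ?case using Cons.IH[OF k(2) zoom_Vbar[OF k(3)]] Cons.prems by (simp del: Vbar.simps)
qed (simp add: words_def)

text \<open>On the star \<open>Vbar 0\<close> this is the coordinate along the spoke
  \<open>i\<close>, zero on the other spokes. Composed with \<open>zoomw w\<close> it is the
  coordinate along one edge of level \<open>n\<close>, and \<open>tdist\<close> is the total change
  of these coordinates.\<close>

definition hat :: "nat => real \<times> real => real" where
 "hat i x = max 0 (x \<bullet> q i)"

lemma ell_hat: "ell (a - b) = (SUM i:{1..4}. \<bar>hat i a - hat i b\<bar>)"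
proof -
 have q34: "q 3 = - q 1" "q 4 = - q 2" by (simp_all add: q_simps)
 have *: "abs (x - y) = abs (max 0 x - max 0 y) + abs (max 0 (-x) - max 0 (-y))" for x y :: real by (auto simp: max_def abs_if)
 show ?thesis unfolding sum4 hat_def ell_def q34 inner_diff_left inner_minus_right
  using *[of "a \<bullet> q 1" "b \<bullet> q 1"] *[of "a \<bullet> q 2" "b \<bullet> q 2"] by simp
qed

lemma hat_scale:
 assumes "i : {1..4}" "j : {1..4}" "0 <= c" shows "hat i (c *\<^sub>R q j) = (if i = j then c else 0)"
 using assms inner_q_q[of j i] by (auto simp: hat_def)

lemma hat_q: "i : {1..4} ==> j : {1..5} ==> hat i (q j) = (if i = j then 1 else 0)"
 using hat_scale[of i j 1] by (cases "j = 5") (auto simp: hat_def q5)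

lemma hat_Vbar0:
 assumes "i : {1..4}" "x : Vbar 0" "0 < hat i x" shows "x = hat i x *\<^sub>R q i"
proof -
 obtain j c where "j : {1..4}" "c : {0..1}" "x = c *\<^sub>R q j" using assms(2) unfolding Vbar0_iff by blast
 thus ?thesis using assms hat_scale[of i j c] by (auto split: if_splits)
qed

lemma hat_Vbar0_bounds: "i : {1..4} ==> x : Vbar 0 ==> 0 <= hat i x & hat i x <= 1"
 unfolding Vbar0_iff by (auto simp: hat_scale)

lemma continuous_on_hat [continuous_intros]: "continuous_on A f ==> continuous_on A (%x. hat i (f x))"
 unfolding hat_def by (intro continuous_intros)

lemma tdist_hat: "tdist n x y = (SUM w:words n. SUM i:{1..4}. \<bar>hat i (zoomw w x) - hat i (zoomw w y)\<bar>) / 3 ^ n"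
 by (simp add: tdist_def ell_hat)

text \<open>A coordinate strictly between 0 and 1 excludes the corners, which are the only values
  that retraction gives to points outside the cell.\<close>

lemma hat_zoomw:
 assumes w: "w : words n" and i: "i : {1..4}" and x: "x : Vbar n"
  and h: "0 < hat i (zoomw w x)" "hat i (zoomw w x) < 1" shows "x = pw w (hat i (zoomw w x) *\<^sub>R q i)"
proof -
 have eq: "zoomw w x = hat i (zoomw w x) *\<^sub>R q i" by (rule hat_Vbar0[OF i zoomw_Vbar[OF w x] h(1)])
 have "zoomw w x ~: q ` {1..4}"
 proof
  assume "zoomw w x : q ` {1..4}"
  then obtain j where "j : {1..4}" "zoomw w x = q j" by blast
  thus False using hat_q[OF i, of j] h by (auto split: if_splits)
 qed
 hence "x = pw w (zoomw w x)" using w x Vbar_vicsek by (intro zoomw_eq_noncorner) auto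
 thus ?thesis using eq by metis
qed

lemma arc_vicsek: "i : {1..4} ==> 0 <= c ==> c <= 1 ==> c *\<^sub>R q i : K"
 by (rule subsetD[OF Vbar_vicsek[of 0]], unfold Vbar0_iff, intro bexI[of _ i] bexI[of _ c]) auto

lemma hat_zoomw_other:
 assumes w: "w : words n" and i: "i : {1..4}" and v: "v : words n" and j: "j : {1..4}"
  and ne: "(w, i) ~= (v, j)" and c: "0 <= c" "c <= 1" shows "hat i (zoomw w (pw v (c *\<^sub>R q j))) : {0, 1}"
proof -
 have K: "c *\<^sub>R q j : K" by (rule arc_vicsek[OF j c])
 show ?thesis
 proof (cases "w = v")
  case True
  thus ?thesis using ne zoomw_psi_word[OF w K] hat_scale[OF i j c(1)] by auto
 next
  case False
  then obtain a where "a : {1..4}" "zoomw w (pw v (c *\<^sub>R q j)) = q a" using zoomw_other_const[OF v w] K by metis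
  thus ?thesis using hat_q[OF i, of a] by auto
 qed
qed

text \<open>A continuous function that takes each interior value at most once cannot turn back: at a
  turning point the intermediate value theorem would yield the same value on both sides. So its
  absolute increments add up.\<close>

lemma between_of_fibres:
 fixes h :: "real => real"
 assumes h: "continuous_on {0..1} h" "!!t. t : {0..1} ==> 0 <= h t & h t <= 1"
  and fib: "!!s t. s : {0..1} ==> t : {0..1} ==> h s = h t ==> 0 < h s ==> h s < 1 ==> s = t"
  and st: "0 <= s" "s <= t" "t <= u" "u <= 1" shows "abs (h s - h u) = abs (h s - h t) + abs (h t - h u)"
proof -
 have cont: "continuous_on {a..b} h" if "0 <= a" "b <= 1" for a b
  using h(1) by (rule continuous_on_subset) (use that in auto)
 have ht: "0 <= h s" "h s <= 1" "0 <= h t" "h t <= 1" "0 <= h u" "h u <= 1" using h(2) st by auto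
 have "\<not> (h s < h t & h u < h t)"
 proof
  assume A: "h s < h t & h u < h t"
  \<comment> \<open>Halfway between the larger outer value and \<open>h t\<close>, hence strictly
    between 0 and 1, where the fibre hypothesis applies.\<close>
  define c where "c = (max (h s) (h u) + h t) / 2"
  have c: "h s <= c" "h u <= c" "c < h t" "0 < c" "c < 1" using A ht by (auto simp: c_def max_def)
  obtain t1 where t1: "s <= t1" "t1 <= t" "h t1 = c" using IVT'[of h s c t] c st cont[of s t] by auto
  obtain t2 where t2: "t <= t2" "t2 <= u" "h t2 = c" using IVT2'[of h u c t] c st cont[of t u] by auto
  have "t1 = t2" using fib[of t1 t2] t1 t2 c st by auto
  thus False using t1 t2 c by auto
 qed
 moreover have "\<not> (h t < h s & h t < h u)"
 proof
  assume A: "h t < h s & h t < h u"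
  define c where "c = (min (h s) (h u) + h t) / 2"
  have c: "c <= h s" "c <= h u" "h t < c" "0 < c" "c < 1" using A ht by (auto simp: c_def min_def)
  obtain t1 where t1: "s <= t1" "t1 <= t" "h t1 = c" using IVT2'[of h t c s] c st cont[of s t] by auto
  obtain t2 where t2: "t <= t2" "t2 <= u" "h t2 = c" using IVT'[of h t c u] c st cont[of t u] by auto
  have "t1 = t2" using fib[of t1 t2] t1 t2 c st by auto
  thus False using t1 t2 c by auto
 qed
 ultimately show ?thesis by (auto simp: abs_if)
qed

section \<open>Curve length of arcs\<close>

lemma telescope_list:
 fixes D :: "real => real => real"
 assumes "!!s t u. 0 <= s ==> s <= t ==> t <= u ==> u <= 1 ==> D s u = D s t + D t u" "D 0 0 = 0"
  and "sorted ts" "set ts <= {0..1}" "ts ~= []"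
 shows "(\<Sum>i<length ts - 1. D (ts ! i) (ts ! Suc i)) = D 0 (last ts) - D 0 (hd ts)" using assms(3-5)
proof (induction ts rule: rev_induct)
 case (snoc x xs)
 show ?case
 proof (cases "xs = []")
  case False
  then obtain m where m: "length xs = Suc m" by (cases xs) auto
  have IH: "(\<Sum>i<length xs - 1. D (xs ! i) (xs ! Suc i)) = D 0 (last xs) - D 0 (hd xs)"
   using snoc False by (auto simp: sorted_append)
  have "(\<Sum>i<length (xs @ [x]) - 1. D ((xs @ [x]) ! i) ((xs @ [x]) ! Suc i))
   = (\<Sum>i<m. D (xs ! i) (xs ! Suc i)) + D (xs ! m) x" using m by (simp add: nth_append)
  also have "(\<Sum>i<m. D (xs ! i) (xs ! Suc i)) = D 0 (last xs) - D 0 (hd xs)" using IH m by simp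
  also have "xs ! m = last xs" using m False by (simp add: last_conv_nth)
  also have "D 0 (last xs) - D 0 (hd xs) + D (last xs) x = D 0 x - D 0 (hd xs)"
  proof -
   have "last xs : set xs" using False by simp
   hence "0 <= last xs" "last xs <= x" "x <= 1" using snoc.prems by (auto simp: sorted_append)
   thus ?thesis using assms(1)[of 0 "last xs" x] by simp
  qed
  finally show ?thesis using False by simp
 qed simp
qed simp

text \<open>Domination by the additive function bounds all polygonal sums from above; the partition
  \<open>F\<close>, on whose consecutive points distance and \<open>D\<close> agree, attains the
  bound.\<close>

lemma curve_length_additive:
 fixes g :: "real => 'a::metric_space"
 assumes add: "!!s t u. 0 <= s ==> s <= t ==> t <= u ==> u <= 1 ==> D s u = D s t + D t u"
  and nn: "!!s t. 0 <= s ==> s <= t ==> t <= 1 ==> dist (g s) (g t) <= D s t" and D0: "D 0 0 = 0"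
  and F: "finite F" "F <= {0..1}" "0 : F" "1 : F"
  and eq: "!!a b. a : F ==> b : F ==> a < b ==> {a<..<b} Int F = {} ==> dist (g a) (g b) = D a b"
 shows "curve_length g = ennreal (D 0 1)"
proof (rule antisym)
 have pos: "0 <= D s t" if "0 <= s" "s <= t" "t <= 1" for s t using nn[OF that] by (meson order_trans zero_le_dist)
 show "curve_length g <= ennreal (D 0 1)" unfolding curve_length_def
 proof (rule SUP_least)
  fix ts assume ts: "ts : {ts. sorted ts & set ts <= {0..1::real}}"
  show "(\<Sum>i<length ts - 1. ennreal (dist (g (ts ! i)) (g (ts ! Suc i)))) <= ennreal (D 0 1)"
  proof (cases "ts = []")
   case False
   have "(\<Sum>i<length ts - 1. dist (g (ts ! i)) (g (ts ! Suc i))) <= (\<Sum>i<length ts - 1. D (ts ! i) (ts ! Suc i))"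
   proof (rule sum_mono)
    fix i assume "i : {..<length ts - 1}"
    hence i: "i < length ts" "Suc i < length ts" by auto
    hence "ts ! i : {0..1}" "ts ! Suc i : {0..1}" using ts nth_mem by blast+
    moreover have "ts ! i <= ts ! Suc i" using ts i by (auto intro: sorted_nth_mono)
    ultimately show "dist (g (ts ! i)) (g (ts ! Suc i)) <= D (ts ! i) (ts ! Suc i)" using nn by auto
   qed
   also have "... = D 0 (last ts) - D 0 (hd ts)"
    by (rule telescope_list[where D = D, OF add D0]) (use ts False in auto)
   also have "... <= D 0 1"
   proof -
    have "last ts : {0..1}" "hd ts : {0..1}" using ts False last_in_set hd_in_set by blast+
    thus ?thesis using add[of 0 "last ts" 1] pos[of "last ts" 1] pos[of 0 "hd ts"] by auto
   qed
   finally show ?thesis by (simp add: sum_ennreal ennreal_leI)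
  qed simp
 qed
 define ts where "ts = sorted_list_of_set F"
 have ts: "sorted ts" "set ts = F" "distinct ts" "ts ~= []" using F by (auto simp: ts_def)
 have hd: "hd ts = 0" 
 proof -
  have "hd ts : F" "!!x. x : F ==> hd ts <= x" using ts by (cases ts; auto)+
  thus ?thesis using F by (intro antisym) auto
 qed
 have la: "last ts = 1"
 proof -
  have "last ts : F" using ts by auto
  moreover have "x <= last ts" if xF: "x : F" for x
  proof -
   obtain i where "i < length ts" "x = ts ! i" using xF ts(2) by (metis in_set_conv_nth)
   thus ?thesis using ts(1,4) by (auto simp: last_conv_nth intro!: sorted_nth_mono)
  qed
  ultimately show ?thesis using F by (intro antisym) auto
 qed
 have "D 0 1 = (\<Sum>i<length ts - 1. D (ts ! i) (ts ! Suc i))"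
  by (subst telescope_list[where D = D, OF add D0]) (use ts F hd la D0 in auto)
 also have "... = (\<Sum>i<length ts - 1. dist (g (ts ! i)) (g (ts ! Suc i)))"
 proof (rule sum.cong)
  fix i assume "i : {..<length ts - 1}"
  hence i: "i < length ts" "Suc i < length ts" by auto
  have "ts ! i < ts ! Suc i" using ts i by (simp add: sorted_wrt_nth_less strict_sorted_iff)
  moreover have "{ts ! i<..<ts ! Suc i} Int F = {}"
  proof -
   have False if xF: "x : F" "ts ! i < x" "x < ts ! Suc i" for x
   proof -
    obtain k where k: "k < length ts" "x = ts ! k" using xF(1) ts(2) by (metis in_set_conv_nth)
    have "i < k" using xF(2) k i sorted_nth_mono[OF ts(1), of k i] by (meson linorder_not_le)
    moreover have "k < Suc i" using xF(3) k i sorted_nth_mono[OF ts(1), of "Suc i" k] by (meson linorder_not_le)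
    ultimately show False by simp
   qed
   thus ?thesis by auto
  qed
  ultimately show "D (ts ! i) (ts ! Suc i) = dist (g (ts ! i)) (g (ts ! Suc i))"
   using eq[of "ts ! i" "ts ! Suc i"] nth_mem[OF i(1)] nth_mem[OF i(2)] unfolding ts(2) by simp
 qed simp
 finally show "ennreal (D 0 1) <= curve_length g"
  unfolding curve_length_def using ts F by (intro SUP_upper2[of ts]) (auto simp: sum_ennreal)
qed

text \<open>Injectivity of the arc enters here: an interior coordinate determines the point by
  \<open>hat_zoomw\<close>, and hence the time.\<close>

lemma arc_hat:
 assumes g: "arc g" "path_image g <= Vbar n" and w: "w : words n" and i: "i : {1..4}"
 defines "h \<equiv> %t. hat i (zoomw w (g t))" shows "continuous_on {0..1} h" "!!t. t : {0..1} ==> 0 <= h t & h t <= 1"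
  "!!s t. s : {0..1} ==> t : {0..1} ==> h s = h t ==> 0 < h s ==> h s < 1 ==> s = t"
proof -
 have gV: "g t : Vbar n" if "t : {0..1}" for t using g(2) that by (auto simp: path_image_def)
 have gc: "continuous_on {0..1} g" using g(1) by (auto simp: arc_def path_def)
 have "continuous_on {0..1} (zoomw w \<circ> g)"
  by (rule continuous_on_compose[OF gc continuous_on_subset[OF continuous_on_zoomw[OF w]]])
   (use gV Vbar_vicsek in blast)
 thus "continuous_on {0..1} h" unfolding h_def by (intro continuous_intros) (simp add: comp_def)
 show "0 <= h t & h t <= 1" if "t : {0..1}" for t
  unfolding h_def by (rule hat_Vbar0_bounds[OF i zoomw_Vbar[OF w gV[OF that]]])
 show "s = t" if st: "s : {0..1}" "t : {0..1}" "h s = h t" "0 < h s" "h s < 1" for s t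
 proof -
  have "g s = pw w (h s *\<^sub>R q i)"
   unfolding h_def by (rule hat_zoomw[OF w i gV[OF st(1)]]) (use st in \<open>simp_all add: h_def\<close>)
  moreover have "g t = pw w (h t *\<^sub>R q i)"
   unfolding h_def by (rule hat_zoomw[OF w i gV[OF st(2)]]) (use st in \<open>simp_all add: h_def\<close>)
  ultimately have "g s = g t" using st(3) by simp
  thus ?thesis using g(1) st(1,2) by (auto simp: arc_def inj_on_def)
 qed
qed

lemma Vbar_edge:
 assumes "x : Vbar n"
 obtains w i c where "w : words n" "i : {1..4}" "0 <= c" "c <= 1" "x = pw w (c *\<^sub>R q i)"
proof -
 obtain w y where "w : words n" "y : Vbar 0" "x = pw w y" using assms unfolding Vbar_eq[of n] by blast
 thus ?thesis using that unfolding Vbar0_iff by auto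
qed

lemma tdist_on_edge:
 assumes "w : words n" "i : {1..4}" "0 <= c" "c <= 1" "0 <= d" "d <= 1"
 shows "tdist n (pw w (c *\<^sub>R q i)) (pw w (d *\<^sub>R q i)) = abs (c - d) / 3 ^ n"
  and "dist (pw w (c *\<^sub>R q i)) (pw w (d *\<^sub>R q i)) = abs (c - d) / 3 ^ n"
proof -
 have "ell (c *\<^sub>R q i - d *\<^sub>R q i) = (SUM j:{1..4}. if j = i then abs (c - d) else 0)"
  unfolding ell_hat by (rule sum.cong) (use assms in \<open>auto simp: hat_scale\<close>)
 hence "ell (c *\<^sub>R q i - d *\<^sub>R q i) = abs (c - d)" using assms(2) by simp
 thus "tdist n (pw w (c *\<^sub>R q i)) (pw w (d *\<^sub>R q i)) = abs (c - d) / 3 ^ n"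
  using tdist_psi_word[OF assms(1) arc_vicsek[OF assms(2,3,4)] arc_vicsek[OF assms(2,5,6)], of 0]
  by (simp add: tdist_0)
 show "dist (pw w (c *\<^sub>R q i)) (pw w (d *\<^sub>R q i)) = abs (c - d) / 3 ^ n"
  unfolding dist_psi_word words_length[OF assms(1)]
  using norm_q[OF assms(2)] by (simp add: dist_norm flip: scaleR_left_diff_distrib)
qed

text \<open>Off the vertices every point has an interior coordinate on exactly one edge. The sets of
  times spent in the open edges are open, disjoint and cover a connected interval, so one edge is
  used throughout; continuity adds the end points.\<close>

lemma arc_stays_in_edge:
 assumes g: "arc g" "path_image g <= Vbar n" and ab: "0 <= a" "a < b" "b <= 1"
  and nV: "!!t. a < t ==> t < b ==> g t ~: V n" shows "dist (g a) (g b) = tdist n (g a) (g b)"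
proof -
 have gV: "g t : Vbar n" if "t : {0..1}" for t using g(2) that by (auto simp: path_image_def)
 define h where "h w i t = hat i (zoomw w (g t))" for w i t
 have hc: "continuous_on {0..1} (h w i)" if "w : words n" "i : {1..4}" for w i
  using arc_hat(1)[OF g that] by (simp add: h_def)
 have rep: "EX w:words n. EX i:{1..4}. 0 < h w i t & h w i t < 1" if t: "a < t" "t < b" for t
 proof -
  have "g t : Vbar n" using gV t ab by auto
  then obtain w i c where *: "w : words n" "i : {1..4}" "0 <= c" "c <= 1" "g t = pw w (c *\<^sub>R q i)"
   by (rule Vbar_edge)
  have "h w i t = c" unfolding h_def *(5)
   using zoomw_psi_word[OF *(1) arc_vicsek[OF *(2-4)]] hat_scale[OF *(2,2,3)] by simp
  moreover have "c ~= 0"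
  proof
   assume "c = 0"
   hence "g t = pw w (q 5)" using * by (simp add: q5)
   thus False using nV[OF t] *(1) unfolding V_eq by auto
  qed
  moreover have "c ~= 1"
  proof
   assume "c = 1"
   hence "g t = pw w (q i)" using * by simp
   thus False using nV[OF t] *(1,2) unfolding V_eq by auto
  qed
  ultimately show ?thesis using * by (intro bexI[of _ w] bexI[of _ i]) auto
 qed
 define E where "E = words n \<times> {1..4::nat}"
 define U where "U e = {t : {a<..<b}. 0 < h (fst e) (snd e) t & h (fst e) (snd e) t < 1}" for e
 have U_open: "open (U e)" if "e : E" for e
 proof -
  have "continuous_on {a<..<b} (h (fst e) (snd e))"
   using hc[of "fst e" "snd e"] that ab unfolding E_def by (auto intro: continuous_on_subset)
  hence "open ({a<..<b} Int h (fst e) (snd e) -` {0<..<1})" by (intro continuous_open_preimage) auto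
  moreover have "U e = {a<..<b} Int h (fst e) (snd e) -` {0<..<1}" by (auto simp: U_def)
  ultimately show ?thesis by simp
 qed
 have U_disj: "U e Int U e' = {}" if "e : E" "e' : E" "e ~= e'" for e e'
 proof -
  obtain w i v j where ee: "e = (w, i)" "e' = (v, j)" by (cases e; cases e')
  have m: "w : words n" "i : {1..4}" "v : words n" "j : {1..4}" using that ee by (auto simp: E_def)
  have False if t: "t : U e" "t : U e'" for t
  proof -
   have t': "a < t" "t < b" "0 < h w i t" "h w i t < 1" "0 < h v j t" "h v j t < 1" using t by (auto simp: U_def ee)
   have "g t = pw v (h v j t *\<^sub>R q j)"
    unfolding h_def by (rule hat_zoomw[OF m(3,4) gV]) (use t' ab in \<open>auto simp: h_def\<close>)
   hence "h w i t : {0, 1}" using hat_zoomw_other[OF m(1,2,3,4), of "h v j t"] t' \<open>e ~= e'\<close> ee by (simp add: h_def)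
   thus False using t' by auto
  qed
  thus ?thesis by blast
 qed
 have U_cover: "{a<..<b} = (UN e:E. U e)" using rep by (fastforce simp: U_def E_def)
 have mid: "(a + b) / 2 : {a<..<b}" using ab by auto
 then obtain e where e: "e : E" "(a + b) / 2 : U e" using U_cover by blast
 have "{a<..<b} <= U e"
 proof -
  let ?W = "UN e':E - {e}. U e'"
  have "open ?W" using U_open by auto
  moreover have "U e Int ?W Int {a<..<b} = {}" using U_disj e by blast
  moreover have "{a<..<b} <= U e Un ?W" unfolding U_cover by blast
  moreover have "U e Int {a<..<b} ~= {}" using e mid by blast
  ultimately have "?W Int {a<..<b} = {}" using connectedD[OF connected_Ioo[of a b] U_open[OF e(1)], of ?W] by blast
  thus ?thesis using \<open>{a<..<b} <= U e Un ?W\<close> by blast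
 qed
 then obtain w i where wi: "w : words n" "i : {1..4}" "!!t. t : {a<..<b} ==> 0 < h w i t & h w i t < 1"
  using e(1) unfolding U_def E_def by fastforce
 have on: "g t = pw w (h w i t *\<^sub>R q i)" if "t : {a<..<b}" for t
  unfolding h_def by (rule hat_zoomw[OF wi(1,2) gV]) (use wi(3)[OF that] that ab in \<open>auto simp: h_def\<close>)
 have cl: "closure {a<..<b} = {a..b}" using ab by simp
 have "continuous_on (closure {a<..<b}) (%t. g t - pw w (h w i t *\<^sub>R q i))"
 proof -
  have "continuous_on {a..b} g" "continuous_on {a..b} (h w i)"
   using g(1) hc[OF wi(1,2)] ab by (auto simp: arc_def path_def intro: continuous_on_subset)
  thus ?thesis unfolding cl by (intro continuous_intros)
 qed
 hence "g t - pw w (h w i t *\<^sub>R q i) = 0" if "t : {a..b}" for t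
  by (rule continuous_constant_on_closure) (use on that cl in auto)
 hence ga: "g a = pw w (h w i a *\<^sub>R q i)" "g b = pw w (h w i b *\<^sub>R q i)" using ab by auto
 have "0 <= h w i t & h w i t <= 1" if "t : {0..1}" for t using arc_hat(2)[OF g wi(1,2) that] by (simp add: h_def)
 hence "0 <= h w i a" "h w i a <= 1" "0 <= h w i b" "h w i b <= 1" using ab by auto
 thus ?thesis unfolding ga by (simp only: tdist_on_edge[OF wi(1,2)])
qed

lemma finite_V: "finite (V n)" unfolding V_eq by simp

lemma curve_length_arc:
 assumes g: "arc g" "path_image g <= Vbar n" shows "curve_length g = ennreal (tdist n (pathstart g) (pathfinish g))"
proof -
 have gK: "g t : K" if "t : {0..1}" for t using g(2) that Vbar_vicsek[of n] unfolding path_image_def by blast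
 have inj: "inj_on g {0..1}" using g(1) by (simp add: arc_def)
 define F where "F = {0, 1} Un {t : {0..1}. g t : V n}"
 have "finite {t : {0..1}. g t : V n}"
  by (rule finite_imageD[OF finite_subset[OF _ finite_V[of n]] inj_on_subset[OF inj]]) auto
 hence F: "finite F" by (simp add: F_def)
 have "curve_length g = ennreal (tdist n (g 0) (g 1))"
 proof (rule curve_length_additive[where D = "%s t. tdist n (g s) (g t)" and F = F])
  fix s t u :: real assume st: "0 <= s" "s <= t" "t <= u" "u <= 1"
  have "abs (hat i (zoomw w (g s)) - hat i (zoomw w (g u)))
   = abs (hat i (zoomw w (g s)) - hat i (zoomw w (g t))) + abs (hat i (zoomw w (g t)) - hat i (zoomw w (g u)))"
   if "w : words n" "i : {1..4}" for w i by (rule between_of_fibres[OF arc_hat[OF g that] st])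
  hence "(SUM w:words n. SUM i:{1..4}. \<bar>hat i (zoomw w (g s)) - hat i (zoomw w (g u))\<bar>)
   = (SUM w:words n. SUM i:{1..4}. \<bar>hat i (zoomw w (g s)) - hat i (zoomw w (g t))\<bar> + abs (hat i (zoomw w (g t)) - hat i (zoomw w (g u))))"
   by (intro sum.cong refl) auto
  thus "tdist n (g s) (g u) = tdist n (g s) (g t) + tdist n (g t) (g u)"
   unfolding tdist_hat by (simp add: sum.distrib add_divide_distrib)
 next
  fix s t :: real assume "0 <= s" "s <= t" "t <= 1"
  thus "dist (g s) (g t) <= tdist n (g s) (g t)" by (intro dist_le_tdist gK) auto
 next
  fix a b assume ab: "a : F" "b : F" "a < b" "{a<..<b} Int F = {}"
  show "dist (g a) (g b) = tdist n (g a) (g b)"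
  proof (rule arc_stays_in_edge[OF g])
   show "0 <= a" "b <= 1" using ab(1,2) by (auto simp: F_def)
   fix t assume "a < t" "t < b"
   thus "g t ~: V n" using ab(4) \<open>0 <= a\<close> \<open>b <= 1\<close> by (fastforce simp: F_def)
  qed fact
 qed (use F in \<open>auto simp: F_def\<close>)
 thus ?thesis by (simp add: pathstart_def pathfinish_def)
qed

lemma path_connected_Vbar: "path_connected (Vbar n)"
proof (induction n)
 case 0
 have "path_connected (closed_segment (q 5) (q 1) Un closed_segment (q 5) (q 2) Un closed_segment (q 5) (q 3) Un closed_segment (q 5) (q 4))"
  by (intro path_connected_Un convex_imp_path_connected convex_closed_segment) (auto intro: ends_in_segment(1))
 thus ?case unfolding Vbar.simps set4 by (simp add: Un_assoc)
next
 case (Suc n)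
 have pc: "path_connected (psi i ` Vbar n)" for i
  by (intro path_connected_continuous_image continuous_on_psi continuous_on_id Suc)
 have m: "psi 5 (q i) : psi 5 ` Vbar n Int psi i ` Vbar n" if "i : {1..4}" for i
 proof -
  have "q k : Vbar n" if "k : {1..5}" for k using q_Vbar0[OF that] Vbar_mono'[of 0 n] by blast
  hence "psi 5 (q i) : psi 5 ` Vbar n" "psi i (q (opp i)) : psi i ` Vbar n" using that opp_mem(1)[of i] by auto
  moreover have "psi 5 (q i) = psi i (q (opp i))" using that by (intro psi_touch) auto
  ultimately show ?thesis by simp
 qed
 have "path_connected (psi 5 ` Vbar n Un psi 1 ` Vbar n Un psi 2 ` Vbar n Un psi 3 ` Vbar n Un psi 4 ` Vbar n)"
  using m[of 1] m[of 2] m[of 3] m[of 4] by (intro path_connected_Un pc) auto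
 moreover have "Vbar (Suc n) = psi 5 ` Vbar n Un psi 1 ` Vbar n Un psi 2 ` Vbar n Un psi 3 ` Vbar n Un psi 4 ` Vbar n"
  unfolding Vbar.simps(2) set5 by auto
 ultimately show ?case by (simp del: Vbar.simps)
qed

text \<open>Path connectedness provides an arc. A competing arc may live at another level; at the
  larger of the two levels both lengths are the same value of \<open>tdist\<close>, which makes the
  description unique.\<close>

lemma skeleton_dist_eq:
 assumes "x : Vbar n" "y : Vbar n" shows "skeleton_dist x y = tdist n x y"
proof (cases "x = y")
 case False
 then obtain g where g: "arc g" "path_image g <= Vbar n" "pathstart g = x" "pathfinish g = y"
  using path_connected_Vbar[of n] assms unfolding path_connected_arcwise by blast
 have "(THE l. EX n g. x : Vbar n & y : Vbar n & arc g & path_image g <= Vbar n \<and>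
     pathstart g = x & pathfinish g = y & l = curve_length g) = ennreal (tdist n x y)"
 proof (rule the_equality)
  show "EX n' g. x : Vbar n' & y : Vbar n' & arc g & path_image g <= Vbar n' \<and>
     pathstart g = x & pathfinish g = y & ennreal (tdist n x y) = curve_length g"
   using g assms curve_length_arc[OF g(1,2)] by metis
  fix l assume "EX n g. x : Vbar n & y : Vbar n & arc g & path_image g <= Vbar n \<and>
     pathstart g = x & pathfinish g = y & l = curve_length g"
  then obtain m g' where g': "arc g'" "path_image g' <= Vbar m" "pathstart g' = x" "pathfinish g' = y"
   "l = curve_length g'" by blast
  let ?k = "max m n"
  have sub: "Vbar m <= Vbar ?k" "Vbar n <= Vbar ?k" by (auto intro!: Vbar_mono')
  have "l = ennreal (tdist ?k x y)" using curve_length_arc[OF g'(1) order_trans[OF g'(2) sub(1)]] g' by simp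
  also have "... = ennreal (tdist n x y)"
   using curve_length_arc[OF g(1) order_trans[OF g(2) sub(2)]] curve_length_arc[OF g(1,2)] g by simp
  finally show "l = ennreal (tdist n x y)" .
 qed
 thus ?thesis using False by (simp add: skeleton_dist_def tdist_nonneg)
qed (simp add: skeleton_dist_def)

section \<open>The geodesic distance\<close>

lemma skeleton_common:
 assumes "x : skeleton" "y : skeleton" obtains n where "x : Vbar n" "y : Vbar n"
proof -
 obtain a b where "x : Vbar a" "y : Vbar b" using assms unfolding skeleton_def by blast
 thus ?thesis using that[of "max a b"] Vbar_mono'[of a "max a b"] Vbar_mono'[of b "max a b"] by auto
qed

text \<open>The vertex has to differ from \<open>x\<close> because \<open>vdist\<close> is a
  punctured limit and limit points of the skeleton are required.\<close>

lemma vicsek_near_vertex: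
 assumes "x : K" "e > 0"
 obtains n v where "v : V n" "dist v x < e" "v ~= x"
proof -
 obtain n where n: "2 / 3 ^ n < e" using assms(2) by (rule power3_small)
 obtain w y where w: "w : words n" "y : K" "x = pw w y" using assms(1) by (rule vicsek_wordE)
 have near: "pw w (q i) : V n & dist (pw w (q i)) x < e" if "i : {1..5}" for i
 proof -
  have "dist (pw w (q i)) x <= 2 / 3 ^ n"
   using dist_vicsek[OF q_vicsek[OF that] w(2)] w by (simp add: dist_psi_word words_length divide_right_mono)
  thus ?thesis using n psi_word_in_V[OF w(1) that] by auto
 qed
 have "q 1 ~= q 2" using inj_onD[OF inj_q, of 1 2] by auto
 hence "y ~= q 1 \<or> y ~= q 2" by auto
 thus ?thesis using that near[of 1] near[of 2] w(3) by fastforce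
qed

lemma V_skeleton: "V n <= skeleton" using V_Vbar unfolding skeleton_def by blast

lemma skeleton_dist_cont:
 assumes "a : skeleton" "b : skeleton" "c : skeleton" "d : skeleton"
 shows "abs (skeleton_dist a b - skeleton_dist c d) <= 10 * dist a c + 10 * dist b d"
proof -
 obtain n1 where n1: "a : Vbar n1" "b : Vbar n1" using assms(1,2) by (rule skeleton_common)
 obtain n2 where n2: "c : Vbar n2" "d : Vbar n2" using assms(3,4) by (rule skeleton_common)
 define n where "n = max n1 n2"
 have V: "a : Vbar n" "b : Vbar n" "c : Vbar n" "d : Vbar n"
  using n1 n2 Vbar_mono'[of n1 n] Vbar_mono'[of n2 n] by (auto simp: n_def)
 have K: "a : K" "b : K" "c : K" "d : K" using assms skeleton_vicsek by auto
 show ?thesis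
  using tdist_triangle[of n a b c] tdist_triangle[of n c b d] tdist_triangle[of n c d a] tdist_triangle[of n a d b]
   tdist_le[OF K(1,3), of n] tdist_le[OF K(2,4), of n] tdist_commute[of n]
  unfolding skeleton_dist_eq[OF V(1,2)] skeleton_dist_eq[OF V(3,4)] by (smt (verit, ccfv_threshold))
qed

text \<open>\<open>Lim\<close> has a usable value only where the limit exists and is unique.
  Existence comes from the uniformly continuous extension given by the Lipschitz bound in both
  variables, uniqueness from the fact that every pair in \<open>K\<close> is a limit point of pairs
  in the skeleton.\<close>

lemma vdist_extension:
 "EX H. continuous_on (K \<times> K) H \<and>
  (ALL x:skeleton. ALL y:skeleton. H (x, y) = skeleton_dist x y) \<and>
  (ALL x:K. ALL y:K. vdist x y = H (x, y))"
proof -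
 let ?f = "%(a, b). skeleton_dist a b"
 have "uniformly_continuous_on (skeleton \<times> skeleton) ?f" unfolding uniformly_continuous_on_def
 proof (intro allI impI)
  fix e :: real assume e: "e > 0"
  show "\<exists>d>0. ALL x:skeleton \<times> skeleton. ALL x':skeleton \<times> skeleton. dist x' x < d --> dist (?f x') (?f x) < e"
  proof (intro exI[of _ "e / 20"] conjI ballI impI)
   fix x x' assume x: "x : skeleton \<times> skeleton" "x' : skeleton \<times> skeleton" and d: "dist x' x < e / 20"
   have "dist (fst x') (fst x) < e / 20" "dist (snd x') (snd x) < e / 20"
    using d dist_fst_le[of x' x] dist_snd_le[of x' x] by auto
   thus "dist (?f x') (?f x) < e" using skeleton_dist_cont[of "fst x'" "snd x'" "fst x" "snd x"] x
    by (auto simp: dist_real_def case_prod_beta)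
  qed (use e in simp)
 qed
 then obtain H where H: "uniformly_continuous_on (closure (skeleton \<times> skeleton)) H"
  "!!z. z : skeleton \<times> skeleton ==> ?f z = H z" by (rule uniformly_continuous_on_extension_on_closure) blast
 have "K <= closure skeleton" unfolding vicsek_closure using V_skeleton by (intro closure_mono) blast
 hence sub: "K \<times> K <= closure (skeleton \<times> skeleton)" unfolding closure_Times by blast
 have c: "continuous_on (closure (skeleton \<times> skeleton)) H" using H(1) by (rule uniformly_continuous_imp_continuous)
 have "vdist x y = H (x, y)" if xy: "x : K" "y : K" for x y
 proof -
  have "(H \<longlongrightarrow> H (x, y)) (at (x, y) within closure (skeleton \<times> skeleton))"
   using c sub xy by (auto simp: continuous_on_def)
  hence "(H \<longlongrightarrow> H (x, y)) (at (x, y) within skeleton \<times> skeleton)" by (rule tendsto_within_subset) (rule closure_subset)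
  moreover have "eventually (%z. H z = ?f z) (at (x, y) within skeleton \<times> skeleton)"
   unfolding eventually_at_filter by (rule always_eventually) (use H(2) in auto)
  ultimately have lim: "(?f \<longlongrightarrow> H (x, y)) (at (x, y) within skeleton \<times> skeleton)" by (rule Lim_transform_eventually)
  have "(x, y) islimpt (skeleton \<times> skeleton)" unfolding islimpt_approachable
  proof (intro allI impI)
   fix e :: real assume e: "e > 0"
   have e2: "0 < e / 2" using e by simp
   obtain n v where v: "v : V n" "dist v x < e / 2" "v ~= x" using xy(1) e2 by (rule vicsek_near_vertex)
   obtain m u where u: "u : V m" "dist u y < e / 2" using xy(2) e2 by (rule vicsek_near_vertex)
   have "dist (v, u) (x, y) <= dist v x + dist u y" by (simp add: dist_Pair_Pair sqrt_sum_squares_le_sum)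
   thus "EX x':skeleton \<times> skeleton. x' ~= (x, y) & dist x' (x, y) < e"
    using u v V_skeleton by (intro bexI[of _ "(v, u)"]) auto
  qed
  hence "\<not> trivial_limit (at (x, y) within skeleton \<times> skeleton)" by (simp add: trivial_limit_within)
  thus ?thesis unfolding vdist_def using lim by (rule tendsto_Lim)
 qed
 moreover have "H (x, y) = skeleton_dist x y" if "x : skeleton" "y : skeleton" for x y
  using H(2)[of "(x, y)"] that by simp
 ultimately show ?thesis by (intro exI[of _ H] conjI continuous_on_subset[OF c sub]) auto
qed

lemma vdist_skeleton: "x : skeleton ==> y : skeleton ==> vdist x y = skeleton_dist x y"
proof -
 assume xy: "x : skeleton" "y : skeleton"
 obtain H where H: "ALL x:skeleton. ALL y:skeleton. H (x, y) = skeleton_dist x y"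
  "ALL x:K. ALL y:K. vdist x y = H (x, y)" using vdist_extension by blast
 have "x : K" "y : K" using xy skeleton_vicsek by auto
 thus ?thesis using H xy by simp
qed

lemma vdist_Vbar: "x : Vbar n ==> y : Vbar n ==> vdist x y = tdist n x y"
proof -
 assume xy: "x : Vbar n" "y : Vbar n"
 hence "x : skeleton" "y : skeleton" by (auto simp: skeleton_def)
 thus ?thesis using vdist_skeleton skeleton_dist_eq[OF xy] by simp
qed

lemma continuous_on_vdist: "continuous_on (K \<times> K) (%z. vdist (fst z) (snd z))"
proof -
 obtain H where H: "continuous_on (K \<times> K) H" "ALL x:K. ALL y:K. vdist x y = H (x, y)"
  using vdist_extension by blast
 show ?thesis by (rule continuous_on_eq[OF H(1)]) (use H(2) in auto)
qed

lemma vertex_extension_le: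
 assumes f: "continuous_on (K \<times> K) f" and g: "continuous_on (K \<times> K) g"
  and le: "!!n u v. u : V n ==> v : V n ==> f (u, v) <= (g (u, v) :: real)" and xy: "x : K" "y : K"
 shows "f (x, y) <= g (x, y)"
proof -
 have cl: "K \<times> K = closure ((\<Union>n. V n) \<times> (\<Union>n. V n))" unfolding closure_Times vicsek_closure ..
 have c: "continuous_on (closure ((\<Union>n. V n) \<times> (\<Union>n. V n))) (%z. f z - g z)"
  unfolding cl[symmetric] by (intro continuous_intros f g)
 have "f (x, y) - g (x, y) <= 0"
 proof (rule continuous_le_on_closure[OF c])
  show "(x, y) : closure ((\<Union>n. V n) \<times> (\<Union>n. V n))" unfolding cl[symmetric] using xy by simp
  fix z assume "z : (\<Union>n. V n) \<times> (\<Union>n. V n)"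
  then obtain a b where ab: "fst z : V a" "snd z : V b" by auto
  have "fst z : V (max a b)" "snd z : V (max a b)" using ab V_mono'[of a "max a b"] V_mono'[of b "max a b"] by auto
  thus "f z - g z <= 0" using le[of "fst z" "max a b" "snd z"] by simp
 qed
 thus ?thesis by simp
qed

lemma dist_le_vdist: assumes "x : K" "y : K" shows "dist x y <= vdist x y"
proof -
 have "(%z. dist (fst z) (snd z)) (x, y) <= (%z. vdist (fst z) (snd z)) (x, y)"
 proof (rule vertex_extension_le[OF _ continuous_on_vdist _ assms])
  show "continuous_on (K \<times> K) (%z. dist (fst z) (snd z))" by (intro continuous_intros)
  fix n u v assume uv: "u : V n" "v : V n"
  hence "u : Vbar n" "v : Vbar n" "u : K" "v : K" using V_Vbar V_vicsek by auto
  thus "dist (fst (u, v)) (snd (u, v)) <= vdist (fst (u, v)) (snd (u, v))" by (simp add: vdist_Vbar dist_le_tdist)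
 qed
 thus ?thesis by simp
qed

lemma vdist_le_dist: assumes "x : K" "y : K" shows "vdist x y <= 10 * dist x y"
proof -
 have "(%z. vdist (fst z) (snd z)) (x, y) <= (%z. 10 * dist (fst z) (snd z)) (x, y)"
 proof (rule vertex_extension_le[OF continuous_on_vdist _ _ assms])
  show "continuous_on (K \<times> K) (%z. 10 * dist (fst z) (snd z))" by (intro continuous_intros)
  fix n u v assume uv: "u : V n" "v : V n"
  hence "u : Vbar n" "v : Vbar n" "u : K" "v : K" using V_Vbar V_vicsek by auto
  thus "vdist (fst (u, v)) (snd (u, v)) <= 10 * dist (fst (u, v)) (snd (u, v))" by (simp add: vdist_Vbar tdist_le)
 qed
 thus ?thesis by simp
qed

lemma vdist_orient:
 assumes "w : words n" "i : {1..4}"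
 shows "vdist (q 5) (pw w (q i)) - vdist (q 5) (pw w (q 5)) = esgn w i / 3 ^ n"
proof -
 have "q 5 : V n" using V_mono'[of 0 n] by auto
 moreover have "pw w (q i) : V n" "pw w (q 5) : V n" using assms by (auto intro!: psi_word_in_V)
 ultimately have "q 5 : Vbar n" "pw w (q i) : Vbar n" "pw w (q 5) : Vbar n" using V_Vbar by auto
 thus ?thesis using tdist_orient[OF assms] by (simp add: vdist_Vbar)
qed

lemma vdist_edge:
 assumes "w : words n" "i : {1..4}" shows "vdist (pw w (q i)) (pw w (q 5)) = 1 / 3 ^ n"
proof -
 have "pw w (q i) : V n" "pw w (q 5) : V n" using assms by (auto intro!: psi_word_in_V)
 hence "pw w (q i) : Vbar n" "pw w (q 5) : Vbar n" using V_Vbar by auto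
 thus ?thesis using tdist_on_edge(1)[OF assms, of 1 0] by (simp add: vdist_Vbar q5)
qed

text \<open>For vertices of level \<open>n\<close> every retracted point is a corner of its cell,
  and the increment of \<open>f\<close> telescopes over the cells. Each cell costs at most L/3^n
  times the star distance, which sums to \<open>L * tdist n\<close>; density of the vertices does
  the rest.\<close>

lemma vdist_vertices_le:
 assumes f: "continuous_on K f"
  and L: "!!n w i. w : words n ==> i : {1..4} ==> \<bar>f (pw w (q i)) - f (pw w (q 5))\<bar> <= L / 3 ^ n"
  and xy: "x : K" "y : K" shows "abs (f x - f y) <= L * vdist x y"
proof -
 have tele: "f u - f v = (SUM w:words n. f (pw w (zoomw w u)) - f (pw w (zoomw w v)))"
  if "u : K" "v : K" for n u v and f :: "real \<times> real => real" using that
 proof (induction n arbitrary: f u v)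
  case (Suc n)
  have "f u - f v = (SUM j:{1..5}. f (psi j (zoom j u)) - f (psi j (zoom j v)))" by (rule zoom_decomp_diff[OF Suc.prems])
  also have "... = (SUM j:{1..5}. SUM w:words n. f (pw (j # w) (zoomw (j # w) u)) - f (pw (j # w) (zoomw (j # w) v)))"
  proof (rule sum.cong)
   fix j :: nat assume "j : {1..5}"
   thus "f (psi j (zoom j u)) - f (psi j (zoom j v))
     = (SUM w:words n. f (pw (j # w) (zoomw (j # w) u)) - f (pw (j # w) (zoomw (j # w) v)))"
    using Suc.IH[OF zoom_vicsek zoom_vicsek, of j u j v "%x. f (psi j x)"] Suc.prems by (simp add: psi_word_Cons)
  qed simp
  finally show ?case unfolding sum_words_Cons .
 qed simp
 have "(%z. \<bar>f (fst z) - f (snd z)\<bar>) (x, y) <= (%z. L * vdist (fst z) (snd z)) (x, y)"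
 proof (rule vertex_extension_le[OF _ _ _ xy])
  show "continuous_on (K \<times> K) (%z. \<bar>f (fst z) - f (snd z)\<bar>)"
   by (intro continuous_intros continuous_on_compose2[OF f]) auto
  show "continuous_on (K \<times> K) (%z. L * vdist (fst z) (snd z))"
   by (intro continuous_intros continuous_on_vdist)
  fix n u v assume uv: "u : V n" "v : V n"
  have L0: "0 <= L" using L[of "[]" 0 1] by (auto intro: order_trans[OF abs_ge_zero])
  have corner: "EX i:{1..5}. zoomw w z = q i" if z: "z : V n" and w: "w : words n" for z w
  proof -
   obtain v' k where v': "v' : words n" "k : {1..5}" "z = pw v' (q k)" using z unfolding V_eq by blast
   show ?thesis
   proof (cases "v' = w")
    case True
    thus ?thesis using v' zoomw_psi_word[OF w q_vicsek[OF v'(2)]] by auto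
   next
    case False
    then obtain a where "a : {1..4}" "zoomw w z = q a" using zoomw_other_const[OF v'(1) w] v' q_vicsek by metis
    thus ?thesis by auto
   qed
  qed
  have edge: "abs (f (pw w (q i)) - f (pw w (q j))) <= L / 3 ^ n * ell (q i - q j)"
   if "w : words n" "i : {1..5}" "j : {1..5}" for w i j
  proof (cases "i = j")
   case False
   have "abs (f (pw w (q k)) - f (pw w (q 5))) <= L / 3 ^ n * (if k = 5 then 0 else 1)" if "k : {1..5}" for k
    using L[OF \<open>w : words n\<close>, of k] that L0 by auto
   note spoke = this
   have "abs (f (pw w (q i)) - f (pw w (q j)))
     <= abs (f (pw w (q i)) - f (pw w (q 5))) + abs (f (pw w (q j)) - f (pw w (q 5)))" by linarith
   also have "... <= L / 3 ^ n * (if i = 5 then 0 else 1) + L / 3 ^ n * (if j = 5 then 0 else 1)"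
    by (rule add_mono[OF spoke[OF that(2)] spoke[OF that(3)]])
   also have "... = L / 3 ^ n * ell (q i - q j)" using False unfolding ell_q_q[OF that(2,3) False] by auto
   finally show ?thesis .
  qed simp
  have K: "u : K" "v : K" using uv V_vicsek by auto
  have "abs (f u - f v) <= (SUM w:words n. \<bar>f (pw w (zoomw w u)) - f (pw w (zoomw w v))\<bar>)"
   unfolding tele[OF K, of f n] by (rule sum_abs)
  also have "... <= (SUM w:words n. L / 3 ^ n * ell (zoomw w u - zoomw w v))"
  proof (rule sum_mono)
   fix w assume w: "w : words n"
   obtain i j where "i : {1..5}" "zoomw w u = q i" "j : {1..5}" "zoomw w v = q j"
    using corner[OF uv(1) w] corner[OF uv(2) w] by blast
   thus "abs (f (pw w (zoomw w u)) - f (pw w (zoomw w v))) <= L / 3 ^ n * ell (zoomw w u - zoomw w v)"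
    using edge[OF w] by simp
  qed
  also have "... = L * tdist n u v" by (simp add: tdist_def sum_distrib_left sum_divide_distrib)
  also have "... = L * vdist u v" using vdist_Vbar[OF subsetD[OF V_Vbar uv(1)] subsetD[OF V_Vbar uv(2)]] by simp
  finally show "abs (f (fst (u, v)) - f (snd (u, v))) <= L * vdist (fst (u, v)) (snd (u, v))" by simp
 qed
 thus ?thesis by simp
qed

section \<open>The self-similar measure and the length measure\<close>

lemma sets_restrict_borel_generator:
 assumes E: "E <= sets (restrict_space borel \<Omega>)" and op: "!!U. open U ==> \<Omega> Int U : sigma_sets \<Omega> E"
 shows "sets (restrict_space borel (\<Omega> :: 'a::topological_space set)) = sigma_sets \<Omega> E"
proof
 have sp: "space (restrict_space borel \<Omega>) = \<Omega>" by (simp add: space_restrict_space)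
 show "sigma_sets \<Omega> E <= sets (restrict_space borel \<Omega>)" using sets.sigma_sets_subset[OF E] by (simp add: sp)
 have "\<Omega> Int A : sigma_sets \<Omega> E" if "A : sigma_sets UNIV {S. open S}" for A using that
 proof induction
  case (Compl A)
  have "\<Omega> Int (UNIV - A) = \<Omega> - (\<Omega> Int A)" by blast
  thus ?case using sigma_sets.Compl[OF Compl.IH] by simp
 next
  case (Union A)
  have "\<Omega> Int (\<Union> (range A)) = (\<Union>i. \<Omega> Int A i)" by blast
  thus ?case using sigma_sets.Union[of "%i. \<Omega> Int A i", OF Union.IH] by simp
 qed (auto intro: op sigma_sets.Empty)
 thus "sets (restrict_space borel \<Omega>) <= sigma_sets \<Omega> E" by (auto simp: sets_restrict_space borel_def)
qed

lemma closed_in_restrict_borel: "closed A ==> A <= \<Omega> ==> A : sets (restrict_space borel \<Omega>)"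
 unfolding sets_restrict_space by (rule image_eqI[of _ _ A]) auto

lemma countable_words: "countable (\<Union>n. words n)" by (rule countable_UN) (simp_all add: countable_finite)

section \<open>The Borel sets of the attractor are generated by cells\<close>

definition cells :: "(real \<times> real) set set" where
 "cells = {pw w ` K | n w. w : words n}"

lemma cellsI: "w : words n ==> pw w ` K : cells" by (auto simp: cells_def)

lemma countable_cells: "countable cells"
proof -
 have "cells = (%w. pw w ` K) ` (\<Union>n. words n)" by (auto simp: cells_def)
 also have "countable ..." by (rule countable_image[OF countable_words])
 finally show ?thesis .
qed

lemma cell_subset: "w : words n ==> pw w ` K <= K" using psi_word_vicsek by blast

lemma cells_meet_point:
 assumes "w : words n" "v : words n" "w ~= v" shows "EX c. pw w ` K Int pw v ` K <= {c}"
proof -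
 obtain a where a: "ALL y:K. zoomw w (pw v y) = q a" using zoomw_other_const[OF assms(2,1)] assms(3) by metis
 have "x = pw w (q a)" if x: "x : pw w ` K Int pw v ` K" for x
 proof -
  obtain y z where "y : K" "x = pw w y" "z : K" "x = pw v z" using x by blast
  hence "y = q a" using a zoomw_psi_word[OF assms(1)] by metis
  thus ?thesis using \<open>x = pw w y\<close> by simp
 qed
 thus ?thesis by blast
qed

lemma words_addE:
 assumes "v : words (n + m)"
 obtains v' u where "v = v' @ u" "v' : words n" "u : words m"
proof -
 have "take n v : words n" "drop n v : words m"
  using assms set_take_subset[of n v] set_drop_subset[of n v] by (auto simp: words_def)
 thus ?thesis using that[of "take n v" "drop n v"] by simp
qed

text \<open>The longer word is cut to the length of the shorter one: either the prefix is
  \<open>w\<close> and the cells are nested, or two distinct cells of one level are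
  compared.\<close>

lemma cells_meet_le:
 assumes w: "w : words n" and v: "v : words m" and nm: "n <= m"
 shows "pw v ` K <= pw w ` K \<or> (EX c. pw w ` K Int pw v ` K <= {c})"
proof -
 have "v : words (n + (m - n))" using v nm by simp
 then obtain v' u where vu: "v = v' @ u" "v' : words n" "u : words (m - n)" by (rule words_addE)
 have sub: "pw v ` K <= pw v' ` K"
  unfolding vu(1) psi_word_append image_comp[symmetric] by (rule image_mono[OF cell_subset[OF vu(3)]])
 show ?thesis
 proof (cases "v' = w")
  case True
  thus ?thesis using sub by simp
 next
  case False
  then obtain c where "pw w ` K Int pw v' ` K <= {c}"
   using cells_meet_point[OF w vu(2) not_sym[OF False]] by (elim exE)
  hence "pw w ` K Int pw v ` K <= {c}" using sub by (rule_tac order_trans[OF Int_mono]) auto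
  thus ?thesis by (intro disjI2 exI)
 qed
qed

text \<open>Cells are not closed under intersection, since two of them may meet in a single point.
  Finite sets are added; they are null for every candidate measure.\<close>

definition cell_gen :: "(real \<times> real) set set" where
 "cell_gen = cells Un {F. finite F & F <= K}"

lemma Int_stable_cell_gen: "Int_stable cell_gen"
proof (rule Int_stableI)
 fix A B assume AB: "A : cell_gen" "B : cell_gen"
 show "A Int B : cell_gen"
 proof (cases "A : cells & B : cells")
  case True
  then obtain w n v m where wv: "w : words n" "A = pw w ` K" "v : words m" "B = pw v ` K"
   by (auto simp: cells_def)
  have "A <= B \<or> B <= A \<or> (EX c. A Int B <= {c})"
   using cells_meet_le[OF wv(1,3)] cells_meet_le[OF wv(3,1)] unfolding wv(2,4) by (metis Int_commute nat_le_linear)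
  moreover have "A Int B <= K" using wv cell_subset by blast
  ultimately show ?thesis
  proof (elim disjE exE)
   fix c assume "A Int B <= {c}" "A Int B <= K"
   hence "finite (A Int B)" using finite_subset by blast
   thus ?thesis using \<open>A Int B <= K\<close> by (simp add: cell_gen_def)
  qed (use AB in \<open>simp_all add: Int_absorb1 Int_absorb2\<close>)
 next
  case False
  hence "finite A & A <= K \<or> finite B & B <= K" using AB by (auto simp: cell_gen_def)
  thus ?thesis by (auto simp: cell_gen_def)
 qed
qed

lemma vicsek_open_cells:
 assumes "open U" shows "K Int U = \<Union>{c : cells. c <= U}"
proof
 show "\<Union>{c : cells. c <= U} <= K Int U"
 proof
  fix x assume "x : \<Union>{c : cells. c <= U}"
  then obtain n w where "w : words n" "x : pw w ` K" "pw w ` K <= U" by (auto simp: cells_def)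
  thus "x : K Int U" using cell_subset by blast
 qed
 show "K Int U <= \<Union>{c : cells. c <= U}"
 proof
  fix x assume x: "x : K Int U"
  then obtain e where e: "e > 0" "ball x e <= U" using assms open_contains_ball by blast
  obtain n where n: "2 / 3 ^ n < e" using e(1) by (rule power3_small)
  have "x : K" using x by simp
  then obtain w y where w: "w : words n" "y : K" "x = pw w y" by (rule vicsek_wordE)
  have "pw w ` K <= ball x e"
  proof
   fix z assume "z : pw w ` K"
   then obtain y' where y': "y' : K" "z = pw w y'" by blast
   have "dist x z = dist y y' / 3 ^ n" unfolding w(3) y'(2) dist_psi_word words_length[OF w(1)] ..
   also have "... <= 2 / 3 ^ n" using dist_vicsek[OF w(2) y'(1)] by (simp add: divide_right_mono)
   finally show "z : ball x e" using n by simp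
  qed
  thus "x : \<Union>{c : cells. c <= U}" using e w cellsI by blast
 qed
qed

lemma sets_vicsek_gen: "sets (restrict_space borel K) = sigma_sets K cell_gen"
proof (rule sets_restrict_borel_generator)
 show "cell_gen <= sets (restrict_space borel K)"
 proof
  fix A assume "A : cell_gen"
  hence "closed A & A <= K"
   unfolding cell_gen_def cells_def using closed_cell cell_subset finite_imp_closed by blast
  thus "A : sets (restrict_space borel K)" by (blast intro: closed_in_restrict_borel)
 qed
 fix U :: "(real \<times> real) set" assume "open U"
 interpret sigma_algebra K "sigma_sets K cell_gen"
  by (rule sigma_algebra_sigma_sets) (auto simp: cell_gen_def cells_def dest: cell_subset[THEN subsetD])
 have "\<Union>{c : cells. c <= U} : sigma_sets K cell_gen"
  by (rule countable_Union) (auto intro: countable_subset[OF _ countable_cells] sigma_sets.Basic simp: cell_gen_def)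
 thus "K Int U : sigma_sets K cell_gen" using vicsek_open_cells[OF \<open>open U\<close>] by simp
qed

lemma ennreal_power_small:
 assumes "!!n. x <= ennreal (1 / c ^ n)" "c > 1" shows "x = 0"
proof -
 have "(%n. ennreal (1 / c ^ n)) \<longlonglongrightarrow> ennreal 0" using assms(2) by (intro tendsto_ennrealI) real_asymp
 hence "x <= ennreal 0" by (rule LIMSEQ_le_const) (use assms(1) in auto)
 thus ?thesis by simp
qed

section \<open>Uniqueness of the self-similar measure\<close>

definition cell_measure :: "(real \<times> real) measure => bool" where
 "cell_measure M \<longleftrightarrow> sets M = sets (restrict_space borel K) & prob_space M \<and>
        (ALL n. ALL w:words n. emeasure M (pw w ` K) = ennreal (1 / 5 ^ n))"

text \<open>Each point lies in cells of measure 5^(-n) for all n.\<close>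

lemma cell_measure_finite:
 assumes M: "cell_measure M" and F: "finite F" "F <= K" shows "emeasure M F = 0"
proof -
 have sM: "A : sets M" if "closed A" "A <= K" for A
  using M closed_in_restrict_borel[OF that] by (simp add: cell_measure_def)
 have pt: "emeasure M {x} = 0" if x: "x : K" for x
 proof (rule ennreal_power_small[of _ 5])
  fix n
  obtain w y where w: "w : words n" "y : K" "x = pw w y" using x by (rule vicsek_wordE)
  have "emeasure M {x} <= emeasure M (pw w ` K)"
   using w cell_subset[OF w(1)] by (intro emeasure_mono sM closed_cell) auto
  thus "emeasure M {x} <= ennreal (1 / 5 ^ n)" using M w(1) by (simp add: cell_measure_def)
 qed simp
 have "(UN x:F. {x}) : null_sets M" using F by (intro null_sets_UN' countable_finite null_setsI) (auto intro!: sM pt)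
 thus ?thesis by (simp add: null_setsD1)
qed

lemma cell_measure_unique:
 assumes "cell_measure M" "cell_measure N" shows "M = N"
proof (rule measure_eqI_generator_eq_countable[OF Int_stable_cell_gen])
 show "cell_gen <= Pow K" by (auto simp: cell_gen_def cells_def dest: cell_subset[THEN subsetD])
 show "sets M = sigma_sets K cell_gen" "sets N = sigma_sets K cell_gen"
  using assms by (auto simp: cell_measure_def sets_vicsek_gen)
 show "emeasure M A = emeasure N A" if "A : cell_gen" for A
 proof (cases "A : cells")
  case True
  then obtain n w where "w : words n" "A = pw w ` K" by (auto simp: cells_def)
  thus ?thesis using assms by (simp add: cell_measure_def)
 next
  case False
  hence "finite A" "A <= K" using that by (auto simp: cell_gen_def)
  thus ?thesis using assms by (simp add: cell_measure_finite)
 qed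
 show "cells <= cell_gen" by (auto simp: cell_gen_def)
 show "\<Union> cells = K" using vicsek_open_cells[of UNIV] by auto
 show "countable cells" by (rule countable_cells)
 show "emeasure M c ~= \<infinity>" if "c : cells" for c using that assms(1) by (auto simp: cells_def cell_measure_def)
qed

subsection \<open>Existence of the self-similar measure\<close>

definition letters :: "nat measure" where "letters = uniform_count_measure {1..5}"

definition approx :: "nat => nat stream => real \<times> real" where
 "approx n s = pw (stake n s) (q 5)"

text \<open>The point addressed by an infinite word. Existence of the self-similar measure reduces
  to that of the product measure on streams of uniformly chosen letters, whose image it is.\<close>

definition code :: "nat stream => real \<times> real" where
 "code s = lim (%n. approx n s)"

lemma prob_letters: "prob_space letters" unfolding letters_def by (rule prob_space_uniform_count_measure) auto

lemma space_letters: "space letters = {1..5}" unfolding letters_def by (rule space_uniform_count_measure)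

lemma space_letter_streams: "space (stream_space letters) = streams {1..5}"
 by (simp only: space_stream_space space_letters)

lemma stake_words: "s : streams {1..5} ==> stake n s : words n"
proof -
 assume s: "s : streams {1..5}"
 have "x : {1..5}" if "x : set (stake n s)" for x
  using that snth_in[OF s] unfolding in_set_conv_nth by (metis stake_nth length_stake)
 thus ?thesis unfolding words_def by (auto simp only: mem_Collect_eq length_stake subset_iff)
qed

lemma approx_vicsek: "s : streams {1..5} ==> approx n s : K"
 unfolding approx_def by (rule psi_word_vicsek[OF stake_words q_vicsek]) auto

lemma approx_cell:
 assumes "s : streams {1..5}" "n <= m" shows "approx m s : pw (stake n s) ` K"
proof -
 have "stake m s = stake n s @ stake (m - n) (sdrop n s)" using assms(2) by (metis stake_add le_add_diff_inverse)
 moreover have "pw (stake (m - n) (sdrop n s)) (q 5) : K"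
  by (intro psi_word_vicsek[OF stake_words q_vicsek])
   (use assms(1) in \<open>auto simp only: streams_iff_snth sdrop_snth\<close>, simp)
 ultimately show ?thesis unfolding approx_def by (simp only: psi_word_append comp_apply) blast
qed

lemma approx_converges: assumes "s : streams {1..5}" shows "(%n. approx n s) \<longlonglongrightarrow> code s"
proof -
 have "Cauchy (%n. approx n s)" unfolding Cauchy_altdef2
 proof (intro allI impI)
  fix e :: real assume "e > 0"
  then obtain n where n: "2 / 3 ^ n < e" by (rule power3_small)
  have "dist (approx m s) (approx n s) < e" if m: "n <= m" for m
  proof -
   obtain y where y: "y : K" "approx m s = pw (stake n s) y" using approx_cell[OF assms m] by blast
   have "dist (approx m s) (approx n s) = dist y (q 5) / 3 ^ n" unfolding y(2) approx_def[of n] dist_psi_word by simp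
   also have "... <= 2 / 3 ^ n" using dist_vicsek[OF y(1) q_vicsek[of 5]] by (simp add: divide_right_mono)
   finally show ?thesis using n by simp
  qed
  thus "EX N. \<forall>n\<ge>N. dist (approx n s) (approx N s) < e" by blast
 qed
 thus ?thesis unfolding code_def by (simp add: Cauchy_convergent_iff convergent_LIMSEQ_iff)
qed

lemma code_vicsek: "s : streams {1..5} ==> code s : K"
 by (rule closed_sequentially[OF compact_imp_closed[OF compact_vicsek] approx_vicsek approx_converges])

lemma code_Cons: assumes "i : {1..5}" "s : streams {1..5}" shows "code (i ## s) = psi i (code s)"
proof -
 have "(%n. psi i (approx n s)) \<longlonglongrightarrow> psi i (code s)" unfolding psi_eq by (intro tendsto_intros approx_converges assms)
 moreover have "psi i (approx n s) = approx (Suc n) (i ## s)" for n by (simp add: approx_def psi_word_Cons)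
 ultimately have "(%n. approx (Suc n) (i ## s)) \<longlonglongrightarrow> psi i (code s)" by simp
 hence "(%n. approx n (i ## s)) \<longlonglongrightarrow> psi i (code s)" by (rule LIMSEQ_imp_Suc)
 moreover have "(%n. approx n (i ## s)) \<longlonglongrightarrow> code (i ## s)" using assms by (intro approx_converges) auto
 ultimately show ?thesis using LIMSEQ_unique by blast
qed

lemma measurable_approx: "approx n : borel_measurable (stream_space letters)"
proof (induction n)
 case (Suc n)
 have q: "q : borel_measurable letters" 
  unfolding measurable_def by (auto simp: sets_uniform_count_measure space_uniform_count_measure letters_def)
 have "(%s. (1/3) *\<^sub>R approx n (stl s) + (2/3) *\<^sub>R q (shd s)) : borel_measurable (stream_space letters)"
  by (intro borel_measurable_add borel_measurable_scaleR measurable_const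
    measurable_compose[OF measurable_stl Suc] measurable_compose[OF measurable_shd q]) simp_all
 moreover have "approx (Suc n) = (%s. (1/3) *\<^sub>R approx n (stl s) + (2/3) *\<^sub>R q (shd s))"
  by (rule ext) (simp add: approx_def psi_word_Cons psi_eq)
 ultimately show ?case by simp
qed (simp add: approx_def)

lemma measurable_code: "code : measurable (stream_space letters) (restrict_space borel K)"
proof (rule measurable_restrict_space2)
 show "code : space (stream_space letters) \<rightarrow> K" unfolding space_letter_streams using code_vicsek by blast
 show "code : borel_measurable (stream_space letters)"
  by (rule borel_measurable_LIMSEQ_metric[where f = approx, OF measurable_approx])
   (simp only: space_letter_streams approx_converges)
qed

definition mu0 :: "(real \<times> real) measure" where
 "mu0 = distr (stream_space letters) (restrict_space borel K) code"

lemma sets_mu0: "sets mu0 = sets (restrict_space borel K)" and space_mu0: "space mu0 = K"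
 by (simp_all add: mu0_def space_restrict_space)

lemma prob_mu0: "prob_space mu0" unfolding mu0_def
 by (rule prob_space.prob_space_distr[OF prob_space.prob_space_stream_space[OF prob_letters] measurable_code])

lemma psi_vimage_sets:
 assumes "i : {1..5}" "A : sets mu0" shows "{y : K. psi i y : A} : sets mu0"
proof -
 have "psi i : measurable mu0 mu0" unfolding measurable_cong_sets[OF sets_mu0 sets_mu0]
  by (rule measurable_restrict_space2, use psi_vicsek assms(1) in \<open>force simp: space_restrict_space\<close>)
   (intro measurable_restrict_space1 borel_measurable_continuous_onI continuous_intros)
 hence "psi i -` A Int space mu0 : sets mu0" using assms(2) by (rule measurable_sets)
 moreover have "psi i -` A Int space mu0 = {y : K. psi i y : A}" by (auto simp: space_mu0)
 ultimately show ?thesis by simp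
qed

text \<open>Conditioning on the first letter of the address.\<close>

lemma mu0_self_similar:
 assumes A: "A : sets mu0" shows "emeasure mu0 A = (SUM i:{1..5}. emeasure mu0 {y : K. psi i y : A}) / 5"
proof -
 interpret prob_space letters by (rule prob_letters)
 let ?S = "stream_space letters"
 have AK: "A : sets (restrict_space borel K)" using A by (simp add: sets_mu0)
 have fifth: "ennreal (1 / 5) = inverse 5" using divide_ennreal[of 1 5] by (simp add: divide_ennreal_def)
 have sp: "space ?S = streams {1..5}" by (rule space_letter_streams)
 define X where "X = code -` A Int space ?S"
 have X: "X : sets ?S" unfolding X_def by (rule measurable_sets[OF measurable_code AK])
 have "emeasure mu0 A = emeasure ?S X" unfolding mu0_def X_def by (rule emeasure_distr[OF measurable_code AK])
 also have "... = (\<integral>\<^sup>+i. emeasure ?S {s : space ?S. i ## s : X} \<partial>letters)" by (rule emeasure_stream_space[OF X])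
 also have "... = (\<integral>\<^sup>+i. emeasure mu0 {y : K. psi i y : A} \<partial>letters)"
 proof (rule nn_integral_cong)
  fix i assume "i : space letters"
  hence i: "i : {1..5}" unfolding space_letters .
  have "{s : space ?S. i ## s : X} = code -` {y : K. psi i y : A} Int space ?S"
   unfolding X_def sp using i code_Cons[OF i] code_vicsek streams.intros[OF i]
   by (intro set_eqI) (simp only: mem_Collect_eq Int_iff vimage_eq, metis)
  thus "emeasure ?S {s : space ?S. i ## s : X} = emeasure mu0 {y : K. psi i y : A}"
   using psi_vimage_sets[OF i A] unfolding mu0_def
   by (subst emeasure_distr[OF measurable_code]) (simp_all add: sets_mu0[unfolded mu0_def])
 qed
 also have "... = (SUM i:{1..5}. emeasure mu0 {y : K. psi i y : A} / 5)"
  unfolding letters_def uniform_count_measure_def by (subst nn_integral_point_measure_finite)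
   (auto intro!: sum.cong simp: divide_ennreal_def mult.commute fifth)
 finally show ?thesis by (simp only: divide_ennreal_def sum_distrib_right)
qed

lemma mu0_point: assumes "x : K" shows "{x} : sets mu0"
 using closed_in_restrict_borel[of "{x}" K] assms by (simp add: sets_mu0)

text \<open>Among the five cells only \<open>a\<close> contains \<open>q a\<close>, so
  self-similarity reads m = m / 5 for this finite mass.\<close>

lemma mu0_corner: assumes a: "a : {1..4}" shows "emeasure mu0 {q a} = 0"
proof -
 interpret prob_space mu0 by (rule prob_mu0)
 have a5: "a : {1..5}" using a by auto
 have "emeasure mu0 {y : K. psi i y : {q a}} = (if i = a then emeasure mu0 {q a} else 0)"
  if "i : {1..5}" for i
 proof (cases "i = a")
  case True
  have "{y : K. psi i y : {q a}} = {q a}" using corner_psi(2)[OF a that] psi_q[of a] q_vicsek[OF a5] True by auto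
  thus ?thesis using True by simp
 next
  case False
  hence "{y : K. psi i y : {q a}} = {}" using corner_psi(1)[OF a that] by blast
  thus ?thesis using False by (simp only: emeasure_empty if_False)
 qed
 hence "(SUM i:{1..5}. emeasure mu0 {y : K. psi i y : {q a}}) = (SUM i:{1..5}. if i = a then emeasure mu0 {q a} else 0)"
  by (intro sum.cong) auto
 also have "... = emeasure mu0 {q a}" using a5 by simp
 finally have "emeasure mu0 {q a} = emeasure mu0 {q a} / 5"
  using mu0_self_similar[OF mu0_point[OF q_vicsek[OF a5]]] by simp
 thus ?thesis using emeasure_eq_measure[of "{q a}"] by (simp add: divide_ennreal flip: ennreal_numeral)
qed

text \<open>The preimages under the other four maps contain at most one corner, which is null, so a
  single summand of the self-similarity remains.\<close>

lemma mu0_psi: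
 assumes j: "j : {1..5}" and A: "A : sets mu0" "psi j ` A : sets mu0"
 shows "emeasure mu0 (psi j ` A) = emeasure mu0 A / 5"
proof -
 have AK: "A <= K" using sets.sets_into_space[OF A(1)] by (simp add: space_mu0)
 have "emeasure mu0 {y : K. psi i y : psi j ` A} = (if i = j then emeasure mu0 A else 0)"
  if i: "i : {1..5}" for i
 proof (cases "i = j")
  case True
  hence "{y : K. psi i y : psi j ` A} = A" using AK inj_image_mem_iff[OF inj_psi] by blast
  thus ?thesis using True by simp
 next
  case False
  have ex: "exit i j : {1..4}" using exit_mem[of i j] i j False by auto
  have "y = q (exit i j)" if y: "y : K" "psi i y : psi j ` A" for y
  proof -
   obtain z where z: "z : K" "psi i y = psi j z" using y(2) AK by blast
   have "y = zoom i (psi i y)" using zoom_same[OF y(1)] by simp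
   also have "... = q (exit i j)" unfolding z(2) using zoom_other[OF j i] False z(1) by auto
   finally show ?thesis .
  qed
  hence "{y : K. psi i y : psi j ` A} <= {q (exit i j)}" by blast
  hence "emeasure mu0 {y : K. psi i y : psi j ` A} <= emeasure mu0 {q (exit i j)}"
   using ex by (intro emeasure_mono mu0_point q_vicsek) auto
  thus ?thesis using False mu0_corner[OF ex] by simp
 qed
 hence "(SUM i:{1..5}. emeasure mu0 {y : K. psi i y : psi j ` A}) = (SUM i:{1..5}. if i = j then emeasure mu0 A else 0)"
  by (intro sum.cong) auto
 also have "... = emeasure mu0 A" using j by simp
 finally show ?thesis by (rule trans[OF mu0_self_similar[OF A(2)] arg_cong[where f = "%x. x / 5"]])
qed

lemma mu0_cells: "w : words n ==> emeasure mu0 (pw w ` K) = ennreal (1 / 5 ^ n)"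
proof (induction w arbitrary: n)
 case Nil
 thus ?case using prob_space.emeasure_space_1[OF prob_mu0] by (simp add: words_def space_mu0)
next
 case (Cons j w)
 then obtain k where k: "n = Suc k" "w : words k" "j : {1..5}" by (auto simp: words_def)
 have e: "pw (j # w) ` K = psi j ` pw w ` K" by (simp only: psi_word_Cons image_comp)
 have s: "pw v ` K : sets mu0" if "v : words m" for v m
  unfolding sets_mu0 by (rule closed_in_restrict_borel[OF closed_cell cell_subset[OF that]])
 have "emeasure mu0 (psi j ` pw w ` K) = emeasure mu0 (pw w ` K) / 5"
  by (rule mu0_psi[OF k(3) s[OF k(2)] s[OF Cons.prems, unfolded e]])
 also have "... = ennreal (1 / 5 ^ k) / ennreal 5" unfolding Cons.IH[OF k(2)] by simp
 also have "... = ennreal (1 / 5 ^ k / 5)" by (rule divide_ennreal) simp_all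
 also have "1 / 5 ^ k / 5 = (1 / 5 ^ n :: real)" by (simp add: k(1))
 finally show ?case unfolding e .
qed

lemma cell_measure_vmu: "cell_measure vmu"
proof -
 have mu0: "cell_measure mu0" using sets_mu0 prob_mu0 mu0_cells by (auto simp: cell_measure_def)
 have "vmu = (THE M. cell_measure M)" by (simp add: vmu_def cell_measure_def)
 also have "... = mu0" by (rule the_equality[where P = cell_measure, OF mu0]) (rule cell_measure_unique[OF _ mu0])
 finally show ?thesis using mu0 by simp
qed

lemma sets_vmu: "sets vmu = sets (restrict_space borel K)" and prob_vmu: "prob_space vmu"
 and emeasure_vmu_cell: "w : words n ==> emeasure vmu (pw w ` K) = ennreal (1 / 5 ^ n)"
 using cell_measure_vmu by (auto simp: cell_measure_def)

lemma space_vmu: "space vmu = K" using sets_eq_imp_space_eq[OF sets_vmu] by (simp add: space_restrict_space)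

subsection \<open>Edges\<close>

definition edge :: "nat list => nat => (real \<times> real) set" where
 "edge w i = (%c. pw w (c *\<^sub>R q i)) ` {0..1}"

text \<open>Edges are handled through their names, because increments and signs depend on the
  orientation from centre to corner that the pair carries.\<close>

definition earcs :: "nat => (nat list \<times> nat) set" where
 "earcs n = words n \<times> {1..4}"

lemma finite_earcs [simp]: "finite (earcs n)" by (simp add: earcs_def)

lemma earcs_iff: "(w, i) : earcs n \<longleftrightarrow> w : words n & i : {1..4}" by (simp add: earcs_def)

lemma edge_segment: "edge w i = pw w ` closed_segment (q 5) (q i)"
proof -
 have "closed_segment (q 5) (q i) = (%c. c *\<^sub>R q i) ` {0..1}" by (auto simp: closed_segment_def q5)
 thus ?thesis by (simp add: edge_def image_comp comp_def)
qed

lemma edges_eq: "edges n = (%(w, i). edge w i) ` earcs n"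
proof -
 have "edges n = {edge w i | w i. w : words n & i : {1..4}}" by (simp only: edges_def edge_segment)
 also have "... = (%(w, i). edge w i) ` earcs n"
  by (rule set_eqI) (simp only: earcs_def mem_Collect_eq image_iff Bex_def split_paired_Ex mem_Sigma_iff
    case_prod_conv conj_ac)
 finally show ?thesis .
qed

lemma edgesI: "(w, i) : earcs n ==> edge w i : edges n"
 unfolding edges_eq by (rule image_eqI[of _ _ "(w, i)"]) simp_all

lemma edgesE:
 assumes "e : edges n" obtains w i where "(w, i) : earcs n" "e = edge w i"
proof -
 obtain z where "z : earcs n" "e = (case z of (w, i) => edge w i)" using assms unfolding edges_eq by (rule imageE)
 thus ?thesis using that[of "fst z" "snd z"] by (simp add: case_prod_beta)
qed

lemma Vbar_edgeE:
 assumes "x : Vbar n" obtains w i where "(w, i) : earcs n" "x : edge w i"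
proof -
 obtain w i c where *: "w : words n" "i : {1..4}" "0 <= c" "c <= 1" "x = pw w (c *\<^sub>R q i)"
  using assms by (rule Vbar_edge)
 have "x : edge w i" unfolding edge_def using * by (intro image_eqI[of _ _ c]) auto
 thus ?thesis using that[of w i] * by (simp add: earcs_iff)
qed

lemma closed_edge: "closed (edge w i)" unfolding edge_def
 by (intro compact_imp_closed compact_continuous_image continuous_intros compact_Icc)

lemma Vbar_edges: "Vbar n = (UN e:earcs n. edge (fst e) (snd e))"
proof
 show "Vbar n <= (UN e:earcs n. edge (fst e) (snd e))"
 proof
  fix x assume "x : Vbar n"
  then obtain w i c where "w : words n" "i : {1..4}" "0 <= c" "c <= 1" "x = pw w (c *\<^sub>R q i)" by (rule Vbar_edge)
  thus "x : (UN e:earcs n. edge (fst e) (snd e))" by (intro UN_I[of "(w, i)"]) (auto simp: earcs_iff edge_def)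
 qed
 show "(UN e:earcs n. edge (fst e) (snd e)) <= Vbar n"
 proof
  fix x assume "x : (UN e:earcs n. edge (fst e) (snd e))"
  then obtain w i c where e: "w : words n" "i : {1..4}" "c : {0..1}" "x = pw w (c *\<^sub>R q i)"
   by (auto simp: earcs_def edge_def)
  have "c *\<^sub>R q i : Vbar 0" unfolding Vbar0_iff using e by (intro bexI[of _ i] bexI[of _ c]) auto
  thus "x : Vbar n" unfolding Vbar_eq[of n] using e by (intro UN_I[of w]) auto
 qed
qed

lemma edge_Vbar: "(w, i) : earcs n ==> edge w i <= Vbar n"
 using UN_upper[of "(w, i)" "earcs n" "%e. edge (fst e) (snd e)"] by (simp add: Vbar_edges)

lemma edge_skeleton: "(w, i) : earcs n ==> edge w i <= skeleton" using edge_Vbar unfolding skeleton_def by fast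

lemma skeleton_edge:
 assumes "x : skeleton" obtains n w i where "(w, i) : earcs n" "x : edge w i"
proof -
 obtain n where "x : Vbar n" using assms unfolding skeleton_def by fast
 thus ?thesis using that by (rule Vbar_edgeE)
qed

lemma edge_split_param:
 assumes "i : {1..4}" shows "pw w ((c / 3) *\<^sub>R q i) = pw (w @ [5]) (c *\<^sub>R q i)"
  and "pw w (((2 - c) / 3) *\<^sub>R q i) = pw (w @ [i]) (c *\<^sub>R q (opp i))"
  and "pw w (((2 + c) / 3) *\<^sub>R q i) = pw (w @ [i]) (c *\<^sub>R q i)"
proof -
 have i: "i : {1..5}" using assms by auto
 have e: "(2 - c) / 3 = 2/3 - c/3" "(2 + c) / 3 = 2/3 + c/3" by (simp_all add: field_simps)
 show "pw w ((c / 3) *\<^sub>R q i) = pw (w @ [5]) (c *\<^sub>R q i)" by (simp add: psi_word_snoc psi_5)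
 show "pw w (((2 - c) / 3) *\<^sub>R q i) = pw (w @ [i]) (c *\<^sub>R q (opp i))"
  unfolding e by (simp add: psi_word_snoc psi_eq q_opp[OF i] scaleR_left_diff_distrib)
 show "pw w (((2 + c) / 3) *\<^sub>R q i) = pw (w @ [i]) (c *\<^sub>R q i)"
  unfolding e by (simp add: psi_word_snoc psi_eq scaleR_left_distrib)
qed

lemma edge_split:
 assumes i: "i : {1..4}" shows "edge w i = edge (w @ [5]) i Un edge (w @ [i]) (opp i) Un edge (w @ [i]) i"
proof
 show "edge w i <= edge (w @ [5]) i Un edge (w @ [i]) (opp i) Un edge (w @ [i]) i"
 proof
  fix x assume "x : edge w i"
  then obtain c where c: "0 <= c" "c <= 1" "x = pw w (c *\<^sub>R q i)" by (auto simp: edge_def)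
  consider "c <= 1/3" | "1/3 <= c" "c <= 2/3" | "2/3 <= c" by linarith
  thus "x : edge (w @ [5]) i Un edge (w @ [i]) (opp i) Un edge (w @ [i]) i"
  proof cases
   case 1
   hence "x : edge (w @ [5]) i"
    unfolding edge_def using c edge_split_param(1)[OF i, of w "3 * c"] by (intro image_eqI[of _ _ "3 * c"]) auto
   thus ?thesis by blast
  next
   case 2
   hence "x : edge (w @ [i]) (opp i)"
    unfolding edge_def using c edge_split_param(2)[OF i, of w "2 - 3 * c"] by (intro image_eqI[of _ _ "2 - 3 * c"]) auto
   thus ?thesis by blast
  next
   case 3
   hence "x : edge (w @ [i]) i"
    unfolding edge_def using c edge_split_param(3)[OF i, of w "3 * c - 2"] by (intro image_eqI[of _ _ "3 * c - 2"]) auto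
   thus ?thesis by blast
  qed
 qed
 have "edge (w @ [5]) i <= edge w i"
 proof
  fix x assume "x : edge (w @ [5]) i"
  then obtain c where c: "0 <= c" "c <= 1" "x = pw (w @ [5]) (c *\<^sub>R q i)" by (auto simp: edge_def)
  thus "x : edge w i" unfolding edge_def edge_split_param(1)[OF i, symmetric] by (intro image_eqI[of _ _ "c / 3"]) auto
 qed
 moreover have "edge (w @ [i]) (opp i) <= edge w i"
 proof
  fix x assume "x : edge (w @ [i]) (opp i)"
  then obtain c where c: "0 <= c" "c <= 1" "x = pw (w @ [i]) (c *\<^sub>R q (opp i))" by (auto simp: edge_def)
  thus "x : edge w i" unfolding edge_def edge_split_param(2)[OF i, symmetric] by (intro image_eqI[of _ _ "(2 - c) / 3"]) auto
 qed
 moreover have "edge (w @ [i]) i <= edge w i"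
 proof
  fix x assume "x : edge (w @ [i]) i"
  then obtain c where c: "0 <= c" "c <= 1" "x = pw (w @ [i]) (c *\<^sub>R q i)" by (auto simp: edge_def)
  thus "x : edge w i" unfolding edge_def edge_split_param(3)[OF i, symmetric] by (intro image_eqI[of _ _ "(2 + c) / 3"]) auto
 qed
 ultimately show "edge (w @ [5]) i Un edge (w @ [i]) (opp i) Un edge (w @ [i]) i <= edge w i" by simp
qed

text \<open>The coordinate along the edge \<open>(w, i)\<close> is \<open>t\<close> at this point,
  but on every other edge of the level it takes only the values 0 and 1.\<close>

lemma edges_meet_same:
 assumes wi: "(w, i) : earcs n" and vj: "(v, j) : earcs n" and ne: "(w, i) ~= (v, j)"
  and t: "0 <= t" "t <= 1" "pw w (t *\<^sub>R q i) : edge v j" shows "t = 0 \<or> t = 1"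
proof -
 have m: "w : words n" "i : {1..4}" "v : words n" "j : {1..4}" using wi vj by (simp_all add: earcs_iff)
 obtain c where c: "0 <= c" "c <= 1" "pw w (t *\<^sub>R q i) = pw v (c *\<^sub>R q j)"
  using t(3) by (auto simp: edge_def)
 have "hat i (zoomw w (pw v (c *\<^sub>R q j))) : {0, 1}" by (rule hat_zoomw_other[OF m ne c(1,2)])
 moreover have "hat i (zoomw w (pw w (t *\<^sub>R q i))) = t"
  unfolding zoomw_psi_word[OF m(1) arc_vicsek[OF m(2) t(1,2)]] using hat_scale[OF m(2,2) t(1)] by simp
 ultimately show ?thesis using c(3) by simp
qed

lemma edges_meet_finite:
 assumes wi: "(w, i) : earcs n" and vj: "(v, j) : earcs n" and ne: "(w, i) ~= (v, j)"
 shows "finite (edge w i Int edge v j)"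
proof (rule finite_subset)
 show "edge w i Int edge v j <= {pw w (0 *\<^sub>R q i), pw w (1 *\<^sub>R q i)}"
 proof
  fix x assume x: "x : edge w i Int edge v j"
  then obtain t where t: "0 <= t" "t <= 1" "x = pw w (t *\<^sub>R q i)" by (auto simp: edge_def)
  hence "t = 0 \<or> t = 1" using edges_meet_same[OF assms, of t] x by simp
  thus "x : {pw w (0 *\<^sub>R q i), pw w (1 *\<^sub>R q i)}" using t(3) by fast
 qed
qed simp

text \<open>Inside the cell \<open>u\<close>, a spoke of a subcell either runs along an old spoke or
  is orthogonal to the old spoke that it is attached to. In the second case it meets the old cables
  at most at its own centre.\<close>

lemma edge_new_or_old:
 assumes "(w, i) : earcs (Suc n)" shows "(EX v j. (v, j) : earcs n & edge w i <= edge v j) \<or> finite (edge w i Int Vbar n)"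
proof -
 obtain u j where uj: "w = u @ [j]" "u : words n" "j : {1..5}"
 proof -
  have "w : words (n + 1)" using assms by (simp add: earcs_iff)
  then obtain u v where "w = u @ v" "u : words n" "v : words 1" by (rule words_addE)
  thus ?thesis using that[of u "hd v"] by (auto simp: words_def length_Suc_conv)
 qed
 have i: "i : {1..4}" using assms by (simp add: earcs_iff)
 consider "j = 5" | "j : {1..4}" "i = j" | "j : {1..4}" "i = opp j" | "j : {1..4}" "i ~= j" "i ~= opp j"
  using uj(3) by force
 thus ?thesis
 proof cases
  case 1
  have "edge w i <= edge u i" unfolding uj(1) 1 edge_split[OF i, of u] by blast
  thus ?thesis using uj(2) i by (intro disjI1 exI[of _ u] exI[of _ i]) (simp add: earcs_iff)
 next
  case 2
  have "edge w i <= edge u j" unfolding uj(1) 2(2) edge_split[OF 2(1), of u] by blast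
  thus ?thesis using uj(2) 2 by (intro disjI1 exI[of _ u] exI[of _ j]) (simp add: earcs_iff)
 next
  case 3
  have "edge w i <= edge u j" unfolding uj(1) 3(2) edge_split[OF 3(1), of u] by blast
  thus ?thesis using uj(2) 3 by (intro disjI1 exI[of _ u] exI[of _ j]) (simp add: earcs_iff)
 next
  case 4
  have orth: "q i \<bullet> q j = 0" using inner_q_q[of i j] i 4 by auto
  have "edge w i Int Vbar n <= {pw w 0}"
  proof
   fix x assume x: "x : edge w i Int Vbar n"
   then obtain t where t: "0 <= t" "t <= 1" "x = pw u (psi j (t *\<^sub>R q i))"
    by (auto simp: edge_def uj(1) psi_word_snoc)
   have "psi j (t *\<^sub>R q i) : K" by (rule psi_vicsek[OF uj(3) arc_vicsek[OF i t(1,2)]])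
   hence "zoomw u x = psi j (t *\<^sub>R q i)" unfolding t(3) by (rule zoomw_psi_word[OF uj(2)])
   moreover have "zoomw u x : Vbar 0" using zoomw_Vbar[OF uj(2)] x by simp
   ultimately have "psi j (t *\<^sub>R q i) : Vbar 0" by simp
   then obtain k c where kc: "k : {1..4}" "c : {0..1}" "psi j (t *\<^sub>R q i) = c *\<^sub>R q k" unfolding Vbar0_iff by fast
   have "q j \<bullet> psi j (t *\<^sub>R q i) = 2/3" "q i \<bullet> psi j (t *\<^sub>R q i) = t / 3"
    using orth inner_q_q[of j j] inner_q_q[of i i] i 4(1)
    by (simp_all add: psi_eq inner_add_right inner_commute[of "q j" "q i"])
   hence k1: "c * (q j \<bullet> q k) = 2/3" "c * (q i \<bullet> q k) = t / 3" unfolding kc(3) by simp_all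
   \<comment> \<open>The inner product with \<open>q j\<close> is 2/3 > 0, which leaves only the
     spoke \<open>j\<close>; orthogonality then forces \<open>t = 0\<close>.\<close>
   have "k = j"
   proof (rule ccontr)
    assume "k ~= j"
    hence "q j \<bullet> q k <= 0" using inner_q_q[of j k] kc(1) 4(1) by auto
    hence "c * (q j \<bullet> q k) <= 0" using kc(2) by (intro mult_nonneg_nonpos) auto
    thus False using k1(1) by linarith
   qed
   hence "t = 0" using k1(2) orth by simp
   thus "x : {pw w 0}" using t(3) by (simp add: uj(1) psi_word_snoc)
  qed
  hence "finite (edge w i Int Vbar n)" by (rule finite_subset) simp
  thus ?thesis by (rule disjI2)
 qed
qed

text \<open>Induction on the difference of levels: an edge inside an older one inherits its
  alternative, and a new edge meets the older cables in a finite set.\<close>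

lemma edges_meet:
 assumes "(w, i) : earcs n" "(v, j) : earcs (n + d)" shows "edge v j <= edge w i \<or> finite (edge v j Int edge w i)"
 using assms(2)
proof (induction d arbitrary: v j)
 case 0
 show ?case
 proof (cases "(w, i) = (v, j)")
  case False
  have "finite (edge w i Int edge v j)" using edges_meet_finite[OF assms(1) _ False] 0 by simp
  thus ?thesis by (simp add: Int_commute)
 qed simp
next
 case (Suc d)
 from edge_new_or_old[of v j "n + d"] Suc.prems
 consider v' j' where "(v', j') : earcs (n + d)" "edge v j <= edge v' j'" | "finite (edge v j Int Vbar (n + d))" by auto
 thus ?case
 proof cases
  case 1
  from Suc.IH[OF 1(1)] show ?thesis
  proof
   assume "edge v' j' <= edge w i"
   thus ?thesis using 1(2) by (intro disjI1) (rule order_trans)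
  next
   assume "finite (edge v' j' Int edge w i)"
   hence "finite (edge v j Int edge w i)" by (rule rev_finite_subset) (use 1(2) in fast)
   thus ?thesis by (rule disjI2)
  qed
 next
  case 2
  have "edge w i <= Vbar (n + d)" using edge_Vbar[OF assms(1)] Vbar_mono'[of n "n + d"] by simp
  hence "finite (edge v j Int edge w i)" by (intro rev_finite_subset[OF 2]) fast
  thus ?thesis by (rule disjI2)
 qed
qed

section \<open>The Borel sets of the skeleton are generated by edges\<close>

definition alledges :: "(real \<times> real) set set" where
 "alledges = (\<Union>n. edges n)"

lemma alledgesE:
 assumes "e : alledges" obtains n w i where "(w, i) : earcs n" "e = edge w i"
proof -
 obtain n where "e : edges n" using assms unfolding alledges_def by fast
 thus ?thesis using that by (rule edgesE)
qed

lemma alledgesI: "(w, i) : earcs n ==> edge w i : alledges"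
 unfolding alledges_def by (rule UN_I[of n]) (simp_all add: edgesI)

lemma countable_alledges: "countable alledges"
 unfolding alledges_def edges_eq by (rule countable_UN) (simp_all add: countable_finite)

text \<open>As for the cells, finite sets complete the edges to a class stable under intersection:
  two edges are nested or meet in a finite set.\<close>

definition edge_gen :: "(real \<times> real) set set" where
 "edge_gen = alledges Un {F. finite F & F <= skeleton}"

lemma alledges_closed: "e : alledges ==> closed e & e <= skeleton"
 by (erule alledgesE) (simp add: closed_edge edge_skeleton)

lemma edge_gen_subset: "edge_gen <= Pow skeleton" unfolding edge_gen_def using alledges_closed by fast

lemma Int_stable_edge_gen: "Int_stable edge_gen"
proof (rule Int_stableI)
 fix A B assume AB: "A : edge_gen" "B : edge_gen"
 have sub: "A Int B <= skeleton" using AB edge_gen_subset by fast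
 show "A Int B : edge_gen"
 proof (cases "A : alledges & B : alledges")
  case True
  obtain n w i where A: "(w, i) : earcs n" "A = edge w i" using True by (meson alledgesE)
  obtain m v j where B: "(v, j) : earcs m" "B = edge v j" using True by (meson alledgesE)
  have "A <= B \<or> B <= A \<or> finite (A Int B)"
  proof (cases "n <= m")
   case True
   hence "(v, j) : earcs (n + (m - n))" using B by simp
   from edges_meet[OF A(1) this] show ?thesis unfolding A(2) B(2) by (auto simp only: Int_commute)
  next
   case False
   hence "(w, i) : earcs (m + (n - m))" using A by simp
   from edges_meet[OF B(1) this] show ?thesis unfolding A(2) B(2) by (auto simp only: Int_commute)
  qed
  thus ?thesis
  proof (elim disjE)
   assume "A <= B" hence "A Int B = A" by (rule Int_absorb2) thus ?thesis using AB by simp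
  next
   assume "B <= A" hence "A Int B = B" by (rule Int_absorb1) thus ?thesis using AB by simp
  next
   assume "finite (A Int B)" thus ?thesis using sub by (simp add: edge_gen_def)
  qed
 next
  case False
  hence "finite A \<or> finite B" using AB unfolding edge_gen_def by fast
  hence "finite (A Int B)" by (rule finite_Int)
  thus ?thesis using sub by (simp add: edge_gen_def)
 qed
qed

lemma edge_small:
 assumes "x : edge w i" "z : edge w i" "(w, i) : earcs n" shows "dist x z <= 1 / 3 ^ n"
proof -
 have wi: "w : words n" "i : {1..4}" using assms(3) by (simp_all add: earcs_iff)
 obtain c d where cd: "0 <= c" "c <= 1" "x = pw w (c *\<^sub>R q i)" "0 <= d" "d <= 1" "z = pw w (d *\<^sub>R q i)"
  using assms(1,2) unfolding edge_def by force
 have "dist x z = abs (c - d) / 3 ^ n" unfolding cd(3,6) by (rule tdist_on_edge(2)[OF wi cd(1,2,4,5)])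
 also have "... <= 1 / 3 ^ n" using cd by (intro divide_right_mono) auto
 finally show ?thesis .
qed

lemma skeleton_open_edges:
 assumes "open U" shows "skeleton Int U = \<Union>{e : alledges. e <= U}"
proof
 show "\<Union>{e : alledges. e <= U} <= skeleton Int U" using alledges_closed by fast
 show "skeleton Int U <= \<Union>{e : alledges. e <= U}"
 proof
  fix x assume x: "x : skeleton Int U"
  hence xU: "x : U" and xS: "x : skeleton" by simp_all
  obtain e where e: "e > 0" "ball x e <= U" using assms xU open_contains_ball by meson
  obtain n where n: "1 / 3 ^ n < e" using e(1) by (rule power3_small)
  obtain k where k: "x : Vbar k" using xS unfolding skeleton_def by fast
  let ?m = "max n k"
  have "x : Vbar ?m" using k Vbar_mono'[of k ?m] by fastforce
  then obtain w i where wi: "(w, i) : earcs ?m" "x : edge w i" by (rule Vbar_edgeE)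
  have "edge w i <= ball x e"
  proof
   fix z assume "z : edge w i"
   hence "dist x z <= 1 / 3 ^ ?m" using edge_small[OF wi(2) _ wi(1)] by simp
   also have "(1::real) / 3 ^ ?m <= 1 / 3 ^ n" by (intro divide_left_mono power_increasing) auto
   finally show "z : ball x e" using n by simp
  qed
  thus "x : \<Union>{e : alledges. e <= U}" using e(2) wi alledgesI[OF wi(1)] by (intro UnionI[of "edge w i"]) auto
 qed
qed

lemma sets_skeleton_gen: "sets (restrict_space borel skeleton) = sigma_sets skeleton edge_gen"
proof (rule sets_restrict_borel_generator)
 show "edge_gen <= sets (restrict_space borel skeleton)"
 proof
  fix A assume "A : edge_gen"
  hence "closed A" "A <= skeleton" unfolding edge_gen_def using alledges_closed finite_imp_closed by fast+
  thus "A : sets (restrict_space borel skeleton)" by (rule closed_in_restrict_borel)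
 qed
 fix U :: "(real \<times> real) set" assume "open U"
 interpret sigma_algebra skeleton "sigma_sets skeleton edge_gen"
  by (rule sigma_algebra_sigma_sets[OF edge_gen_subset])
 have "\<Union>{e : alledges. e <= U} : sigma_sets skeleton edge_gen"
 proof (rule countable_Union)
  show "countable {e : alledges. e <= U}" by (rule countable_subset[OF _ countable_alledges]) fast
  show "{e : alledges. e <= U} <= sigma_sets skeleton edge_gen" unfolding edge_gen_def by (auto intro: sigma_sets.Basic)
 qed
 thus "skeleton Int U : sigma_sets skeleton edge_gen" using skeleton_open_edges[OF \<open>open U\<close>] by simp
qed

text \<open>It serves twice: for uniqueness of the length measure and, applied to densities, to show
  that a function whose integral over every edge vanishes is null.\<close>

lemma edge_determined:
 assumes M: "sets M = sets (restrict_space borel skeleton)" and N: "sets N = sets (restrict_space borel skeleton)"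
  and eq: "!!n w i. (w, i) : earcs n ==> emeasure M (edge w i) = emeasure N (edge w i)"
  and fin: "!!n w i. (w, i) : earcs n ==> emeasure M (edge w i) ~= \<infinity>"
  and null: "!!F. finite F ==> F <= skeleton ==> emeasure M F = emeasure N F" shows "M = N"
proof (rule measure_eqI_generator_eq_countable[OF Int_stable_edge_gen edge_gen_subset])
 show "sets M = sigma_sets skeleton edge_gen" "sets N = sigma_sets skeleton edge_gen"
  using M N by (simp_all add: sets_skeleton_gen)
 show "emeasure M A = emeasure N A" if A: "A : edge_gen" for A
 proof (cases "A : alledges")
  case True
  thus ?thesis by (rule alledgesE) (simp add: eq)
 next
  case False
  thus ?thesis using A null unfolding edge_gen_def by fast
 qed
 show "alledges <= edge_gen" by (simp add: edge_gen_def)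
 show "\<Union> alledges = skeleton" using skeleton_open_edges[of UNIV] by simp
 show "countable alledges" by (rule countable_alledges)
 show "emeasure M e ~= \<infinity>" if "e : alledges" for e using that by (rule alledgesE) (use fin in auto)
qed

section \<open>Uniqueness of the length measure\<close>

definition edge_measure :: "(real \<times> real) measure => bool" where
 "edge_measure M \<longleftrightarrow> sets M = sets (restrict_space borel skeleton) & sigma_finite_measure M \<and>
        (ALL n. ALL e:edges n. emeasure M e = ennreal (1 / 3 ^ n))"

lemma edge_measureD: "edge_measure M ==> (w, i) : earcs n ==> emeasure M (edge w i) = ennreal (1 / 3 ^ n)"
 using edgesI[of w i n] unfolding edge_measure_def by simp

lemma edge_measure_finite:
 assumes M: "edge_measure M" and F: "finite F" "F <= skeleton" shows "emeasure M F = 0"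
proof -
 have sM: "A : sets M" if "closed A" "A <= skeleton" for A
  using M closed_in_restrict_borel[OF that] by (simp add: edge_measure_def)
 have pt: "emeasure M {x} = 0" if x: "x : skeleton" for x
 proof (rule ennreal_power_small[of _ 3])
  fix n
  obtain k where k: "x : Vbar k" using x unfolding skeleton_def by fast
  let ?m = "max n k"
  have "x : Vbar ?m" using k Vbar_mono'[of k ?m] by fastforce
  then obtain w i where wi: "(w, i) : earcs ?m" "x : edge w i" by (rule Vbar_edgeE)
  have "emeasure M {x} <= emeasure M (edge w i)"
   using wi by (intro emeasure_mono sM closed_edge edge_skeleton[OF wi(1)]) simp
  also have "... = ennreal (1 / 3 ^ ?m)" by (rule edge_measureD[OF M wi(1)])
  also have "... <= ennreal (1 / 3 ^ n)" by (intro ennreal_leI divide_left_mono power_increasing) auto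
  finally show "emeasure M {x} <= ennreal (1 / 3 ^ n)" .
 qed simp
 have "(UN x:F. {x}) : null_sets M"
 proof (rule null_sets_UN')
  show "countable F" using F(1) by (rule countable_finite)
  fix x assume "x : F"
  hence "x : skeleton" using F(2) by fast
  thus "{x} : null_sets M" by (intro null_setsI pt sM) simp_all
 qed
 thus ?thesis by (simp add: null_setsD1)
qed

lemma edge_measure_unique:
 assumes "edge_measure M" "edge_measure N" shows "M = N"
proof (rule edge_determined)
 show "sets M = sets (restrict_space borel skeleton)" "sets N = sets (restrict_space borel skeleton)"
  using assms by (simp_all add: edge_measure_def)
 show "emeasure M (edge w i) = emeasure N (edge w i)" if "(w, i) : earcs n" for n w i
  using edge_measureD[OF assms(1) that] edge_measureD[OF assms(2) that] by simp
 show "emeasure M (edge w i) ~= \<infinity>" if "(w, i) : earcs n" for n w i using edge_measureD[OF assms(1) that] by simp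
 show "emeasure M F = emeasure N F" if "finite F" "F <= skeleton" for F
  using edge_measure_finite[OF assms(1) that] edge_measure_finite[OF assms(2) that] by simp
qed

subsection \<open>Existence of the length measure\<close>

text \<open>Length of a set along one edge in units of that edge, by pulling back to the parameter
  interval.\<close>

definition arclen :: "nat list => nat => (real \<times> real) set => ennreal" where
 "arclen w i A = (\<integral>\<^sup>+t. ind {0..1} t * ind A (pw w (t *\<^sub>R q i)) \<partial>lborel)"

definition netlen :: "nat => (real \<times> real) set => ennreal" where
 "netlen n A = (SUM e:earcs n. arclen (fst e) (snd e) A) * ennreal (1 / 3 ^ n)"

lemma measurable_edge_param [measurable]: "(%t. pw w (t *\<^sub>R q i)) : borel_measurable borel"
 by (intro borel_measurable_continuous_onI continuous_intros)

lemma arclen_affine: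
 assumes A[measurable]: "A : sets borel" and c: "c ~= 0"
  and p: "!!t. pw w ((a + c * t) *\<^sub>R q i) = pw v (t *\<^sub>R q j)"
 shows "(\<integral>\<^sup>+t. ind {0..1} ((t - a) / c) * ind A (pw w (t *\<^sub>R q i)) \<partial>lborel) = ennreal \<bar>c\<bar> * arclen v j A"
proof -
 have "(\<integral>\<^sup>+t. ind {0..1} ((t - a) / c) * ind A (pw w (t *\<^sub>R q i)) \<partial>lborel)
  = ennreal \<bar>c\<bar> * (\<integral>\<^sup>+t. ind {0..1} ((a + c * t - a) / c) * ind A (pw w ((a + c * t) *\<^sub>R q i)) \<partial>lborel)"
  by (rule nn_integral_real_affine[OF _ c]) measurable
 thus ?thesis using c by (simp add: arclen_def p)
qed

lemma arclen_split:
 assumes i: "i : {1..4}" and A[measurable]: "A : sets borel"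
 shows "arclen w i A <= ennreal (1/3) * (arclen (w @ [5]) i A + arclen (w @ [i]) (opp i) A + arclen (w @ [i]) i A)"
proof -
 let ?I = "%a c. \<integral>\<^sup>+t. ind {0..1} ((t - a) / c) * ind A (pw w (t *\<^sub>R q i)) \<partial>lborel"
 have p1: "pw w ((0 + (1/3) * t) *\<^sub>R q i) = pw (w @ [5]) (t *\<^sub>R q i)" for t
  using edge_split_param(1)[OF i, of w t] by simp
 have p2: "pw w ((2/3 + (-1/3) * t) *\<^sub>R q i) = pw (w @ [i]) (t *\<^sub>R q (opp i))" for t
  using edge_split_param(2)[OF i, of w t] by (simp add: diff_divide_distrib)
 have p3: "pw w ((2/3 + (1/3) * t) *\<^sub>R q i) = pw (w @ [i]) (t *\<^sub>R q i)" for t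
  using edge_split_param(3)[OF i, of w t] by (simp add: add_divide_distrib)
 \<comment> \<open>The three arguments rescale the thirds of the edge to the unit interval; the
   slope -1/3 accounts for the reversed middle third.\<close>
 have "arclen w i A <= (\<integral>\<^sup>+t. ind {0..1} ((t - 0) / (1/3)) * ind A (pw w (t *\<^sub>R q i))
  + ind {0..1} ((t - 2/3) / (- 1/3)) * ind A (pw w (t *\<^sub>R q i))
  + ind {0..1} ((t - 2/3) / (1/3)) * ind A (pw w (t *\<^sub>R q i)) \<partial>lborel)"
  unfolding arclen_def by (intro nn_integral_mono) (auto simp: indicator_def)
 also have "... = ?I 0 (1/3) + ?I (2/3) (-1/3) + ?I (2/3) (1/3)"
  by (subst nn_integral_add, measurable, subst nn_integral_add, measurable)
 also have "?I 0 (1/3) = ennreal (1/3) * arclen (w @ [5]) i A" using arclen_affine[OF A _ p1] by simp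
 also have "?I (2/3) (-1/3) = ennreal (1/3) * arclen (w @ [i]) (opp i) A" using arclen_affine[OF A _ p2] by simp
 also have "?I (2/3) (1/3) = ennreal (1/3) * arclen (w @ [i]) i A" using arclen_affine[OF A _ p3] by simp
 finally show ?thesis by (simp add: distrib_left)
qed

lemma sum_earcs: "(SUM e:earcs n. f (fst e) (snd e)) = (SUM w:words n. SUM i:{1..4}. f w i)"
 unfolding earcs_def by (simp add: sum.cartesian_product case_prod_beta)

text \<open>Of the twenty edges in the subcells of \<open>w\<close> the left side lists the twelve
  that subdivide its spokes; the other eight are dropped. Lengths and energies both use
  this.\<close>

lemma sum_earcs_Suc_ge:
 fixes f :: "nat list => nat => 'a::ordered_comm_monoid_add"
 assumes f: "!!w i. 0 <= f w i" shows "(SUM w:words n. SUM i:{1..4}. f (w @ [5]) i + f (w @ [i]) (opp i) + f (w @ [i]) i)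
  <= (SUM w:words (Suc n). SUM i:{1..4}. f w i)" unfolding sum_words_snoc
proof (rule sum_mono)
 fix w
 let ?g = "%j. SUM i:{1..4}. f (w @ [j]) i"
 have two: "f (w @ [i]) (opp i) + f (w @ [i]) i <= ?g i" if "i : {1..4}" for i
 proof -
  have "(SUM k:{opp i, i}. f (w @ [i]) k) <= ?g i" by (rule sum_mono2) (use that opp_mem(2)[OF that] f in auto)
  thus ?thesis using opp_neq[OF that] by simp
 qed
 have "(SUM i:{1..4}. f (w @ [5]) i + f (w @ [i]) (opp i) + f (w @ [i]) i)
   = ?g 5 + (SUM i:{1..4}. f (w @ [i]) (opp i) + f (w @ [i]) i)" by (simp only: sum.distrib add.assoc)
 also have "... <= ?g 5 + (SUM i:{1..4}. ?g i)" by (intro add_left_mono sum_mono two)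
 also have "... = (SUM j:{1..5}. ?g j)" unfolding sum5[of ?g] sum4[of ?g] by (simp add: ac_simps)
 finally show "(SUM i:{1..4}. f (w @ [5]) i + f (w @ [i]) (opp i) + f (w @ [i]) i) <= (SUM j:{1..5}. ?g j)" .
qed

lemma netlen_Suc_mono:
 assumes A: "A : sets borel" shows "netlen n A <= netlen (Suc n) A"
proof -
 have "(SUM w:words n. SUM i:{1..4}. arclen w i A)
  <= (SUM w:words n. SUM i:{1..4}. ennreal (1/3) * (arclen (w @ [5]) i A + arclen (w @ [i]) (opp i) A + arclen (w @ [i]) i A))"
  by (intro sum_mono arclen_split A)
 also have "... = ennreal (1/3) * (SUM w:words n. SUM i:{1..4}. arclen (w @ [5]) i A + arclen (w @ [i]) (opp i) A + arclen (w @ [i]) i A)"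
  by (simp only: sum_distrib_left)
 also have "... <= ennreal (1/3) * (SUM w:words (Suc n). SUM i:{1..4}. arclen w i A)"
  by (intro mult_left_mono sum_earcs_Suc_ge) simp_all
 finally have "netlen n A <= ennreal (1/3) * (SUM w:words (Suc n). SUM i:{1..4}. arclen w i A) * ennreal (1 / 3 ^ n)"
  unfolding netlen_def sum_earcs[of "%w i. arclen w i A"] by (rule mult_right_mono) simp
 also have "... = (SUM w:words (Suc n). SUM i:{1..4}. arclen w i A) * (ennreal (1/3) * ennreal (1 / 3 ^ n))"
  by (simp only: ac_simps)
 also have "ennreal (1/3) * ennreal (1 / 3 ^ n) = ennreal (1 / 3 ^ Suc n)"
  by (subst ennreal_mult[symmetric]) (simp_all add: field_simps)
 finally show ?thesis unfolding netlen_def[of "Suc n"] sum_earcs[of "%w i. arclen w i A"] .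
qed

lemma arclen_suminf:
 assumes "!!k::nat. A k : sets borel" "disjoint_family A" shows "arclen w i (\<Union>k. A k) = (\<Sum>k. arclen w i (A k))"
proof -
 note [measurable] = assms(1)
 have "arclen w i (\<Union>k. A k) = (\<integral>\<^sup>+t. (\<Sum>k. ind {0..1} t * ind (A k) (pw w (t *\<^sub>R q i))) \<partial>lborel)"
  unfolding arclen_def by (simp only: suminf_indicator[OF assms(2), symmetric] ennreal_suminf_cmult)
 also have "... = (\<Sum>k. arclen w i (A k))" unfolding arclen_def by (rule nn_integral_suminf) measurable
 finally show ?thesis .
qed

lemma netlen_suminf:
 assumes "!!k::nat. A k : sets borel" "disjoint_family A" shows "netlen n (\<Union>k. A k) = (\<Sum>k. netlen n (A k))"
 unfolding netlen_def arclen_suminf[OF assms] ennreal_suminf_multc by (simp add: suminf_sum summableI)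

text \<open>The lengths inside the cable systems increase with the level, and an increasing limit of
  measures is again countably additive.\<close>

definition nu0 :: "(real \<times> real) measure" where
 "nu0 = measure_of skeleton (sets (restrict_space borel skeleton)) (%A. SUP n. netlen n A)"

lemma skeleton_borel: "skeleton : sets borel"
 unfolding skeleton_def using closed_Vbar by (intro sets.countable_UN) auto

lemma restrict_skeleton_borel: "A : sets (restrict_space borel skeleton) ==> A : sets borel"
 using skeleton_borel by (subst (asm) sets_restrict_space_iff) auto

lemma sigma_algebra_skeleton: "sigma_algebra skeleton (sets (restrict_space borel skeleton))"
 using sets.sigma_algebra_axioms[of "restrict_space borel skeleton"] by (simp add: space_restrict_space)

lemma sets_nu0: "sets nu0 = sets (restrict_space borel skeleton)" and space_nu0: "space nu0 = skeleton"
proof -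
 interpret sigma_algebra skeleton "sets (restrict_space borel skeleton)" by (rule sigma_algebra_skeleton)
 show "sets nu0 = sets (restrict_space borel skeleton)"
  unfolding nu0_def using space_closed by (simp add: sigma_sets_eq)
 show "space nu0 = skeleton" unfolding nu0_def using space_closed by simp
qed

lemma emeasure_nu0:
 assumes "A : sets (restrict_space borel skeleton)" shows "emeasure nu0 A = (SUP n. netlen n A)" unfolding nu0_def
proof (rule emeasure_measure_of_sigma[OF sigma_algebra_skeleton])
 show "positive (sets (restrict_space borel skeleton)) (%A. SUP n. netlen n A)"
  by (simp add: positive_def netlen_def arclen_def)
 show "countably_additive (sets (restrict_space borel skeleton)) (%A. SUP n. netlen n A)"
  unfolding countably_additive_def
 proof (intro allI impI)
  fix A :: "nat => (real \<times> real) set"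
  assume A: "range A <= sets (restrict_space borel skeleton)" "disjoint_family A"
  hence b: "A k : sets borel" for k by (intro restrict_skeleton_borel) auto
  have "(\<Sum>k. SUP n. netlen n (A k)) = (SUP n. \<Sum>k. netlen n (A k))"
   by (rule ennreal_suminf_SUP_eq) (intro incseq_SucI netlen_Suc_mono b)
  thus "(\<Sum>k. SUP n. netlen n (A k)) = (SUP n. netlen n (\<Union>k. A k))" by (simp only: netlen_suminf[OF b A(2)])
 qed
qed fact

lemma arclen_edge_self: "arclen w i (edge w i) = 1"
proof -
 have "arclen w i (edge w i) = (\<integral>\<^sup>+t. ind {0..1::real} t \<partial>lborel)"
  unfolding arclen_def by (intro nn_integral_cong) (auto simp: indicator_def edge_def)
 thus ?thesis by simp
qed

lemma arclen_edge_other: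
 assumes "(w, i) : earcs n" "(v, j) : earcs n" "(w, i) ~= (v, j)" shows "arclen w i (edge v j) = 0"
proof -
 have "arclen w i (edge v j) <= (\<integral>\<^sup>+t. ind {0, 1::real} t \<partial>lborel)" unfolding arclen_def
 proof (rule nn_integral_mono)
  fix t :: real
  show "ind {0..1} t * ind (edge v j) (pw w (t *\<^sub>R q i)) <= (ind {0, 1} t :: ennreal)"
   using edges_meet_same[OF assms, of t] by (auto simp: indicator_def)
 qed
 also have "... = 0" by (subst nn_integral_indicator) (auto simp: emeasure_lborel_countable)
 finally show ?thesis by simp
qed

lemma netlen_edge_same:
 assumes "(w, i) : earcs n" shows "netlen n (edge w i) = ennreal (1 / 3 ^ n)"
proof -
 have "(SUM e:earcs n. arclen (fst e) (snd e) (edge w i)) = (SUM e:earcs n. if e = (w, i) then 1 else 0)"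
 proof (rule sum.cong)
  fix e assume e: "e : earcs n"
  show "arclen (fst e) (snd e) (edge w i) = (if e = (w, i) then 1 else 0)"
  proof (cases "e = (w, i)")
   case True
   thus ?thesis by (simp add: arclen_edge_self)
  next
   case False
   thus ?thesis using arclen_edge_other[of "fst e" "snd e" n w i] e assms by simp
  qed
 qed simp
 also have "... = 1" using assms by simp
 finally show ?thesis by (simp add: netlen_def)
qed

lemma netlen_Un: assumes "A : sets borel" "B : sets borel" shows "netlen n (A Un B) <= netlen n A + netlen n B"
proof -
 have "arclen w i (A Un B) <= arclen w i A + arclen w i B" for w i
 proof -
  note [measurable] = assms
  have "arclen w i (A Un B) <= (\<integral>\<^sup>+t. ind {0..1} t * ind A (pw w (t *\<^sub>R q i))
    + ind {0..1} t * ind B (pw w (t *\<^sub>R q i)) \<partial>lborel)"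
   unfolding arclen_def by (intro nn_integral_mono) (auto simp: indicator_def)
  also have "... = arclen w i A + arclen w i B" unfolding arclen_def by (rule nn_integral_add) measurable
  finally show ?thesis .
 qed
 hence "(SUM e:earcs n. arclen (fst e) (snd e) (A Un B)) <= (SUM e:earcs n. arclen (fst e) (snd e) A + arclen (fst e) (snd e) B)"
  by (intro sum_mono)
 thus ?thesis unfolding netlen_def sum.distrib distrib_right[symmetric] by (rule mult_right_mono) simp
qed

lemma earcs_snoc:
 assumes "(w, i) : earcs n"
 shows "(w @ [5], i) : earcs (Suc n)" "(w @ [i], opp i) : earcs (Suc n)" "(w @ [i], i) : earcs (Suc n)"
 using assms opp_mem(2)[of i] by (auto simp: earcs_iff snoc_in_words)

text \<open>Splitting into thirds bounds the length from above by induction; monotonicity in the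
  level bounds it from below.\<close>

lemma netlen_edge: "(w, i) : earcs n ==> netlen (n + d) (edge w i) = ennreal (1 / 3 ^ n)"
proof (induction d arbitrary: w i n)
 case 0
 thus ?case by (simp add: netlen_edge_same)
next
 case (Suc d)
 have i: "i : {1..4}" using Suc.prems by (simp add: earcs_iff)
 have b: "edge v j : sets borel" for v j using closed_edge by (rule borel_closed)
 have IH: "netlen (n + Suc d) (edge v j) = ennreal (1 / 3 ^ Suc n)" if "(v, j) : earcs (Suc n)" for v j
  using Suc.IH[OF that] by simp
 have "netlen (n + Suc d) (edge w i) <= netlen (n + Suc d) (edge (w @ [5]) i)
   + netlen (n + Suc d) (edge (w @ [i]) (opp i)) + netlen (n + Suc d) (edge (w @ [i]) i)"
  unfolding edge_split[OF i, of w] by (rule order_trans[OF netlen_Un add_right_mono[OF netlen_Un]]) (intro b sets.Un)+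
 also have "... = ennreal (1 / 3 ^ n)"
  unfolding IH[OF earcs_snoc(1)[OF Suc.prems]] IH[OF earcs_snoc(2)[OF Suc.prems]] IH[OF earcs_snoc(3)[OF Suc.prems]]
  by (subst ennreal_plus[symmetric], simp_all)+
 finally have "netlen (n + Suc d) (edge w i) <= ennreal (1 / 3 ^ n)" .
 moreover have "ennreal (1 / 3 ^ n) <= netlen (n + Suc d) (edge w i)"
  using netlen_Suc_mono[OF b, of "n + d" w i] Suc.IH[OF Suc.prems] by simp
 ultimately show ?case by (rule antisym)
qed

lemma edge_sets: "(w, i) : earcs n ==> edge w i : sets (restrict_space borel skeleton)"
 by (rule closed_in_restrict_borel[OF closed_edge edge_skeleton])

lemma nu0_edge: assumes "(w, i) : earcs n" shows "emeasure nu0 (edge w i) = ennreal (1 / 3 ^ n)"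
 unfolding emeasure_nu0[OF edge_sets[OF assms]]
proof (rule antisym)
 show "(SUP m. netlen m (edge w i)) <= ennreal (1 / 3 ^ n)"
 proof (rule SUP_least)
  fix m
  have "netlen m (edge w i) <= netlen (n + m) (edge w i)"
   by (rule lift_Suc_mono_le[where f = "%k. netlen k (edge w i)"]) (simp_all add: netlen_Suc_mono closed_edge borel_closed)
  thus "netlen m (edge w i) <= ennreal (1 / 3 ^ n)" using netlen_edge[OF assms] by simp
 qed
 show "ennreal (1 / 3 ^ n) <= (SUP m. netlen m (edge w i))"
  using netlen_edge[OF assms, of 0] by (intro SUP_upper2[of n]) simp_all
qed

lemma edge_measure_nu0: "edge_measure nu0" unfolding edge_measure_def
proof (intro conjI allI ballI)
 show "sets nu0 = sets (restrict_space borel skeleton)" by (rule sets_nu0)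
 show "emeasure nu0 e = ennreal (1 / 3 ^ n)" if "e : edges n" for n e using that by (rule edgesE) (simp add: nu0_edge)
 show "sigma_finite_measure nu0"
 proof
  show "EX A. countable A & A <= sets nu0 & \<Union> A = space nu0 & (ALL a:A. emeasure nu0 a ~= \<infinity>)"
  proof (intro exI[of _ alledges] conjI ballI)
   show "countable alledges" by (rule countable_alledges)
   show "alledges <= sets nu0"
    unfolding sets_nu0 by (rule subsetI, rule closed_in_restrict_borel[OF conjunct1[OF alledges_closed] conjunct2[OF alledges_closed]])
   show "\<Union> alledges = space nu0" using skeleton_open_edges[of UNIV] by (simp add: space_nu0)
   show "emeasure nu0 e ~= \<infinity>" if "e : alledges" for e using that by (rule alledgesE) (simp add: nu0_edge)
  qed
 qed
qed

lemma edge_measure_vnu: "edge_measure vnu"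
proof -
 have "vnu = (THE M. edge_measure M)" by (simp add: vnu_def edge_measure_def)
 also have "... = nu0"
  by (rule the_equality[where P = edge_measure, OF edge_measure_nu0]) (rule edge_measure_unique[OF _ edge_measure_nu0])
 finally show ?thesis using edge_measure_nu0 by simp
qed

lemma sets_vnu: "sets vnu = sets (restrict_space borel skeleton)" and sigma_finite_vnu: "sigma_finite_measure vnu"
 using edge_measure_vnu by (simp_all add: edge_measure_def)

lemma space_vnu: "space vnu = skeleton" using sets_eq_imp_space_eq[OF sets_vnu] by (simp add: space_restrict_space)

lemmas emeasure_vnu_edge = edge_measureD[OF edge_measure_vnu]
lemmas emeasure_vnu_finite = edge_measure_finite[OF edge_measure_vnu]

section \<open>Power inequalities\<close>

text \<open>The tangent inequality for x^p at the point \<open>s\<close>, rearranged. Choosing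
  \<open>s\<close> afterwards as a mean turns it into Jensen's or Hoelder's inequality.\<close>

lemma young_powr:
 assumes p: "1 < p" and x: "0 <= x" and s: "0 < (s::real)" shows "x <= (x powr p * s powr (1 - p) + (p - 1) * s) / p"
proof -
 have "(x / s) * 1 <= (x / s) powr p / p + 1 powr (p / (p - 1)) / (p / (p - 1))"
  by (rule Youngs_inequality) (use assms in \<open>auto simp: field_simps\<close>)
 hence "x / s <= (x / s) powr p / p + (p - 1) / p" using p by simp
 hence "s * (x / s) <= s * ((x / s) powr p / p + (p - 1) / p)" using s by (intro mult_left_mono) auto
 also have "... = (x powr p * (s * s powr (- p)) + (p - 1) * s) / p"
  using x s p by (simp add: powr_divide powr_minus field_simps)
 also have "s * s powr (- p) = s powr (1 - p)" using s by (simp add: powr_diff powr_minus field_simps)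
 finally show ?thesis using s by simp
qed

lemma powr_sum_weighted:
 fixes w y :: "'a => real"
 assumes p: "1 < p" and I: "finite I" and w: "!!i. i : I ==> 0 <= w i" and y: "!!i. i : I ==> 0 <= y i"
 shows "(SUM i:I. w i * y i) powr p <= (SUM i:I. w i) powr (p - 1) * (SUM i:I. w i * y i powr p)"
proof -
 let ?W = "SUM i:I. w i" and ?Y = "SUM i:I. w i * y i" and ?P = "SUM i:I. w i * y i powr p"
 have nn: "0 <= ?W" "0 <= ?Y" "0 <= ?P" using w y by (auto intro!: sum_nonneg)
 show ?thesis
 proof (cases "?Y = 0")
  case True
  thus ?thesis using nn by simp
 next
  case False
  hence Y: "0 < ?Y" using nn by simp
  have W: "0 < ?W"
  proof (rule ccontr)
   assume "\<not> 0 < ?W"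
   hence "?W = 0" using nn by simp
   hence "w i = 0" if "i : I" for i using sum_nonneg_eq_0_iff[OF I, of w] w that by auto
   thus False using Y by simp
  qed
  define s where "s = ?Y / ?W"
  have s: "0 < s" using Y W by (simp add: s_def)
  have "?Y <= (SUM i:I. w i * ((y i powr p * s powr (1 - p) + (p - 1) * s) / p))"
   by (intro sum_mono mult_left_mono young_powr p s y w)
  also have "... = (?P * s powr (1 - p) + (p - 1) * s * ?W) / p"
   unfolding sum_distrib_right sum_distrib_left sum.distrib[symmetric] sum_divide_distrib
   by (intro sum.cong refl) (simp add: algebra_simps)
  also have "s * ?W = ?Y" using W by (simp add: s_def)
  hence "(?P * s powr (1 - p) + (p - 1) * s * ?W) / p = (?P * s powr (1 - p) + (p - 1) * ?Y) / p"
   by (simp add: mult.assoc)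
  finally have "p * ?Y <= ?P * s powr (1 - p) + (p - 1) * ?Y" using p by (simp add: field_simps)
  hence "?Y <= ?P * s powr (1 - p)" by (simp add: algebra_simps)
  hence "?Y * s powr (p - 1) <= ?P * s powr (1 - p) * s powr (p - 1)" by (intro mult_right_mono) auto
  also have "... = ?P" using s by (simp add: mult.assoc flip: powr_add)
  finally have *: "?Y * s powr (p - 1) <= ?P" .
  have "?Y powr p = ?Y * ?Y powr (p - 1)" using powr_mult_base[of ?Y "p - 1"] nn by simp
  also have "... = ?Y * (?W powr (p - 1) * s powr (p - 1))" using Y W by (simp add: s_def powr_divide)
  also have "... = ?W powr (p - 1) * (?Y * s powr (p - 1))" by simp
  also have "... <= ?W powr (p - 1) * ?P" using * by (intro mult_left_mono) auto
  finally show ?thesis .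
 qed
qed

lemma powr_sum_le:
 fixes y :: "'a => real"
 assumes "1 < p" "finite I" "!!i. i : I ==> 0 <= y i"
 shows "(SUM i:I. y i) powr p <= real (card I) powr (p - 1) * (SUM i:I. y i powr p)"
 using powr_sum_weighted[OF assms(1,2), of "%_. 1" y] assms(3) by simp

lemma powr_add_le:
 assumes "1 < p" "0 <= a" "0 <= (b::real)" shows "(a + b) powr p <= 2 powr (p - 1) * (a powr p + b powr p)"
 using powr_sum_le[of p "{True, False}" "%x. if x then a else b"] assms by simp

lemma powr_add3_le:
 assumes "1 < p" "0 <= a" "0 <= b" "0 <= (c::real)"
 shows "(a + b + c) powr p <= 3 powr (p - 1) * (a powr p + b powr p + c powr p)"
 using powr_sum_le[of p "{0, 1, 2::nat}" "%x. if x = 0 then a else if x = 1 then b else c"] assms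
 by (simp add: add.assoc)

text \<open>Hoelder's inequality with weights t^m: the constant does not depend on the number of
  terms, at the price of a factor t^(1-p) > 1 per step that the decay of \<open>b\<close> has to
  absorb.\<close>

lemma powr_geometric_sum:
 fixes b :: "nat => real"
 assumes p: "1 < p" and t: "0 < t" "t < 1" and b: "!!m. 0 <= b m"
 shows "(\<Sum>m<M. b m) powr p <= (1 / (1 - t)) powr (p - 1) * (\<Sum>m<M. (t powr (1 - p)) ^ m * b m powr p)"
proof -
 have "(\<Sum>m<M. b m) = (\<Sum>m<M. t ^ m * (b m / t ^ m))" using t by simp
 hence "(\<Sum>m<M. b m) powr p <= (\<Sum>m<M. t ^ m) powr (p - 1) * (\<Sum>m<M. t ^ m * (b m / t ^ m) powr p)"
  using powr_sum_weighted[OF p, of "{..<M}" "%m. t ^ m" "%m. b m / t ^ m"] t b by simp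
 also have "... <= (1 / (1 - t)) powr (p - 1) * (\<Sum>m<M. t ^ m * (b m / t ^ m) powr p)"
 proof (rule mult_right_mono)
  have "(\<Sum>m<M. t ^ m) <= 1 / (1 - t)" using t by (simp add: sum_gp_strict field_simps)
  thus "(\<Sum>m<M. t ^ m) powr (p - 1) <= (1 / (1 - t)) powr (p - 1)" using t p by (intro powr_mono2 sum_nonneg) auto
 qed (use t in \<open>auto intro!: sum_nonneg\<close>)
 also have "(\<Sum>m<M. t ^ m * (b m / t ^ m) powr p) = (\<Sum>m<M. (t powr (1 - p)) ^ m * b m powr p)"
 proof (rule sum.cong)
  fix m
  have "t ^ m * (b m / t ^ m) powr p = (t powr m * t powr (- (m * p))) * b m powr p"
   using t b by (simp add: powr_divide powr_powr powr_minus flip: powr_realpow) (simp add: field_simps)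
  also have "t powr m * t powr (- (m * p)) = (t powr (1 - p)) ^ m"
   using t by (simp add: powr_powr algebra_simps flip: powr_add powr_realpow)
  finally show "t ^ m * (b m / t ^ m) powr p = (t powr (1 - p)) ^ m * b m powr p" .
 qed simp
 finally show ?thesis .
qed

section \<open>Discrete energies\<close>

definition incr :: "(real \<times> real => real) => nat list => nat => real" where
 "incr f w i = f (pw w (q i)) - f (pw w (q 5))"

text \<open>The relation that increments satisfy under subdivision; the middle term is negative
  because that third is named against the direction of the edge. The abstract \<open>d\<close> also
  covers prescribed increments and shifted families.\<close>

definition consistent :: "(nat list => nat => real) => bool" where
 "consistent d \<longleftrightarrow> (ALL n w i. (w, i) : earcs n -->
  d w i = d (w @ [5]) i - d (w @ [i]) (opp i) + d (w @ [i]) i)"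

text \<open>The factor is 3^(np) 3^(-n): this is the integral of the p-th power of the difference
  quotients over the cables of level \<open>n\<close>.\<close>

definition energy :: "real => (nat list => nat => real) => nat => real" where
 "energy p d n = (3 powr (p - 1)) ^ n * (SUM w:words n. SUM i:{1..4}. \<bar>d w i\<bar> powr p)"

lemma psi_word_snoc5: "pw (w @ [5]) (q 5) = pw w (q 5)" by (simp add: psi_word_snoc psi_q)

lemma psi_word_snoc_q: "pw (w @ [i]) (q i) = pw w (q i)" by (simp add: psi_word_snoc psi_q)

lemma psi_word_snoc_touch: "i : {1..5} ==> pw (w @ [5]) (q i) = pw (w @ [i]) (q (opp i))"
 by (simp add: psi_word_snoc psi_touch)

lemma incr_step:
 assumes "i : {1..5}"
 shows "f (pw (w @ [i]) (q 5)) - f (pw w (q 5)) = incr f (w @ [5]) i - incr f (w @ [i]) (opp i)"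
 unfolding incr_def psi_word_snoc5 psi_word_snoc_touch[OF assms] by simp

lemma incr_5 [simp]: "incr f w 5 = 0" by (simp add: incr_def)

lemma consistent_incr: "consistent (incr f)" unfolding consistent_def
proof (intro allI impI)
 fix n w i assume "(w, i) : earcs n"
 hence "i : {1..5}" by (auto simp: earcs_iff)
 from psi_word_snoc_touch[OF this, of w] show "incr f w i = incr f (w @ [5]) i - incr f (w @ [i]) (opp i) + incr f (w @ [i]) i"
  unfolding incr_def psi_word_snoc5 psi_word_snoc_q by simp
qed

lemma energy_nonneg: "0 <= energy p d n" unfolding energy_def by (intro mult_nonneg_nonneg sum_nonneg) auto

text \<open>The power mean inequality over the three parts of an edge; edges that are new at the
  next level only add.\<close>

lemma energy_Suc_mono:
 assumes p: "1 < p" and d: "consistent d" shows "energy p d n <= energy p d (Suc n)"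
proof -
 let ?f = "%w i. \<bar>d w i\<bar> powr p"
 have "?f w i <= 3 powr (p - 1) * (?f (w @ [5]) i + ?f (w @ [i]) (opp i) + ?f (w @ [i]) i)"
  if "w : words n" "i : {1..4}" for w i
 proof -
  have "d w i = d (w @ [5]) i - d (w @ [i]) (opp i) + d (w @ [i]) i"
   using d that unfolding consistent_def earcs_iff by blast
  hence "abs (d w i) <= abs (d (w @ [5]) i) + abs (d (w @ [i]) (opp i)) + abs (d (w @ [i]) i)" by linarith
  hence "?f w i <= (abs (d (w @ [5]) i) + abs (d (w @ [i]) (opp i)) + abs (d (w @ [i]) i)) powr p"
   using p by (intro powr_mono2) auto
  also have "... <= 3 powr (p - 1) * (?f (w @ [5]) i + ?f (w @ [i]) (opp i) + ?f (w @ [i]) i)"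
   by (intro powr_add3_le p) auto
  finally show ?thesis .
 qed
 hence "(SUM w:words n. SUM i:{1..4}. ?f w i)
   <= (SUM w:words n. SUM i:{1..4}. 3 powr (p - 1) * (?f (w @ [5]) i + ?f (w @ [i]) (opp i) + ?f (w @ [i]) i))"
  by (intro sum_mono)
 also have "... = 3 powr (p - 1) * (SUM w:words n. SUM i:{1..4}. ?f (w @ [5]) i + ?f (w @ [i]) (opp i) + ?f (w @ [i]) i)"
  by (simp only: sum_distrib_left)
 also have "... <= 3 powr (p - 1) * (SUM w:words (Suc n). SUM i:{1..4}. ?f w i)"
  by (intro mult_left_mono sum_earcs_Suc_ge) auto
 finally have "(3 powr (p - 1)) ^ n * (SUM w:words n. SUM i:{1..4}. ?f w i)
   <= (3 powr (p - 1)) ^ n * (3 powr (p - 1) * (SUM w:words (Suc n). SUM i:{1..4}. ?f w i))" by (intro mult_left_mono) auto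
 thus ?thesis unfolding energy_def power_Suc by (simp only: mult_ac)
qed

lemma energy_mono: "1 < p ==> consistent d ==> m <= n ==> energy p d m <= energy p d n"
 by (rule lift_Suc_mono_le[of "energy p d"]) (simp_all add: energy_Suc_mono)

definition shift :: "(nat list => nat => real) => nat list => nat list => nat => real" where
 "shift d w u i = d (w @ u) i"

lemma consistent_shift: "consistent d ==> w : words k ==> consistent (shift d w)" unfolding consistent_def shift_def
proof (intro allI impI)
 fix n u i
 assume d: "ALL n w i. (w, i) : earcs n --> d w i = d (w @ [5]) i - d (w @ [i]) (opp i) + d (w @ [i]) i"
  and w: "w : words k" and u: "(u, i) : earcs n"
 have "(w @ u, i) : earcs (k + n)" using w u by (simp add: earcs_iff append_in_words words_length)
 thus "d (w @ u) i = d (w @ u @ [5]) i - d (w @ u @ [i]) (opp i) + d (w @ u @ [i]) i" using d by simp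
qed

text \<open>The weight is multiplicative in the level and words split uniquely, so the rescaled
  energies of the cells add up exactly.\<close>

lemma energy_add: "(3 powr (p - 1)) ^ k * (SUM w:words k. energy p (shift d w) n) = energy p d (k + n)"
 unfolding energy_def shift_def sum_words_add power_add by (simp add: sum_distrib_left mult.assoc)

text \<open>The oscillation of a function in a cell is controlled by a chain of edges of decreasing length.\<close>

lemma chain_bound:
 assumes f: "continuous_on K f" and t: "0 < t" "t < (1::real)" and B: "0 <= B" and w: "w : words k"
  and d: "!!n u i. u : words n ==> i : {1..4} ==> \<bar>incr f (w @ u) i\<bar> <= B * t ^ n" and x: "x : K"
 shows "abs (f (pw w x) - f (pw w (q 5))) <= 2 * B / (1 - t)"
proof -
 have step: "abs (f (pw (w @ u) (q 5)) - f (pw w (q 5))) <= 2 * B * (\<Sum>m<n. t ^ m)" if "u : words n" for u n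
  using that
 proof (induction n arbitrary: u)
  case (Suc n)
  have "u : words (n + 1)" using Suc.prems by simp
  then obtain v j where "u = v @ j" "v : words n" "j : words 1" by (rule words_addE)
  then obtain i where u: "u = v @ [i]" "v : words n" "i : {1..5}" by (auto simp: words_def length_Suc_conv)
  have m: "v @ [j] : words (Suc n)" if "j : {1..5}" for j using u(2) that by (simp add: snoc_in_words)
  have le: "abs (incr f (w @ v @ [j]) i') <= B * t ^ n" if "j : {1..5}" "i' : {1..5}" for j i'
  proof (cases "i' = 5")
   case False
   hence "abs (incr f (w @ v @ [j]) i') <= B * t ^ Suc n" using d[OF m[OF that(1)], of i'] that by auto
   also have "... <= B * t ^ n" using t B by (intro mult_left_mono power_decreasing) auto
   finally show ?thesis .
  qed (use B t in simp)
  have "abs (f (pw (w @ v @ [i]) (q 5)) - f (pw (w @ v) (q 5))) <= 2 * (B * t ^ n)"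
   using incr_step[OF u(3), of f "w @ v"] le[of 5 i] le[of i "opp i"] u(3) opp_mem(1)[OF u(3)] by auto
  thus ?case using Suc.IH[OF u(2)] unfolding u(1) by (simp add: algebra_simps)
 qed simp
 have geo: "(\<Sum>m<n. t ^ m) <= 1 / (1 - t)" for n using t by (simp add: sum_gp_strict field_simps)
 have bound: "abs (f (pw (w @ u) (q 5)) - f (pw w (q 5))) <= 2 * B / (1 - t)" if "u : words n" for u n
 proof -
  have "2 * B * (\<Sum>m<n. t ^ m) <= 2 * B * (1 / (1 - t))" using geo B by (intro mult_left_mono) auto
  thus ?thesis using step[OF that] by simp
 qed
 define U where "U n = (SOME u. u : words n & (EX y:K. x = pw u y))" for n
 have "U n : words n & (EX y:K. x = pw (U n) y)" for n
 proof -
  obtain u y where "u : words n" "y : K" "x = pw u y" using x by (rule vicsek_wordE)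
  hence "EX u. u : words n & (EX y:K. x = pw u y)" by blast
  thus ?thesis unfolding U_def by (rule someI_ex)
 qed
 hence U: "U n : words n" "EX y:K. x = pw (U n) y" for n by simp_all
 have lim: "(%n. pw (w @ U n) (q 5)) \<longlonglongrightarrow> pw w x"
 proof (rule metric_LIMSEQ_I)
  fix e :: real assume "e > 0"
  then obtain N where N: "2 / 3 ^ N < e" by (rule power3_small)
  have "dist (pw (w @ U n) (q 5)) (pw w x) < e" if "n \<ge> N" for n
  proof -
   obtain y where y: "y : K" "x = pw (U n) y" using U(2) by blast
   have "dist (pw (w @ U n) (q 5)) (pw w x) = dist (q 5) y / 3 ^ (k + n)"
    unfolding y(2) psi_word_append comp_apply dist_psi_word words_length[OF w] words_length[OF U(1)]
    by (simp add: power_add)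
   also have "... <= 2 / 3 ^ (k + n)" using dist_vicsek[OF q_vicsek[of 5] y(1)] by (intro divide_right_mono) auto
   also have "... <= 2 / 3 ^ N" using that by (intro divide_left_mono power_increasing) auto
   finally show ?thesis using N by simp
  qed
  thus "EX no. \<forall>n\<ge>no. dist (pw (w @ U n) (q 5)) (pw w x) < e" by blast
 qed
 have "(%n. f (pw (w @ U n) (q 5))) \<longlonglongrightarrow> f (pw w x)"
 proof (rule continuous_on_tendsto_compose[OF f lim])
  show "pw w x : K" by (rule psi_word_vicsek[OF w x])
  have "pw (w @ U n) (q 5) : K" for n
   using psi_word_vicsek[OF w psi_word_vicsek[OF U(1) q_vicsek[of 5]]] by (simp add: psi_word_append)
  thus "\<forall>\<^sub>F n in sequentially. pw (w @ U n) (q 5) : K" by simp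
 qed
 hence "(%n. \<bar>f (pw (w @ U n) (q 5)) - f (pw w (q 5))\<bar>) \<longlonglongrightarrow> \<bar>f (pw w x) - f (pw w (q 5))\<bar>"
  by (intro tendsto_intros)
 thus ?thesis by (rule LIMSEQ_le_const2) (intro exI[of _ 0] allI impI bound[OF U(1)])
qed

section \<open>Neighbouring cells\<close>

text \<open>A cell that comes so close to \<open>q a\<close> has only the letter \<open>a\<close> in
  its word, since the other subcells stay sqrt 2 / 3 > 1/3 away from the corner.\<close>

lemma corner_near:
 "a : {1..4} ==> u : words k ==> y : K ==> dist (pw u y) (q a) < 1 / 3 ^ Suc k ==>
  q a : pw u ` K"
proof (induction u arbitrary: k)
 case Nil
 thus ?case using q_vicsek[of a] by auto
next
 case (Cons b u)
 then obtain m where m: "k = Suc m" "u : words m" "b : {1..5}" by (auto simp: words_def)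
 have yK: "pw u y : K" by (rule psi_word_vicsek[OF m(2) Cons.prems(3)])
 have "b = a"
 proof (rule ccontr)
  assume "b ~= a"
  have "(1::real) / 3 ^ Suc k <= 1 / 3 ^ 1" by (intro divide_left_mono power_increasing) auto
  moreover have "dist (psi b (pw u y)) (q a) < 1 / 3 ^ Suc k"
   using Cons.prems(4) by (simp only: psi_word_Cons comp_apply)
  ultimately have "dist (psi b (pw u y)) (q a) < 1 / 3" using less_le_trans by (metis power_one_right)
  moreover have "pw u y : sqr" using yK vicsek_sqr by blast
  hence "sqrt 2 / 3 <= dist (psi b (pw u y)) (q a)" by (rule corner_dist[OF Cons.prems(1) m(3) \<open>b ~= a\<close>])
  ultimately show False using sqrt2_bounds by linarith
 qed
 have "dist (pw u y) (q a) / 3 = dist (psi a (pw u y)) (psi a (q a))" by (rule dist_psi[symmetric])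
 also have "... < 1 / 3 ^ Suc k" using Cons.prems(4) \<open>b = a\<close> by (simp add: psi_word_Cons psi_q)
 finally have "dist (pw u y) (q a) < 1 / 3 ^ Suc m" by (simp add: m(1))
 then obtain z where z: "z : K" "q a = pw u z" using Cons.IH[OF Cons.prems(1) m(2) Cons.prems(3)] by blast
 have "q a = pw (b # u) z" using z(2) psi_q[of a] \<open>b = a\<close> by (simp add: psi_word_Cons)
 thus ?case using z(1) by blast
qed

text \<open>After removal of common letters only the central cell and a corner cell can be that
  close. By \<open>touch_dist\<close> both points are then equally close to the touching point, and
  by \<open>corner_near\<close> both cells contain it.\<close>

lemma near_cells_touch:
 "u : words k ==> v : words k ==> x : K ==> y : K ==>
  dist (pw u x) (pw v y) < 1 / 3 ^ Suc k ==> EX z. z : pw u ` K & z : pw v ` K"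
proof (induction k arbitrary: u v)
 case 0
 thus ?case by (intro exI[of _ x]) auto
next
 case (Suc k)
 obtain i u' where u: "u = i # u'" "i : {1..5}" "u' : words k" using Suc.prems(1) by (rule words_SucE)
 obtain j v' where v: "v = j # v'" "j : {1..5}" "v' : words k" using Suc.prems(2) by (rule words_SucE)
 have K: "pw u' x : K" "pw v' y : K" using u v Suc.prems psi_word_vicsek by auto
 have d: "dist (psi i (pw u' x)) (psi j (pw v' y)) < 1 / 3 ^ Suc (Suc k)"
  using Suc.prems(5) by (simp add: u v psi_word_Cons)
 have touch: "EX z. z : pw (5 # u1) ` K & z : pw (a # v1) ` K"
  if a: "a : {1..4}" and u1: "u1 : words k" "x1 : K" and v1: "v1 : words k" "y1 : K"
   and d1: "dist (psi 5 (pw u1 x1)) (psi a (pw v1 y1)) < 1 / 3 ^ Suc (Suc k)" for a u1 v1 x1 y1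
 proof -
  have s: "pw u1 x1 : sqr" "pw v1 y1 : sqr"
   using psi_word_vicsek[OF u1] psi_word_vicsek[OF v1] vicsek_sqr by auto
  have a5: "a : {1..5}" using a by auto
  have "dist (pw u1 x1) (q a) / 3 < 1 / 3 ^ Suc (Suc k)"
   using touch_dist(1)[OF a s] d1 unfolding dist_psi by linarith
  hence 1: "q a : pw u1 ` K" by (intro corner_near[OF a u1]) simp
  have "dist (pw v1 y1) (q (opp a)) / 3 < 1 / 3 ^ Suc (Suc k)"
   using touch_dist(2)[OF a s] d1 unfolding psi_touch[OF a5] dist_psi by linarith
  hence 2: "q (opp a) : pw v1 ` K" by (intro corner_near[OF opp_mem(2)[OF a] v1]) simp
  have "psi 5 (q a) : pw (5 # u1) ` K" using 1 by (auto simp: psi_word_Cons)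
  moreover have "psi 5 (q a) : pw (a # v1) ` K" unfolding psi_touch[OF a5] using 2 by (auto simp: psi_word_Cons)
  ultimately show ?thesis by blast
 qed
 consider "i = j" | "i = 5" "j : {1..4}" | "j = 5" "i : {1..4}" | "i : {1..4}" "j : {1..4}" "i ~= j"
  using u(2) v(2) by force
 thus ?case
 proof cases
  case 1
  have "dist (pw u' x) (pw v' y) < 1 / 3 ^ Suc k" using d unfolding 1 dist_psi by simp
  then obtain z where "z : pw u' ` K" "z : pw v' ` K"
   using Suc.IH[OF u(3) v(3) Suc.prems(3,4)] by blast
  hence "psi i z : pw u ` K" "psi i z : pw v ` K"
   unfolding u v 1 psi_word_Cons image_comp[symmetric] by simp_all
  thus ?thesis by blast
 next
  case 2
  thus ?thesis using touch[OF 2(2) u(3) Suc.prems(3) v(3) Suc.prems(4)] d u v by simp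
 next
  case 3
  have "dist (psi 5 (pw v' y)) (psi i (pw u' x)) < 1 / 3 ^ Suc (Suc k)"
   using d unfolding 3(1) by (simp only: dist_commute)
  from touch[OF 3(2) v(3) Suc.prems(4) u(3) Suc.prems(3) this] show ?thesis unfolding u(1) v(1) 3(1) by blast
 next
  case 4
  have "(1::real) / 3 ^ Suc (Suc k) <= 1 / 3 ^ 1" by (intro divide_left_mono power_increasing) auto
  from less_le_trans[OF d this] have "dist (psi i (pw u' x)) (psi j (pw v' y)) < 1 / 3" by simp
  moreover have "sqrt 2 / 3 <= dist (psi i (pw u' x)) (psi j (pw v' y))"
   by (rule corner_cells_dist[OF 4]) (use K vicsek_sqr in auto)
  ultimately have False using sqrt2_bounds by linarith
  thus ?thesis ..
 qed
qed

text \<open>The centres of the cells of level \<open>k\<close> are distinct points of a square lattice of mesh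
 \<open>sqrt 2 / 3 ^ k\<close>.\<close>

primrec lat :: "nat list => int \<times> int" where
 "lat [] = (0, 0)"
| "lat (j # w) = (let z = lat w; s = 3 ^ length w; e = (if j = 1 then (-1, 1) else if j = 2 then (1, 1)
   else if j = 3 then (1, -1) else if j = 4 then (-1, -1) else (0, 0)) in (fst z + s * fst e, snd z + s * snd e))"

lemma lat_centre: "w : words k ==>
  pw w 0 = (sqrt 2 / 3 ^ k * of_int (fst (lat w)), sqrt 2 / 3 ^ k * of_int (snd (lat w)))"
proof (induction w arbitrary: k)
 case Nil
 thus ?case by (simp add: words_def zero_prod_def)
next
 case (Cons j w)
 then obtain m where m: "k = Suc m" "w : words m" "j : {1..5}" by (auto simp: words_def)
 have l: "length w = m" using m(2) by (rule words_length)
 show ?case using m(3) Cons.IH[OF m(2)] unfolding idx5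
  by (elim disjE) (simp_all add: psi_word_Cons psi_eq q_simps m(1) l Let_def field_simps)
qed

lemma inj_psi_word_0: "inj_on (%w. pw w 0) (words k)"
proof (rule inj_onI)
 fix v w assume vw: "v : words k" "w : words k" "pw v 0 = pw w 0"
 show "v = w"
 proof (rule ccontr)
  assume "v ~= w"
  then obtain a where a: "a : {1..4}" "ALL y:K. zoomw w (pw v y) = q a"
   using zoomw_other_const[OF vw(1,2)] by metis
  have z: "q 5 : K" by (rule q_vicsek) simp
  have "zoomw w (pw v (q 5)) = q a" using a(2) z by blast
  moreover have "zoomw w (pw w (q 5)) = q 5" by (rule zoomw_psi_word[OF vw(2) z])
  ultimately have "q a = q 5" using vw(3) by (simp add: q5)
  thus False using inj_onD[OF inj_q, of a 5] a(1) by auto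
 qed
qed

text \<open>The radius is 20/3^k for points of the two cells plus at most 1/3^k for each distance to
  a centre. The number 20 is ten times the bound 2 for the diameter of \<open>K\<close>, as needed
  for balls of \<open>vdist\<close> that contain a cell.\<close>

definition nbrs :: "nat => nat list => nat list set" where
 "nbrs k u = {v : words k. dist (pw u 0) (pw v 0) <= 22 / 3 ^ k}"

lemma card_nbrs: assumes u: "u : words k" shows "card (nbrs k u) <= 2025"
proof -
 have inj: "inj_on lat (nbrs k u)"
 proof (rule inj_onI)
  fix v w assume vw: "v : nbrs k u" "w : nbrs k u" "lat v = lat w"
  hence m: "v : words k" "w : words k" by (auto simp: nbrs_def)
  have "pw v 0 = pw w 0" unfolding lat_centre[OF m(1)] lat_centre[OF m(2)] vw(3) ..
  thus "v = w" using inj_onD[OF inj_psi_word_0 _ m] by blast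
 qed
 have one: "abs (a - b) <= 22" if "abs (sqrt 2 / 3 ^ k * of_int a - sqrt 2 / 3 ^ k * of_int b) <= 22 / (3::real) ^ k" for a b :: int
 proof -
  have "abs (sqrt 2 / 3 ^ k * of_int a - sqrt 2 / 3 ^ k * of_int b) = sqrt 2 / 3 ^ k * abs (of_int a - of_int b :: real)"
   unfolding right_diff_distrib[symmetric] abs_mult by simp
  hence "sqrt 2 * abs (of_int a - of_int b :: real) <= 22" using that by (simp add: field_simps)
  moreover have "1 * abs (of_int a - of_int b :: real) <= sqrt 2 * abs (of_int a - of_int b)"
   using sqrt2_bounds by (intro mult_right_mono) auto
  ultimately have "abs (of_int a - of_int b :: real) <= 22" by (metis mult_1 order_trans)
  thus ?thesis by linarith
 qed
 \<comment> \<open>A lattice box with 45 points on each side, whence the bound 45^2 = 2025.\<close>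
 define B where "B = {fst (lat u) - 22..fst (lat u) + 22} \<times> {snd (lat u) - 22..snd (lat u) + 22}"
 have "lat ` nbrs k u <= B"
 proof
  fix z assume "z : lat ` nbrs k u"
  then obtain v where v: "v : words k" "dist (pw u 0) (pw v 0) <= 22 / 3 ^ k" "z = lat v"
   by (auto simp: nbrs_def)
  have h: "abs (fst (pw u 0) - fst (pw v 0)) <= 22 / 3 ^ k" "abs (snd (pw u 0) - snd (pw v 0)) <= 22 / 3 ^ k"
   using order_trans[OF dist_fst_le v(2)] order_trans[OF dist_snd_le v(2)] by (simp_all add: dist_real_def)
  have "abs (fst (lat u) - fst (lat v)) <= 22" "abs (snd (lat u) - snd (lat v)) <= 22"
   by (rule one[OF h(1)[unfolded lat_centre[OF u] lat_centre[OF v(1)] fst_conv]],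
     rule one[OF h(2)[unfolded lat_centre[OF u] lat_centre[OF v(1)] snd_conv]])
  thus "z : B" unfolding B_def v(3) mem_Times_iff by auto
 qed
 hence "card (lat ` nbrs k u) <= card B" by (intro card_mono) (simp_all add: B_def)
 also have "card B = 2025" by (simp add: B_def card_cartesian_product)
 finally show ?thesis by (simp add: card_image[OF inj])
qed

lemma nbrsI:
 assumes "u : words k" "v : words k" "x : pw u ` K" "y : pw v ` K" "dist x y <= 20 / 3 ^ k"
 shows "v : nbrs k u"
proof -
 obtain x' y' where xy: "x' : K" "x = pw u x'" "y' : K" "y = pw v y'" using assms(3,4) by blast
 have "dist (pw u 0) x = norm x' / 3 ^ k" "dist y (pw v 0) = norm y' / 3 ^ k"
  unfolding xy(2,4) dist_psi_word words_length[OF assms(1)] words_length[OF assms(2)] by simp_all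
 hence "dist (pw u 0) x <= 1 / 3 ^ k" "dist y (pw v 0) <= 1 / 3 ^ k"
  using norm_vicsek[OF xy(1)] norm_vicsek[OF xy(3)] by (simp_all add: divide_right_mono)
 hence "dist (pw u 0) (pw v 0) <= 1 / 3 ^ k + 20 / 3 ^ k + 1 / 3 ^ k"
  using assms(5) dist_triangle[of "pw u 0" "pw v 0" x] dist_triangle[of x "pw v 0" y] by linarith
 also have "... = 22 / 3 ^ k" by (simp add: add_divide_distrib[symmetric])
 finally show ?thesis using assms(2) by (simp add: nbrs_def)
qed

lemma nbrs_sym: "u : words k ==> v : words k ==> v : nbrs k u \<longleftrightarrow> u : nbrs k v" by (simp add: nbrs_def dist_commute)

text \<open>Double counting: the relation is symmetric and each word has at most 2025
  neighbours.\<close>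

lemma sum_nbrs_le:
 fixes g :: "nat list => real"
 assumes "!!v. v : words k ==> 0 <= g v" shows "(SUM u:words k. SUM v:nbrs k u. g v) <= 2025 * (SUM v:words k. g v)"
proof -
 have nb: "sum h (nbrs k u) = (SUM v:words k. if v : nbrs k u then h v else 0)" for h :: "nat list => real" and u
 proof -
  have "nbrs k u = {v : words k. v : nbrs k u}" by (auto simp: nbrs_def)
  hence "sum h (nbrs k u) = sum h {v : words k. v : nbrs k u}" by (rule arg_cong)
  thus ?thesis by (simp only: sum.inter_filter finite_words)
 qed
 have "(SUM u:words k. SUM v:nbrs k u. g v) = (SUM u:words k. SUM v:words k. if v : nbrs k u then g v else 0)"
  by (rule sum.cong[OF refl nb])
 also have "... = (SUM v:words k. SUM u:words k. if v : nbrs k u then g v else 0)" by (rule sum.swap)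
 also have "... = (SUM v:words k. real (card (nbrs k v)) * g v)"
 proof (rule sum.cong)
  fix v assume v: "v : words k"
  have "(SUM u:words k. if v : nbrs k u then g v else 0) = (SUM u:words k. if u : nbrs k v then g v else 0)"
   by (rule sum.cong) (simp_all add: nbrs_sym[OF _ v])
  also have "... = (SUM u:nbrs k v. g v)" by (rule nb[symmetric])
  finally show "(SUM u:words k. if v : nbrs k u then g v else 0) = real (card (nbrs k v)) * g v" by simp
 qed simp
 also have "... <= (SUM v:words k. 2025 * g v)"
 proof (intro sum_mono mult_right_mono)
  fix v assume "v : words k"
  thus "real (card (nbrs k v)) <= 2025" "0 <= g v" using card_nbrs[of v k] assms by auto
 qed
 finally show ?thesis by (simp add: sum_distrib_left)
qed

section \<open>The Sobolev seminorm and the discrete energies\<close>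

lemma cell_sets: "w : words n ==> pw w ` K : sets vmu"
 unfolding sets_vmu by (rule closed_in_restrict_borel[OF closed_cell cell_subset])

lemma measurable_continuous_vmu:
 assumes "continuous_on K f" shows "f : borel_measurable vmu" unfolding measurable_cong_sets[OF sets_vmu refl]
 by (rule borel_measurable_continuous_on_restrict[OF assms])

lemma vball_closed: assumes "x : K" shows "closed (vball x r)"
proof -
 have "continuous_on K (%y. vdist (fst (x, y)) (snd (x, y)))"
  by (rule continuous_on_compose2[OF continuous_on_vdist]) (use assms in \<open>auto intro!: continuous_intros\<close>)
 hence "closed (K Int (%y. vdist x y) -` {..r})"
  by (intro continuous_closed_preimage compact_imp_closed[OF compact_vicsek]) simp_all
 moreover have "vball x r = K Int (%y. vdist x y) -` {..r}" by (auto simp: vball_def)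
 ultimately show ?thesis by simp
qed

lemma vball_sets: "x : K ==> vball x r : sets vmu"
 unfolding sets_vmu by (rule closed_in_restrict_borel[OF vball_closed]) (auto simp: vball_def)

lemma ennpowr_le:
 assumes "x <= ennreal b" "0 <= a" "0 <= b" shows "ennpowr x a <= ennreal (b powr a)"
proof -
 have "x ~= \<top>" using assms(1) by (metis ennreal_less_top leD top.not_eq_extremum)
 moreover have "enn2real x <= b" using assms enn2real_leI by blast
 ultimately show ?thesis using assms by (auto simp: ennpowr_def intro!: ennreal_leI powr_mono2)
qed

lemma ennpowr_leD:
 assumes "ennpowr x a <= ennreal c" "0 < a" "0 <= c" shows "x <= ennreal (c powr (1 / a))"
proof (cases x)
 case (real y)
 have "y powr a <= c" using assms real by (auto simp: ennpowr_def)
 hence "(y powr a) powr (1 / a) <= c powr (1 / a)" using assms by (intro powr_mono2) auto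
 hence "y <= c powr (1 / a)" using assms(2) real by (simp add: powr_powr)
 thus ?thesis using real by (simp add: ennreal_leI)
next
 case top
 thus ?thesis using assms(1) by (simp add: ennpowr_def top_unique)
qed

text \<open>The upper threshold is the one of \<open>near_cells_touch\<close>; the lower one costs
  only a bounded factor.\<close>

lemma real_triadic:
 assumes "0 < r" "r < (1/3::real)" obtains k where "1 / 3 ^ (k + 2) <= r" "r < 1 / 3 ^ Suc k"
proof -
 obtain n where n: "1 / 3 ^ n < r" using assms(1) by (rule power3_small)
 have "1 / (3::real) ^ (n + 2) <= 1 / 3 ^ n" by (intro divide_left_mono power_increasing) auto
 hence ex: "1 / 3 ^ (n + 2) <= r" using n by linarith
 define k where "k = (LEAST k. 1 / 3 ^ (k + 2) <= r)"
 have k: "1 / 3 ^ (k + 2) <= r" unfolding k_def by (rule LeastI[of "%k. 1 / 3 ^ (k + 2) <= r", OF ex])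
 have "r < 1 / 3 ^ Suc k"
 proof (cases k)
  case 0
  thus ?thesis using assms(2) by simp
 next
  case (Suc j)
  hence "j < (LEAST k. 1 / 3 ^ (k + 2) <= r)" using k_def by simp
  hence "\<not> 1 / 3 ^ (j + 2) <= r" by (rule not_less_Least)
  thus ?thesis using Suc by simp
 qed
 thus ?thesis using k that by blast
qed

lemma three_powr_dim: "3 powr dim_h = 5" by (simp add: dim_h_def powr_def)

lemma alpha_pos: "1 < p ==> 0 < alpha p" unfolding alpha_def dim_h_def by (intro add_pos_pos) (auto simp: field_simps)

text \<open>From one scale to the next r^(alpha p) changes by the factor 5 of the cell measure times
  the factor 3^(p-1) of the energy.\<close>

lemma alpha_scale: assumes "1 < p" shows "3 powr (alpha p * p) = 5 * 3 powr (p - 1)"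
proof -
 have "alpha p * p = dim_h + (p - 1)" using assms by (simp add: alpha_def field_simps)
 thus ?thesis by (simp only: powr_add three_powr_dim)
qed

section \<open>From discrete energies to the Sobolev seminorm\<close>

lemma vball_dist: "x : K ==> y : vball x r ==> y : K & dist x y <= r"
 using dist_le_vdist[of x y] by (auto simp: vball_def)

text \<open>A global bound is distributed over the cells of level \<open>k\<close>: the local
  suprema are limits of monotone sequences, so the finite sum of the local energies passes to the
  limit.\<close>

lemma cell_energy:
 assumes p: "1 < p" and d: "consistent d" and E: "!!n. energy p d n <= E"
 obtains e where "!!v. v : words k ==> 0 <= e v" "!!v n. v : words k ==> energy p (shift d v) n <= e v"
  "(3 powr (p - 1)) ^ k * (SUM v:words k. e v) <= E"
proof -
 define e where "e v = (SUP n. energy p (shift d v) n)" for v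
 let ?r = "3 powr (p - 1)"
 have r: "0 < ?r ^ k" by simp
 have le: "?r ^ k * energy p (shift d v) n <= E" if "v : words k" for v n
 proof -
  have "energy p (shift d v) n <= (SUM v:words k. energy p (shift d v) n)"
   by (rule member_le_sum[OF that]) (simp_all add: energy_nonneg)
  hence "?r ^ k * energy p (shift d v) n <= ?r ^ k * (SUM v:words k. energy p (shift d v) n)"
   by (intro mult_left_mono) simp_all
  thus ?thesis using energy_add[of p k d n] E[of "k + n"] by linarith
 qed
 have bdd: "bdd_above (range (energy p (shift d v)))" if "v : words k" for v
  by (rule bdd_aboveI2[where M = "E / ?r ^ k"]) (use le[OF that] r in \<open>simp add: field_simps\<close>)
 have lim: "(%n. energy p (shift d v) n) \<longlonglongrightarrow> e v" if "v : words k" for v unfolding e_def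
  by (rule LIMSEQ_incseq_SUP[OF bdd[OF that]])
   (intro incseq_SucI energy_Suc_mono p consistent_shift[OF d that])
 have up: "energy p (shift d v) n <= e v" if "v : words k" for v n
  unfolding e_def by (rule cSUP_upper[OF _ bdd[OF that]]) simp
 have "(%n. ?r ^ k * (SUM v:words k. energy p (shift d v) n)) \<longlonglongrightarrow> ?r ^ k * (SUM v:words k. e v)" by (intro tendsto_intros lim)
 hence "?r ^ k * (SUM v:words k. e v) <= E" by (rule LIMSEQ_le_const2) (use E in \<open>auto simp: energy_add\<close>)
 moreover have "0 <= e v" if "v : words k" for v using up[OF that, of 0] energy_nonneg[of p "shift d v" 0] by linarith
 ultimately show ?thesis using that up by blast
qed

text \<open>A single edge inside the cell carries at most the whole energy of the cell, so
  increments decay like 3^((1/p - 1) n) and \<open>chain_bound\<close> sums them. This is the Morrey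
  estimate of the setting.\<close>

lemma cell_oscillation:
 assumes p: "1 < p" and f: "continuous_on K f" and v: "v : words k"
  and e: "0 <= e" "!!n. energy p (shift (incr f) v) n <= e" and x: "x : pw v ` K"
 shows "abs (f x - f (pw v (q 5))) <= 2 / (1 - 3 powr (1/p - 1)) * e powr (1/p)"
proof -
 let ?t = "3 powr (1/p - 1)" and ?r = "3 powr (p - 1)"
 have "?t < 3 powr 0" using p by (intro powr_less_mono) (auto simp: field_simps)
 hence t: "0 < ?t" "?t < 1" by simp_all
 obtain y where y: "y : K" "x = pw v y" using x by blast
 have "abs (incr f (v @ u) i) <= e powr (1/p) * ?t ^ n" if u: "u : words n" and i: "i : {1..4}" for n u i
 proof -
  have "abs (shift (incr f) v u i) powr p <= (SUM i:{1..4}. \<bar>shift (incr f) v u i\<bar> powr p)" by (rule member_le_sum[OF i]) auto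
  also have "... <= (SUM u:words n. SUM i:{1..4}. \<bar>shift (incr f) v u i\<bar> powr p)"
   by (rule member_le_sum[OF u]) (auto intro: sum_nonneg)
  finally have "?r ^ n * abs (incr f (v @ u) i) powr p <= energy p (shift (incr f) v) n"
   unfolding energy_def by (intro mult_left_mono) (auto simp: shift_def)
  hence "?r ^ n * abs (incr f (v @ u) i) powr p <= e" using e(2)[of n] by linarith
  hence "(?r ^ n * abs (incr f (v @ u) i) powr p) powr (1/p) <= e powr (1/p)" using p by (intro powr_mono2) auto
  moreover have "(?r ^ n * abs (incr f (v @ u) i) powr p) powr (1/p) = (?r ^ n) powr (1/p) * abs (incr f (v @ u) i)"
   using p by (simp add: powr_mult powr_powr)
  moreover have "(?r ^ n) powr (1/p) * ?t ^ n = 1"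
  proof -
   have "(?r ^ n) powr (1/p) * ?t ^ n = 3 powr ((p - 1) * n * (1/p) + (1/p - 1) * n)"
    by (simp add: powr_powr powr_add flip: powr_realpow)
   also have "(p - 1) * n * (1/p) + (1/p - 1) * n = 0" using p by (simp add: field_simps)
   finally show ?thesis by simp
  qed
  ultimately have "?t ^ n * ((?r ^ n) powr (1/p) * abs (incr f (v @ u) i)) <= ?t ^ n * e powr (1/p)"
   by (intro mult_left_mono) auto
  thus ?thesis using \<open>(?r ^ n) powr (1/p) * ?t ^ n = 1\<close> by (metis mult.assoc mult.commute mult_1)
 qed
 from chain_bound[OF f t _ v this y(1)] show ?thesis unfolding y(2) by simp
qed

text \<open>The conventions for division cover m = 0 and m = \<top>, so averages over balls can be
  bounded before anything is known about the measure of the ball.\<close>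

lemma ennreal_divide_mult_le: "c / m * m <= (c::ennreal)"
proof (cases "m = 0 \<or> m = \<top>")
 case True
 thus ?thesis by auto
next
 case False
 thus ?thesis by (simp add: ennreal_divide_times less_top ennreal_times_divide
    ennreal_mult_divide_eq mult.commute)
qed

lemma ball_average_le:
 assumes x: "x : K" and h: "!!y. y : vball x r ==> h y <= c"
 shows "(\<integral>\<^sup>+y\<in>vball x r. h y / emeasure vmu (vball x r) \<partial>vmu) <= c"
proof -
 have "(\<integral>\<^sup>+y\<in>vball x r. h y / emeasure vmu (vball x r) \<partial>vmu)
   <= (\<integral>\<^sup>+y. c / emeasure vmu (vball x r) * ind (vball x r) y \<partial>vmu)"
  by (intro nn_integral_mono) (auto simp: indicator_def intro!: divide_right_mono_ennreal h)
 also have "... = c / emeasure vmu (vball x r) * emeasure vmu (vball x r)"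
  by (rule nn_integral_cmult_indicator[OF vball_sets[OF x]])
 also have "... <= c" by (rule ennreal_divide_mult_le)
 finally show ?thesis .
qed

definition ball_energy :: "real => (real \<times> real => real) => real => ennreal" where
 "ball_energy p f r = (\<integral>\<^sup>+x. (\<integral>\<^sup>+y\<in>vball x r. ennreal (abs (f y - f x) powr p) / emeasure vmu (vball x r) \<partial>vmu) \<partial>vmu)"

text \<open>Such a ball about a point of the cell \<open>u\<close> meets only cells that touch
  \<open>u\<close>, so the oscillation over it is bounded, through the common point, by the energies
  of two cells. Bounded overlap of the neighbours sums these.\<close>

lemma ball_energy_le:
 assumes p: "1 < p" and f: "continuous_on K f" and E: "!!n. energy p (incr f) n <= E"
  and r: "0 < r" "r < 1 / 3 ^ Suc k"
 shows "ball_energy p f r <= ennreal (4050 * (8 / (1 - 3 powr (1/p - 1))) powr p * E / (5 * 3 powr (p - 1)) ^ k)"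
proof -
 let ?t = "3 powr (1/p - 1)" and ?r = "3 powr (p - 1)"
 have "?t < 3 powr 0" using p by (intro powr_less_mono) (auto simp: field_simps)
 hence t: "?t < 1" by simp
 define c where "c = 2 / (1 - ?t)"
 have c: "0 < c" using t by (simp add: c_def)
 obtain e where e: "!!v. v : words k ==> 0 <= e v" "!!v n. v : words k ==> energy p (shift (incr f) v) n <= e v"
  "?r ^ k * (SUM v:words k. e v) <= E" using cell_energy[OF p consistent_incr E] by metis
 define S where "S u = (SUM v:nbrs k u. e v)" for u
 have S0: "0 <= S u" for u unfolding S_def by (intro sum_nonneg e) (simp add: nbrs_def)
 \<comment> \<open>Here 4 c = 8 / (1 - t), and the factor 2 times the 2025 of
   \<open>sum_nbrs_le\<close> is the 4050 of the statement.\<close>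
 define c2 where "c2 = 2 * (4 * c) powr p"
 have pair: "abs (f y - f x) powr p <= c2 * S u"
  if u: "u : words k" and x: "x : pw u ` K" and y: "y : K" and xy: "dist x y < 1 / 3 ^ Suc k" for u x y
 proof -
  obtain v y' where v: "v : words k" "y' : K" "y = pw v y'" using y by (rule vicsek_wordE)
  have yv: "y : pw v ` K" using v by blast
  obtain x' where x': "x' : K" "x = pw u x'" using x by blast
  have "dist (pw u x') (pw v y') < 1 / 3 ^ Suc k" using xy x' v by simp
  then obtain z where z: "z : pw u ` K" "z : pw v ` K"
   using near_cells_touch[OF u v(1) x'(1) v(2)] by blast
  have ou: "abs (f a - f (pw u (q 5))) <= c * e u powr (1/p)" if "a : pw u ` K" for a
   unfolding c_def by (rule cell_oscillation[OF p f u e(1)[OF u] e(2)[OF u] that])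
  have ov: "abs (f a - f (pw v (q 5))) <= c * e v powr (1/p)" if "a : pw v ` K" for a
   unfolding c_def by (rule cell_oscillation[OF p f v(1) e(1)[OF v(1)] e(2)[OF v(1)] that])
  have "abs (f y - f x) <= 2 * c * (e u powr (1/p) + e v powr (1/p))"
   using ou[OF x] ou[OF z(1)] ov[OF yv] ov[OF z(2)] by (simp add: algebra_simps)
  hence "abs (f y - f x) powr p <= (2 * c * (e u powr (1/p) + e v powr (1/p))) powr p" using p by (intro powr_mono2) auto
  also have "... = (2 * c) powr p * (e u powr (1/p) + e v powr (1/p)) powr p" using c by (simp add: powr_mult)
  also have "... <= (2 * c) powr p * (2 powr (p - 1) * ((e u powr (1/p)) powr p + (e v powr (1/p)) powr p))"
   by (intro mult_left_mono powr_add_le p) auto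
  also have "(e u powr (1/p)) powr p = e u" using p e(1)[OF u] by (simp add: powr_powr)
  also have "(e v powr (1/p)) powr p = e v" using p e(1)[OF v(1)] by (simp add: powr_powr)
  also have "(2 * c) powr p * (2 powr (p - 1) * (e u + e v)) <= (4 * c) powr p * (2 * S u)"
  proof -
   have "2 powr (p - 1) <= (2::real) powr p" by (intro powr_mono) auto
   hence "(2 * c) powr p * 2 powr (p - 1) <= (2 * c) powr p * 2 powr p" by (intro mult_left_mono) auto
   also have "... = (4 * c) powr p" using c by (simp flip: powr_mult)
   finally have A: "(2 * c) powr p * 2 powr (p - 1) <= (4 * c) powr p" .
   have un: "u : nbrs k u" by (simp add: nbrs_def u)
   have "(1::real) / 3 ^ Suc k <= 20 / 3 ^ k" by (simp add: field_simps)
   hence vn: "v : nbrs k u" using xy by (intro nbrsI[OF u v(1) x yv]) linarith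
   have fin: "finite (nbrs k u)" by (simp add: nbrs_def)
   have "e u <= S u" "e v <= S u"
    unfolding S_def by (rule member_le_sum[OF un _ fin], simp add: nbrs_def e, rule member_le_sum[OF vn _ fin], simp add: nbrs_def e)
   hence "((2 * c) powr p * 2 powr (p - 1)) * (e u + e v) <= (4 * c) powr p * (2 * S u)"
    using e(1)[OF u] e(1)[OF v(1)] by (intro mult_mono A) auto
   thus ?thesis by (simp only: mult.assoc)
  qed
  finally show ?thesis by (simp add: c2_def mult_ac)
 qed
 have inner: "(\<integral>\<^sup>+y\<in>vball x r. ennreal (abs (f y - f x) powr p) / emeasure vmu (vball x r) \<partial>vmu)
   <= (SUM u:words k. ennreal (c2 * S u) * ind (pw u ` K) x)" if x: "x : K" for x
 proof -
  obtain u x' where u: "u : words k" "x' : K" "x = pw u x'" using x by (rule vicsek_wordE)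
  have xu: "x : pw u ` K" using u by blast
  have "(\<integral>\<^sup>+y\<in>vball x r. ennreal (abs (f y - f x) powr p) / emeasure vmu (vball x r) \<partial>vmu) <= ennreal (c2 * S u)"
  proof (rule ball_average_le[OF x])
   fix y assume "y : vball x r"
   hence "y : K" "dist x y < 1 / 3 ^ Suc k" using vball_dist[OF x] r(2) by fastforce+
   thus "ennreal (abs (f y - f x) powr p) <= ennreal (c2 * S u)" by (intro ennreal_leI pair[OF u(1) xu])
  qed
  also have "... = ennreal (c2 * S u) * ind (pw u ` K) x" using xu by simp
  also have "... <= (SUM u:words k. ennreal (c2 * S u) * ind (pw u ` K) x)"
   by (rule member_le_sum[OF u(1)]) simp_all
  finally show ?thesis .
 qed
 have "ball_energy p f r <= (\<integral>\<^sup>+x. (SUM u:words k. ennreal (c2 * S u) * ind (pw u ` K) x) \<partial>vmu)"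
  unfolding ball_energy_def by (rule nn_integral_mono, rule inner) (simp only: space_vmu)
 also have "... = (SUM u:words k. ennreal (c2 * S u) * ennreal (1 / 5 ^ k))"
 proof -
  have "(%x. ennreal (c2 * S u) * ind (pw u ` K) x) : borel_measurable vmu" if "u : words k" for u
   using cell_sets[OF that] by simp
  hence "(\<integral>\<^sup>+x. (SUM u:words k. ennreal (c2 * S u) * ind (pw u ` K) x) \<partial>vmu)
   = (SUM u:words k. \<integral>\<^sup>+x. ennreal (c2 * S u) * ind (pw u ` K) x \<partial>vmu)" by (rule nn_integral_sum)
  also have "... = (SUM u:words k. ennreal (c2 * S u) * ennreal (1 / 5 ^ k))"
   by (rule sum.cong) (simp_all add: nn_integral_cmult_indicator cell_sets emeasure_vmu_cell)
  finally show ?thesis .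
 qed
 also have "... = (SUM u:words k. ennreal (c2 * S u * (1 / 5 ^ k)))"
  by (intro sum.cong refl ennreal_mult[symmetric]) (simp_all add: c2_def S0)
 also have "... = ennreal (SUM u:words k. c2 * S u * (1 / 5 ^ k))" by (rule sum_ennreal) (simp add: c2_def S0)
 also have "... <= ennreal (4050 * (8 / (1 - ?t)) powr p * E / (5 * ?r) ^ k)"
 proof (rule ennreal_leI)
  have "(SUM u:words k. S u) <= 2025 * (SUM v:words k. e v)" unfolding S_def by (rule sum_nbrs_le) (rule e(1))
  also have "(SUM v:words k. e v) <= E / ?r ^ k" using e(3) by (simp add: field_simps)
  finally have "(SUM u:words k. S u) <= 2025 * (E / ?r ^ k)" by simp
  hence "c2 * (1 / 5 ^ k) * (SUM u:words k. S u) <= c2 * (1 / 5 ^ k) * (2025 * (E / ?r ^ k))"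
   by (intro mult_left_mono) (auto simp: c2_def)
  also have "... = 4050 * (8 / (1 - ?t)) powr p * E / (5 * ?r) ^ k" by (simp add: c2_def c_def power_mult_distrib)
  also have "c2 * (1 / 5 ^ k) * (SUM u:words k. S u) = (SUM u:words k. c2 * S u * (1 / 5 ^ k))"
   unfolding sum_distrib_left by (simp only: mult_ac)
  finally show "(SUM u:words k. c2 * S u * (1 / 5 ^ k)) <= 4050 * (8 / (1 - ?t)) powr p * E / (5 * ?r) ^ k" .
 qed
 finally show ?thesis .
qed

lemma sobolev_upper:
 assumes p: "1 < p" shows "\<exists>C>0. ALL f E. continuous_on K f --> (ALL n. energy p (incr f) n <= E) -->
  sobolev_seminorm_p p f <= ennreal (C * E powr (1/p))"
proof -
 let ?t = "3 powr (1/p - 1)" and ?r = "3 powr (p - 1)" and ?a = "alpha p"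
 define c where "c = 4050 * (8 / (1 - ?t)) powr p"
 have "?t < 3 powr 0" using p by (intro powr_less_mono) (auto simp: field_simps)
 hence "0 < 8 / (1 - ?t)" by simp
 hence "0 < (8 / (1 - ?t)) powr p" by (metis powr_gt_zero less_irrefl)
 hence c: "0 < c" unfolding c_def by (rule mult_pos_pos[rotated]) simp
 have a: "0 < ?a" by (rule alpha_pos[OF p])
 \<comment> \<open>The factor 3^(2 alpha) is the loss from r >= 3^(-k-2), while
   \<open>ball_energy_le\<close> scales with 3^(-k).\<close>
 define C where "C = 3 powr (2 * ?a) * c powr (1/p)"
 show ?thesis
 proof (intro exI[of _ C] conjI allI impI)
  show "0 < C" using c by (simp add: C_def)
  fix f E assume f: "continuous_on K f" and "ALL n. energy p (incr f) n <= E"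
  hence E: "!!n. energy p (incr f) n <= E" by blast
  have E0: "0 <= E" using E[of 0] energy_nonneg[of p "incr f" 0] by linarith
  have "eventually (%r. ennreal (1 / r powr ?a) * ennpowr (ball_energy p f r) (1/p) <= ennreal (C * E powr (1/p))) (at_right 0)"
  proof -
   have "ennreal (1 / r powr ?a) * ennpowr (ball_energy p f r) (1/p) <= ennreal (C * E powr (1/p))"
    if r: "0 < r" "r < 1/3" for r
   proof -
    obtain k where k: "1 / 3 ^ (k + 2) <= r" "r < 1 / 3 ^ Suc k" using r by (rule real_triadic)
    have "ennpowr (ball_energy p f r) (1/p) <= ennreal ((c * E / (5 * ?r) ^ k) powr (1/p))"
     using ball_energy_le[OF p f E r(1) k(2)] c E0 p by (intro ennpowr_le) (auto simp: c_def)
    hence "ennreal (1 / r powr ?a) * ennpowr (ball_energy p f r) (1/p)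
     <= ennreal (1 / r powr ?a) * ennreal ((c * E / (5 * ?r) ^ k) powr (1/p))" by (intro mult_left_mono) simp_all
    also have "... = ennreal (1 / r powr ?a * (c * E / (5 * ?r) ^ k) powr (1/p))"
     by (rule ennreal_mult[symmetric]) simp_all
    also have "... <= ennreal (C * E powr (1/p))"
    proof (rule ennreal_leI)
     have "3 powr real (k + 2) = 3 ^ (k + 2)" by (rule powr_realpow) simp
     hence "3 powr (- real (k + 2)) <= r" using k(1) by (simp only: powr_minus_divide)
     hence "(3 powr (- real (k + 2))) powr ?a <= r powr ?a" using a by (intro powr_mono2) auto
     hence "1 / r powr ?a <= 1 / (3 powr (- real (k + 2))) powr ?a"
      using r(1) by (intro divide_left_mono mult_pos_pos) auto
     also have "... = 3 powr (real (k + 2) * ?a)"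
     proof -
      have "1 / (3 powr (- z)) powr ?a = 3 powr (z * ?a)" for z :: real
       unfolding powr_powr mult_minus_left by (simp add: powr_minus_divide)
      thus ?thesis .
     qed
     finally have A: "1 / r powr ?a <= 3 powr (real (k + 2) * ?a)" .
     have B: "(5 * ?r) ^ k = 3 powr (?a * p * k)"
      unfolding alpha_scale[OF p, symmetric] by (simp add: powr_powr flip: powr_realpow)
     have "(c * E / (5 * ?r) ^ k) powr (1/p) = (c powr (1/p) * E powr (1/p)) / 3 powr (?a * p * k * (1/p))"
      unfolding B using c E0 by (simp add: powr_divide powr_mult powr_powr)
     also have "?a * p * k * (1/p) = k * ?a" using p by simp
     finally have D: "(c * E / (5 * ?r) ^ k) powr (1/p) = (c powr (1/p) * E powr (1/p)) / 3 powr (k * ?a)" .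
     have "1 / r powr ?a * (c * E / (5 * ?r) ^ k) powr (1/p)
      <= 3 powr (real (k + 2) * ?a) * (c * E / (5 * ?r) ^ k) powr (1/p)" by (intro mult_right_mono A) auto
     also have "... = C * E powr (1/p)" unfolding D C_def by (simp add: algebra_simps powr_add)
     finally show "1 / r powr ?a * (c * E / (5 * ?r) ^ k) powr (1/p) <= C * E powr (1/p)" .
    qed
    finally show ?thesis .
   qed
   thus ?thesis unfolding eventually_at_right_field by (intro exI[of _ "1/3"]) auto
  qed
  thus "sobolev_seminorm_p p f <= ennreal (C * E powr (1/p))"
   unfolding sobolev_seminorm_p_def ball_energy_def by (rule Limsup_bounded)
 qed
qed

section \<open>From the Sobolev seminorm to discrete energies\<close>

lemma cell_diameter:
 assumes u: "u : words k" and x: "x : pw u ` K" and y: "y : pw u ` K"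
 shows "vdist x y <= 20 / 3 ^ k"
proof -
 obtain x' y' where xy: "x' : K" "x = pw u x'" "y' : K" "y = pw u y'" using x y by blast
 have "dist x y = dist x' y' / 3 ^ k" unfolding xy(2,4) dist_psi_word words_length[OF u] ..
 also have "... <= 2 / 3 ^ k" using dist_vicsek[OF xy(1,3)] by (intro divide_right_mono) auto
 finally have "10 * dist x y <= 20 / 3 ^ k" by simp
 moreover have "x : K" "y : K" using x y cell_subset[OF u] by auto
 ultimately show ?thesis using vdist_le_dist[of x y] by linarith
qed

text \<open>The ball is covered by the neighbours of one cell that contains its centre.\<close>

lemma ball_measure_le:
 assumes x: "x : K" shows "emeasure vmu (vball x (20 / 3 ^ k)) <= ennreal (2025 / 5 ^ k)"
proof -
 obtain u x' where u: "u : words k" "x' : K" "x = pw u x'" using x by (rule vicsek_wordE)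
 have fin: "finite (nbrs k u)" by (simp add: nbrs_def)
 have "vball x (20 / 3 ^ k) <= (UN v:nbrs k u. pw v ` K)"
 proof
  fix y assume "y : vball x (20 / 3 ^ k)"
  hence y: "y : K" "dist x y <= 20 / 3 ^ k" using vball_dist[OF x] by auto
  obtain v y' where v: "v : words k" "y' : K" "y = pw v y'" using y(1) by (rule vicsek_wordE)
  have "v : nbrs k u" by (rule nbrsI[OF u(1) v(1) _ _ y(2)]) (use u v in auto)
  thus "y : (UN v:nbrs k u. pw v ` K)" using v by blast
 qed
 hence "emeasure vmu (vball x (20 / 3 ^ k)) <= emeasure vmu (UN v:nbrs k u. pw v ` K)"
  by (rule emeasure_mono) (use fin cell_sets in \<open>auto simp: nbrs_def\<close>)
 also have "... <= (SUM v:nbrs k u. emeasure vmu (pw v ` K))"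
  by (rule emeasure_subadditive_finite[OF fin]) (auto simp: nbrs_def intro: cell_sets)
 also have "... = (SUM v:nbrs k u. ennreal (1 / 5 ^ k))" by (rule sum.cong) (auto simp: nbrs_def emeasure_vmu_cell)
 also have "... = ennreal (real (card (nbrs k u)) * (1 / 5 ^ k))"
  by (simp add: ennreal_of_nat_eq_real_of_nat ennreal_mult[symmetric])
 also have "... <= ennreal (2025 * (1 / 5 ^ k))" using card_nbrs[OF u(1)] by (intro ennreal_leI mult_right_mono) auto
 finally show ?thesis by simp
qed

text \<open>Working over a cell instead of a ball keeps the domain of integration fixed while
  \<open>x\<close> moves.\<close>

definition cell_osc :: "real => (real \<times> real => real) => nat list => real \<times> real => ennreal" where
 "cell_osc p f u x = (\<integral>\<^sup>+y. ennreal (abs (f y - f x) powr p) * ind (pw u ` K) y \<partial>vmu)"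

definition cell_int :: "real => (real \<times> real => real) => nat list => ennreal" where
 "cell_int p f u = (\<integral>\<^sup>+x. cell_osc p f u x * ind (pw u ` K) x \<partial>vmu)"

lemma measurable_cell_osc:
 assumes f: "continuous_on K f" and u: "u : words k" shows "cell_osc p f u : borel_measurable vmu"
proof -
 interpret prob_space vmu by (rule prob_vmu)
 note [measurable] = measurable_continuous_vmu[OF f] cell_sets[OF u]
 show ?thesis unfolding cell_osc_def by measurable
qed

text \<open>By \<open>cell_diameter\<close> the radius is large enough for the ball to contain the
  whole cell.\<close>

lemma cell_osc_le_ball:
 assumes f: "continuous_on K f" and u: "u : words k" and x: "x : pw u ` K"
 shows "cell_osc p f u x <= ennreal (2025 / 5 ^ k) *
  (\<integral>\<^sup>+y\<in>vball x (20 / 3 ^ k). ennreal (abs (f y - f x) powr p) / emeasure vmu (vball x (20 / 3 ^ k)) \<partial>vmu)"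
proof -
 let ?B = "vball x (20 / 3 ^ k)" and ?m = "emeasure vmu (vball x (20 / 3 ^ k))"
 note [measurable] = measurable_continuous_vmu[OF f]
 have xK: "x : K" using x cell_subset[OF u] by auto
 note [measurable] = vball_sets[OF xK]
 have sub: "pw u ` K <= ?B" using cell_diameter[OF u x] cell_subset[OF u] by (auto simp: vball_def)
 have "emeasure vmu (pw u ` K) <= ?m" by (rule emeasure_mono[OF sub vball_sets[OF xK]])
 moreover have "0 < emeasure vmu (pw u ` K)" by (simp add: emeasure_vmu_cell[OF u])
 ultimately have m0: "?m ~= 0" by auto
 have mtop: "?m ~= \<top>" using ball_measure_le[OF xK, of k] by (metis ennreal_less_top leD top.not_eq_extremum)
 have "cell_osc p f u x <= (\<integral>\<^sup>+y. ennreal (2025 / 5 ^ k) * (ennreal (abs (f y - f x) powr p) / ?m * ind ?B y) \<partial>vmu)"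
  unfolding cell_osc_def
 proof (rule nn_integral_mono)
  fix y
  have "ennreal (abs (f y - f x) powr p) = ?m * (ennreal (abs (f y - f x) powr p) / ?m)"
   using m0 mtop by (simp add: ennreal_times_divide ennreal_mult_divide_eq mult.commute)
  also have "... <= ennreal (2025 / 5 ^ k) * (ennreal (abs (f y - f x) powr p) / ?m)"
   by (intro mult_right_mono ball_measure_le[OF xK]) simp
  finally show "ennreal (abs (f y - f x) powr p) * ind (pw u ` K) y
    <= ennreal (2025 / 5 ^ k) * (ennreal (abs (f y - f x) powr p) / ?m * ind ?B y)"
   using sub by (auto simp: indicator_def)
 qed
 also have "... = ennreal (2025 / 5 ^ k) * (\<integral>\<^sup>+y\<in>?B. ennreal (abs (f y - f x) powr p) / ?m \<partial>vmu)"
  by (rule nn_integral_cmult) measurable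
 finally show ?thesis .
qed

text \<open>Stated for arbitrary \<open>h\<close> because it is applied to ball averages as
  functions of the centre and to integrands built from the K-functional, whose measurability is not
  established. The simple functions below the integrand are rescaled directly.\<close>

lemma nn_integral_cmult_le:
 assumes c: "0 < c" shows "(\<integral>\<^sup>+x. ennreal c * h x \<partial>M) <= ennreal c * (\<integral>\<^sup>+x. h x \<partial>M)"
 unfolding nn_integral_def[of M "%x. ennreal c * h x"]
proof (rule SUP_least)
 fix g assume "g : {g. simple_function M g & g <= (%x. ennreal c * h x)}"
 hence g: "simple_function M g" "!!x. g x <= ennreal c * h x" by (auto simp: le_fun_def)
 note [measurable] = borel_measurable_simple_function[OF g(1)]
 have cc: "ennreal c * (ennreal (1 / c) * z) = z" "ennreal (1 / c) * (ennreal c * z) = z" for z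
  using c by (simp_all flip: mult.assoc ennreal_mult)
 have "integral\<^sup>S M g = (\<integral>\<^sup>+x. ennreal c * (ennreal (1 / c) * g x) \<partial>M)"
  by (simp only: cc nn_integral_eq_simple_integral[OF g(1)])
 also have "... = ennreal c * (\<integral>\<^sup>+x. ennreal (1 / c) * g x \<partial>M)" by (rule nn_integral_cmult) measurable
 also have "... <= ennreal c * (\<integral>\<^sup>+x. h x \<partial>M)"
 proof (intro mult_left_mono nn_integral_mono)
  fix x
  have "ennreal (1 / c) * g x <= ennreal (1 / c) * (ennreal c * h x)" by (intro mult_left_mono g(2)) simp
  thus "ennreal (1 / c) * g x <= h x" by (simp only: cc)
 qed simp
 finally show "integral\<^sup>S M g <= ennreal c * (\<integral>\<^sup>+x. h x \<partial>M)" .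
qed

text \<open>One factor 2025 compares the measure of the ball with that of a cell, the other bounds
  the number of cells of the level containing a given point.\<close>

lemma sum_cell_int_le:
 assumes f: "continuous_on K f"
 shows "(SUM u:words k. cell_int p f u) <= ennreal (2025\<^sup>2 / 5 ^ k) * ball_energy p f (20 / 3 ^ k)"
proof -
 let ?h = "%x. \<integral>\<^sup>+y\<in>vball x (20 / 3 ^ k). ennreal (abs (f y - f x) powr p) / emeasure vmu (vball x (20 / 3 ^ k)) \<partial>vmu"
 have "(SUM u:words k. cell_int p f u) = (\<integral>\<^sup>+x. (SUM u:words k. cell_osc p f u x * ind (pw u ` K) x) \<partial>vmu)"
  unfolding cell_int_def
 proof (rule nn_integral_sum[symmetric])
  fix u assume u: "u : words k"
  note [measurable] = measurable_cell_osc[OF f u] cell_sets[OF u]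
  show "(%x. cell_osc p f u x * ind (pw u ` K) x) : borel_measurable vmu" by measurable
 qed
 also have "... <= (\<integral>\<^sup>+x. ennreal (2025\<^sup>2 / 5 ^ k) * ?h x \<partial>vmu)"
 proof (rule nn_integral_mono)
  fix x assume "x : space vmu"
  hence x: "x : K" by (simp add: space_vmu)
  obtain u0 x' where u0: "u0 : words k" "x' : K" "x = pw u0 x'" using x by (rule vicsek_wordE)
  have fin: "finite (nbrs k u0)" "nbrs k u0 <= words k" by (auto simp: nbrs_def)
  have "(SUM u:words k. cell_osc p f u x * ind (pw u ` K) x)
   <= (SUM u:words k. if u : nbrs k u0 then ennreal (2025 / 5 ^ k) * ?h x else 0)"
  proof (rule sum_mono)
   fix u assume u: "u : words k"
   show "cell_osc p f u x * ind (pw u ` K) x <= (if u : nbrs k u0 then ennreal (2025 / 5 ^ k) * ?h x else 0)"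
   proof (cases "x : pw u ` K")
    case True
    have "u : nbrs k u0" by (rule nbrsI[OF u0(1) u _ True, of x]) (use u0 in auto)
    thus ?thesis using cell_osc_le_ball[OF f u True, of p] True by simp
   qed simp
  qed
  also have "... = (SUM u:nbrs k u0. ennreal (2025 / 5 ^ k) * ?h x)" using fin by (simp add: sum.If_cases Int_absorb1)
  also have "... = ennreal (real (card (nbrs k u0))) * (ennreal (2025 / 5 ^ k) * ?h x)"
   by (simp add: ennreal_of_nat_eq_real_of_nat)
  also have "... <= ennreal 2025 * (ennreal (2025 / 5 ^ k) * ?h x)"
   using card_nbrs[OF u0(1)] by (intro mult_right_mono ennreal_leI) auto
  also have "... = ennreal (2025\<^sup>2 / 5 ^ k) * ?h x"
   unfolding mult.assoc[symmetric] by (subst ennreal_mult[symmetric]) (simp_all add: power2_eq_square)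
  finally show "(SUM u:words k. cell_osc p f u x * ind (pw u ` K) x) <= ennreal (2025\<^sup>2 / 5 ^ k) * ?h x" .
 qed
 also have "... <= ennreal (2025\<^sup>2 / 5 ^ k) * ball_energy p f (20 / 3 ^ k)"
  unfolding ball_energy_def by (rule nn_integral_cmult_le) simp
 finally show ?thesis .
qed

text \<open>If every point were worse than the mean value \<open>5 ^ k * j\<close>, the integral
  over a cell of measure 5^(-k) would exceed \<open>j\<close>.\<close>

lemma exists_good_point:
 assumes f: "continuous_on K f" and u: "u : words k" and J: "cell_int p f u = ennreal j" "0 <= j"
 shows "EX x:pw u ` K. cell_osc p f u x <= ennreal (5 ^ k * j)"
proof (rule ccontr)
 assume "\<not> ?thesis"
 hence gt: "ennreal (5 ^ k * j) < cell_osc p f u x" if "x : pw u ` K" for x using that by (meson not_le)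
 note [measurable] = measurable_cell_osc[OF f u] cell_sets[OF u]
 let ?I = "ind (pw u ` K) :: _ => ennreal"
 have int: "(\<integral>\<^sup>+x. ennreal (5 ^ k * j) * ?I x \<partial>vmu) = ennreal j"
 proof -
  have "(\<integral>\<^sup>+x. ennreal (5 ^ k * j) * ?I x \<partial>vmu) = ennreal (5 ^ k * j) * ennreal (1 / 5 ^ k)"
   by (subst nn_integral_cmult_indicator[OF cell_sets[OF u]]) (simp add: emeasure_vmu_cell[OF u])
  thus ?thesis using J(2) by (simp flip: ennreal_mult)
 qed
 have "(\<integral>\<^sup>+x. ennreal (5 ^ k * j) * ?I x \<partial>vmu) < (\<integral>\<^sup>+x. cell_osc p f u x * ?I x \<partial>vmu)"
 proof (rule nn_integral_less)
  show "(\<integral>\<^sup>+x. ennreal (5 ^ k * j) * ?I x \<partial>vmu) ~= \<infinity>" by (simp add: int)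
  show "AE x in vmu. ennreal (5 ^ k * j) * ?I x <= cell_osc p f u x * ?I x"
   using gt by (intro AE_I2) (auto simp: indicator_def intro: less_imp_le)
  show "\<not> (AE x in vmu. cell_osc p f u x * ?I x <= ennreal (5 ^ k * j) * ?I x)"
  proof
   assume "AE x in vmu. cell_osc p f u x * ?I x <= ennreal (5 ^ k * j) * ?I x"
   hence "AE x in vmu. x ~: pw u ` K"
    by (rule AE_mp) (use gt in \<open>auto simp: indicator_def not_le split: if_splits intro!: AE_I2\<close>)
   hence "emeasure vmu (pw u ` K) = 0"
    using AE_iff_measurable[OF cell_sets[OF u], of "%x. x ~: pw u ` K"] cell_subset[OF u]
    by (auto simp: space_vmu)
   thus False by (simp add: emeasure_vmu_cell[OF u])
  qed
 qed measurable
 thus False unfolding int cell_int_def[symmetric] J(1) by simp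
qed

text \<open>Both values are compared with \<open>f y\<close> and averaged over \<open>y\<close> in
  the smaller cell, whose measure is 5^(-k-1).\<close>

lemma good_points_near:
 assumes p: "1 < p" and f: "continuous_on K f" and u: "u : words k" and i: "i : {1..5}"
  and x: "cell_osc p f u x <= ennreal a" "0 <= a" and z: "cell_osc p f (u @ [i]) z <= ennreal b" "0 <= b"
 shows "abs (f x - f z) powr p <= 2 powr (p - 1) * 5 ^ Suc k * (a + b)"
proof -
 have ui: "u @ [i] : words (Suc k)" using u i by (simp add: snoc_in_words)
 have sub: "pw (u @ [i]) ` K <= pw u ` K" unfolding psi_word_append image_comp[symmetric]
  by (rule image_mono) (rule cell_subset[of "[i]" 1], use i in \<open>simp add: words_def\<close>)
 note [measurable] = measurable_continuous_vmu[OF f] cell_sets[OF ui] cell_sets[OF u]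
 let ?C = "pw (u @ [i]) ` K"
 let ?hx = "%y. ennreal (abs (f y - f x) powr p) * ind (pw u ` K) y"
 let ?hz = "%y. ennreal (abs (f y - f z) powr p) * ind ?C y"
 have "ennreal (abs (f x - f z) powr p) * ennreal (1 / 5 ^ Suc k) = (\<integral>\<^sup>+y. ennreal (abs (f x - f z) powr p) * ind ?C y \<partial>vmu)"
  by (subst nn_integral_cmult_indicator[OF cell_sets[OF ui]]) (simp only: emeasure_vmu_cell[OF ui])
 also have "... <= (\<integral>\<^sup>+y. ennreal (2 powr (p - 1)) * (?hx y + ?hz y) \<partial>vmu)"
 proof (rule nn_integral_mono)
  fix y
  have "abs (f x - f z) powr p <= (abs (f y - f x) + abs (f y - f z)) powr p" using p by (intro powr_mono2) auto
  also have "... <= 2 powr (p - 1) * (abs (f y - f x) powr p + abs (f y - f z) powr p)" by (intro powr_add_le p) auto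
  finally have "ennreal (abs (f x - f z) powr p) <= ennreal (2 powr (p - 1) * (abs (f y - f x) powr p + abs (f y - f z) powr p))"
   by (rule ennreal_leI)
  also have "... = ennreal (2 powr (p - 1)) * (ennreal (abs (f y - f x) powr p) + ennreal (abs (f y - f z) powr p))"
   by (simp add: ennreal_mult ennreal_plus)
  finally show "ennreal (abs (f x - f z) powr p) * ind ?C y <= ennreal (2 powr (p - 1)) * (?hx y + ?hz y)"
   using sub by (auto simp: indicator_def)
 qed
 also have "... = ennreal (2 powr (p - 1)) * (cell_osc p f u x + cell_osc p f (u @ [i]) z)"
  unfolding cell_osc_def by (subst nn_integral_cmult, measurable, subst nn_integral_add, measurable)
 also have "... <= ennreal (2 powr (p - 1)) * (ennreal a + ennreal b)" by (intro mult_left_mono add_mono x z) simp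
 also have "... = ennreal (2 powr (p - 1) * (a + b))" using x z by (simp add: ennreal_mult ennreal_plus)
 finally have "ennreal (abs (f x - f z) powr p * (1 / 5 ^ Suc k)) <= ennreal (2 powr (p - 1) * (a + b))"
  by (subst ennreal_mult) simp_all
 hence "abs (f x - f z) powr p * (1 / 5 ^ Suc k) <= 2 powr (p - 1) * (a + b)" using x z by (simp add: ennreal_le_iff)
 thus ?thesis by (simp add: field_simps)
qed

text \<open>Repeating the letter \<open>i\<close> shrinks the cells to the fixed corner, so values
  at arbitrary points of these cells determine the value at the vertex.\<close>

lemma replicate_cell:
 assumes u: "u : words k" and i: "i : {1..5}" and X: "!!m. X m : pw (u @ replicate m i) ` K"
  and f: "continuous_on K f" shows "(%m. f (X m)) \<longlonglongrightarrow> f (pw u (q i))"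
proof (rule continuous_on_tendsto_compose[OF f])
 have ur: "u @ replicate m i : words (k + m)" for m using u i by (auto simp: words_def)
 have fix_: "pw (u @ replicate m i) (q i) = pw u (q i)" for m
 proof (induction m)
  case (Suc m)
  have "u @ replicate (Suc m) i = (u @ replicate m i) @ [i]" by (simp add: replicate_append_same)
  thus ?case using Suc by (simp only: psi_word_snoc_q)
 qed simp
 show "X \<longlonglongrightarrow> pw u (q i)"
 proof (rule metric_LIMSEQ_I)
  fix e :: real assume "e > 0"
  then obtain N where N: "2 / 3 ^ N < e" by (rule power3_small)
  have "dist (X m) (pw u (q i)) < e" if "m \<ge> N" for m
  proof -
   obtain y where y: "y : K" "X m = pw (u @ replicate m i) y" using X[of m] by blast
   have "dist (X m) (pw u (q i)) = dist y (q i) / 3 ^ (k + m)"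
    unfolding y(2) fix_[of m, symmetric] dist_psi_word words_length[OF ur] ..
   also have "... <= 2 / 3 ^ (k + m)" using dist_vicsek[OF y(1) q_vicsek[OF i]] by (intro divide_right_mono) auto
   also have "... <= 2 / 3 ^ N" using that by (intro divide_left_mono power_increasing) auto
   finally show ?thesis using N by simp
  qed
  thus "EX no. \<forall>n\<ge>no. dist (X n) (pw u (q i)) < e" by blast
 qed
 show "pw u (q i) : K" by (rule psi_word_vicsek[OF u q_vicsek[OF i]])
 show "\<forall>\<^sub>F m in sequentially. X m : K" using X cell_subset[OF ur] by (intro always_eventually) blast
qed

text \<open>The telescoping series along the cells shrinking to a vertex converges because the weight
 \<open>3 powr ((p - 1) / 2)\<close> of the Hoelder inequality is less than the gain \<open>3 powr (p - 1)\<close> per level.\<close>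

lemma energy_from_cells:
 assumes p: "1 < p" and f: "continuous_on K f" and A: "0 <= A"
  and J: "!!m. m \<ge> k ==> (SUM u:words m. cell_int p f u) <= ennreal (A / (25 * 3 powr (p - 1)) ^ m)"
 shows "energy p (incr f) k <= 400 * 4 powr p * (1 / (1 - 3 powr (-1/2))) powr (p - 1) / (1 - 3 powr ((1 - p) / 2)) * A"
proof -
 let ?r = "3 powr (p - 1)" and ?s = "3 powr ((p - 1) / 2)" and ?t = "3 powr (-1/2) :: real"
 have "?t < 3 powr 0" by (intro powr_less_mono) auto
 hence t: "0 < ?t" "?t < 1" by simp_all
 define j where "j u = enn2real (cell_int p f u)" for u
 have fin: "cell_int p f u ~= \<top>" if "m \<ge> k" "u : words m" for u m
 proof -
  have "cell_int p f u <= (SUM u:words m. cell_int p f u)" by (rule member_le_sum[OF that(2)]) simp_all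
  also have "... <= ennreal (A / (25 * ?r) ^ m)" by (rule J[OF that(1)])
  finally show ?thesis by (metis ennreal_less_top leD top.not_eq_extremum)
 qed
 have j: "cell_int p f u = ennreal (j u)" "0 <= j u" if "m \<ge> k" "u : words m" for u m
  using fin[OF that] by (simp_all add: j_def less_top)
 have sumj: "(SUM u:words m. j u) <= A / (25 * ?r) ^ m" if m: "m \<ge> k" for m
 proof -
  have "ennreal (SUM u:words m. j u) = (SUM u:words m. ennreal (j u))" using j(2)[OF m] by (simp add: sum_ennreal)
  also have "... = (SUM u:words m. cell_int p f u)" using j(1)[OF m] by (intro sum.cong) auto
  also have "... <= ennreal (A / (25 * ?r) ^ m)" by (rule J[OF m])
  finally show ?thesis using A by (simp add: ennreal_le_iff)
 qed
 \<comment> \<open>A good point is chosen once for every word, so that it can end one step of the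
   telescoping sum and start the next.\<close>
 define X where "X u = (SOME x. x : pw u ` K & cell_osc p f u x <= ennreal (5 ^ length u * j u))" for u
 have X: "X u : pw u ` K" "cell_osc p f u (X u) <= ennreal (5 ^ m * j u)" if "m \<ge> k" "u : words m" for u m
 proof -
  have "EX x. x : pw u ` K & cell_osc p f u x <= ennreal (5 ^ length u * j u)"
   using exists_good_point[OF f that(2) j[OF that]] by (simp only: words_length[OF that(2)]) blast
  from someI_ex[OF this] show "X u : pw u ` K" "cell_osc p f u (X u) <= ennreal (5 ^ m * j u)"
   unfolding X_def[symmetric] by (simp_all only: words_length[OF that(2)] simp_thms)
 qed
 define D where "D = (1 / (1 - ?t)) powr (p - 1)"
 have D0: "0 <= D" by (simp add: D_def)
 have weight: "?t powr (1 - p) = ?s"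
 proof -
  have "(-1/2) * (1 - p) = (p - 1) / 2" by (simp add: field_simps)
  thus ?thesis by (simp only: powr_powr)
 qed
 have srel: "?s * ?s = ?r" by (simp flip: powr_add)
 have "3 powr 0 < ?s" using p by (intro powr_less_mono) auto
 hence s1: "1 < ?s" by simp
 have sinv: "1 / ?s = 3 powr ((1 - p) / 2)"
 proof -
  have "(1 - p) / 2 = - ((p - 1) / 2)" by (simp add: field_simps)
  thus ?thesis by (simp only: powr_minus_divide)
 qed
 have corner: "(SUM u:words k. \<bar>f (pw u (q i)) - f (X u)\<bar> powr p) <= 50 * 2 powr (p - 1) * D * A / (1 - 1 / ?s) / ?r ^ k"
  if i: "i : {1..5}" for i
 proof -
  define U where "U u m = u @ replicate m i" for u m
  have U: "U u m : words (k + m)" if "u : words k" for u m using that i by (auto simp: U_def words_def)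
  have US: "U u (Suc m) = U u m @ [i]" for u m by (simp add: U_def replicate_append_same)
  have UX: "X (U u m) : pw (U u m) ` K" "cell_osc p f (U u m) (X (U u m)) <= ennreal (5 ^ (k + m) * j (U u m))"
   "0 <= j (U u m)" if "u : words k" for u m using X[OF _ U[OF that, of m]] j(2)[OF _ U[OF that, of m]] by simp_all
  \<comment> \<open>For fixed \<open>m\<close> the words ending in \<open>m\<close> copies of
    \<open>i\<close> are only some of those of length \<open>k + m\<close>; non-negativity lets the
    full sum bound theirs.\<close>
  have sumU: "(SUM u:words k. j (U u m)) <= A / (25 * ?r) ^ (k + m)" for m
  proof -
   have "(SUM u:words k. j (U u m)) <= (SUM u:words k. SUM w:words m. j (u @ w))"
   proof (rule sum_mono)
    fix u assume u: "u : words k"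
    have rm: "replicate m i : words m" using i by (auto simp: words_def)
    show "j (U u m) <= (SUM w:words m. j (u @ w))" unfolding U_def by (rule member_le_sum[OF rm]) (simp_all add: j_def)
   qed
   also have "... = (SUM u:words (k + m). j u)" by (rule sum_words_add[symmetric])
   also have "... <= A / (25 * ?r) ^ (k + m)" by (rule sumj) simp
   finally show ?thesis .
  qed
  have step: "abs (f (X (U u (Suc m))) - f (X (U u m))) powr p <= 25 * 2 powr (p - 1) * 25 ^ (k + m) * (j (U u m) + j (U u (Suc m)))"
   if u: "u : words k" for u m
  proof -
   have "abs (f (X (U u m)) - f (X (U u (Suc m)))) powr p
    <= 2 powr (p - 1) * 5 ^ Suc (k + m) * (5 ^ (k + m) * j (U u m) + 5 ^ (k + Suc m) * j (U u (Suc m)))"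
   proof (rule good_points_near[OF p f U[OF u] i UX(2)[OF u]])
    show "cell_osc p f (U u m @ [i]) (X (U u (Suc m))) <= ennreal (5 ^ (k + Suc m) * j (U u (Suc m)))"
     using UX(2)[OF u, of "Suc m"] by (simp only: US)
   qed (use UX(3)[OF u] in simp_all)
   also have "... <= 2 powr (p - 1) * 5 ^ Suc (k + m) * (5 * 5 ^ (k + m) * j (U u m) + 5 * 5 ^ (k + m) * j (U u (Suc m)))"
    using UX(3)[OF u] by (intro mult_left_mono add_mono mult_right_mono) auto
   also have "... = 25 * 2 powr (p - 1) * (5 ^ (k + m) * 5 ^ (k + m)) * (j (U u m) + j (U u (Suc m)))"
    by (simp add: algebra_simps)
   also have "(5::real) ^ (k + m) * 5 ^ (k + m) = 25 ^ (k + m)" by (simp flip: power_mult_distrib)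
   finally show ?thesis by (simp add: abs_minus_commute)
  qed
  have partial: "(SUM u:words k. \<bar>f (X (U u M)) - f (X (U u 0))\<bar> powr p) <= 50 * 2 powr (p - 1) * D * A / (1 - 1 / ?s) / ?r ^ k" for M
  proof -
   have "abs (f (X (U u M)) - f (X (U u 0))) powr p
     <= D * (\<Sum>m<M. ?s ^ m * (25 * 2 powr (p - 1) * 25 ^ (k + m) * (j (U u m) + j (U u (Suc m)))))" if u: "u : words k" for u
   proof -
    have "f (X (U u M)) - f (X (U u 0)) = (\<Sum>m<M. f (X (U u (Suc m))) - f (X (U u m)))"
     by (rule sum_lessThan_telescope[symmetric])
    hence "abs (f (X (U u M)) - f (X (U u 0))) <= (\<Sum>m<M. \<bar>f (X (U u (Suc m))) - f (X (U u m))\<bar>)" by (simp only: sum_abs)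
    hence "abs (f (X (U u M)) - f (X (U u 0))) powr p <= (\<Sum>m<M. \<bar>f (X (U u (Suc m))) - f (X (U u m))\<bar>) powr p"
     using p by (intro powr_mono2) auto
    also have "... <= D * (\<Sum>m<M. ?s ^ m * abs (f (X (U u (Suc m))) - f (X (U u m))) powr p)"
     unfolding D_def weight[symmetric] by (rule powr_geometric_sum[OF p t]) simp
    also have "... <= D * (\<Sum>m<M. ?s ^ m * (25 * 2 powr (p - 1) * 25 ^ (k + m) * (j (U u m) + j (U u (Suc m)))))"
     by (intro mult_left_mono sum_mono step u D0) simp
    finally show ?thesis .
   qed
   hence "(SUM u:words k. \<bar>f (X (U u M)) - f (X (U u 0))\<bar> powr p)
     <= (SUM u:words k. D * (\<Sum>m<M. ?s ^ m * (25 * 2 powr (p - 1) * 25 ^ (k + m) * (j (U u m) + j (U u (Suc m))))))"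
    by (intro sum_mono)
   also have "... = D * (\<Sum>m<M. SUM u:words k. ?s ^ m * (25 * 2 powr (p - 1) * 25 ^ (k + m) * (j (U u m) + j (U u (Suc m)))))"
    by (subst sum.swap) (simp only: sum_distrib_left)
   also have "... = D * (\<Sum>m<M. ?s ^ m * (25 * 2 powr (p - 1) * 25 ^ (k + m)) * ((SUM u:words k. j (U u m)) + (SUM u:words k. j (U u (Suc m)))))"
    by (simp only: sum_distrib_left sum.distrib[symmetric] mult.assoc)
   also have "... <= D * (\<Sum>m<M. ?s ^ m * (25 * 2 powr (p - 1) * 25 ^ (k + m)) * (2 * (A / (25 * ?r) ^ (k + m))))"
   proof (intro mult_left_mono sum_mono D0)
    fix m
    have "(1::real) * (25 * ?r) ^ (k + m) <= (25 * ?r) * (25 * ?r) ^ (k + m)"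
    proof (intro mult_right_mono)
     have "3 powr 0 <= ?r" using p by (intro powr_mono) auto
     thus "1 <= 25 * ?r" by simp
    qed simp
    hence "A / (25 * ?r) ^ (k + Suc m) <= A / (25 * ?r) ^ (k + m)" using A by (intro divide_left_mono) auto
    thus "(SUM u:words k. j (U u m)) + (SUM u:words k. j (U u (Suc m))) <= 2 * (A / (25 * ?r) ^ (k + m))"
     using sumU[of m] sumU[of "Suc m"] by linarith
   qed simp
   also have "... = D * (50 * 2 powr (p - 1) * A / ?r ^ k) * (\<Sum>m<M. (1 / ?s) ^ m)"
   proof -
    have "?s ^ m * (25 * 2 powr (p - 1) * 25 ^ (k + m)) * (2 * (A / (25 * ?r) ^ (k + m)))
      = (50 * 2 powr (p - 1) * A / ?r ^ k) * (1 / ?s) ^ m" for m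
    proof -
     have "?r ^ m = ?s ^ m * ?s ^ m" by (simp flip: srel power_mult_distrib)
     hence "?s ^ m / ?r ^ m = (1 / ?s) ^ m" by (simp add: power_divide)
     thus ?thesis by (simp add: power_mult_distrib power_add field_simps)
    qed
    thus ?thesis by (simp only: sum_distrib_left mult.assoc)
   qed
   also have "... <= D * (50 * 2 powr (p - 1) * A / ?r ^ k) * (1 / (1 - 1 / ?s))"
   proof (intro mult_left_mono)
    have "1 / ?s < 1" "0 < 1 / ?s" using s1 by auto
    moreover have "(\<Sum>m<M. z ^ m) <= 1 / (1 - z)" if "0 < z" "z < 1" for z :: real
     using that by (simp add: sum_gp_strict field_simps)
    ultimately show "(\<Sum>m<M. (1 / ?s) ^ m) <= 1 / (1 - 1 / ?s)" by blast
   qed (use A D0 in simp)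
   finally show ?thesis by (simp add: mult_ac)
  qed
  have "(%M. SUM u:words k. \<bar>f (X (U u M)) - f (X (U u 0))\<bar> powr p) \<longlonglongrightarrow> (SUM u:words k. \<bar>f (pw u (q i)) - f (X (U u 0))\<bar> powr p)"
  proof (intro tendsto_sum tendsto_powr2 tendsto_intros)
   fix u assume "u : words k"
   thus "(%M. f (X (U u M))) \<longlonglongrightarrow> f (pw u (q i))"
    using UX(1) unfolding U_def by (intro replicate_cell[OF _ i _ f]) auto
  qed (use p in auto)
  hence "(SUM u:words k. \<bar>f (pw u (q i)) - f (X (U u 0))\<bar> powr p) <= 50 * 2 powr (p - 1) * D * A / (1 - 1 / ?s) / ?r ^ k"
   by (rule LIMSEQ_le_const2) (use partial in blast)
  thus ?thesis by (simp add: U_def)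
 qed
 define R where "R = 50 * 2 powr (p - 1) * D * A / (1 - 1 / ?s) / ?r ^ k"
 have "(SUM u:words k. SUM i:{1..4}. \<bar>incr f u i\<bar> powr p)
   <= (SUM u:words k. SUM i:{1..4}. 2 powr (p - 1) * (abs (f (pw u (q i)) - f (X u)) powr p + abs (f (pw u (q 5)) - f (X u)) powr p))"
 proof (intro sum_mono)
  fix u i
  have "abs (incr f u i) powr p <= (abs (f (pw u (q i)) - f (X u)) + abs (f (pw u (q 5)) - f (X u))) powr p"
   unfolding incr_def using p by (intro powr_mono2) auto
  also have "... <= 2 powr (p - 1) * (abs (f (pw u (q i)) - f (X u)) powr p + abs (f (pw u (q 5)) - f (X u)) powr p)"
   by (intro powr_add_le p) auto
  finally show "abs (incr f u i) powr p <= 2 powr (p - 1) * (abs (f (pw u (q i)) - f (X u)) powr p + abs (f (pw u (q 5)) - f (X u)) powr p)" .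
 qed
 also have "... = 2 powr (p - 1) * (SUM i:{1..4::nat}. (SUM u:words k. \<bar>f (pw u (q i)) - f (X u)\<bar> powr p) + (SUM u:words k. \<bar>f (pw u (q 5)) - f (X u)\<bar> powr p))"
  by (subst sum.swap) (simp only: sum_distrib_left sum.distrib[symmetric])
 also have "... <= 2 powr (p - 1) * (SUM i:{1..4::nat}. R + R)"
  unfolding R_def by (intro mult_left_mono sum_mono add_mono corner) auto
 also have "... = 8 * 2 powr (p - 1) * R" by simp
 finally have "?r ^ k * (SUM u:words k. SUM i:{1..4}. \<bar>incr f u i\<bar> powr p) <= ?r ^ k * (8 * 2 powr (p - 1) * R)"
  by (intro mult_left_mono) auto
 also have "... = 400 * (2 powr (p - 1) * 2 powr (p - 1)) * D / (1 - 1 / ?s) * A" by (simp add: R_def)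
 also have "... <= 400 * 4 powr p * D / (1 - 1 / ?s) * A"
 proof (intro mult_right_mono divide_right_mono mult_left_mono A D0)
  have "2 powr (p - 1) * 2 powr (p - 1) = (4::real) powr (p - 1)" by (simp flip: powr_mult)
  also have "... <= 4 powr p" by (intro powr_mono) auto
  finally show "2 powr (p - 1) * 2 powr (p - 1) <= (4::real) powr p" .
 qed (use s1 in auto)
 finally show ?thesis unfolding energy_def D_def sinv .
qed

text \<open>At radius 20/3^m the seminorm bounds the ball energy by a multiple of 5^(-m)
  3^(-(p-1)m), and the measure of the ball gives another 5^(-m); this is the decay that
  \<open>energy_from_cells\<close> requires. The limsup controls only small radii, and monotonicity
  of the energies carries the bound back to coarse levels.\<close>

lemma sobolev_lower:
 assumes p: "1 < p" shows "\<exists>C>0. ALL f s n. continuous_on K f --> 0 <= s --> sobolev_seminorm_p p f <= ennreal s -->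
  energy p (incr f) n <= C * s powr p"
proof -
 let ?r = "3 powr (p - 1)" and ?a = "alpha p"
 define c where "c = 400 * 4 powr p * (1 / (1 - 3 powr (-1/2))) powr (p - 1) / (1 - 3 powr ((1 - p) / 2))"
 have "3 powr (-1/2) < 3 powr (0::real)" "3 powr ((1 - p) / 2) < 3 powr (0::real)"
  using p by (intro powr_less_mono; simp)+
 hence l: "3 powr (-1/2) < (1::real)" "3 powr ((1 - p) / 2) < (1::real)" by simp_all
 hence "0 < (1 / (1 - 3 powr (-1/2) :: real)) powr (p - 1)" by simp
 hence c: "0 < c" unfolding c_def using l by (intro divide_pos_pos mult_pos_pos) auto
 define C where "C = c * (2025\<^sup>2 * 20 powr (?a * p))"
 have C: "0 < C" using c by (simp add: C_def)
 have main: "energy p (incr f) n <= C * s' powr p"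
  if f: "continuous_on K f" and s: "0 <= s" "sobolev_seminorm_p p f <= ennreal s" "s < s'" for f s s' n
 proof -
  have "ennreal s < ennreal s'" using s by (simp add: ennreal_less_iff)
  hence "eventually (%r. ennreal (1 / r powr ?a) * ennpowr (ball_energy p f r) (1/p) < ennreal s') (at_right 0)"
   using s(2) unfolding sobolev_seminorm_p_def ball_energy_def[symmetric] Limsup_le_iff by blast
  then obtain b where b: "b > 0" "!!r. 0 < r ==> r < b ==> ennreal (1 / r powr ?a) * ennpowr (ball_energy p f r) (1/p) < ennreal s'"
   unfolding eventually_at_right_field by blast
  obtain N where N: "20 / 3 ^ N < b" using b(1) by (rule power3_small)
  have J: "(SUM u:words m. cell_int p f u) <= ennreal ((2025\<^sup>2 * 20 powr (?a * p) * s' powr p) / (25 * ?r) ^ m)" if "m \<ge> max n N" for m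
  proof -
   define r where "r = 20 / (3::real) ^ m"
   have "r <= 20 / 3 ^ N" unfolding r_def using that by (intro divide_left_mono power_increasing) auto
   hence r: "0 < r" "r < b" using N by (simp_all add: r_def)
   have ra: "0 < r powr ?a" using r by simp
   have "ennpowr (ball_energy p f r) (1/p) = ennreal (r powr ?a) * (ennreal (1 / r powr ?a) * ennpowr (ball_energy p f r) (1/p))"
    using r by (simp flip: mult.assoc ennreal_mult)
   also have "... <= ennreal (r powr ?a) * ennreal s'" by (intro mult_left_mono less_imp_le[OF b(2)[OF r]]) simp
   also have "... = ennreal (r powr ?a * s')" using s by (simp add: ennreal_mult)
   finally have "ball_energy p f r <= ennreal ((r powr ?a * s') powr (1 / (1 / p)))"
    using p s by (intro ennpowr_leD) auto
   hence B: "ball_energy p f r <= ennreal (r powr (?a * p) * s' powr p)" using s by (simp add: powr_mult powr_powr)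
   have rp: "r powr (?a * p) = 20 powr (?a * p) / (5 * ?r) ^ m"
    unfolding r_def alpha_scale[OF p, symmetric] by (simp add: powr_divide powr_powr mult_ac flip: powr_realpow)
   have "(SUM u:words m. cell_int p f u) <= ennreal (2025\<^sup>2 / 5 ^ m) * ball_energy p f r"
    unfolding r_def by (rule sum_cell_int_le[OF f])
   also have "... <= ennreal (2025\<^sup>2 / 5 ^ m) * ennreal (r powr (?a * p) * s' powr p)" by (intro mult_left_mono B) simp
   also have "... = ennreal (2025\<^sup>2 / 5 ^ m * (r powr (?a * p) * s' powr p))"
    by (rule ennreal_mult[symmetric]) simp_all
   also have "2025\<^sup>2 / 5 ^ m * (r powr (?a * p) * s' powr p) = (2025\<^sup>2 * 20 powr (?a * p) * s' powr p) / (25 * ?r) ^ m"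
   proof -
    have "25 * ?r = 5 * (5 * ?r)" by simp
    hence e: "(25 * ?r) ^ m = 5 ^ m * (5 * ?r) ^ m" by (simp only: power_mult_distrib)
    have "a1 / b1 * (a2 / b2 * a3) = (a1 * a2 * a3) / (b1 * b2)" for a1 b1 a2 b2 a3 :: real by simp
    thus ?thesis unfolding rp e .
   qed
   finally show ?thesis .
  qed
  have "energy p (incr f) n <= energy p (incr f) (max n N)" by (rule energy_mono[OF p consistent_incr]) simp
  also have "... <= c * (2025\<^sup>2 * 20 powr (?a * p) * s' powr p)"
   unfolding c_def by (rule energy_from_cells[OF p f _ J]) simp_all
  finally show ?thesis by (simp add: C_def mult_ac)
 qed
 show ?thesis
 proof (intro exI[of _ C] conjI allI impI C)
  fix f s n assume f: "continuous_on K f" and s: "0 <= s" "sobolev_seminorm_p p f <= ennreal s"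
  \<comment> \<open>The limsup gives eventual bounds only for s' > s; letting s' decrease to s
    restores the claimed power.\<close>
  have "((%s'. C * s' powr p) \<longlongrightarrow> C * s powr p) (at_right s)"
   using p s by (intro tendsto_intros tendsto_powr2) (auto simp: eventually_at_filter)
  thus "energy p (incr f) n <= C * s powr p"
  proof (rule tendsto_lowerbound)
   show "\<forall>\<^sub>F s' in at_right s. energy p (incr f) n <= C * s' powr p"
    unfolding eventually_at_right_field using main[OF f s] by (intro exI[of _ "s + 1"]) auto
  qed simp
 qed
qed

section \<open>Gradients\<close>

text \<open>Young's inequality at the point (B/a)^(1/p), where its two terms balance. For B = 0 this
  point degenerates and the integrand vanishes almost everywhere.\<close>

lemma nn_integral_holder_bound:
 fixes h :: "'a => real"
 assumes p: "1 < p" and A [measurable]: "A : sets M" and a: "emeasure M A <= ennreal a" "0 < a"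
  and h [measurable]: "h : borel_measurable M"
  and B: "(\<integral>\<^sup>+x. ennreal (abs (h x) powr p) * ind A x \<partial>M) <= ennreal B" "0 <= B"
 shows "(\<integral>\<^sup>+x. ennreal \<bar>h x\<bar> * ind A x \<partial>M) <= ennreal (a powr (1 - 1 / p) * B powr (1 / p))"
proof (cases "B = 0")
 case True
 have "AE x in M. ennreal (abs (h x) powr p) * ind A x = 0"
  using B True by (subst nn_integral_0_iff_AE[symmetric]) auto
 hence "AE x in M. ennreal \<bar>h x\<bar> * ind A x = 0"
 proof eventually_elim
  case (elim x)
  have "\<not> (0 < abs (h x) powr p) \<or> x ~: A" using elim by (auto simp: indicator_def split: if_splits)
  hence "h x = 0 \<or> x ~: A" by auto
  thus ?case by auto
 qed
 hence "(\<integral>\<^sup>+x. ennreal \<bar>h x\<bar> * ind A x \<partial>M) = 0" by (subst nn_integral_0_iff_AE) auto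
 thus ?thesis by simp
next
 case False
 with B have Bp: "0 < B" by simp
 define s where "s = (B / a) powr (1 / p)"
 have s: "0 < s" using Bp a by (simp add: s_def)
 have sp: "s powr p = B / a" using p Bp a by (simp add: s_def powr_powr)
 have s1: "s powr (1 - p) * B = s * a" using sp s Bp a by (simp add: powr_diff field_simps)
 define c1 where "c1 = s powr (1 - p) / p"
 define c2 where "c2 = (p - 1) * s / p"
 have c: "0 <= c1" "0 <= c2" using p s by (auto simp: c1_def c2_def)
 have "(\<integral>\<^sup>+x. ennreal \<bar>h x\<bar> * ind A x \<partial>M)
  <= (\<integral>\<^sup>+x. ennreal c1 * (ennreal (abs (h x) powr p) * ind A x) + ennreal c2 * ind A x \<partial>M)"
 proof (rule nn_integral_mono)
  fix x
  have "abs (h x) <= (abs (h x) powr p * s powr (1 - p) + (p - 1) * s) / p" by (rule young_powr[OF p _ s]) simp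
  also have "... = c1 * abs (h x) powr p + c2" by (simp add: c1_def c2_def add_divide_distrib)
  finally have "ennreal \<bar>h x\<bar> <= ennreal c1 * ennreal (abs (h x) powr p) + ennreal c2"
   using c by (simp add: ennreal_mult[symmetric] ennreal_plus[symmetric] del: ennreal_plus)
  thus "ennreal \<bar>h x\<bar> * ind A x <= ennreal c1 * (ennreal (abs (h x) powr p) * ind A x) + ennreal c2 * ind A x"
   by (auto simp: indicator_def)
 qed
 also have "... = ennreal c1 * (\<integral>\<^sup>+x. ennreal (abs (h x) powr p) * ind A x \<partial>M) + ennreal c2 * emeasure M A"
  by (subst nn_integral_add) (auto simp: nn_integral_cmult nn_integral_cmult_indicator)
 also have "... <= ennreal c1 * ennreal B + ennreal c2 * ennreal a" by (intro add_mono mult_left_mono B a) auto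
 also have "... = ennreal (c1 * B + c2 * a)"
  using c a Bp by (simp add: ennreal_mult[symmetric] ennreal_plus[symmetric] del: ennreal_plus)
 also have "c1 * B + c2 * a = (s powr (1 - p) * B + (p - 1) * (s * a)) / p"
  by (simp add: c1_def c2_def add_divide_distrib)
 also have "... = s * a" unfolding s1 using p by (simp add: field_simps)
 also have "... = a powr (1 - 1 / p) * B powr (1 / p)"
  using a Bp by (simp add: s_def powr_divide powr_diff field_simps)
 finally show ?thesis .
qed

section \<open>Edges and vertices under the length measure\<close>

lemma edge_vnu [measurable, simp]: "(w, i) : earcs n ==> edge w i : sets vnu" by (simp add: sets_vnu edge_sets)

lemma V_skeleton_subset: "V n <= skeleton" using V_Vbar[of n] by (auto simp: skeleton_def)

lemma finite_null: "finite F ==> F <= skeleton ==> F : null_sets vnu"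
proof (rule null_setsI)
 assume F: "finite F" "F <= skeleton"
 show "emeasure vnu F = 0" by (rule emeasure_vnu_finite[OF F])
 have "F : sets borel" using F(1) by (simp add: finite_imp_closed)
 thus "F : sets vnu" unfolding sets_vnu using F(2) skeleton_borel by (simp add: sets_restrict_space_iff)
qed

lemma V_null: "V n : null_sets vnu" by (rule finite_null[OF finite_V V_skeleton_subset])

lemma AE_not_V: "AE x in vnu. x ~: V n" by (rule AE_not_in[OF V_null])

lemma V_vnu [measurable]: "V n : sets vnu" using V_null by (rule null_setsD2)

lemma edge_unique:
 assumes x: "x ~: V n" and wi: "(w, i) : earcs n" "x : edge w i" and vj: "(v, j) : earcs n" "x : edge v j"
 shows "(v, j) = (w, i)"
proof (rule ccontr)
 assume "\<not> ?thesis"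
 hence ne: "(w, i) ~= (v, j)" by auto
 obtain t where t: "0 <= t" "t <= 1" "x = pw w (t *\<^sub>R q i)" using wi(2) unfolding edge_def by auto
 have "t = 0 \<or> t = 1" using edges_meet_same[OF wi(1) vj(1) ne t(1,2)] vj(2) t(3) by simp
 hence "x = pw w (q 5) \<or> x = pw w (q i)" using t(3) q5 by auto
 moreover have "pw w (q 5) : V n" "pw w (q i) : V n"
  using wi(1) by (auto simp: earcs_iff intro!: psi_word_in_V)
 ultimately show False using x by auto
qed

lemma sum_edge_indicator:
 fixes c :: "nat list \<times> nat => 'a::semiring_1"
 assumes x: "x ~: V n" and wi: "(w, i) : earcs n" "x : edge w i"
 shows "(SUM e:earcs n. ind (edge (fst e) (snd e)) x * c e) = c (w, i)"
proof -
 have "(SUM e:earcs n. ind (edge (fst e) (snd e)) x * c e) = (SUM e:earcs n. if e = (w, i) then c e else 0)"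
 proof (rule sum.cong[OF refl])
  fix e assume e: "e : earcs n"
  obtain v j where vj: "e = (v, j)" by (cases e)
  show "ind (edge (fst e) (snd e)) x * c e = (if e = (w, i) then c e else 0)"
  proof (cases "e = (w, i)")
   case True thus ?thesis using wi by simp
  next
   case False
   hence "x ~: edge v j" using edge_unique[OF x wi, of v j] e vj by auto
   hence "ind (edge (fst e) (snd e)) x * c e = 0" using vj by simp
   thus ?thesis unfolding if_not_P[OF False] .
  qed
 qed
 thus ?thesis using wi by simp
qed

lemma sum_edges_le:
 assumes h [measurable]: "h : borel_measurable vnu"
 shows "(SUM w:words n. SUM i:{1..4}. \<integral>\<^sup>+x. h x * ind (edge w i) x \<partial>vnu) <= (\<integral>\<^sup>+x. h x \<partial>vnu)"
proof -
 have ed: "edge (fst e) (snd e) : sets vnu" if "e : earcs n" for e using that by (cases e) simp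
 note [measurable] = ed
 have "(SUM w:words n. SUM i:{1..4}. \<integral>\<^sup>+x. h x * ind (edge w i) x \<partial>vnu)
  = (SUM e:earcs n. \<integral>\<^sup>+x. h x * ind (edge (fst e) (snd e)) x \<partial>vnu)" by (rule sum_earcs[symmetric])
 also have "... = (\<integral>\<^sup>+x. (SUM e:earcs n. h x * ind (edge (fst e) (snd e)) x) \<partial>vnu)"
  by (rule nn_integral_sum[symmetric]) (use ed in measurable)
 also have "... <= (\<integral>\<^sup>+x. h x \<partial>vnu)"
 proof (rule nn_integral_mono_AE, use AE_not_V[of n] in eventually_elim)
  fix x assume x: "x ~: V n"
  have eq: "(SUM e:earcs n. h x * ind (edge (fst e) (snd e)) x)
   = (SUM e:earcs n. ind (edge (fst e) (snd e)) x * h x)" by (simp add: mult.commute)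
  show "(SUM e:earcs n. h x * ind (edge (fst e) (snd e)) x) <= h x"
  proof (cases "EX w i. (w, i) : earcs n & x : edge w i")
   case True
   then obtain w i where "(w, i) : earcs n" "x : edge w i" by auto
   from sum_edge_indicator[OF x this, of "%_. h x"] show ?thesis unfolding eq by simp
  next
   case False
   hence "(SUM e:earcs n. h x * ind (edge (fst e) (snd e)) x) = 0"
    by (intro sum.neutral) (auto simp: indicator_def)
   thus ?thesis by (simp only: zero_le)
  qed
 qed
 finally show ?thesis .
qed

text \<open>The three parts overlap only in finite sets, which are null.\<close>

lemma edge_split_integral:
 fixes h :: "real \<times> real => real"
 assumes wi: "(w, i) : earcs n" and h: "set_integrable vnu (edge w i) h"
 shows "(LINT x:edge w i|vnu. h x) = (LINT x:edge (w @ [5]) i|vnu. h x)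
  + (LINT x:edge (w @ [i]) (opp i)|vnu. h x) + (LINT x:edge (w @ [i]) i|vnu. h x)"
proof -
 have i: "i : {1..4}" using wi by (simp add: earcs_iff)
 note e = earcs_snoc[OF wi]
 note split = edge_split[OF i, of w]
 have null: "AE x in vnu. \<not> (x : edge v j & x : edge u k)"
  if "(v, j) : earcs (Suc n)" "(u, k) : earcs (Suc n)" "(v, j) ~= (u, k)" for v j u k
 proof -
  have "edge v j Int edge u k : null_sets vnu"
   using edges_meet_finite[OF that] edge_skeleton[OF that(1)] by (intro finite_null) auto
  from AE_not_in[OF this] show ?thesis by simp
 qed
 have ne: "(w @ [5], i) ~= (w @ [i], opp i)" "(w @ [5], i) ~= (w @ [i], i)" "(w @ [i], opp i) ~= (w @ [i], i)"
  using i opp_neq[of i] by auto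
 have int: "set_integrable vnu (edge (w @ [5]) i) h" "set_integrable vnu (edge (w @ [i]) (opp i)) h"
  "set_integrable vnu (edge (w @ [i]) i) h" by (rule set_integrable_subset[OF h]; use e split in auto)+
 have "(LINT x:edge w i|vnu. h x) = (LINT x:edge (w @ [5]) i Un edge (w @ [i]) (opp i)|vnu. h x) + (LINT x:edge (w @ [i]) i|vnu. h x)"
  unfolding split
 proof (rule set_integral_Un_AE)
  show "AE x in vnu. \<not> (x : edge (w @ [5]) i Un edge (w @ [i]) (opp i) & x : edge (w @ [i]) i)"
   using null[OF e(1,3) ne(2)] null[OF e(2,3) ne(3)] by eventually_elim auto
  show "set_integrable vnu (edge (w @ [5]) i Un edge (w @ [i]) (opp i)) h"
   by (rule set_integrable_Un) (use int e in auto)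
 qed (use int e in auto)
 also have "(LINT x:edge (w @ [5]) i Un edge (w @ [i]) (opp i)|vnu. h x)
  = (LINT x:edge (w @ [5]) i|vnu. h x) + (LINT x:edge (w @ [i]) (opp i)|vnu. h x)"
  by (rule set_integral_Un_AE) (use null[OF e(1,2) ne(1)] int e in auto)
 finally show ?thesis .
qed

text \<open>Induction from fine to coarse: what holds on the edges of level \<open>n\<close> and
  passes from the three parts to the whole holds on all coarser edges.\<close>

lemma edge_induct:
 assumes base: "!!w i. (w, i) : earcs n ==> P w i"
  and step: "!!k w i. (w, i) : earcs k ==> k < n ==> P (w @ [5]) i ==> P (w @ [i]) (opp i) ==> P (w @ [i]) i ==> P w i"
 shows "(w, i) : earcs k ==> k <= n ==> P w i"
proof (induction "n - k" arbitrary: k w i)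
 case 0
 thus ?case using base by simp
next
 case (Suc m)
 hence k: "k < n" "m = n - Suc k" by auto
 show ?case
  by (rule step[OF Suc.prems(1) k(1)]; rule Suc.hyps(1)[OF k(2)]) (use earcs_snoc[OF Suc.prems(1)] k in auto)
qed

lemma edge_integrable_bounded:
 fixes h :: "real \<times> real => real"
 assumes "(w, i) : earcs n" "h : borel_measurable vnu" "!!x. \<bar>h x\<bar> <= B" shows "set_integrable vnu (edge w i) h"
 unfolding set_integrable_def
 by (rule integrableI_bounded_set_indicator[where B=B]) (use assms emeasure_vnu_edge[OF assms(1)] in auto)

lemma measure_edge: "(w, i) : earcs n ==> measure vnu (edge w i) = 1 / 3 ^ n"
 unfolding measure_def by (simp add: emeasure_vnu_edge)

lemma edge_integral_const: "(w, i) : earcs n ==> (LINT x:edge w i|vnu. c) = c / 3 ^ n"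
 for c :: real by (subst set_integral_const) (auto simp: measure_edge emeasure_vnu_edge)

text \<open>Local integrability only: the total length is infinite, so a function in L^p with p > 1
  need not be integrable. \<open>is_gradient_iff\<close> adds global integrability for the exponent
  1.\<close>

definition lgrad :: "(real \<times> real => real) => (real \<times> real => real) => bool" where
 "lgrad f g \<longleftrightarrow> g : borel_measurable vnu & (ALL n w i. (w, i) : earcs n -->
  set_integrable vnu (edge w i) g & incr f w i = esgn w i * (LINT x:edge w i|vnu. g x))"

lemma lgradD:
 assumes "lgrad f g" shows "g : borel_measurable vnu" and "(w, i) : earcs n ==> set_integrable vnu (edge w i) g"
  and "(w, i) : earcs n ==> incr f w i = esgn w i * (LINT x:edge w i|vnu. g x)"
 using assms unfolding lgrad_def by blast+

lemma esgn_neq_0: "esgn w i ~= 0" by (simp add: esgn_def)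

section \<open>Linearity and uniqueness of gradients\<close>

lemma lgrad_add:
 assumes "lgrad f g" "lgrad f' g'" shows "lgrad (%x. f x + f' x) (%x. g x + g' x)" unfolding lgrad_def
proof (intro conjI allI impI)
 show "(%x. g x + g' x) : borel_measurable vnu" using lgradD(1)[OF assms(1)] lgradD(1)[OF assms(2)] by simp
 fix n w i assume e: "(w, i) : earcs n"
 note a = lgradD(2,3)[OF assms(1) e] lgradD(2,3)[OF assms(2) e]
 show "set_integrable vnu (edge w i) (%x. g x + g' x)" using a by (intro set_integral_add)
 show "incr (%x. f x + f' x) w i = esgn w i * (LINT x:edge w i|vnu. g x + g' x)"
  using a by (simp add: set_integral_add incr_def algebra_simps)
qed

lemma lgrad_uminus:
 assumes "lgrad f g" shows "lgrad (%x. - f x) (%x. - g x)" unfolding lgrad_def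
proof (intro conjI allI impI)
 show "(%x. - g x) : borel_measurable vnu" using lgradD(1)[OF assms] by simp
 fix n w i assume e: "(w, i) : earcs n"
 note a = lgradD(2,3)[OF assms e]
 show "set_integrable vnu (edge w i) (%x. - g x)" using a unfolding set_integrable_def by simp
 show "incr (%x. - f x) w i = esgn w i * (LINT x:edge w i|vnu. - g x)"
  using a by (simp add: set_integral_uminus incr_def)
qed

lemma lgrad_diff: "lgrad f g ==> lgrad f' g' ==> lgrad (%x. f x - f' x) (%x. g x - g' x)"
 using lgrad_add[OF _ lgrad_uminus] by simp

text \<open>Cut off outside one edge, the positive and the negative part of the function are
  densities of finite measures that agree on all edges and on finite sets. By
  \<open>edge_determined\<close> they coincide.\<close>

lemma lgrad_0_edge:
 fixes g :: "real \<times> real => real"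
 assumes g [measurable]: "g : borel_measurable vnu"
  and int: "!!n w i. (w, i) : earcs n ==> set_integrable vnu (edge w i) g"
  and 0: "!!n w i. (w, i) : earcs n ==> (LINT x:edge w i|vnu. g x) = 0" and e: "(w, i) : earcs n"
 shows "AE x\<in>edge w i in vnu. g x = 0"
proof -
 define h where "h x = ind (edge w i) x * g x" for x
 note [measurable] = edge_vnu[OF e]
 have hm [measurable]: "h : borel_measurable vnu" unfolding h_def by measurable
 have hi: "integrable vnu h" using int[OF e] unfolding set_integrable_def h_def by simp
 have hn: "(\<integral>\<^sup>+x. ennreal (norm (h x)) \<partial>vnu) < \<infinity>" using hi unfolding integrable_iff_bounded by simp
 have fin: "(\<integral>\<^sup>+x. ennreal (s * h x) \<partial>vnu) ~= \<infinity>" if s: "abs s = 1" for s :: real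
 proof -
  have "(\<integral>\<^sup>+x. ennreal (s * h x) \<partial>vnu) <= (\<integral>\<^sup>+x. ennreal (norm (h x)) \<partial>vnu)"
   by (rule nn_integral_mono, rule ennreal_leI)
    (metis abs_ge_self abs_mult mult_1 real_norm_def s)
  thus ?thesis using hn by (auto simp: top_unique)
 qed
 have sets_d: "sets (density vnu k) = sets (restrict_space borel skeleton)" for k by (simp add: sets_vnu)
 \<comment> \<open>Since \<open>ennreal\<close> sends negative numbers to 0, these densities are the
   positive and the negative part of \<open>h\<close>.\<close>
 have dens: "density vnu (%x. ennreal (h x)) = density vnu (%x. ennreal (- h x))"
 proof (rule edge_determined[OF sets_d sets_d])
  fix m v j assume vj: "(v, j) : earcs m"
  note [measurable] = edge_vnu[OF vj]
  have hv: "set_integrable vnu (edge v j) h" unfolding set_integrable_def using hi vj by (intro integrable_mult_indicator) auto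
  have "(LINT x:edge v j|vnu. h x) = 0"
  proof -
   have *: "(LINT x:edge v j|vnu. h x) = (LINT x:edge v j Int edge w i|vnu. g x)"
    unfolding set_lebesgue_integral_def h_def by (simp add: indicator_inter_arith ac_simps)
   have "edge v j <= edge w i \<or> edge w i <= edge v j \<or> finite (edge v j Int edge w i)"
   proof (cases "n <= m")
    case True
    hence "(v, j) : earcs (n + (m - n))" using vj by simp
    from edges_meet[OF e this] show ?thesis by auto
   next
    case False
    hence "(w, i) : earcs (m + (n - m))" using e by simp
    from edges_meet[OF vj this] show ?thesis by (auto simp: Int_commute)
   qed
   then consider "edge v j Int edge w i = edge v j" | "edge v j Int edge w i = edge w i" | "finite (edge v j Int edge w i)"
    by auto
   thus ?thesis
   proof cases
    case 3
    hence "edge v j Int edge w i : null_sets vnu" using edge_skeleton[OF e] by (intro finite_null) auto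
    hence "AE x in vnu. ind (edge v j Int edge w i) x *\<^sub>R g x = 0" by (rule AE_mp[OF AE_not_in]) auto
    thus ?thesis unfolding * unfolding set_lebesgue_integral_def by (rule integral_eq_zero_AE)
   qed (simp_all add: * 0[OF vj] 0[OF e])
  qed
  hence z: "(LINT x|vnu. ind (edge v j) x * h x) = 0" by (simp add: set_lebesgue_integral_def)
  have hvi: "integrable vnu (%x. ind (edge v j) x * h x)" using hv by (simp add: set_integrable_def)
  have fin': "(\<integral>\<^sup>+x. ennreal (s * (ind (edge v j) x * h x)) \<partial>vnu) ~= \<infinity>" if s: "abs s = 1" for s
  proof -
   have "(\<integral>\<^sup>+x. ennreal (s * (ind (edge v j) x * h x)) \<partial>vnu) <= (\<integral>\<^sup>+x. ennreal (s * h x) \<partial>vnu)"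
    by (rule nn_integral_mono) (auto simp: indicator_def)
   thus ?thesis using fin[OF s] by (auto simp: top_unique)
  qed
  have em: "emeasure (density vnu (%x. ennreal (s * h x))) (edge v j) = (\<integral>\<^sup>+x. ennreal (s * (ind (edge v j) x * h x)) \<partial>vnu)" for s
   by (subst emeasure_density) (auto simp: indicator_def intro!: nn_integral_cong)
  have "enn2real (\<integral>\<^sup>+x. ennreal (ind (edge v j) x * h x) \<partial>vnu) = enn2real (\<integral>\<^sup>+x. ennreal (- (ind (edge v j) x * h x)) \<partial>vnu)"
   using z real_lebesgue_integral_def[OF hvi] by simp
  thus "emeasure (density vnu (%x. ennreal (h x))) (edge v j) = emeasure (density vnu (%x. ennreal (- h x))) (edge v j)"
   using em[of 1] em[of "-1"] fin'[of 1] fin'[of "-1"] by simp (metis ennreal_enn2real less_top)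
  show "emeasure (density vnu (%x. ennreal (h x))) (edge v j) ~= \<infinity>" using em[of 1] fin'[of 1] by simp
 next
  fix F :: "(real \<times> real) set" assume F: "finite F" "F <= skeleton"
  have N: "F : null_sets vnu" by (rule finite_null[OF F])
  have "emeasure (density vnu k) F = 0" if "k : borel_measurable vnu" for k
   using emeasure_density[OF that null_setsD2[OF N]] nn_integral_null_set[OF N] by simp
  thus "emeasure (density vnu (%x. ennreal (h x))) F = emeasure (density vnu (%x. ennreal (- h x))) F" by simp
 qed
 have "AE x in vnu. ennreal (h x) = ennreal (- h x)"
  by (rule sigma_finite_measure.density_unique[OF sigma_finite_vnu _ _ dens]) auto
 thus ?thesis
 proof eventually_elim
  case (elim x)
  have "h x = 0"
  proof (rule ccontr)
   assume "h x ~= 0"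
   then consider "h x > 0" | "h x < 0" by linarith
   thus False using elim by cases (auto simp: ennreal_neg)
  qed
  thus ?case by (auto simp: h_def)
 qed
qed

lemma AE_edges:
 assumes "!!n w i. (w, i) : earcs n ==> AE x\<in>edge w i in vnu. P x" shows "AE x in vnu. P x"
proof -
 have "AE x in vnu. ALL n. ALL e:earcs n. x : edge (fst e) (snd e) --> P x" unfolding AE_all_countable
 proof (intro allI AE_finite_allI)
  fix n e assume "e : earcs n"
  thus "AE x\<in>edge (fst e) (snd e) in vnu. P x" using assms[of "fst e" "snd e" n] by simp
 qed simp
 moreover have "AE x in vnu. x : skeleton" using AE_space[of vnu] by (simp add: space_vnu)
 ultimately show ?thesis
 proof eventually_elim
  case (elim x)
  obtain n w i where "(w, i) : earcs n" "x : edge w i" by (rule skeleton_edge[OF elim(2)])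
  thus ?case using elim(1)[rule_format, of "(w, i)" n] by simp
 qed
qed

lemma lgrad_unique:
 assumes "lgrad f g" "lgrad f g'" shows "AE x in vnu. g x = g' x"
proof -
 have "AE x in vnu. g x - g' x = 0"
 proof (rule AE_edges, rule lgrad_0_edge)
  show "(%x. g x - g' x) : borel_measurable vnu" using lgradD(1)[OF assms(1)] lgradD(1)[OF assms(2)] by simp
  fix n w i assume e: "(w, i) : earcs n"
  note a = lgradD(2,3)[OF assms(1) e] lgradD(2,3)[OF assms(2) e]
  show "set_integrable vnu (edge w i) (%x. g x - g' x)" using a by (intro set_integral_diff)
  show "(LINT x:edge w i|vnu. g x - g' x) = 0" using a esgn_neq_0[of w i] by (simp add: set_integral_diff(2))
 qed
 thus ?thesis by simp
qed

section \<open>Bounds on increments from bounds on the gradient\<close>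

lemma edge_integrable_Lp:
 assumes p: "1 < p" and g [measurable]: "g : borel_measurable vnu" and e: "(w, i) : earcs n"
  and B: "(\<integral>\<^sup>+x. ennreal (abs (g x) powr p) * ind (edge w i) x \<partial>vnu) <= ennreal B" "0 <= B"
 shows "set_integrable vnu (edge w i) g"
  and "abs (LINT x:edge w i|vnu. g x) <= (1 / 3 ^ n) powr (1 - 1 / p) * B powr (1 / p)"
proof -
 note [measurable] = edge_vnu[OF e]
 have *: "(\<integral>\<^sup>+x. ennreal \<bar>g x\<bar> * ind (edge w i) x \<partial>vnu) <= ennreal ((1 / 3 ^ n) powr (1 - 1 / p) * B powr (1 / p))"
  by (rule nn_integral_holder_bound[OF p]) (use B emeasure_vnu_edge[OF e] in auto)
 have eq: "(\<integral>\<^sup>+x. ennreal (norm (ind (edge w i) x *\<^sub>R g x)) \<partial>vnu) = (\<integral>\<^sup>+x. ennreal \<bar>g x\<bar> * ind (edge w i) x \<partial>vnu)"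
  by (rule nn_integral_cong) (simp add: indicator_def)
 show si: "set_integrable vnu (edge w i) g"
  unfolding set_integrable_def integrable_iff_bounded eq infinity_ennreal_def
 proof (rule conjI)
  show "(%x. ind (edge w i) x *\<^sub>R g x) : borel_measurable vnu"
   by (intro borel_measurable_scaleR borel_measurable_indicator edge_vnu[OF e] g)
  show "(\<integral>\<^sup>+x. ennreal \<bar>g x\<bar> * ind (edge w i) x \<partial>vnu) < \<top>" by (rule le_less_trans[OF * ennreal_less_top])
 qed
 show "abs (LINT x:edge w i|vnu. g x) <= (1 / 3 ^ n) powr (1 - 1 / p) * B powr (1 / p)"
 proof -
  have "ennreal (norm (LINT x:edge w i|vnu. g x)) <= ennreal ((1 / 3 ^ n) powr (1 - 1 / p) * B powr (1 / p))"
   using order_trans[OF integral_norm_bound_ennreal[OF si[unfolded set_integrable_def]] *[folded eq]]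
   unfolding set_lebesgue_integral_def .
  thus ?thesis by (subst (asm) ennreal_le_iff) (auto intro: mult_nonneg_nonneg)
 qed
qed

text \<open>Hoelder's inequality on an edge costs exactly the factor that the weight in
  \<open>energy\<close> compensates, and the edges of one level overlap only in a null set.\<close>

lemma lgrad_energy:
 assumes p: "1 < p" and fg: "lgrad f g" and G: "(\<integral>\<^sup>+x. ennreal (abs (g x) powr p) \<partial>vnu) <= ennreal G" "0 <= G"
 shows "energy p (incr f) n <= G"
proof -
 note g [measurable] = lgradD(1)[OF fg]
 define B where "B w i = enn2real (\<integral>\<^sup>+x. ennreal (abs (g x) powr p) * ind (edge w i) x \<partial>vnu)" for w i
 have B: "(\<integral>\<^sup>+x. ennreal (abs (g x) powr p) * ind (edge w i) x \<partial>vnu) = ennreal (B w i)" "0 <= B w i" for w i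
 proof -
  have "(\<integral>\<^sup>+x. ennreal (abs (g x) powr p) * ind (edge w i) x \<partial>vnu) <= (\<integral>\<^sup>+x. ennreal (abs (g x) powr p) \<partial>vnu)"
   by (rule nn_integral_mono) (auto simp: indicator_def)
  also have "... < \<top>" using le_less_trans[OF G(1) ennreal_less_top] .
  finally show "(\<integral>\<^sup>+x. ennreal (abs (g x) powr p) * ind (edge w i) x \<partial>vnu) = ennreal (B w i)" by (simp add: B_def)
  show "0 <= B w i" by (simp add: B_def)
 qed
 have c: "((1 / 3 ^ n) powr (1 - 1 / p)) powr p * (3 powr (p - 1)) ^ n = 1"
 proof -
  have "((1 / 3 ^ n) powr (1 - 1 / p)) powr p = (1 / 3 ^ n :: real) powr (p - 1)" using p by (simp add: powr_powr left_diff_distrib)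
  also have "... = 1 / (3 powr (p - 1)) ^ n" by (simp add: powr_divide powr_realpow[symmetric] powr_powr mult.commute)
  finally show ?thesis by simp
 qed
 have "abs (incr f w i) powr p <= ((1 / 3 ^ n) powr (1 - 1 / p)) powr p * B w i" if e: "w : words n" "i : {1..4}" for w i
 proof -
  have we: "(w, i) : earcs n" using e by (simp add: earcs_iff)
  have "abs (incr f w i) <= (1 / 3 ^ n) powr (1 - 1 / p) * B w i powr (1 / p)"
   using edge_integrable_Lp(2)[OF p g we, of "B w i"] B[of w i] lgradD(3)[OF fg we] by (simp add: abs_mult abs_esgn)
  hence "abs (incr f w i) powr p <= ((1 / 3 ^ n) powr (1 - 1 / p) * B w i powr (1 / p)) powr p"
   using p by (intro powr_mono2) auto
  also have "... = ((1 / 3 ^ n) powr (1 - 1 / p)) powr p * (B w i powr (1 / p)) powr p" by (rule powr_mult)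
  also have "(B w i powr (1 / p)) powr p = B w i" using p B(2)[of w i] by (simp add: powr_powr)
  finally show ?thesis .
 qed
 hence "energy p (incr f) n <= (3 powr (p - 1)) ^ n * (SUM w:words n. SUM i:{1..4}. ((1 / 3 ^ n) powr (1 - 1 / p)) powr p * B w i)"
  unfolding energy_def by (intro mult_left_mono sum_mono) auto
 also have "... = (((1 / 3 ^ n) powr (1 - 1 / p)) powr p * (3 powr (p - 1)) ^ n) * (SUM w:words n. SUM i:{1..4}. B w i)"
  by (simp only: sum_distrib_left mult.assoc mult.left_commute)
 also have "... = (SUM w:words n. SUM i:{1..4}. B w i)" unfolding c by simp
 also have "... <= G"
 proof -
  have "ennreal (SUM w:words n. SUM i:{1..4}. B w i) = (SUM w:words n. SUM i:{1..4}. ennreal (B w i))"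
   using B(2) by (simp add: sum_ennreal sum_nonneg)
  also have "... <= (\<integral>\<^sup>+x. ennreal (abs (g x) powr p) \<partial>vnu)" unfolding B(1)[symmetric] by (rule sum_edges_le) measurable
  also have "... <= ennreal G" by (rule G)
  finally show ?thesis using G(2) by simp
 qed
 finally show ?thesis .
qed

lemma lgrad_bounded:
 assumes fg: "lgrad f g" and L: "AE x in vnu. \<bar>g x\<bar> <= L" and e: "(w, i) : earcs n" shows "abs (incr f w i) <= L / 3 ^ n"
proof -
 note [measurable] = edge_vnu[OF e] lgradD(1)[OF fg]
 note si = lgradD(2)[OF fg e]
 have "abs (LINT x:edge w i|vnu. g x) <= (LINT x:edge w i|vnu. \<bar>g x\<bar>)"
  unfolding set_lebesgue_integral_def using si[unfolded set_integrable_def]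
  by (intro order_trans[OF integral_abs_bound]) (simp add: abs_mult)
 also have "... <= (LINT x:edge w i|vnu. L)" unfolding set_lebesgue_integral_def
 proof (rule integral_mono_AE)
  show "integrable vnu (%x. ind (edge w i) x *\<^sub>R \<bar>g x\<bar>)"
   using set_integrable_abs[OF si] by (simp add: set_integrable_def)
  show "integrable vnu (%x. ind (edge w i) x *\<^sub>R L)"
   using edge_integrable_bounded[OF e, of "%_. L" "abs L"] by (simp add: set_integrable_def)
  show "AE x in vnu. ind (edge w i) x *\<^sub>R \<bar>g x\<bar> <= ind (edge w i) x *\<^sub>R L"
   using L by eventually_elim (auto simp: indicator_def)
 qed
 also have "... = L / 3 ^ n" by (rule edge_integral_const[OF e])
 finally show ?thesis unfolding lgradD(3)[OF fg e] by (simp add: abs_mult abs_esgn)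
qed

section \<open>Convergence of difference quotients\<close>

text \<open>The bracket after \<open>2 * (1 + M) ^ 3 / e\<close> is the Bregman distance of sqrt (1
  + x^2), non-negative by convexity. Where both numbers are at most \<open>M\<close> in modulus it
  dominates a multiple of the squared difference; elsewhere the p-th powers take over. All p > 1 are
  covered in the same way.\<close>

lemma bregman_bound:
 fixes a b :: real
 assumes p: "1 < p" and M: "0 < M" and e: "0 < e"
 shows "abs (b - a) <= e + 2 * (1 + M) ^ 3 / e * (sqrt (1 + b\<^sup>2) - sqrt (1 + a\<^sup>2) - a / sqrt (1 + a\<^sup>2) * (b - a))
  + 2 * M powr (1 - p) * (abs a powr p + abs b powr p)"
proof -
 let ?A = "sqrt (1 + a\<^sup>2)" and ?B = "sqrt (1 + b\<^sup>2)"
 let ?R = "?B - ?A - a / ?A * (b - a)"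
 have sq: "?A * ?A = 1 + a\<^sup>2" "?B * ?B = 1 + b\<^sup>2" by simp_all
 have pos: "1 <= ?A" "1 <= ?B" by simp_all
 have "(1 + a * b)\<^sup>2 <= (1 + a\<^sup>2) * (1 + b\<^sup>2)"
  using zero_le_power2[of "a - b"] by (simp add: power2_eq_square algebra_simps)
 hence "abs (1 + a * b) <= ?A * ?B" by (metis real_sqrt_abs real_sqrt_le_iff real_sqrt_mult)
 hence le: "1 + a * b <= ?A * ?B" "0 <= ?A * ?B + (1 + a * b)" by linarith+
 \<comment> \<open>The identity (AB)^2 - (1 + ab)^2 = (a - b)^2 for the two roots makes the
   convexity quantitative.\<close>
 have id: "(?A * ?B - (1 + a * b)) * (?A * ?B + (1 + a * b)) = (a - b)\<^sup>2"
 proof -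
  have "(?A * ?B - (1 + a * b)) * (?A * ?B + (1 + a * b)) = (?A * ?A) * (?B * ?B) - (1 + a * b)\<^sup>2"
   by (simp only: power2_eq_square) (simp only: algebra_simps)
  thus ?thesis unfolding sq by (simp add: power2_eq_square algebra_simps)
 qed
 have R: "?R * ?A = ?A * ?B - (1 + a * b)"
 proof -
  have gen: "A ~= 0 ==> x / A * y * A = x * y" for A x y :: real by simp
  have q: "?A ~= 0" using pos(1) by linarith
  have "?R * ?A = ?B * ?A - ?A * ?A - a / ?A * (b - a) * ?A" by (simp only: left_diff_distrib)
  also have "... = ?A * ?B - (1 + a * b)" unfolding gen[OF q] sq by (simp add: power2_eq_square algebra_simps)
  finally show ?thesis .
 qed
 have sgn: "0 <= x" if "0 <= x * A" "1 <= A" for x A :: real using that by (auto simp: zero_le_mult_iff)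
 have R0: "0 <= ?R" by (rule sgn[OF _ pos(1)], unfold R) (use le(1) in linarith)
 have key: "(b - a)\<^sup>2 <= 2 * ?A ^ 2 * ?B * ?R"
 proof -
  have "(b - a)\<^sup>2 = (?R * ?A) * (?A * ?B + (1 + a * b))" unfolding R id by (simp add: power2_commute)
  also have "... <= (?R * ?A) * (2 * (?A * ?B))" using le R0 pos by (intro mult_left_mono) auto
  finally show ?thesis by (simp only: power2_eq_square mult_ac)
 qed
 have nn: "0 <= 2 * M powr (1 - p) * (abs a powr p + abs b powr p)" by simp
 have nR: "0 <= 2 * (1 + M) ^ 3 / e * ?R" using R0 M e by simp
 show ?thesis
 proof (cases "abs a <= M & abs b <= M")
  case True
  have s: "sqrt (1 + x\<^sup>2) <= 1 + M" if "abs x <= M" for x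
  proof (rule real_le_lsqrt)
   have "x\<^sup>2 <= M\<^sup>2" using that M by (metis abs_le_square_iff abs_of_pos)
   thus "1 + x\<^sup>2 <= (1 + M)\<^sup>2" using M by (simp add: power2_eq_square algebra_simps)
  qed (use M in auto)
  have "2 * ?A ^ 2 * ?B <= 2 * (1 + M) ^ 2 * (1 + M)" using True s pos M by (intro mult_mono power_mono) auto
  hence "2 * ?A ^ 2 * ?B * ?R <= 2 * (1 + M) ^ 3 * ?R"
   using R0 by (intro mult_right_mono) (auto simp: power3_eq_cube power2_eq_square mult_ac)
  with key have k: "(b - a)\<^sup>2 <= 2 * (1 + M) ^ 3 * ?R" by linarith
  have "abs (b - a) * e <= e\<^sup>2 + (b - a)\<^sup>2"
  proof (cases "abs (b - a) <= e")
   case True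
   hence "abs (b - a) * e <= e * e" using e by (intro mult_right_mono) auto
   thus ?thesis using zero_le_power2[of "b - a"] unfolding power2_eq_square by linarith
  next
   case False
   hence "abs (b - a) * e <= abs (b - a) * abs (b - a)" by (intro mult_left_mono) auto
   also have "... = (b - a)\<^sup>2" by (simp add: power2_eq_square flip: abs_mult)
   finally show ?thesis using zero_le_power2[of e] by linarith
  qed
  hence "abs (b - a) <= e + (b - a)\<^sup>2 / e" using e by (simp add: field_simps power2_eq_square)
  also have "... <= e + 2 * (1 + M) ^ 3 * ?R / e" using k e by (intro add_left_mono divide_right_mono) auto
  also have "2 * (1 + M) ^ 3 * ?R / e = 2 * (1 + M) ^ 3 / e * ?R" by simp
  finally show ?thesis using nn by linarith
 next
  case False
  define m where "m = max \<bar>a\<bar> \<bar>b\<bar>"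
  have m: "M < m" "0 < m" "abs (b - a) <= 2 * m" using False M by (auto simp: m_def)
  have "m = m powr (1 - p) * m powr p" using m by (simp add: powr_add[symmetric])
  also have "... <= M powr (1 - p) * m powr p" using m M p by (intro mult_right_mono powr_mono2') auto
  also have "m powr p <= abs a powr p + abs b powr p" by (auto simp: m_def max_def)
  finally have "m <= M powr (1 - p) * (abs a powr p + abs b powr p)" by (simp add: mult_left_mono)
  thus ?thesis using m nR e by linarith
 qed
qed

text \<open>The oriented difference quotients as a step function. Vertices get the value 0 because
  several edges may meet there and the sum would count all of them; they form a null set.\<close>

definition gstep :: "(nat list => nat => real) => nat => real \<times> real => real" where
 "gstep d n x = (if x : V n then 0 else
  SUM e:earcs n. ind (edge (fst e) (snd e)) x * (esgn (fst e) (snd e) * 3 ^ n * d (fst e) (snd e)))"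

lemma gstep_edge: "x ~: V n ==> (w, i) : earcs n ==> x : edge w i ==> gstep d n x = esgn w i * 3 ^ n * d w i"
 unfolding gstep_def
 using sum_edge_indicator[of x n w i "%e. esgn (fst e) (snd e) * 3 ^ n * d (fst e) (snd e)"] by simp

lemma gstep_cases:
 obtains "gstep d n x = 0" | w i where "(w, i) : earcs n" "x ~: V n" "x : edge w i" "gstep d n x = esgn w i * 3 ^ n * d w i"
proof (cases "x ~: V n & (EX w i. (w, i) : earcs n & x : edge w i)")
 case True
 then obtain w i where "x ~: V n" "(w, i) : earcs n" "x : edge w i" by auto
 with that(2) gstep_edge show ?thesis by blast
next
 case False
 have "gstep d n x = 0"
 proof (cases "x : V n")
  case nV: False
  have "(SUM e:earcs n. ind (edge (fst e) (snd e)) x * (esgn (fst e) (snd e) * 3 ^ n * d (fst e) (snd e))) = 0"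
   using False nV by (intro sum.neutral) (auto simp: indicator_def)
  thus ?thesis by (simp add: gstep_def)
 qed (simp add: gstep_def)
 thus ?thesis by (rule that(1))
qed

lemma gstep_measurable [measurable]: "gstep d n : borel_measurable vnu"
proof -
 have ed: "edge (fst e) (snd e) : sets vnu" if "e : earcs n" for e using that by (cases e) simp
 have "(%x. SUM e:earcs n. ind (edge (fst e) (snd e)) x * (esgn (fst e) (snd e) * 3 ^ n * d (fst e) (snd e))) : borel_measurable vnu"
  by (rule borel_measurable_sum) (use ed in measurable)
 thus ?thesis unfolding gstep_def[abs_def] by measurable
qed

lemma gstep_bounded: obtains B where "0 <= B" "!!x. \<bar>gstep d n x\<bar> <= B"
proof
 show "0 <= (SUM e:earcs n. 3 ^ n * abs (d (fst e) (snd e)))" by (intro sum_nonneg) auto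
 show "abs (gstep d n x) <= (SUM e:earcs n. 3 ^ n * abs (d (fst e) (snd e)))" for x
 proof (rule gstep_cases[of d n x])
  assume "gstep d n x = 0" thus ?thesis by (auto intro!: sum_nonneg)
 next
  fix w i assume a: "(w, i) : earcs n" "gstep d n x = esgn w i * 3 ^ n * d w i"
  hence "abs (gstep d n x) = 3 ^ n * abs (d (fst (w, i)) (snd (w, i)))" by (simp add: abs_mult abs_esgn)
  also have "... <= (SUM e:earcs n. 3 ^ n * abs (d (fst e) (snd e)))" by (rule member_le_sum) (use a in auto)
  finally show ?thesis .
 qed
qed

section \<open>The martingale of difference quotients\<close>

lemma gstep_integrable: "(w, i) : earcs k ==> set_integrable vnu (edge w i) (gstep d n)"
 by (rule gstep_bounded[of d n], rule edge_integrable_bounded[of w i k]) (auto simp del: split_paired_All)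

text \<open>The integral over a coarse edge does not change with the level: this is the martingale
  property for the partitions into edges.\<close>

lemma gstep_integral:
 assumes d: "consistent d" shows "(w, i) : earcs k ==> k <= n ==> (LINT x:edge w i|vnu. gstep d n x) = esgn w i * d w i"
proof (rule edge_induct[where P="%w i. (LINT x:edge w i|vnu. gstep d n x) = esgn w i * d w i" and n=n])
 fix w i assume e: "(w, i) : earcs n"
 have "(LINT x:edge w i|vnu. gstep d n x) = (LINT x:edge w i|vnu. esgn w i * 3 ^ n * d w i)"
  by (rule set_lebesgue_integral_cong_AE) (use e AE_not_V[of n] in \<open>auto elim!: eventually_mono simp: gstep_edge\<close>)
 also have "... = esgn w i * d w i" using edge_integral_const[OF e, of "esgn w i * 3 ^ n * d w i"] by simp
 finally show "(LINT x:edge w i|vnu. gstep d n x) = esgn w i * d w i" .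
next
 fix k w i assume e: "(w, i) : earcs k" and IH: "(LINT x:edge (w @ [5]) i|vnu. gstep d n x) = esgn (w @ [5]) i * d (w @ [5]) i"
  "(LINT x:edge (w @ [i]) (opp i)|vnu. gstep d n x) = esgn (w @ [i]) (opp i) * d (w @ [i]) (opp i)"
  "(LINT x:edge (w @ [i]) i|vnu. gstep d n x) = esgn (w @ [i]) i * d (w @ [i]) i"
 have "d w i = d (w @ [5]) i - d (w @ [i]) (opp i) + d (w @ [i]) i" using d e unfolding consistent_def by blast
 hence m: "esgn w i * d w i = esgn w i * (d (w @ [5]) i - d (w @ [i]) (opp i) + d (w @ [i]) i)" by (rule arg_cong)
 have "i : {1..4}" "w : words k" using e by (auto simp: earcs_iff)
 thus "(LINT x:edge w i|vnu. gstep d n x) = esgn w i * d w i"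
  unfolding edge_split_integral[OF e gstep_integrable[OF e]] IH m by (simp add: esgn_split algebra_simps)
qed auto

text \<open>On an edge of level \<open>n\<close> the first factor is constant almost everywhere and
  the second has mean zero; coarser edges are unions of these.\<close>

lemma gstep_orthogonal:
 assumes d: "consistent d" and nm: "n <= m" and psi: "continuous_on UNIV (h :: real => real)" and B: "!!x. \<bar>h x\<bar> <= B"
 shows "(w, i) : earcs k ==> k <= n ==> (LINT x:edge w i|vnu. h (gstep d n x) * (gstep d m x - gstep d n x)) = 0"
proof (rule edge_induct[where P="%w i. (LINT x:edge w i|vnu. h (gstep d n x) * (gstep d m x - gstep d n x)) = 0" and n=n])
 have [measurable]: "h : borel_measurable borel" using psi by (rule borel_measurable_continuous_onI)
 have si: "set_integrable vnu (edge w i) (%x. h (gstep d n x) * (gstep d m x - gstep d n x))" if "(w, i) : earcs k" for w i k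
 proof -
  obtain B1 where B1: "0 <= B1" "!!x. \<bar>gstep d n x\<bar> <= B1" using gstep_bounded[of d n] by blast
  obtain B2 where B2: "0 <= B2" "!!x. \<bar>gstep d m x\<bar> <= B2" using gstep_bounded[of d m] by blast
  have "abs (h (gstep d n x) * (gstep d m x - gstep d n x)) <= B * (B2 + B1)" for x
   unfolding abs_mult by (intro mult_mono B order_trans[OF abs_triangle_ineq4] add_mono B1 B2) (use order_trans[OF _ B[of 0]] in auto)
  thus ?thesis by (intro edge_integrable_bounded[OF that]) auto
 qed
 {
  fix w i assume e: "(w, i) : earcs n"
  let ?v = "esgn w i * 3 ^ n * d w i"
  have "(LINT x:edge w i|vnu. h (gstep d n x) * (gstep d m x - gstep d n x)) = (LINT x:edge w i|vnu. h ?v * (gstep d m x - gstep d n x))"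
   by (rule set_lebesgue_integral_cong_AE) (use e AE_not_V[of n] in \<open>auto elim!: eventually_mono simp: gstep_edge\<close>)
  also have "... = h ?v * (LINT x:edge w i|vnu. gstep d m x - gstep d n x)" by simp
  also have "(LINT x:edge w i|vnu. gstep d m x - gstep d n x) = 0"
   using gstep_integral[OF d e nm] gstep_integral[OF d e, of n] gstep_integrable[OF e] by (simp add: set_integral_diff(2))
  finally show "(LINT x:edge w i|vnu. h (gstep d n x) * (gstep d m x - gstep d n x)) = 0" by simp
 next
  fix k w i assume e: "(w, i) : earcs k" and IH: "(LINT x:edge (w @ [5]) i|vnu. h (gstep d n x) * (gstep d m x - gstep d n x)) = 0"
   "(LINT x:edge (w @ [i]) (opp i)|vnu. h (gstep d n x) * (gstep d m x - gstep d n x)) = 0"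
   "(LINT x:edge (w @ [i]) i|vnu. h (gstep d n x) * (gstep d m x - gstep d n x)) = 0"
  thus "(LINT x:edge w i|vnu. h (gstep d n x) * (gstep d m x - gstep d n x)) = 0"
   unfolding edge_split_integral[OF e si[OF e]] by simp
 }
qed auto

text \<open>The integrals of sqrt (1 + x^2) along the martingale increase and are bounded, hence
  converge. After integration of \<open>bregman_bound\<close> the linear term drops out by
  orthogonality, and the increments of these integrals control the L^1 distance once
  \<open>M\<close> and \<open>r\<close> are fixed.\<close>

lemma gstep_Cauchy:
 assumes d: "consistent d" and p: "1 < p" and e: "(w, i) : earcs k"
  and B: "!!n. k <= n ==> (LINT x:edge w i|vnu. \<bar>gstep d n x\<bar> powr p) <= B" and eps: "0 < eps"
 obtains N where "k <= N" "!!m n. N <= n ==> n <= m ==> (LINT x:edge w i|vnu. \<bar>gstep d m x - gstep d n x\<bar>) <= eps"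
proof -
 let ?I = "%h :: real \<times> real => real. LINT x:edge w i|vnu. h x"
 have [measurable]: "edge w i : sets vnu" using e by simp
 \<comment> \<open>All integrands are continuous functions of two bounded step functions, hence
   bounded and integrable over an edge.\<close>
 have si: "set_integrable vnu (edge w i) (%x. h (gstep d n x) (gstep d m x))"
  if h: "continuous_on ({- C..C} \<times> {- C..C}) (%(a, b). h a b)" "!!x. \<bar>gstep d n x\<bar> <= C" "!!x. \<bar>gstep d m x\<bar> <= C"
   "(%x. h (gstep d n x) (gstep d m x)) : borel_measurable vnu" for h :: "real => real => real" and n m C
 proof -
  have "bounded ((%(a, b). h a b) ` ({- C..C} \<times> {- C..C}))"
   by (rule compact_imp_bounded, rule compact_continuous_image[OF h(1)]) (simp add: compact_Times)
  then obtain D where D: "ALL y:(%(a, b). h a b) ` ({- C..C} \<times> {- C..C}). \<bar>y\<bar> <= D" unfolding bounded_iff by auto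
  show ?thesis
  proof (rule edge_integrable_bounded[OF e h(4)])
   fix x
   have "(gstep d n x, gstep d m x) : {- C..C} \<times> {- C..C}" using h(2,3)[of x] by (auto simp: abs_le_iff)
   thus "abs (h (gstep d n x) (gstep d m x)) <= D" using D by force
  qed
 qed
 have si': "set_integrable vnu (edge w i) (%x. h (gstep d n x) (gstep d m x))"
  if h: "continuous_on UNIV (%(a, b). h a b)" "(%x. h (gstep d n x) (gstep d m x)) : borel_measurable vnu" for h :: "real => real => real" and n m
 proof -
  obtain B1 where B1: "0 <= B1" "!!x. \<bar>gstep d n x\<bar> <= B1" using gstep_bounded[of d n] by blast
  obtain B2 where B2: "0 <= B2" "!!x. \<bar>gstep d m x\<bar> <= B2" using gstep_bounded[of d m] by blast
  show ?thesis
   by (rule si[where C="max B1 B2"]) (use h B1 B2 in \<open>auto intro: continuous_on_subset simp: le_max_iff_disj\<close>)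
 qed
 define \<Phi> where "\<Phi> x = sqrt (1 + x\<^sup>2)" for x :: real
 define \<phi> where "\<phi> x = x / sqrt (1 + x\<^sup>2)" for x :: real
 have ne: "sqrt (1 + x\<^sup>2) ~= 0" for x :: real using add_pos_nonneg[OF zero_less_one zero_le_power2[of x]] by simp
 have cont: "continuous_on UNIV \<Phi>" "continuous_on UNIV \<phi>"
  unfolding \<Phi>_def \<phi>_def using ne by (auto intro!: continuous_intros)
 have [measurable]: "\<Phi> : borel_measurable borel" "\<phi> : borel_measurable borel"
  using cont by (auto intro: borel_measurable_continuous_onI)
 have \<phi>1: "abs (\<phi> x) <= 1" for x
 proof -
  have "abs x <= sqrt (1 + x\<^sup>2)" by (rule real_le_rsqrt) simp
  moreover have "0 < sqrt (1 + x\<^sup>2)" by (simp add: add_pos_nonneg)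
  ultimately show ?thesis unfolding \<phi>_def by (simp only: abs_divide abs_of_pos divide_le_eq_1_pos)
 qed
 have \<Phi>i: "set_integrable vnu (edge w i) (%x. \<Phi> (gstep d n x))" for n
  by (rule si'[of "%a b. \<Phi> a" n n]) (auto simp: case_prod_beta' intro!: continuous_on_compose2[OF cont(1)] continuous_intros)
 have pi: "set_integrable vnu (edge w i) (%x. \<bar>gstep d n x\<bar> powr p)" for n
 proof (rule si'[of "%a b. \<bar>a\<bar> powr p" n n])
  show "continuous_on UNIV (%(a, b). \<bar>a :: real\<bar> powr p)"
   unfolding case_prod_beta' by (rule continuous_on_powr') (use p in \<open>auto intro!: continuous_intros\<close>)
 qed auto
 have gi: "set_integrable vnu (edge w i) (%x. \<phi> (gstep d n x) * (gstep d m x - gstep d n x))" for n m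
  by (rule si'[of "%a b. \<phi> a * (b - a)" n m])
   (auto simp: case_prod_beta' intro!: continuous_on_compose2[OF cont(2)] continuous_intros)
 have ai: "set_integrable vnu (edge w i) (%x. \<bar>gstep d m x - gstep d n x\<bar>)" for n m
  by (rule si'[of "%a b. \<bar>b - a\<bar>" n m]) (auto simp: case_prod_beta' intro!: continuous_intros)
 have ci: "set_integrable vnu (edge w i) (%_. c :: real)" for c
  by (rule edge_integrable_bounded[OF e, where B="abs c"]) auto
 define A where "A n = ?I (%x. \<Phi> (gstep d n x))" for n
 have orth: "?I (%x. \<phi> (gstep d n x) * (gstep d m x - gstep d n x)) = 0" if "n <= m" "k <= n" for n m
  by (rule gstep_orthogonal[OF d that(1) cont(2) \<phi>1 e that(2)])
 have main: "?I (%x. \<bar>gstep d m x - gstep d n x\<bar>) <= r / 3 ^ k + 2 * (1 + M) ^ 3 / r * (A m - A n) + 2 * M powr (1 - p) * (2 * B)"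
  if nm: "n <= m" "k <= n" and M: "0 < M" and r: "0 < r" for n m M r
 proof -
  let ?c = "2 * (1 + M) ^ 3 / r" and ?b = "2 * M powr (1 - p)"
  have "?I (%x. \<bar>gstep d m x - gstep d n x\<bar>) <= ?I (%x. r + ?c * (\<Phi> (gstep d m x) - \<Phi> (gstep d n x) - \<phi> (gstep d n x) * (gstep d m x - gstep d n x))
   + ?b * (abs (gstep d n x) powr p + abs (gstep d m x) powr p))" unfolding \<Phi>_def \<phi>_def
   by (rule set_integral_mono, rule ai, (intro set_integral_add set_integrable_mult_right set_integral_diff ci
    \<Phi>i[unfolded \<Phi>_def] gi[unfolded \<phi>_def] pi), rule bregman_bound[OF p M r])
  also have "... = ?I (%x. r) + ?c * (A m - A n - 0) + ?b * (?I (%x. \<bar>gstep d n x\<bar> powr p) + ?I (%x. \<bar>gstep d m x\<bar> powr p))"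
   using orth[OF nm] by (simp add: set_integral_add set_integral_diff ci \<Phi>i gi pi A_def)
  also have "... <= r / 3 ^ k + ?c * (A m - A n) + ?b * (2 * B)"
  proof -
   have "?b * (?I (%x. \<bar>gstep d n x\<bar> powr p) + ?I (%x. \<bar>gstep d m x\<bar> powr p)) <= ?b * (2 * B)"
    using B[of n] B[of m] nm by (intro mult_left_mono) auto
   thus ?thesis using edge_integral_const[OF e, of r] by simp
  qed
  finally show ?thesis .
 qed
 have mono: "A n <= A m" if "n <= m" "k <= n" for n m
 proof -
  have "?I (%x. \<phi> (gstep d n x) * (gstep d m x - gstep d n x)) <= ?I (%x. \<Phi> (gstep d m x) - \<Phi> (gstep d n x))"
  proof (rule set_integral_mono[OF gi set_integral_diff(1)[OF \<Phi>i \<Phi>i]])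
   fix x
   let ?a = "gstep d n x" and ?b = "gstep d m x"
   have "(1 + ?a * ?b)\<^sup>2 <= (1 + ?a\<^sup>2) * (1 + ?b\<^sup>2)"
    using zero_le_power2[of "?a - ?b"] by (simp add: power2_eq_square algebra_simps)
   hence "abs (1 + ?a * ?b) <= \<Phi> ?a * \<Phi> ?b" unfolding \<Phi>_def by (metis real_sqrt_abs real_sqrt_le_iff real_sqrt_mult)
   moreover have "\<Phi> ?a * \<Phi> ?a = 1 + ?a\<^sup>2" "0 < \<Phi> ?a" by (simp_all add: \<Phi>_def add_pos_nonneg)
   ultimately show "\<phi> ?a * (?b - ?a) <= \<Phi> ?b - \<Phi> ?a"
    unfolding \<phi>_def \<Phi>_def[symmetric] by (simp add: field_simps power2_eq_square)
  qed
  thus ?thesis using orth[OF that] by (simp add: set_integral_diff \<Phi>i A_def)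
 qed
 have bdd: "A n <= 2 / 3 ^ k + B" if "k <= n" for n
 proof -
  have "A n <= ?I (%x. 2 + abs (gstep d n x) powr p)" unfolding A_def
  proof (rule set_integral_mono[OF \<Phi>i set_integral_add(1)[OF ci pi]])
   fix x
   let ?a = "abs (gstep d n x)"
   have "\<Phi> ?a <= 1 + ?a" unfolding \<Phi>_def by (rule real_le_lsqrt) (auto simp: power2_eq_square algebra_simps)
   also have "?a <= 1 + ?a powr p"
   proof (cases "?a <= 1")
    case False
    hence "?a powr 1 <= ?a powr p" using p by (intro powr_mono) auto
    thus ?thesis using False by simp
   qed (use powr_ge_zero[of ?a p] in linarith)
   finally show "\<Phi> (gstep d n x) <= 2 + ?a powr p" by (simp add: \<Phi>_def)
  qed
  also have "... = 2 / 3 ^ k + ?I (%x. \<bar>gstep d n x\<bar> powr p)"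
   using edge_integral_const[OF e, of 2] by (simp add: set_integral_add ci pi)
  finally show ?thesis using B[OF that] by simp
 qed
 have B0: "0 <= B"
 proof -
  have "0 <= ?I (%x. \<bar>gstep d k x\<bar> powr p)" unfolding set_lebesgue_integral_def by (rule integral_nonneg_AE) auto
  thus ?thesis using B[of k] by simp
 qed
 obtain M where M: "0 < M" "2 * M powr (1 - p) * (2 * B) <= eps / 3"
 proof -
  \<comment> \<open>Chosen so that 4 t B <= eps / 3; the power 1/(1-p) solves M^(1-p) = t, and B + 1
    avoids a zero denominator.\<close>
  let ?t = "eps / (12 * (B + 1))"
  have t: "0 < ?t" using eps B0 by simp
  show thesis
  proof (rule that)
   show "0 < ?t powr (1 / (1 - p))" unfolding powr_gt_zero by (rule less_imp_neq[OF t, symmetric])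
   have "(x powr (1 / (1 - p))) powr (1 - p) = x" if "0 < x" for x :: real using that p by (simp add: powr_powr)
   from this[OF t] have "(?t powr (1 / (1 - p))) powr (1 - p) = ?t" .
   moreover have "2 * ?t * (2 * B) <= eps / 3" using eps B0 by (simp add: field_simps)
   ultimately show "2 * (?t powr (1 / (1 - p))) powr (1 - p) * (2 * B) <= eps / 3" by simp
  qed
 qed
 define r where "r = eps / 3"
 have r: "0 < r" "r / 3 ^ k <= eps / 3" using eps by (auto simp: r_def divide_le_eq)
 define c where "c = 2 * (1 + M) ^ 3 / r"
 have c: "0 < c" using M r by (simp add: c_def)
 have "convergent (%j. A (k + j))"
 proof (rule Bseq_mono_convergent)
  show "Bseq (%j. A (k + j))"
  proof (rule BseqI'[where K="abs (A k) + abs (2 / 3 ^ k + B)"])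
   fix j
   have "A k <= A (k + j)" "A (k + j) <= 2 / 3 ^ k + B" by (rule mono bdd; simp)+
   thus "norm (A (k + j)) <= abs (A k) + abs (2 / 3 ^ k + B)" unfolding real_norm_def by arith
  qed
  show "ALL m n. m <= n --> A (k + m) <= A (k + n)" using mono by auto
 qed
 hence "Cauchy (%j. A (k + j))" by (rule convergent_Cauchy)
 moreover have "0 < eps / (3 * c)" using eps c by simp
 ultimately obtain N where N: "\<forall>m\<ge>N. \<forall>n\<ge>N. dist (A (k + m)) (A (k + n)) < eps / (3 * c)" unfolding Cauchy_def by blast
 show thesis
 proof (rule that[of "k + N"])
  fix m n assume mn: "k + N <= n" "n <= m"
  have "dist (A (k + (m - k))) (A (k + (n - k))) < eps / (3 * c)" using mn by (intro N[rule_format]) auto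
  hence "A m - A n < eps / (3 * c)" using mn by (simp add: dist_real_def)
  hence "c * (A m - A n) <= eps / 3" using c by (simp add: field_simps)
  thus "?I (%x. \<bar>gstep d m x - gstep d n x\<bar>) <= eps"
   using main[OF mn(2) _ M(1) r(1), folded c_def] mn(1) M(2) r(2) by linarith
 qed simp
qed

text \<open>For each \<open>j\<close> one index serves the finitely many edges of levels up to
  \<open>j\<close>, so a single subsequence converges in L^1 on every edge at a geometric rate.
  Summable increments give convergence almost everywhere, and the edge integrals pass to the
  limit.\<close>

lemma gradient_exists:
 assumes d: "consistent d" and p: "1 < p"
  and loc: "!!k w i. (w, i) : earcs k ==> EX B. \<forall>n\<ge>k. (LINT x:edge w i|vnu. \<bar>gstep d n x\<bar> powr p) <= B"
 shows "EX s g. g : borel_measurable vnu & (AE x in vnu. (%j. gstep d (s j) x) \<longlonglongrightarrow> g x) \<and>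
  (ALL n w i. (w, i) : earcs n --> set_integrable vnu (edge w i) g & (LINT x:edge w i|vnu. g x) = esgn w i * d w i)"
proof -
 have "EX N. ALL e:(\<Union>k\<le>j. earcs k). ALL m n. N <= n --> n <= m -->
   (LINT x:edge (fst e) (snd e)|vnu. \<bar>gstep d m x - gstep d n x\<bar>) <= (1/2) ^ j" for j
 proof -
  have "ALL e:(\<Union>k\<le>j. earcs k). EX N. ALL m n. N <= n --> n <= m -->
   (LINT x:edge (fst e) (snd e)|vnu. \<bar>gstep d m x - gstep d n x\<bar>) <= (1/2) ^ j"
  proof
   fix e assume "e : (\<Union>k\<le>j. earcs k)"
   then obtain k where "e : earcs k" by auto
   hence e: "(fst e, snd e) : earcs k" by simp
   obtain B where B: "!!n. k <= n ==> (LINT x:edge (fst e) (snd e)|vnu. \<bar>gstep d n x\<bar> powr p) <= B" using loc[OF e] by auto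
   have pos: "0 < (1/2 :: real) ^ j" by simp
   show "EX N. ALL m n. N <= n --> n <= m --> (LINT x:edge (fst e) (snd e)|vnu. \<bar>gstep d m x - gstep d n x\<bar>) <= (1/2) ^ j"
   proof (rule gstep_Cauchy[OF d p e _ pos])
    fix n assume "k <= n"
    thus "(LINT x:edge (fst e) (snd e)|vnu. \<bar>gstep d n x\<bar> powr p) <= B" by (rule B)
   next
    fix N assume N: "!!m n. N <= n ==> n <= m ==> (LINT x:edge (fst e) (snd e)|vnu. \<bar>gstep d m x - gstep d n x\<bar>) <= (1/2) ^ j"
    show ?thesis by (intro exI[of _ N] allI impI N)
   qed
  qed
  then obtain N where N: "ALL e:(\<Union>k\<le>j. earcs k). ALL m n. N e <= n --> n <= m -->
   (LINT x:edge (fst e) (snd e)|vnu. \<bar>gstep d m x - gstep d n x\<bar>) <= (1/2) ^ j" by (rule bchoice[THEN exE])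
  have fin: "finite (\<Union>k\<le>j. earcs k)" by simp
  show ?thesis
  proof (intro exI[of _ "SUM e:(\<Union>k\<le>j. earcs k). N e"] ballI allI impI)
   fix e m n assume e: "e : (\<Union>k\<le>j. earcs k)" and n: "(SUM e:(\<Union>k\<le>j. earcs k). N e) <= n" "n <= m"
   have "N e <= (SUM e:(\<Union>k\<le>j. earcs k). N e)" by (rule member_le_sum[OF e _ fin]) simp
   thus "(LINT x:edge (fst e) (snd e)|vnu. \<bar>gstep d m x - gstep d n x\<bar>) <= (1/2) ^ j"
    using N e n by (meson order_trans)
  qed
 qed
 hence "ALL j. EX N. ALL e:(\<Union>k\<le>j. earcs k). ALL m n. N <= n --> n <= m -->
   (LINT x:edge (fst e) (snd e)|vnu. \<bar>gstep d m x - gstep d n x\<bar>) <= (1/2) ^ j" by (rule allI)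
 then obtain N where N0: "ALL j. ALL e:(\<Union>k\<le>j. earcs k). ALL m n. N j <= n --> n <= m -->
   (LINT x:edge (fst e) (snd e)|vnu. \<bar>gstep d m x - gstep d n x\<bar>) <= (1/2) ^ j" by (rule choice[THEN exE])
 have N: "(LINT x:edge (fst e) (snd e)|vnu. \<bar>gstep d m x - gstep d n x\<bar>) <= (1/2) ^ j"
  if "e : (\<Union>k\<le>j. earcs k)" "N j <= n" "n <= m" for j e m n using N0[rule_format, of e j n m] that by simp
 \<comment> \<open>Partial sums make the indices monotone, and the added \<open>j\<close> ensures
   that the level \<open>s j\<close> is at least \<open>j\<close>, as \<open>gstep_integral\<close>
   requires.\<close>
 define s where "s j = (\<Sum>i\<le>j. N i) + j" for j
 have sN: "N j <= s j" "j <= s j" "s j <= s (Suc j)" for j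
 proof -
  have "N j <= (\<Sum>i\<le>j. N i)" by (rule member_le_sum) auto
  thus "N j <= s j" by (simp add: s_def)
  show "j <= s j" "s j <= s (Suc j)" by (simp_all add: s_def)
 qed
 define D where "D j x = abs (gstep d (s (Suc j)) x - gstep d (s j) x)" for j x
 have [measurable]: "D j : borel_measurable vnu" for j unfolding D_def[abs_def] by measurable
 have Dint: "(\<integral>\<^sup>+x. ennreal (D j x) * ind (edge w i) x \<partial>vnu) <= ennreal ((1/2) ^ j)" if e: "(w, i) : earcs k" "k <= j" for w i k j
 proof -
  have si: "set_integrable vnu (edge w i) (D j)"
   unfolding D_def[abs_def] using gstep_integrable[OF e(1)] by (intro set_integrable_abs set_integral_diff(1))
  have "(\<integral>\<^sup>+x. ennreal (D j x) * ind (edge w i) x \<partial>vnu) = (\<integral>\<^sup>+x. ennreal (ind (edge w i) x *\<^sub>R D j x) \<partial>vnu)"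
   by (rule nn_integral_cong) (simp add: indicator_def)
  also have "... = ennreal (LINT x:edge w i|vnu. D j x)" unfolding set_lebesgue_integral_def
   by (rule nn_integral_eq_integral[OF si[unfolded set_integrable_def]]) (simp add: D_def)
  also have "... <= ennreal ((1/2) ^ j)"
   unfolding D_def using N[of "(w, i)" j "s j" "s (Suc j)"] e sN by (intro ennreal_leI) auto
  finally show ?thesis .
 qed
 have summ: "AE x in vnu. summable (%j. D j x)"
 proof (rule AE_edges)
  fix k w i assume e: "(w, i) : earcs k"
  note [measurable] = edge_vnu[OF e]
  \<comment> \<open>On an edge of level \<open>k\<close> only the increments from index
    \<open>k\<close> on are controlled, hence the shift.\<close>
  have "(\<integral>\<^sup>+x. (\<Sum>j. ennreal (D (j + k) x) * ind (edge w i) x) \<partial>vnu) = (\<Sum>j. \<integral>\<^sup>+x. ennreal (D (j + k) x) * ind (edge w i) x \<partial>vnu)"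
   by (rule nn_integral_suminf) measurable
  also have "... <= (\<Sum>j. ennreal ((1/2) ^ (j + k)))" by (intro suminf_le Dint[OF e] allI) auto
  also have "... <= (\<Sum>j. ennreal ((1/2) ^ j))" by (intro suminf_le allI) (auto intro!: ennreal_leI power_decreasing)
  also have "... = ennreal (\<Sum>j. (1/2) ^ j)" by (rule suminf_ennreal2) (auto intro!: summable_geometric)
  also have "... < \<infinity>" by simp
  finally have "(\<integral>\<^sup>+x. (\<Sum>j. ennreal (D (j + k) x) * ind (edge w i) x) \<partial>vnu) ~= \<infinity>" by simp
  hence "AE x in vnu. (\<Sum>j. ennreal (D (j + k) x) * ind (edge w i) x) ~= \<infinity>" by (intro nn_integral_noteq_infinite) measurable
  thus "AE x\<in>edge w i in vnu. summable (%j. D j x)"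
  proof eventually_elim
   case (elim x)
   show ?case
   proof
    assume x: "x : edge w i"
    hence "(\<Sum>j. ennreal (D (j + k) x)) ~= \<top>" using elim by simp
    hence "summable (%j. D (j + k) x)" by (rule summable_suminf_not_top[rotated]) (simp add: D_def)
    thus "summable (%j. D j x)" using summable_iff_shift[of "%j. D j x" k] by simp
   qed
  qed
 qed
 define g where "g x = lim (%j. gstep d (s j) x)" for x
 have gm [measurable]: "g : borel_measurable vnu" unfolding g_def[abs_def] by (rule borel_measurable_lim_metric) simp
 have lim: "AE x in vnu. (%j. gstep d (s j) x) \<longlonglongrightarrow> g x" using summ
 proof eventually_elim
  case (elim x)
  have "summable (%j. gstep d (s (Suc j)) x - gstep d (s j) x)"
   by (rule summable_rabs_cancel) (use elim in \<open>simp add: D_def\<close>)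
  hence "(%n. \<Sum>j<n. gstep d (s (Suc j)) x - gstep d (s j) x) \<longlonglongrightarrow> (\<Sum>j. gstep d (s (Suc j)) x - gstep d (s j) x)"
   by (rule summable_LIMSEQ)
  from tendsto_add[OF this[unfolded sum_lessThan_telescope[of "%j. gstep d (s j) x"]] tendsto_const]
  have "(%n. (gstep d (s n) x - gstep d (s 0) x) + gstep d (s 0) x) \<longlonglongrightarrow> (\<Sum>j. gstep d (s (Suc j)) x - gstep d (s j) x) + gstep d (s 0) x"
   .
  hence "convergent (%n. gstep d (s n) x)" by (auto simp: convergent_def)
  thus ?case unfolding g_def by (simp add: convergent_LIMSEQ_iff)
 qed
 have edge: "set_integrable vnu (edge w i) g & (LINT x:edge w i|vnu. g x) = esgn w i * d w i" if e: "(w, i) : earcs k" for k w i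
 proof -
  note [measurable] = edge_vnu[OF e]
  have close: "(\<integral>\<^sup>+x. ennreal \<bar>g x - gstep d (s j) x\<bar> * ind (edge w i) x \<partial>vnu) <= ennreal (2 * (1/2) ^ j)" if j: "k <= j" for j
  proof -
   have "(\<integral>\<^sup>+x. ennreal \<bar>g x - gstep d (s j) x\<bar> * ind (edge w i) x \<partial>vnu) <= (\<integral>\<^sup>+x. (\<Sum>r. ennreal (D (r + j) x) * ind (edge w i) x) \<partial>vnu)"
   proof (rule nn_integral_mono_AE, use lim summ in eventually_elim)
    fix x assume l: "(%j. gstep d (s j) x) \<longlonglongrightarrow> g x" and su: "summable (%j. D j x)"
    have sj: "summable (%r. D (r + j) x)" using su by (simp add: summable_iff_shift[of "%j. D j x" j])
    have "abs (gstep d (s (n + j)) x - gstep d (s j) x) <= (\<Sum>r. D (r + j) x)" for n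
    proof -
     have "gstep d (s (n + j)) x - gstep d (s j) x = (\<Sum>r<n. gstep d (s (Suc r + j)) x - gstep d (s (r + j)) x)"
      using sum_lessThan_telescope[of "%r. gstep d (s (r + j)) x" n] by simp
     also have "abs (...) <= (\<Sum>r<n. D (r + j) x)" unfolding D_def by (rule order_trans[OF sum_abs]) simp
     also have "... <= (\<Sum>r. D (r + j) x)" by (rule sum_le_suminf[OF sj]) (auto simp: D_def)
     finally show ?thesis .
    qed
    moreover have "(%n. \<bar>gstep d (s (n + j)) x - gstep d (s j) x\<bar>) \<longlonglongrightarrow> \<bar>g x - gstep d (s j) x\<bar>"
     by (intro tendsto_intros LIMSEQ_ignore_initial_segment l)
    ultimately have "abs (g x - gstep d (s j) x) <= (\<Sum>r. D (r + j) x)" by (intro LIMSEQ_le_const2) auto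
    hence "ennreal \<bar>g x - gstep d (s j) x\<bar> <= (\<Sum>r. ennreal (D (r + j) x))"
     by (subst suminf_ennreal2[OF _ sj]) (auto simp: D_def intro!: ennreal_leI)
    thus "ennreal \<bar>g x - gstep d (s j) x\<bar> * ind (edge w i) x <= (\<Sum>r. ennreal (D (r + j) x) * ind (edge w i) x)"
     by (auto simp: indicator_def)
   qed
   also have "... = (\<Sum>r. \<integral>\<^sup>+x. ennreal (D (r + j) x) * ind (edge w i) x \<partial>vnu)" by (rule nn_integral_suminf) measurable
   also have "... <= (\<Sum>r. ennreal ((1/2) ^ (r + j)))" by (intro suminf_le Dint[OF e] allI) (use j in auto)
   also have "... = ennreal (\<Sum>r. (1/2) ^ (r + j))"
   proof (rule suminf_ennreal2)
    show "summable (%r. (1/2 :: real) ^ (r + j))" by (subst summable_iff_shift) (rule summable_geometric, simp)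
   qed simp
   also have "(\<Sum>r. (1/2 :: real) ^ (r + j)) = 2 * (1/2) ^ j"
   proof -
    have sg: "summable (%r. (1/2 :: real) ^ r)" by (rule summable_geometric) simp
    have "(\<Sum>r. (1/2 :: real) ^ r) = 2" using suminf_geometric[of "1/2 :: real"] by simp
    thus ?thesis unfolding power_add using suminf_mult2[OF sg, of "(1/2) ^ j"] by simp
   qed
   finally show ?thesis .
  qed
  have di: "set_integrable vnu (edge w i) (%x. g x - gstep d (s j) x)"
   and db: "abs (LINT x:edge w i|vnu. g x - gstep d (s j) x) <= 2 * (1/2) ^ j" if j: "k <= j" for j
  proof -
   have eq: "(\<integral>\<^sup>+x. ennreal (norm (ind (edge w i) x *\<^sub>R (g x - gstep d (s j) x))) \<partial>vnu)
    = (\<integral>\<^sup>+x. ennreal \<bar>g x - gstep d (s j) x\<bar> * ind (edge w i) x \<partial>vnu)"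
    by (rule nn_integral_cong) (simp add: indicator_def)
   show di: "set_integrable vnu (edge w i) (%x. g x - gstep d (s j) x)"
    unfolding set_integrable_def integrable_iff_bounded eq infinity_ennreal_def
    by (rule conjI, measurable, rule le_less_trans[OF close[OF j] ennreal_less_top])
   have "ennreal (norm (LINT x:edge w i|vnu. g x - gstep d (s j) x)) <= ennreal (2 * (1/2) ^ j)"
    using order_trans[OF integral_norm_bound_ennreal[OF di[unfolded set_integrable_def]] close[OF j, folded eq]]
    unfolding set_lebesgue_integral_def .
   thus "abs (LINT x:edge w i|vnu. g x - gstep d (s j) x) <= 2 * (1/2) ^ j" by (subst (asm) ennreal_le_iff) auto
  qed
  have gi: "set_integrable vnu (edge w i) g"
   using set_integral_add(1)[OF di[of k] gstep_integrable[OF e, of d "s k"]] by simp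
  have b: "abs ((LINT x:edge w i|vnu. g x) - esgn w i * d w i) <= 2 * (1/2) ^ j" if j: "k <= j" for j
   using db[OF j] gstep_integral[OF d e, of "s j"] order_trans[OF j sN(2)]
   by (simp add: set_integral_diff(2)[OF gi gstep_integrable[OF e]])
  have "abs ((LINT x:edge w i|vnu. g x) - esgn w i * d w i) <= 0"
  proof (rule LIMSEQ_le_const)
   have "(%j. (1/2 :: real) ^ j) \<longlonglongrightarrow> 0" by (rule LIMSEQ_power_zero) simp
   from tendsto_mult_right_zero[OF this, of 2] show "(%j. 2 * (1/2 :: real) ^ j) \<longlonglongrightarrow> 0" .
   show "EX N. \<forall>n\<ge>N. \<bar>(LINT x:edge w i|vnu. g x) - esgn w i * d w i\<bar> <= 2 * (1/2) ^ n" using b by auto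
  qed
  thus ?thesis using gi by simp
 qed
 have ed: "ALL n w i. (w, i) : earcs n --> set_integrable vnu (edge w i) g & (LINT x:edge w i|vnu. g x) = esgn w i * d w i"
  by (intro allI impI) (rule edge)
 show ?thesis by (rule exI[of _ s], rule exI[of _ g]) (intro conjI gm lim ed)
qed

section \<open>Gradients of functions of finite energy and of Lipschitz functions\<close>

lemma lgradI:
 assumes "g : borel_measurable vnu"
  and "!!n w i. (w, i) : earcs n ==> set_integrable vnu (edge w i) g & (LINT x:edge w i|vnu. g x) = esgn w i * incr f w i"
 shows "lgrad f g" unfolding lgrad_def
proof (intro conjI allI impI)
 fix n w i assume "(w, i) : earcs n"
 from assms(2)[OF this] show "set_integrable vnu (edge w i) g" "incr f w i = esgn w i * (LINT x:edge w i|vnu. g x)"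
  by (simp_all add: esgn_def)
qed (rule assms(1))

lemma gstep_energy:
 assumes p: "1 < p" shows "(\<integral>\<^sup>+x. ennreal (abs (gstep d n x) powr p) \<partial>vnu) <= ennreal (energy p d n)"
proof -
 let ?c = "%e. (3 ^ n * abs (d (fst e) (snd e))) powr p"
 have ed: "edge (fst e) (snd e) : sets vnu" if "e : earcs n" for e using that by (cases e) simp
 have "(\<integral>\<^sup>+x. ennreal (abs (gstep d n x) powr p) \<partial>vnu) <= (\<integral>\<^sup>+x. (SUM e:earcs n. ennreal (?c e) * ind (edge (fst e) (snd e)) x) \<partial>vnu)"
 proof (rule nn_integral_mono)
  fix x
  show "ennreal (abs (gstep d n x) powr p) <= (SUM e:earcs n. ennreal (?c e) * ind (edge (fst e) (snd e)) x)"
  proof (rule gstep_cases[of d n x])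
   assume "gstep d n x = 0" thus ?thesis using p by simp
  next
   fix w i assume a: "(w, i) : earcs n" "x : edge w i" "gstep d n x = esgn w i * 3 ^ n * d w i"
   hence "ennreal (abs (gstep d n x) powr p) = ennreal (?c (w, i)) * ind (edge (fst (w, i)) (snd (w, i))) x"
    by (simp add: abs_mult abs_esgn)
   also have "... <= (SUM e:earcs n. ennreal (?c e) * ind (edge (fst e) (snd e)) x)" by (rule member_le_sum) (use a in auto)
   finally show ?thesis .
  qed
 qed
 also have "... = (SUM e:earcs n. ennreal (?c e) * emeasure vnu (edge (fst e) (snd e)))"
  by (subst nn_integral_sum) (use ed in \<open>auto intro!: sum.cong nn_integral_cmult_indicator\<close>)
 also have "... = (SUM e:earcs n. ennreal ((3 powr (p - 1)) ^ n * abs (d (fst e) (snd e)) powr p))"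
 proof (rule sum.cong[OF refl])
  fix e assume "e : earcs n"
  hence "(fst e, snd e) : earcs n" by simp
  moreover have "?c e * (1 / 3 ^ n) = (3 powr (p - 1)) ^ n * abs (d (fst e) (snd e)) powr p"
   by (simp add: powr_mult powr_realpow[symmetric] powr_powr powr_diff field_simps)
  ultimately show "ennreal (?c e) * emeasure vnu (edge (fst e) (snd e)) = ennreal ((3 powr (p - 1)) ^ n * abs (d (fst e) (snd e)) powr p)"
   by (simp add: emeasure_vnu_edge ennreal_mult[symmetric] del: ennreal_mult)
 qed
 also have "... = ennreal (SUM e:earcs n. (3 powr (p - 1)) ^ n * abs (d (fst e) (snd e)) powr p)" by (rule sum_ennreal) simp
 also have "(SUM e:earcs n. (3 powr (p - 1)) ^ n * abs (d (fst e) (snd e)) powr p) = energy p d n"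
  unfolding energy_def sum_earcs[of "%w i. (3 powr (p - 1)) ^ n * abs (d w i) powr p"] by (simp add: sum_distrib_left)
 finally show ?thesis .
qed

text \<open>Fatou's lemma along the subsequence keeps the energy bound for the limit.\<close>

lemma energy_gradient:
 assumes p: "1 < p" and E: "!!n. energy p (incr f) n <= E"
 obtains g where "lgrad f g" "(\<integral>\<^sup>+x. ennreal (abs (g x) powr p) \<partial>vnu) <= ennreal E"
proof -
 have loc: "EX B. \<forall>n\<ge>k. (LINT x:edge w i|vnu. \<bar>gstep (incr f) n x\<bar> powr p) <= B" if e: "(w, i) : earcs k" for k w i
 proof (intro exI[of _ E] allI impI)
  fix n
  note [measurable] = edge_vnu[OF e]
  have "(LINT x:edge w i|vnu. \<bar>gstep (incr f) n x\<bar> powr p) = enn2real (\<integral>\<^sup>+x. ennreal (ind (edge w i) x *\<^sub>R \<bar>gstep (incr f) n x\<bar> powr p) \<partial>vnu)"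
   unfolding set_lebesgue_integral_def by (rule integral_eq_nn_integral) auto
  also have "... <= enn2real (ennreal E)"
  proof (rule enn2real_mono)
   have "(\<integral>\<^sup>+x. ennreal (ind (edge w i) x *\<^sub>R \<bar>gstep (incr f) n x\<bar> powr p) \<partial>vnu) <= (\<integral>\<^sup>+x. ennreal (abs (gstep (incr f) n x) powr p) \<partial>vnu)"
    by (rule nn_integral_mono) (simp add: indicator_def)
   also have "... <= ennreal E" using order_trans[OF gstep_energy[OF p] ennreal_leI[OF E]] .
   finally show "(\<integral>\<^sup>+x. ennreal (ind (edge w i) x *\<^sub>R \<bar>gstep (incr f) n x\<bar> powr p) \<partial>vnu) <= ennreal E" .
  qed simp
  also have "... = E" using order_trans[OF energy_nonneg E] by (rule enn2real_ennreal)
  finally show "(LINT x:edge w i|vnu. \<bar>gstep (incr f) n x\<bar> powr p) <= E" .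
 qed
 obtain s g where sg: "g : borel_measurable vnu & (AE x in vnu. (%j. gstep (incr f) (s j) x) \<longlonglongrightarrow> g x) \<and>
  (ALL n w i. (w, i) : earcs n --> set_integrable vnu (edge w i) g & (LINT x:edge w i|vnu. g x) = esgn w i * incr f w i)"
  using gradient_exists[OF consistent_incr p loc] by blast
 note g [measurable] = conjunct1[OF sg] and lim = conjunct1[OF conjunct2[OF sg]]
  and gi = conjunct2[OF conjunct2[OF sg], rule_format]
 have "(\<integral>\<^sup>+x. ennreal (abs (g x) powr p) \<partial>vnu) <= (\<integral>\<^sup>+x. liminf (%j. ennreal (abs (gstep (incr f) (s j) x) powr p)) \<partial>vnu)"
 proof (rule nn_integral_mono_AE, use lim in eventually_elim)
  fix x assume "(%j. gstep (incr f) (s j) x) \<longlonglongrightarrow> g x"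
  hence "(%j. ennreal (abs (gstep (incr f) (s j) x) powr p)) \<longlonglongrightarrow> ennreal (abs (g x) powr p)"
   using p by (intro tendsto_intros tendsto_powr' tendsto_ennrealI) auto
  from lim_imp_Liminf[OF _ this] show "ennreal (abs (g x) powr p) <= liminf (%j. ennreal (abs (gstep (incr f) (s j) x) powr p))" by simp
 qed
 also have "... <= liminf (%j. \<integral>\<^sup>+x. ennreal (abs (gstep (incr f) (s j) x) powr p) \<partial>vnu)" by (rule nn_integral_liminf) measurable
 also have "... <= ennreal E"
 proof (rule order_trans[OF Liminf_le_Limsup Limsup_bounded])
  show "\<forall>\<^sub>F j in sequentially. (\<integral>\<^sup>+x. ennreal (abs (gstep (incr f) (s j) x) powr p) \<partial>vnu) <= ennreal E"
   using order_trans[OF gstep_energy[OF p] ennreal_leI[OF E]] by (intro always_eventually allI)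
 qed simp
 finally have bd: "(\<integral>\<^sup>+x. ennreal (abs (g x) powr p) \<partial>vnu) <= ennreal E" .
 have "lgrad f g" by (rule lgradI[OF g], erule gi)
 thus thesis using bd by (rule that)
qed

lemma lipschitz_gradient:
 assumes L: "!!n w i. (w, i) : earcs n ==> \<bar>incr f w i\<bar> <= L / 3 ^ n"
 obtains g where "lgrad f g" "AE x in vnu. \<bar>g x\<bar> <= L"
proof -
 have L0: "0 <= L" using L[of "[]" 1 0] by (simp add: earcs_iff words_0)
 have bd: "abs (gstep (incr f) n x) <= L" for n x
 proof (rule gstep_cases[of "incr f" n x])
  fix w i assume a: "(w, i) : earcs n" "gstep (incr f) n x = esgn w i * 3 ^ n * incr f w i"
  thus ?thesis using L[OF a(1)] by (simp add: abs_mult abs_esgn field_simps)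
 qed (use L0 in simp)
 have loc: "EX B. \<forall>n\<ge>k. (LINT x:edge w i|vnu. \<bar>gstep (incr f) n x\<bar> powr 2) <= B" if e: "(w, i) : earcs k" for k w i
 proof (intro exI[of _ "L powr 2 / 3 ^ k"] allI impI)
  fix n
  have b: "abs (gstep (incr f) n x) powr 2 <= L powr 2" for x by (intro powr_mono2 bd) auto
  have "(LINT x:edge w i|vnu. \<bar>gstep (incr f) n x\<bar> powr 2) <= (LINT x:edge w i|vnu. L powr 2)"
   by (rule set_integral_mono; (rule edge_integrable_bounded[OF e, where B="L powr 2"])?) (use b in auto)
  also have "... = L powr 2 / 3 ^ k" by (rule edge_integral_const[OF e])
  finally show "(LINT x:edge w i|vnu. \<bar>gstep (incr f) n x\<bar> powr 2) <= L powr 2 / 3 ^ k" .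
 qed
 \<comment> \<open>The exponent 2 is a convenient choice above 1: bounded quotients satisfy the
   local hypothesis of \<open>gradient_exists\<close> on each edge.\<close>
 have two: "1 < (2 :: real)" by simp
 obtain s g where sg: "g : borel_measurable vnu & (AE x in vnu. (%j. gstep (incr f) (s j) x) \<longlonglongrightarrow> g x) \<and>
  (ALL n w i. (w, i) : earcs n --> set_integrable vnu (edge w i) g & (LINT x:edge w i|vnu. g x) = esgn w i * incr f w i)"
  using gradient_exists[OF consistent_incr two loc] by blast
 note g [measurable] = conjunct1[OF sg] and lim = conjunct1[OF conjunct2[OF sg]]
  and gi = conjunct2[OF conjunct2[OF sg], rule_format]
 have "AE x in vnu. \<bar>g x\<bar> <= L" using lim
 proof eventually_elim
  case (elim x)
  from tendsto_rabs[OF elim] show ?case by (rule LIMSEQ_le_const2) (use bd in auto)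
 qed
 moreover have "lgrad f g" by (rule lgradI[OF g], erule gi)
 ultimately show thesis by (rule that[rotated])
qed

section \<open>Functions with a given gradient\<close>

text \<open>Interpolation of prescribed increments in the cell \<open>w\<close>, for consistent
  \<open>d\<close> with value 0 at the centre. The recursion glues the subcells as in
  \<open>zoom_decomp\<close>; the subtracted constant sums, over the corner cells, the value at the
  touching point minus that at the centre of the cell.\<close>

primrec lift :: "(nat list => nat => real) => nat => nat list => real \<times> real => real" where
 "lift d 0 w x = (SUM i:{1..4}. d w i * hat i x)"
| "lift d (Suc n) w x = (SUM j:{1..5}. lift d n (w @ [j]) (zoom j x)) - (SUM j:{1..4}. d (w @ [j]) (opp j))"

text \<open>The value at the centre of the subcell relative to the centre of \<open>w\<close>: out
  along a spoke of the central subcell and on along the spoke of the cell \<open>k\<close> that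
  starts at the touching point, as in \<open>incr_step\<close>.\<close>

definition lift_shift :: "(nat list => nat => real) => nat list => nat => real" where
 "lift_shift d w k = (if k = 5 then 0 else d (w @ [5]) k - d (w @ [k]) (opp k))"

lemma snocw: "w : words l ==> j : {1..5} ==> w @ [j] : words (Suc l)" by (simp add: words_def)

lemma zoom_5_other: "k : {1..4} ==> y : K ==> zoom 5 (psi k y) = q k" by (subst zoom_other) (auto simp: exit_def)

lemma zoom_j_other: "j : {1..4} ==> k : {1..5} ==> k ~= j ==> y : K ==> zoom j (psi k y) = q (opp j)"
 by (subst zoom_other) (auto simp: exit_def)

text \<open>In the cell \<open>k\<close> the other retractions are constant corners, and the
  summands of the remaining corner cells cancel against the subtracted sum.\<close>

lemma lift_psi:
 assumes q: "!!j i. j : {1..5} ==> i : {1..4} ==> lift d n (w @ [j]) (q i) = d (w @ [j]) i"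
  and k: "k : {1..5}" and y: "y : K" shows "lift d (Suc n) w (psi k y) = lift d n (w @ [k]) y + lift_shift d w k"
proof -
 let ?a = "%j. lift d n (w @ [j]) (zoom j (psi k y))" and ?b = "%j. d (w @ [j]) (opp j)"
 have "{1..5} = insert 5 {1..4::nat}" by auto
 hence s: "(SUM j:{1..5}. ?a j) = ?a 5 + (SUM j:{1..4}. ?a j)" by simp
 have ab: "?a j = ?b j" if "j : {1..4}" "j ~= k" for j
  using that k y opp_mem[of j] by (subst zoom_j_other) (auto intro!: q)
 show ?thesis
 proof (cases "k = 5")
  case True
  have "(SUM j:{1..4}. ?a j) = (SUM j:{1..4}. ?b j)" by (rule sum.cong[OF refl], rule ab) (use True in auto)
  thus ?thesis unfolding lift.simps s using True y by (simp add: zoom_same lift_shift_def)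
 next
  case False
  hence k4: "k : {1..4}" using k by auto
  have "(SUM j:{1..4} - {k}. ?a j) = (SUM j:{1..4} - {k}. ?b j)" by (rule sum.cong[OF refl], rule ab) auto
  hence "(SUM j:{1..4}. ?a j) - (SUM j:{1..4}. ?b j) = ?a k - ?b k"
   using sum.remove[OF finite_atLeastAtMost k4, of ?a] sum.remove[OF finite_atLeastAtMost k4, of ?b] by linarith
  moreover have "?a 5 = d (w @ [5]) k" using zoom_5_other[OF k4 y] q[of 5 k] k4 by simp
  ultimately show ?thesis unfolding lift.simps s using False y by (simp add: zoom_same lift_shift_def)
 qed
qed

lemma lift_corner:
 assumes d: "consistent d" shows "w : words l ==> i : {1..4} ==> lift d n w (q i) = d w i"
  and "w : words l ==> lift d n w (q 5) = 0"
proof (induction n arbitrary: w l i)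
 case 0
 {
  case 1
  have "(SUM j:{1..4}. d w j * hat j (q i)) = (SUM j:{1..4}. if j = i then d w i else 0)"
   by (rule sum.cong[OF refl]) (use 1 in \<open>auto simp: hat_q\<close>)
  thus ?case using 1 by simp
 next
  case 2
  show ?case by (simp add: hat_q)
 }
next
 case (Suc n)
 {
  case 1
  have dw: "d w i = d (w @ [5]) i - d (w @ [i]) (opp i) + d (w @ [i]) i"
   using d 1 unfolding consistent_def earcs_iff by blast
  have "lift d (Suc n) w (psi i (q i)) = lift d n (w @ [i]) (q i) + lift_shift d w i"
   by (rule lift_psi, rule Suc.IH(1)[of _ "Suc l"]) (use 1 in \<open>auto intro!: snocw q_vicsek\<close>)
  also have "lift d n (w @ [i]) (q i) = d (w @ [i]) i"
   by (rule Suc.IH(1)[of _ "Suc l"]) (use 1 in \<open>auto intro!: snocw\<close>)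
  finally show ?case using 1 dw by (simp add: psi_q lift_shift_def)
 next
  case 2
  have "lift d (Suc n) w (psi 5 (q 5)) = lift d n (w @ [5]) (q 5) + lift_shift d w 5"
   by (rule lift_psi, rule Suc.IH(1)[of _ "Suc l"]) (use 2 in \<open>auto intro!: snocw q_vicsek\<close>)
  also have "lift d n (w @ [5]) (q 5) = 0" by (rule Suc.IH(2)[of _ "Suc l"]) (use 2 in \<open>auto intro!: snocw\<close>)
  finally show ?case by (simp add: psi_q lift_shift_def)
 }
qed

lemma lift_cell:
 assumes "consistent d" "w : words l" "k : {1..5}" "y : K"
 shows "lift d (Suc n) w (psi k y) = lift d n (w @ [k]) y + lift_shift d w k"
 by (rule lift_psi, rule lift_corner(1)[of d _ "Suc l"]) (use assms in \<open>auto intro!: snocw\<close>)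

lemma continuous_lift: "continuous_on K (lift d n w)"
proof (induction n arbitrary: w)
 case 0
 show ?case unfolding lift.simps[abs_def] by (intro continuous_intros)
next
 case (Suc n)
 have "continuous_on K (%x. lift d n (w @ [j]) (zoom j x))" if "j : {1..5}" for j
  by (rule continuous_on_compose2[OF Suc.IH continuous_on_zoom[OF that]]) (use zoom_vicsek[OF that] in auto)
 thus ?case unfolding lift.simps[abs_def] by (intro continuous_intros)
qed

text \<open>Only the first refinement is estimated, and 10 = 4 + 2 + 4 collects two interpolants and
  the shift. A later refinement is the previous one inside a subcell, because the shifts
  cancel.\<close>

lemma lift_step_bound:
 assumes d: "consistent d" and rho: "0 < \<rho>" "\<rho> < 1" and C: "0 <= C"
  and b: "!!l w i. (w, i) : earcs l ==> \<bar>d w i\<bar> <= C * \<rho> ^ l"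
 shows "w : words l ==> x : K ==> \<bar>lift d (Suc n) w x - lift d n w x\<bar> <= 10 * C * \<rho> ^ (l + n)"
proof (induction n arbitrary: w l x)
 case 0
 have l0: "abs (lift d 0 u z) <= 4 * (C * \<rho> ^ m)" if u: "u : words m" and z: "z : K" for u m z
 proof -
  have h: "abs (hat i z) <= 1" if "i : {1..4}" for i
  proof -
   have "z \<bullet> q i <= norm z * norm (q i)" by (rule norm_cauchy_schwarz)
   also have "... <= 1" using norm_vicsek[OF z] norm_q[OF that] by simp
   finally show ?thesis by (simp add: hat_def)
  qed
  have "abs (lift d 0 u z) <= (SUM i:{1..4}. \<bar>d u i * hat i z\<bar>)" unfolding lift.simps by (rule sum_abs)
  also have "... <= (SUM i:{1..4::nat}. C * \<rho> ^ m)"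
  proof (rule sum_mono)
   fix i :: nat assume i: "i : {1..4}"
   have "abs (d u i) * abs (hat i z) <= (C * \<rho> ^ m) * 1" by (intro mult_mono b h) (use i u C rho in \<open>auto simp: earcs_iff\<close>)
   thus "abs (d u i * hat i z) <= C * \<rho> ^ m" by (simp add: abs_mult)
  qed
  finally show ?thesis by simp
 qed
 obtain k y where ky: "k : {1..5}" "y : K" "x = psi k y" using 0(2) by (rule vicsekE)
 have wk: "w @ [j] : words (Suc l)" if "j : {1..5}" for j using 0(1) that by (rule snocw)
 have "abs (lift_shift d w k) <= 2 * (C * \<rho> ^ Suc l)"
 proof (cases "k = 5")
  case True thus ?thesis using C rho by (simp add: lift_shift_def)
 next
  case False
  hence k4: "k : {1..4}" using ky by auto
  have "(w @ [5], k) : earcs (Suc l)" "(w @ [k], opp k) : earcs (Suc l)"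
   using earcs_snoc[of w k l] 0(1) k4 by (auto simp: earcs_iff)
  from b[OF this(1)] b[OF this(2)] show ?thesis using False unfolding lift_shift_def if_not_P[OF False] by linarith
 qed
 moreover have "abs (lift d 0 (w @ [k]) y) <= 4 * (C * \<rho> ^ Suc l)" by (rule l0[OF wk[OF ky(1)] ky(2)])
 moreover have "C * \<rho> ^ Suc l <= C * \<rho> ^ l" using C rho by (intro mult_left_mono power_decreasing) auto
 moreover have "abs (lift d 0 w x) <= 4 * (C * \<rho> ^ l)" by (rule l0[OF 0])
 ultimately have "abs (lift d (Suc 0) w x - lift d 0 w x) <= 10 * (C * \<rho> ^ l)"
  unfolding ky(3) lift_cell[OF d 0(1) ky(1,2)] by linarith
 thus ?case by (simp only: add_0_right mult.assoc)
next
 case (Suc n)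
 obtain k y where ky: "k : {1..5}" "y : K" "x = psi k y" using Suc.prems(2) by (rule vicsekE)
 have "lift d (Suc (Suc n)) w x - lift d (Suc n) w x = lift d (Suc n) (w @ [k]) y - lift d n (w @ [k]) y"
  unfolding ky(3) lift_cell[OF d Suc.prems(1) ky(1,2)] by simp
 moreover have "abs (lift d (Suc n) (w @ [k]) y - lift d n (w @ [k]) y) <= 10 * C * \<rho> ^ (Suc l + n)"
  by (rule Suc.IH[OF snocw[OF Suc.prems(1) ky(1)] ky(2)])
 ultimately show ?case by (simp only: add_Suc add_Suc_right)
qed

text \<open>Weierstrass' test gives uniform limits. They are formed for all words together, since
  the increments in a cell are read off from the limit attached to that cell.\<close>

lemma lift_exists:
 assumes d: "consistent d" and rho: "0 < \<rho>" "\<rho> < 1" and C: "0 <= C"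
  and b: "!!l w i. (w, i) : earcs l ==> \<bar>d w i\<bar> <= C * \<rho> ^ l"
 shows "EX f. continuous_on K f & (ALL l w i. (w, i) : earcs l --> incr f w i = d w i)"
proof -
 define F where "F w x = (\<Sum>n. lift d (Suc n) w x - lift d n w x)" for w x
 define G where "G w x = F w x + lift d 0 w x" for w x
 have tel: "(\<Sum>i<n. lift d (Suc i) w x - lift d i w x) = lift d n w x - lift d 0 w x" for n w x
  by (rule sum_lessThan_telescope[of "%i. lift d i w x"])
 have unif: "uniform_limit K (%n x. lift d n w x - lift d 0 w x) (F w) sequentially" if w: "w : words l" for w l
 proof -
  have "uniform_limit K (%n x. \<Sum>i<n. lift d (Suc i) w x - lift d i w x) (%x. \<Sum>i. lift d (Suc i) w x - lift d i w x) sequentially"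
  proof (rule Weierstrass_m_test)
   fix n x assume "x : K"
   from lift_step_bound[OF d rho C b w this, of n]
   show "norm (lift d (Suc n) w x - lift d n w x) <= 10 * C * \<rho> ^ l * \<rho> ^ n" by (simp only: real_norm_def power_add mult.assoc)
  next
   show "summable (%n. 10 * C * \<rho> ^ l * \<rho> ^ n)" by (intro summable_mult summable_geometric) (use rho in simp)
  qed
  thus ?thesis unfolding tel F_def[abs_def] .
 qed
 have lim: "(%n. lift d n w x) \<longlonglongrightarrow> G w x" if "w : words l" "x : K" for w l x
  using tendsto_add[OF tendsto_uniform_limitI[OF unif[OF that(1)] that(2)] tendsto_const[of "lift d 0 w x"]]
  by (simp add: G_def)
 have cont: "continuous_on K (G w)" if "w : words l" for w l
 proof -
  have "continuous_on K (F w)" by (rule uniform_limit_theorem[OF always_eventually unif[OF that]])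
    (intro allI continuous_on_diff continuous_lift, simp)
  thus ?thesis unfolding G_def[abs_def] by (intro continuous_on_add continuous_lift)
 qed
 have cell: "G w (psi k y) = G (w @ [k]) y + lift_shift d w k" if w: "w : words l" and k: "k : {1..5}" and y: "y : K" for w l k y
 proof (rule LIMSEQ_unique)
  show "(%n. lift d (Suc n) w (psi k y)) \<longlonglongrightarrow> G w (psi k y)" by (rule LIMSEQ_Suc, rule lim[OF w psi_vicsek[OF k y]])
  show "(%n. lift d (Suc n) w (psi k y)) \<longlonglongrightarrow> G (w @ [k]) y + lift_shift d w k"
   unfolding lift_cell[OF d w k y] by (intro tendsto_add tendsto_const lim[OF snocw[OF w k] y])
 qed
 have word: "G u (pw w x) - G u (pw w y) = G (u @ w) x - G (u @ w) y"
  if "u : words l" "w : words m" "x : K" "y : K" for u w l m x y using that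
 proof (induction w arbitrary: u l m)
  case Nil
  thus ?case by simp
 next
  case (Cons k w)
  obtain m' where m: "m = Suc m'" "w : words m'" "k : {1..5}" using Cons.prems(2) by (auto simp: words_def)
  have v: "pw w x : K" "pw w y : K" using m Cons.prems by (auto intro!: psi_word_vicsek)
  have "G u (pw (k # w) x) - G u (pw (k # w) y) = G (u @ [k]) (pw w x) - G (u @ [k]) (pw w y)"
   unfolding psi_word_Cons o_apply cell[OF Cons.prems(1) m(3) v(1)] cell[OF Cons.prems(1) m(3) v(2)] by simp
  also have "... = G ((u @ [k]) @ w) x - G ((u @ [k]) @ w) y"
   by (rule Cons.IH[OF snocw[OF Cons.prems(1) m(3)] m(2) Cons.prems(3,4)])
  finally show ?case by simp
 qed
 have nil: "[] : words 0" by (simp add: words_0)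
 show ?thesis
 proof (intro exI[of _ "G []"] conjI allI impI)
  show "continuous_on K (G [])" by (rule cont[OF nil])
  fix l w i assume "(w, i) : earcs l"
  hence wi: "w : words l" "i : {1..4}" by (auto simp: earcs_iff)
  have qv: "q i : K" "q 5 : K" using wi by (auto intro!: q_vicsek)
  have "G w (q i) = d w i"
   by (rule LIMSEQ_unique[OF lim[OF wi(1) qv(1)]]) (simp only: lift_corner(1)[OF d wi] tendsto_const)
  moreover have "G w (q 5) = 0"
   by (rule LIMSEQ_unique[OF lim[OF wi(1) qv(2)]]) (simp only: lift_corner(2)[OF d wi(1)] tendsto_const)
  ultimately show "incr (G []) w i = d w i" unfolding incr_def word[OF nil wi(1) qv] by simp
 qed
qed

text \<open>By Hoelder the integral over an edge of level \<open>l\<close> is at most a constant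
  times 3^(-(1 - 1/p) l); for p > 1 this geometric decay makes the interpolants converge.\<close>

lemma lgrad_lift:
 assumes p: "1 < p" and g [measurable]: "g : borel_measurable vnu"
  and G: "(\<integral>\<^sup>+x. ennreal (abs (g x) powr p) \<partial>vnu) <= ennreal G" "0 <= G"
 obtains f where "continuous_on K f" "lgrad f g"
proof -
 define d where "d w i = esgn w i * (LINT x:edge w i|vnu. g x)" for w i
 have part: "(\<integral>\<^sup>+x. ennreal (abs (g x) powr p) * ind (edge w i) x \<partial>vnu) <= ennreal G" for w i
  by (rule order_trans[OF nn_integral_mono G(1)]) (simp add: indicator_def)
 have si: "set_integrable vnu (edge w i) g" if "(w, i) : earcs l" for w i l
  by (rule edge_integrable_Lp(1)[OF p g that part G(2)])
 have "consistent d" unfolding consistent_def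
 proof (intro allI impI)
  fix n w i assume e: "(w, i) : earcs n"
  hence "i : {1..4}" "w : words n" by (auto simp: earcs_iff)
  from esgn_split[OF this] show "d w i = d (w @ [5]) i - d (w @ [i]) (opp i) + d (w @ [i]) i"
   unfolding d_def edge_split_integral[OF e si[OF e]] by (simp add: algebra_simps)
 qed
 moreover have "0 < (1/3 :: real) powr (1 - 1 / p)" by simp
 moreover have "(1/3 :: real) powr (1 - 1 / p) < 1" using gr_one_powr[of 3 "1 - 1 / p"] p by (simp add: powr_divide)
 moreover have "0 <= G powr (1 / p)" by simp
 moreover have "abs (d w i) <= G powr (1 / p) * ((1/3) powr (1 - 1 / p)) ^ l" if e: "(w, i) : earcs l" for w i l
 proof -
  have "((1/3) powr (1 - 1 / p)) ^ l = (1 / 3 ^ l :: real) powr (1 - 1 / p)"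
   by (simp add: powr_realpow[symmetric] powr_powr powr_divide mult.commute)
  thus ?thesis using edge_integrable_Lp(2)[OF p g e part G(2)] by (simp add: d_def abs_mult abs_esgn mult.commute)
 qed
 ultimately have "EX f. continuous_on K f & (ALL l w i. (w, i) : earcs l --> incr f w i = d w i)"
  by (rule lift_exists)
 then obtain f where f0: "continuous_on K f & (ALL l w i. (w, i) : earcs l --> incr f w i = d w i)" by blast
 note f = conjunct1[OF f0] conjunct2[OF f0, rule_format]
 have "lgrad f g" unfolding lgrad_def
 proof (intro conjI allI impI g)
  fix n w i assume e: "(w, i) : earcs n"
  show "set_integrable vnu (edge w i) g" by (rule si[OF e])
  show "incr f w i = esgn w i * (LINT x:edge w i|vnu. g x)" using f(2)[OF e] by (simp add: d_def)
 qed
 with f(1) show thesis by (rule that)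
qed

lemma ennreal_term_le_suminf: "f j <= suminf f" for f :: "nat => ennreal" using sum_le_suminf[of f "{j}"] by simp

section \<open>Decomposition at the levels of the rearrangement\<close>

text \<open>All terms are at most \<open>Z\<close>, so z^P <= Z^(P-1) z; this is the inclusion of
  l^1 in l^P.\<close>

lemma suminf_powr_le:
 assumes P: "1 <= P" and z: "!!j. 0 <= z j" and Z: "(\<Sum>j. ennreal (z j)) <= ennreal Z" "0 <= Z"
 shows "(\<Sum>j. ennreal (z j powr P)) <= ennreal (Z powr P)"
proof -
 have zZ: "z j <= Z" for j
 proof -
  have "ennreal (z j) <= (\<Sum>j. ennreal (z j))" by (rule ennreal_term_le_suminf)
  thus ?thesis using Z z[of j] by (metis ennreal_le_iff order_trans)
 qed
 have "z j powr P <= Z powr (P - 1) * z j" for j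
 proof (cases "z j = 0")
  case False
  hence "0 < z j" using z[of j] by simp
  hence "z j powr P = z j powr (P - 1) * z j" by (simp add: powr_diff)
  also have "... <= Z powr (P - 1) * z j" using P zZ[of j] z[of j] by (intro mult_right_mono powr_mono2) auto
  finally show ?thesis .
 qed simp
 hence "(\<Sum>j. ennreal (z j powr P)) <= (\<Sum>j. ennreal (Z powr (P - 1)) * ennreal (z j))"
  by (intro suminf_le allI) (auto simp: ennreal_mult[symmetric] z intro!: ennreal_leI)
 also have "... = ennreal (Z powr (P - 1)) * (\<Sum>j. ennreal (z j))" by simp
 also have "... <= ennreal (Z powr (P - 1)) * ennreal Z" by (intro mult_left_mono Z) simp
 also have "... = ennreal (Z powr (P - 1) * Z)" using Z by (simp add: ennreal_mult)
 also have "Z powr (P - 1) * Z = Z powr P"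
 proof (cases "Z = 0")
  case False
  thus ?thesis using Z(2) by (simp add: powr_diff)
 qed simp
 finally show ?thesis .
qed

text \<open>The ratio is split as r = t t. One factor serves as the Hoelder weight, and t^(1-p) r^p
  = t^(1+p) < 1 remains.\<close>

lemma geometric_suminf_powr:
 assumes p: "1 < p" and r: "0 < r" "r < 1"
 obtains C \<rho> where "0 < C" "0 < \<rho>" "\<rho> < 1"
  "!!y. (!!j. 0 <= y j) ==> ennpowr (\<Sum>j. ennreal (r ^ j * y j)) p <= ennreal C * (\<Sum>j. ennreal (\<rho> ^ j * y j powr p))"
proof -
 define t where "t = sqrt r"
 have t: "0 < t" "t < 1" "t * t = r" using r by (auto simp: t_def)
 define \<rho> where "\<rho> = t powr (1 + p)"
 define C where "C = (1 / (1 - t)) powr (p - 1)"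
 have C: "0 < C" using t by (simp add: C_def)
 have rho: "0 < \<rho>" using t by (simp add: \<rho>_def)
 have rho1: "\<rho> < 1" using t p gr_one_powr[of "1 / t" "1 + p"] by (simp add: \<rho>_def powr_divide)
 have rp: "t powr (1 - p) * r powr p = \<rho>"
  unfolding t(3)[symmetric] \<rho>_def powr_mult powr_add[symmetric] by (simp add: add.commute)
 have main: "ennpowr (\<Sum>j. ennreal (r ^ j * y j)) p <= ennreal C * (\<Sum>j. ennreal (\<rho> ^ j * y j powr p))"
  if y: "!!j. 0 <= y j" for y
 proof (cases "(\<Sum>j. ennreal (\<rho> ^ j * y j powr p)) = \<top>")
  case True
  thus ?thesis using C by (simp add: ennreal_mult_top)
 next
  case False
  have sm: "summable (%j. \<rho> ^ j * y j powr p)" by (rule summable_suminf_not_top[OF _ False]) (use rho in simp)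
  define B where "B = (\<Sum>j. \<rho> ^ j * y j powr p)"
  have B: "(\<Sum>j. ennreal (\<rho> ^ j * y j powr p)) = ennreal B" "0 <= B"
   unfolding B_def using rho by (auto intro!: suminf_ennreal2 suminf_nonneg sm)
  have part: "(\<Sum>j<n. r ^ j * y j) <= (C * B) powr (1 / p)" for n
  proof -
   have nn: "0 <= (\<Sum>j<n. r ^ j * y j)" using r y by (intro sum_nonneg) simp
   have "(\<Sum>j<n. r ^ j * y j) powr p <= C * (\<Sum>j<n. (t powr (1 - p)) ^ j * (r ^ j * y j) powr p)"
    unfolding C_def by (rule powr_geometric_sum[OF p t(1,2)]) (use r y in simp)
   also have "(\<Sum>j<n. (t powr (1 - p)) ^ j * (r ^ j * y j) powr p) = (\<Sum>j<n. \<rho> ^ j * y j powr p)"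
   proof (rule sum.cong[OF refl])
    fix j
    have "(r ^ j * y j) powr p = (r powr p) ^ j * y j powr p"
     using r by (simp add: powr_mult powr_realpow[symmetric] powr_powr mult.commute)
    hence "(t powr (1 - p)) ^ j * (r ^ j * y j) powr p = (t powr (1 - p) * r powr p) ^ j * y j powr p"
     by (simp add: power_mult_distrib)
    thus "(t powr (1 - p)) ^ j * (r ^ j * y j) powr p = \<rho> ^ j * y j powr p" unfolding rp .
   qed
   also have "(\<Sum>j<n. \<rho> ^ j * y j powr p) <= B" unfolding B_def by (rule sum_le_suminf[OF sm]) (use rho in auto)
   finally have "(\<Sum>j<n. r ^ j * y j) powr p <= C * B" using C by simp
   hence "((\<Sum>j<n. r ^ j * y j) powr p) powr (1 / p) <= (C * B) powr (1 / p)" using p by (intro powr_mono2) auto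
   thus ?thesis using nn p by (simp add: powr_powr)
  qed
  have "(\<Sum>j. ennreal (r ^ j * y j)) <= ennreal ((C * B) powr (1 / p))"
  proof (rule suminf_le_const[OF summableI])
   fix n
   have "(\<Sum>j<n. ennreal (r ^ j * y j)) = ennreal (\<Sum>j<n. r ^ j * y j)" by (rule sum_ennreal) (use r y in simp)
   thus "(\<Sum>j<n. ennreal (r ^ j * y j)) <= ennreal ((C * B) powr (1 / p))" using ennreal_leI[OF part] by simp
  qed
  hence "ennpowr (\<Sum>j. ennreal (r ^ j * y j)) p <= ennreal (((C * B) powr (1 / p)) powr p)"
   by (rule ennpowr_le) (use p in auto)
  also have "((C * B) powr (1 / p)) powr p = C * B" using p C B(2) by (simp add: powr_powr)
  finally show ?thesis unfolding B(1) using C B(2) by (simp add: ennreal_mult)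
 qed
 show thesis by (rule that[OF C rho rho1 main])
qed

text \<open>The measure dt/t is invariant under dilations.\<close>

lemma nn_integral_scale:
 fixes f :: "real => ennreal"
 assumes [measurable]: "f : borel_measurable borel" and a: "0 < a"
 shows "(\<integral>\<^sup>+t. f (a * t) * ennreal (1 / t) * ind {0<..} t \<partial>lborel) = (\<integral>\<^sup>+t. f t * ennreal (1 / t) * ind {0<..} t \<partial>lborel)"
proof -
 have "(\<integral>\<^sup>+t. f t * ennreal (1 / t) * ind {0<..} t \<partial>lborel)
  = ennreal \<bar>a\<bar> * (\<integral>\<^sup>+t. f (0 + a * t) * ennreal (1 / (0 + a * t)) * ind {0<..} (0 + a * t) \<partial>lborel)"
  by (rule nn_integral_real_affine) (use a in auto)
 also have "... = (\<integral>\<^sup>+t. ennreal \<bar>a\<bar> * (f (0 + a * t) * ennreal (1 / (0 + a * t)) * ind {0<..} (0 + a * t)) \<partial>lborel)"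
  by (rule nn_integral_cmult[symmetric]) measurable
 also have "... = (\<integral>\<^sup>+t. f (a * t) * ennreal (1 / t) * ind {0<..} t \<partial>lborel)"
 proof (rule nn_integral_cong)
  fix t
  show "ennreal \<bar>a\<bar> * (f (0 + a * t) * ennreal (1 / (0 + a * t)) * ind {0<..} (0 + a * t)) = f (a * t) * ennreal (1 / t) * ind {0<..} t"
  proof (cases "0 < t")
   case True
   have "ennreal a * ennreal (1 / (a * t)) = ennreal (1 / t)" using a True by (subst ennreal_mult[symmetric]) auto
   thus ?thesis using a True by (simp add: mult.left_commute[of "ennreal a"])
  next
   case False
   hence "\<not> 0 < a * t" using a by (simp add: zero_less_mult_iff)
   thus ?thesis using False by simp
  qed
 qed
 finally show ?thesis by simp
qed

text \<open>The density of d(t^a): the parameter \<open>t\<close> stands for sets of measure t^a,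
  and \<open>wt_total\<close> recovers any measure \<open>m\<close> by integrating over t^a <
  m.\<close>

definition wt :: "real => real => ennreal" where
 "wt a t = ennreal (a * t powr (a - 1)) * ind {0<..} t"

lemma wt_measurable [measurable]: "wt a : borel_measurable borel" unfolding wt_def[abs_def] by measurable

lemma wt_interval:
 assumes a: "0 < a" and c: "0 <= c"
 shows "(\<integral>\<^sup>+t. wt a t * ind {t. ennreal (t powr a) < ennreal c} t \<partial>lborel) = ennreal c"
proof -
 define b where "b = c powr (1 / a)"
 have b: "0 <= b" "b powr a = c" using a c by (auto simp: b_def powr_powr)
 have "((%x. x powr (a - 1)) has_integral (b powr (a - 1 + 1) / (a - 1 + 1))) {0..b}"
  by (rule has_integral_powr_from_0) (use a b in auto)
 from has_integral_mult_right[OF this, of a] have "((%x. a * x powr (a - 1)) has_integral c) {0..b}" using a b by simp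
 hence I: "(\<integral>\<^sup>+t. ennreal (a * t powr (a - 1)) * ind {0..b} t \<partial>lborel) = ennreal c"
  by (rule nn_integral_has_integral_lebesgue'[rotated]) (use a in simp)
 have "(\<integral>\<^sup>+t. wt a t * ind {t. ennreal (t powr a) < ennreal c} t \<partial>lborel)
  = (\<integral>\<^sup>+t. ennreal (a * t powr (a - 1)) * ind {0..b} t \<partial>lborel)"
 proof (rule nn_integral_cong_AE, use AE_lborel_singleton[of 0] AE_lborel_singleton[of b] in eventually_elim)
  fix t :: real assume t: "t ~= 0" "t ~= b"
  have "t powr a < c \<longleftrightarrow> t < b" if "0 < t"
  proof
   assume "t powr a < c"
   hence "(t powr a) powr (1 / a) < c powr (1 / a)" using a by (intro powr_less_mono2) auto
   thus "t < b" using a that by (simp add: powr_powr b_def)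
  next
   assume "t < b"
   hence "t powr a < b powr a" using a that by (intro powr_less_mono2) auto
   thus "t powr a < c" using b by simp
  qed
  thus "wt a t * ind {t. ennreal (t powr a) < ennreal c} t = ennreal (a * t powr (a - 1)) * ind {0..b} t"
   using t c by (cases "0 < t") (auto simp: wt_def indicator_def ennreal_less_iff)
 qed
 thus ?thesis using I by simp
qed

lemma wt_total:
 assumes a: "0 < a" shows "(\<integral>\<^sup>+t. wt a t * ind {t. ennreal (t powr a) < m} t \<partial>lborel) = m"
proof (cases m)
 case (real c)
 thus ?thesis using wt_interval[OF a] by simp
next
 case top
 have "(\<integral>\<^sup>+t. wt a t * ind {t. ennreal (t powr a) < m} t \<partial>lborel) = \<top>"
 proof (rule ccontr)
  assume "\<not> ?thesis"
  hence "(\<integral>\<^sup>+t. wt a t * ind {t. ennreal (t powr a) < m} t \<partial>lborel) < \<top>" by (simp add: less_top)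
  then obtain n where n: "(\<integral>\<^sup>+t. wt a t * ind {t. ennreal (t powr a) < m} t \<partial>lborel) < of_nat n" using ennreal_Ex_less_of_nat by blast
  have "of_nat n = ennreal (real n)" by (simp add: ennreal_of_nat_eq_real_of_nat)
  also have "... = (\<integral>\<^sup>+t. wt a t * ind {t. ennreal (t powr a) < ennreal (real n)} t \<partial>lborel)" by (rule wt_interval[OF a, symmetric]) simp
  also have "... <= (\<integral>\<^sup>+t. wt a t * ind {t. ennreal (t powr a) < m} t \<partial>lborel)"
   by (rule nn_integral_mono) (auto simp: indicator_def top less_top[symmetric])
  finally show False using n by simp
 qed
 thus ?thesis using top by simp
qed

locale level_sets = sigma_finite_measure M for M :: "'a measure" +
 fixes g :: "'a => real" and a p :: real
 assumes g [measurable]: "g : borel_measurable M" and a: "0 < a" and p: "1 < p"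
begin

text \<open>The distribution function, written through an indicator of a difference so that the
  joint measurability needed for Fubini is visible.\<close>

definition dst :: "real => ennreal" where
 "dst l = (\<integral>\<^sup>+x. ind {0<..} (abs (g x) - l) \<partial>M)"

lemma dst_measurable [measurable]: "dst : borel_measurable borel" unfolding dst_def[abs_def] by measurable

lemma dst_eq: "dst l = emeasure M {x : space M. l < abs (g x)}"
proof -
 have "dst l = (\<integral>\<^sup>+x. ind {x : space M. l < abs (g x)} x \<partial>M)"
  unfolding dst_def by (rule nn_integral_cong) (auto simp: indicator_def)
 thus ?thesis by simp
qed

lemma dst_antimono: "l <= l' ==> dst l' <= dst l"
 unfolding dst_def by (rule nn_integral_mono) (auto simp: indicator_def)

text \<open>The p-th power of the decreasing rearrangement at t^a, expressed as a length so that
  Fubini applies.\<close>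

definition lvl :: "real => ennreal" where
 "lvl t = (\<integral>\<^sup>+s. ind {0<..} s * ind {0<..} (dst (s powr (1 / p)) - ennreal (t powr a)) \<partial>lborel)"

lemma diff_pos_iff: "0 < x - ennreal y \<longleftrightarrow> ennreal y < x"
proof
 assume x: "0 < x - ennreal y"
 show "ennreal y < x"
 proof (rule ccontr)
  assume "\<not> ennreal y < x"
  hence "x <= ennreal y" by simp
  hence "x - ennreal y = 0" by (intro diff_eq_0_ennreal le_less_trans[OF _ ennreal_less_top])
  with x show False by simp
 qed
qed (rule diff_gr0_ennreal)

lemma powr_root_less: "0 < s ==> 0 <= y ==> s powr (1 / p) < y \<longleftrightarrow> s < y powr p"
proof
 assume s: "0 < s" "0 <= y" "s powr (1 / p) < y"
 hence "(s powr (1 / p)) powr p < y powr p" using p by (intro powr_less_mono2) auto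
 thus "s < y powr p" using s p by (simp add: powr_powr)
next
 assume s: "0 < s" "0 <= y" "s < y powr p"
 hence "s powr (1 / p) < (y powr p) powr (1 / p)" using p by (intro powr_less_mono2) auto
 thus "s powr (1 / p) < y" using s p by (simp add: powr_powr)
qed

text \<open>Fubini twice: over the levels \<open>s\<close> of the p-th power, then over
  \<open>t\<close> once each value of the distribution function is written by
  \<open>wt_total\<close>.\<close>

lemma layer_cake: "(\<integral>\<^sup>+x. ennreal (abs (g x) powr p) \<partial>M) = (\<integral>\<^sup>+t. wt a t * lvl t \<partial>lborel)"
proof -
 interpret P1: pair_sigma_finite M lborel by unfold_locales
 have "(\<integral>\<^sup>+x. ennreal (abs (g x) powr p) \<partial>M) = (\<integral>\<^sup>+x. (\<integral>\<^sup>+s. ind {0<..} s * ind {0<..} (abs (g x) - s powr (1 / p)) \<partial>lborel) \<partial>M)"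
 proof (rule nn_integral_cong)
  fix x
  have "(\<integral>\<^sup>+s. ind {0<..} s * ind {0<..} (abs (g x) - s powr (1 / p)) \<partial>lborel) = (\<integral>\<^sup>+s. ind {0<..<abs (g x) powr p} s \<partial>lborel)"
   by (rule nn_integral_cong) (use powr_root_less in \<open>auto simp: indicator_def\<close>)
  thus "ennreal (abs (g x) powr p) = (\<integral>\<^sup>+s. ind {0<..} s * ind {0<..} (abs (g x) - s powr (1 / p)) \<partial>lborel)" by simp
 qed
 also have "... = (\<integral>\<^sup>+s. (\<integral>\<^sup>+x. ind {0<..} s * ind {0<..} (abs (g x) - s powr (1 / p)) \<partial>M) \<partial>lborel)"
  by (rule P1.Fubini'[symmetric]) measurable
 also have "... = (\<integral>\<^sup>+s. ind {0<..} s * dst (s powr (1 / p)) \<partial>lborel)"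
  unfolding dst_def by (rule nn_integral_cong) (simp add: nn_integral_cmult)
 also have "... = (\<integral>\<^sup>+s. (\<integral>\<^sup>+t. wt a t * (ind {0<..} s * ind {0<..} (dst (s powr (1 / p)) - ennreal (t powr a))) \<partial>lborel) \<partial>lborel)"
 proof (rule nn_integral_cong)
  fix s :: real
  have "(\<integral>\<^sup>+t. wt a t * (ind {0<..} s * ind {0<..} (dst (s powr (1 / p)) - ennreal (t powr a))) \<partial>lborel)
   = (\<integral>\<^sup>+t. ind {0<..} s * (wt a t * ind {t. ennreal (t powr a) < dst (s powr (1 / p))} t) \<partial>lborel)"
   by (rule nn_integral_cong) (auto simp: indicator_def diff_pos_iff)
  also have "... = ind {0<..} s * (\<integral>\<^sup>+t. wt a t * ind {t. ennreal (t powr a) < dst (s powr (1 / p))} t \<partial>lborel)"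
   by (rule nn_integral_cmult) measurable
  finally show "ind {0<..} s * dst (s powr (1 / p)) = (\<integral>\<^sup>+t. wt a t * (ind {0<..} s * ind {0<..} (dst (s powr (1 / p)) - ennreal (t powr a))) \<partial>lborel)"
   using wt_total[OF a] by simp
 qed
 also have "... = (\<integral>\<^sup>+t. (\<integral>\<^sup>+s. wt a t * (ind {0<..} s * ind {0<..} (dst (s powr (1 / p)) - ennreal (t powr a))) \<partial>lborel) \<partial>lborel)"
  by (rule lborel_pair.Fubini') measurable
 also have "... = (\<integral>\<^sup>+t. wt a t * lvl t \<partial>lborel)"
  unfolding lvl_def by (rule nn_integral_cong) (rule nn_integral_cmult, measurable)
 finally show ?thesis .
qed

lemma lvl_le:
 assumes R: "!!l. 0 < l ==> ennreal (t powr a) < dst l ==> ennreal l <= R" shows "lvl t <= ennpowr R p"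
proof (cases R)
 case top thus ?thesis by (simp add: ennpowr_def)
next
 case (real r)
 have "lvl t <= (\<integral>\<^sup>+s. ind {0..r powr p} s \<partial>lborel)" unfolding lvl_def
 proof (rule nn_integral_mono)
  fix s :: real
  have "s <= r powr p" if s: "0 < s" "ennreal (t powr a) < dst (s powr (1 / p))"
  proof -
   have "s powr (1 / p) <= r" using R[of "s powr (1 / p)"] s real by simp
   hence "(s powr (1 / p)) powr p <= r powr p" using p by (intro powr_mono2) auto
   thus ?thesis using s(1) p by (simp add: powr_powr)
  qed
  thus "ind {0<..} s * ind {0<..} (dst (s powr (1 / p)) - ennreal (t powr a)) <= (ind {0..r powr p} s :: ennreal)"
   by (auto simp: indicator_def diff_pos_iff)
 qed
 thus ?thesis using real by (simp add: ennpowr_def)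
qed

text \<open>The form is made for the K-functional: \<open>R\<close> only has to dominate, for each
  \<open>t\<close>, the levels exceeded on sets of measure more than t^a.\<close>

lemma interpolation_lower:
 assumes R: "!!t l. 0 < t ==> 0 < l ==> ennreal (t powr a) < dst l ==> ennreal l <= R t"
 shows "(\<integral>\<^sup>+x. ennreal (abs (g x) powr p) \<partial>M) <= (\<integral>\<^sup>+t. wt a t * ennpowr (R t) p \<partial>lborel)" unfolding layer_cake
proof (rule nn_integral_mono)
 fix t
 show "wt a t * lvl t <= wt a t * ennpowr (R t) p"
 proof (cases "0 < t")
  case True
  thus ?thesis by (intro mult_left_mono lvl_le R) auto
 qed (simp add: wt_def)
qed

end

locale level_sets_finite = level_sets +
 fixes G :: real
 assumes G: "(\<integral>\<^sup>+x. ennreal (abs (g x) powr p) \<partial>M) <= ennreal G" "0 <= G"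
begin

section \<open>The decreasing rearrangement\<close>

lemma dst_finite: assumes l: "0 < l" shows "dst l <= ennreal (G / l powr p)"
proof -
 have "ennreal (l powr p) * dst l = (\<integral>\<^sup>+x. ennreal (l powr p) * ind {0<..} (abs (g x) - l) \<partial>M)"
  unfolding dst_def by (rule nn_integral_cmult[symmetric]) measurable
 also have "... <= (\<integral>\<^sup>+x. ennreal (abs (g x) powr p) \<partial>M)"
  by (rule nn_integral_mono) (use l p in \<open>auto simp: indicator_def intro!: ennreal_leI powr_mono2\<close>)
 also have "... <= ennreal G" by (rule G)
 finally have le: "ennreal (l powr p) * dst l <= ennreal G" .
 have lp: "0 < l powr p" using l by simp
 have "dst l = ennreal (1 / l powr p) * (ennreal (l powr p) * dst l)"
  using lp by (simp add: mult.assoc[symmetric] ennreal_mult[symmetric])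
 also have "... <= ennreal (1 / l powr p) * ennreal G" by (intro mult_left_mono le) simp
 also have "... = ennreal (G / l powr p)" using G(2) lp by (simp add: ennreal_mult[symmetric])
 finally show ?thesis .
qed

text \<open>The decreasing rearrangement at measure t^a; the value for t <= 0 is a default.\<close>

definition T :: "real => real" where
 "T t = (if 0 < t then Inf {l. 0 <= l & dst l <= ennreal (t powr a)} else 0)"

lemma T_set: assumes t: "0 < t" obtains l where "0 < l" "dst l <= ennreal (t powr a)"
proof -
 define l where "l = (G / t powr a + 1) powr (1 / p) "
 have pos: "0 < G / t powr a + 1" using t G(2) by (simp add: add_nonneg_pos)
 hence l: "0 < l" "l powr p = G / t powr a + 1" using p by (auto simp: l_def powr_powr)
 have "G / (G / t powr a + 1) <= t powr a" using pos t by (simp add: divide_le_eq distrib_left)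
 hence "dst l <= ennreal (t powr a)" using dst_finite[OF l(1)] unfolding l(2) by (meson ennreal_leI order_trans)
 with l(1) show thesis by (rule that)
qed

lemma T_nonneg: "0 <= T t"
proof (cases "0 < t")
 case True
 obtain l where "0 < l" "dst l <= ennreal (t powr a)" by (rule T_set[OF True])
 hence "l : {l. 0 <= l & dst l <= ennreal (t powr a)}" by simp
 hence "{l. 0 <= l & dst l <= ennreal (t powr a)} ~= {}" by blast
 hence "0 <= Inf {l. 0 <= l & dst l <= ennreal (t powr a)}" by (rule cInf_greatest) simp
 thus ?thesis unfolding T_def by simp
qed (simp add: T_def)

text \<open>Continuity of the measure from below. It makes the infimum in the definition of
  \<open>T\<close> attained.\<close>

lemma dst_right: assumes "!!n::nat. dst (l + 1 / Suc n) <= c" shows "dst l <= c"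
proof -
 have "dst l = emeasure M (\<Union>n::nat. {x : space M. l + 1 / Suc n < abs (g x)})" unfolding dst_eq
 proof (rule arg_cong[where f="emeasure M"], rule set_eqI)
  fix x
  show "x : {x : space M. l < abs (g x)} \<longleftrightarrow> x : (\<Union>n::nat. {x : space M. l + 1 / Suc n < abs (g x)})"
  proof
   assume x: "x : {x : space M. l < abs (g x)}"
   hence "0 < abs (g x) - l" by simp
   then obtain n where "inverse (real (Suc n)) < abs (g x) - l" using reals_Archimedean by blast
   thus "x : (\<Union>n::nat. {x : space M. l + 1 / Suc n < abs (g x)})" using x by (auto simp: inverse_eq_divide intro!: exI[of _ n])
  next
   assume "x : (\<Union>n::nat. {x : space M. l + 1 / Suc n < abs (g x)})"
   then obtain n :: nat where n: "x : space M" "l + 1 / Suc n < abs (g x)" by auto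
   have "0 < 1 / real (Suc n)" by simp
   hence "l < abs (g x)" using n(2) by linarith
   thus "x : {x : space M. l < abs (g x)}" using n by simp
  qed
 qed
 also have "... = (SUP n::nat. emeasure M {x : space M. l + 1 / Suc n < abs (g x)})"
 proof (rule SUP_emeasure_incseq[symmetric])
  show "incseq (%n::nat. {x : space M. l + 1 / Suc n < abs (g x)})"
  proof (rule incseq_SucI, rule subsetI)
   fix n x assume x: "x : {x : space M. l + 1 / Suc n < abs (g x)}"
   have "1 / real (Suc (Suc n)) <= 1 / real (Suc n)" by (intro divide_left_mono) auto
   hence "l + 1 / real (Suc (Suc n)) < abs (g x)" using x by simp
   thus "x : {x : space M. l + 1 / Suc (Suc n) < abs (g x)}" using x by simp
  qed
 qed auto
 also have "... <= c" by (rule SUP_least) (use assms in \<open>simp add: dst_eq\<close>)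
 finally show ?thesis .
qed

text \<open>A Galois connection between rearrangement and distribution function; measurability of
  \<open>T\<close> and the integral bound are read off from it.\<close>

lemma T_le_iff: assumes t: "0 < t" and l: "0 <= l" shows "T t <= l \<longleftrightarrow> dst l <= ennreal (t powr a)"
proof
 let ?S = "{l. 0 <= l & dst l <= ennreal (t powr a)}"
 have bdd: "bdd_below ?S" by (rule bdd_belowI[of _ 0]) simp
 obtain l0 where l0: "0 < l0" "dst l0 <= ennreal (t powr a)" by (rule T_set[OF t])
 hence "l0 : ?S" by simp
 hence ne: "?S ~= {}" by blast
 {
  assume "dst l <= ennreal (t powr a)"
  hence "Inf ?S <= l" using l by (intro cInf_lower bdd) simp
  thus "T t <= l" using t by (simp add: T_def)
 next
  assume Tl: "T t <= l"
  show "dst l <= ennreal (t powr a)"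
  proof (rule dst_right)
   fix n :: nat
   have "0 < 1 / real (Suc n)" by simp
   hence "Inf ?S < l + 1 / Suc n" using Tl t unfolding T_def if_P[OF t] by linarith
   then obtain l' where l': "l' : ?S" "l' < l + 1 / Suc n" using cInf_less_iff[OF ne bdd] by blast
   have "dst (l + 1 / Suc n) <= dst l'" by (rule dst_antimono[OF less_imp_le[OF l'(2)]])
   also have "... <= ennreal (t powr a)" using l'(1) by simp
   finally show "dst (l + 1 / Suc n) <= ennreal (t powr a)" .
  qed
 }
qed

lemma dst_T: "0 < t ==> dst (T t) <= ennreal (t powr a)" using T_le_iff[of t "T t"] T_nonneg[of t] by simp

lemma T_measurable [measurable]: "T : borel_measurable borel"
proof (rule borel_measurable_iff_greater[THEN iffD2], rule allI)
 fix l
 show "{w : space borel. l < T w} : sets borel"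
 proof (cases "0 <= l")
  case True
  have "{w : space borel. l < T w} = {w : space borel. 0 < w & ennreal (w powr a) < dst l}"
  proof (rule set_eqI)
   fix w
   show "w : {w : space borel. l < T w} \<longleftrightarrow> w : {w : space borel. 0 < w & ennreal (w powr a) < dst l}"
    using T_le_iff[of w l] True by (cases "0 < w") (auto simp: not_le[symmetric] T_def)
  qed
  thus ?thesis by simp
 next
  case False
  hence "l < T w" for w using T_nonneg[of w] by linarith
  hence "{w : space borel. l < T w} = UNIV" by simp
  thus ?thesis by simp
 qed
qed

text \<open>The interval below \<open>T t powr p\<close> lies in the set whose length is
  \<open>lvl t\<close>, so the layer-cake formula applies.\<close>

lemma T_integral: "(\<integral>\<^sup>+t. wt a t * ennreal (T t powr p) \<partial>lborel) <= ennreal G"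
proof -
 have "(\<integral>\<^sup>+t. wt a t * ennreal (T t powr p) \<partial>lborel) <= (\<integral>\<^sup>+t. wt a t * lvl t \<partial>lborel)"
 proof (rule nn_integral_mono)
  fix t
  show "wt a t * ennreal (T t powr p) <= wt a t * lvl t"
  proof (cases "0 < t")
   case True
   have "ennreal (T t powr p) = (\<integral>\<^sup>+s. ind {0<..<T t powr p} s \<partial>lborel)" by simp
   also have "... <= lvl t" unfolding lvl_def
   proof (rule nn_integral_mono)
    fix s :: real
    have "ennreal (t powr a) < dst (s powr (1 / p))" if s: "0 < s" "s < T t powr p"
    proof -
     have "s powr (1 / p) < T t" using powr_root_less[OF s(1) T_nonneg] s(2) by simp
     thus ?thesis using T_le_iff[OF True, of "s powr (1 / p)"] by (simp add: not_le)
    qed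
    thus "ind {0<..<T t powr p} s <= (ind {0<..} s * ind {0<..} (dst (s powr (1 / p)) - ennreal (t powr a)) :: ennreal)"
     by (auto simp: indicator_def diff_pos_iff)
   qed
   finally show ?thesis by (intro mult_left_mono) auto
  qed (simp add: wt_def)
 qed
 also have "... <= ennreal G" using G(1) unfolding layer_cake .
 finally show ?thesis .
qed

text \<open>On the layer between \<open>u j\<close> and \<open>v j\<close> the modulus of
  \<open>g\<close> is replaced by the upper end, and the measure of the layer by that of the
  superlevel set at the lower end.\<close>

lemma level_integral_le:
 assumes P: "0 < P" and N: "N : null_sets M"
  and E: "!!x. x : E ==> x : space M ==> x ~: N ==> g x ~= 0 ==> \<exists>j::nat. u j < abs (g x) & abs (g x) <= v j"
  and u: "!!j. dst (u j) <= ennreal (m j)" and v: "!!j. 0 <= v j" and m: "!!j. 0 <= m j"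
 shows "(\<integral>\<^sup>+x. ennreal (abs (g x) powr P) * ind E x \<partial>M) <= (\<Sum>j. ennreal (v j powr P * m j))"
proof -
 have "(\<integral>\<^sup>+x. ennreal (abs (g x) powr P) * ind E x \<partial>M) <= (\<integral>\<^sup>+x. (\<Sum>j. ennreal (v j powr P) * ind {0<..} (abs (g x) - u j)) \<partial>M)"
 proof (rule nn_integral_mono_AE, use AE_not_in[OF N] AE_space[of M] in eventually_elim)
  fix x assume x: "x ~: N" "x : space M"
  show "ennreal (abs (g x) powr P) * ind E x <= (\<Sum>j. ennreal (v j powr P) * ind {0<..} (abs (g x) - u j))"
  proof (cases "x : E & g x ~= 0")
   case True
   then obtain j where j: "u j < abs (g x)" "abs (g x) <= v j" using E x by blast
   have "ennreal (abs (g x) powr P) * ind E x <= ennreal (v j powr P) * ind {0<..} (abs (g x) - u j)"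
    using j P True by (auto intro!: ennreal_leI powr_mono2)
   also have "... <= (\<Sum>j. ennreal (v j powr P) * ind {0<..} (abs (g x) - u j))"
    by (rule ennreal_term_le_suminf[of "%j. ennreal (v j powr P) * ind {0<..} (abs (g x) - u j)"])
   finally show ?thesis .
  qed (auto simp: indicator_def)
 qed
 also have "... = (\<Sum>j. \<integral>\<^sup>+x. ennreal (v j powr P) * ind {0<..} (abs (g x) - u j) \<partial>M)" by (rule nn_integral_suminf) measurable
 also have "... <= (\<Sum>j. ennreal (v j powr P * m j))"
 proof (intro suminf_le allI)
  fix j
  have "(\<integral>\<^sup>+x. ennreal (v j powr P) * ind {0<..} (abs (g x) - u j) \<partial>M) = ennreal (v j powr P) * dst (u j)"
   unfolding dst_def by (rule nn_integral_cmult) measurable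
  also have "... <= ennreal (v j powr P) * ennreal (m j)" by (intro mult_left_mono u) simp
  also have "... = ennreal (v j powr P * m j)" using m by (simp add: ennreal_mult)
  finally show "(\<integral>\<^sup>+x. ennreal (v j powr P) * ind {0<..} (abs (g x) - u j) \<partial>M) <= ennreal (v j powr P * m j)" .
 qed auto
 finally show ?thesis .
qed

end

section \<open>Norms of the two parts of a function cut at its rearrangement\<close>

lemma powr_dyadic_quotient:
 assumes Y: "0 < (Y :: real)"
 shows "(Y / 2 ^ Suc j) powr (- x) * (Y / 2 ^ j) powr y = Y powr (y - x) * 2 powr x * (2 powr (x - y)) ^ j"
proof -
 have l: "ln (Y / 2 ^ n) = ln Y - real n * ln 2" for n using Y by (simp add: ln_div ln_realpow)
 have "(Y / 2 ^ Suc j) powr (- x) * (Y / 2 ^ j) powr y = exp (- x * (ln Y - real (Suc j) * ln 2) + y * (ln Y - real j * ln 2))"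
  unfolding exp_add powr_def l using Y by simp
 also have "... = exp ((y - x) * ln Y + x * ln 2 + real j * ((x - y) * ln 2))"
  by (rule arg_cong[where f=exp]) (simp add: algebra_simps)
 also have "... = Y powr (y - x) * 2 powr x * (2 powr (x - y)) ^ j"
  unfolding exp_add exp_of_nat_mult powr_def using Y by simp
 finally show ?thesis .
qed

lemma powr_dyadic_product:
 assumes Y: "0 < (Y :: real)"
 shows "(2 ^ j * Y) powr (- x) * (2 ^ Suc j * Y) powr y = Y powr (y - x) * 2 powr y * (2 powr (y - x)) ^ j"
proof -
 have l: "ln (2 ^ n * Y) = ln Y + real n * ln 2" for n using Y by (simp add: ln_mult ln_realpow)
 have "(2 ^ j * Y) powr (- x) * (2 ^ Suc j * Y) powr y = exp (- x * (ln Y + real j * ln 2) + y * (ln Y + real (Suc j) * ln 2))"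
  unfolding exp_add powr_def l using Y by simp
 also have "... = exp ((y - x) * ln Y + y * ln 2 + real j * ((y - x) * ln 2))"
  by (rule arg_cong[where f=exp]) (simp add: algebra_simps)
 also have "... = Y powr (y - x) * 2 powr y * (2 powr (y - x)) ^ j"
  unfolding exp_add exp_of_nat_mult powr_def using Y by simp
 finally show ?thesis .
qed

context level_sets_finite
begin

text \<open>Dilating \<open>t\<close> by this factor doubles t^a.\<close>

definition cc :: real where "cc = 2 powr (1 / a)"

text \<open>Normalized so that the integral of S^p dt/t is at most \<open>G / a\<close>.\<close>

definition S :: "real => real" where "S t = (t powr a) powr (1 / p) * T t"

text \<open>Smaller scales bound the part above \<open>T t\<close>, larger scales the part below.
  One function holds both sums so that one number \<open>h\<close> serves for both parts; the
  indices \<open>Suc j\<close> and \<open>j\<close> match the layers of the two estimates.\<close>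

definition Hs :: "real => real => ennreal" where
 "Hs r t = (\<Sum>j. ennreal (r ^ j * (2 * (S (inverse (cc ^ Suc j) * t) + S (cc ^ j * t)))))"

lemma cc: "0 < cc" "cc powr a = 2" "(cc ^ j) powr a = 2 ^ j"
proof -
 show "0 < cc" "cc powr a = 2" using a by (simp_all add: cc_def powr_powr)
 thus "(cc ^ j) powr a = 2 ^ j" by (simp add: powr_realpow[symmetric] powr_powr) (metis mult.commute powr_powr)
qed

lemma cc_powr: "0 < t ==> (cc ^ j * t) powr a = 2 ^ j * t powr a"
  "0 < t ==> (inverse (cc ^ j) * t) powr a = t powr a / 2 ^ j"
proof -
 show "(cc ^ j * t) powr a = 2 ^ j * t powr a" by (simp add: powr_mult cc(3))
 have "inverse (cc ^ j) powr a = inverse ((cc ^ j) powr a)" using cc(1) by (simp add: powr_def ln_inverse exp_minus)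
 thus "(inverse (cc ^ j) * t) powr a = t powr a / 2 ^ j" by (simp only: powr_mult cc(3) divide_inverse mult.commute)
qed

lemma S_nonneg: "0 <= S t" unfolding S_def using T_nonneg by simp

lemma S_measurable [measurable]: "S : borel_measurable borel" unfolding S_def[abs_def] by measurable

lemma Hs_measurable [measurable]: "Hs r : borel_measurable borel" unfolding Hs_def[abs_def] by measurable

lemma T_S: "0 < t ==> T t = S t * (t powr a) powr (- (1 / p))" unfolding S_def by (simp add: powr_minus)

text \<open>The layer between the values of \<open>T\<close> at t / cc^j and t / cc^(j+1) has
  measure at most t^a / 2^j. The P-norms of the layers are summed with ratio 2^(1/p - 1/P), and the
  l^1 sum dominates the l^P sum. Points above all these values form a null set.\<close>

lemma upper_high:
 assumes t: "0 < t" and P: "1 <= P" and r: "2 powr (1 / p - 1 / P) <= r" and h: "Hs r t = ennreal h" "0 <= h"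
 shows "(\<integral>\<^sup>+x. ennreal (abs (g x) powr P) * ind {x. T t < abs (g x)} x \<partial>M)
  <= ennreal (((t powr a) powr (1 / P - 1 / p) * h) powr P)"
proof -
 let ?u = "%j. inverse (cc ^ j) * t" and ?Y = "t powr a" and ?e = "(t powr a) powr (1 / P - 1 / p)"
 have u: "0 < ?u j" for j using t cc(1) by simp
 have Y: "0 < ?Y" using t by simp
 have r0: "0 <= r" by (rule order_trans[OF powr_ge_zero r])
 define N where "N = {x : space M. ALL j. T (?u j) < abs (g x)}"
 have N: "N : null_sets M"
 proof (rule null_setsI)
  show Nm: "N : sets M" unfolding N_def by measurable
  have le: "emeasure M N <= ennreal (?Y * (1/2) ^ j)" for j
  proof -
   have "emeasure M N <= dst (T (?u j))" unfolding dst_eq by (rule emeasure_mono) (auto simp: N_def)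
   also have "... <= ennreal (?u j powr a)" by (rule dst_T[OF u])
   finally show ?thesis unfolding cc_powr(2)[OF t] by (simp add: power_divide)
  qed
  have "(%j. ennreal (?Y * (1/2) ^ j)) \<longlonglongrightarrow> ennreal (?Y * 0)"
   by (intro tendsto_ennrealI tendsto_mult tendsto_const LIMSEQ_power_zero) simp
  hence "emeasure M N <= ennreal (?Y * 0)" by (rule LIMSEQ_le_const) (use le in auto)
  thus "emeasure M N = 0" by simp
 qed
 define z where "z j = T (?u (Suc j)) * (?Y / 2 ^ j) powr (1 / P)" for j
 have z0: "0 <= z j" for j unfolding z_def using T_nonneg by simp
 have zP: "z j powr P = T (?u (Suc j)) powr P * (?Y / 2 ^ j)" for j
  unfolding z_def powr_mult using P Y by (simp add: powr_powr)
 have "(\<integral>\<^sup>+x. ennreal (abs (g x) powr P) * ind {x. T t < abs (g x)} x \<partial>M) <= (\<Sum>j. ennreal (T (?u (Suc j)) powr P * (?Y / 2 ^ j)))"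
 proof (rule level_integral_le[OF _ N, where u="%j. T (?u j)"])
  fix x assume x: "x : {x. T t < abs (g x)}" "x : space M" "x ~: N"
  hence "EX j. \<not> T (?u j) < abs (g x)" by (simp add: N_def)
  hence ex0: "\<not> T (?u (LEAST j. \<not> T (?u j) < abs (g x))) < abs (g x)" by (rule LeastI_ex)
  define k where "k = (LEAST j. \<not> T (?u j) < abs (g x))"
  note ex = ex0[folded k_def]
  have "k ~= 0"
  proof
   assume "k = 0"
   with ex x(1) show False by simp
  qed
  then obtain j where j: "k = Suc j" by (cases k) auto
  have "T (?u j) < abs (g x)" using not_less_Least[of j "%j. \<not> T (?u j) < abs (g x)"] j unfolding k_def[symmetric] by simp
  moreover have "abs (g x) <= T (?u (Suc j))" using ex unfolding j by (simp only: not_less)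
  ultimately show "EX j. T (?u j) < abs (g x) & abs (g x) <= T (?u (Suc j))" by blast
 next
  show "dst (T (?u j)) <= ennreal (?Y / 2 ^ j)" for j using dst_T[OF u[of j]] unfolding cc_powr(2)[OF t] .
 qed (use P T_nonneg in auto)
 also have "... = (\<Sum>j. ennreal (z j powr P))" unfolding zP ..
 also have "... <= ennreal ((?e * h) powr P)"
 proof (rule suminf_powr_le[OF P z0])
  have zle: "z j <= ?e * (r ^ j * (2 * (S (?u (Suc j)) + S (cc ^ j * t))))" for j
  proof -
   have "z j = S (?u (Suc j)) * ((?Y / 2 ^ Suc j) powr (- (1 / p)) * (?Y / 2 ^ j) powr (1 / P))"
    unfolding z_def T_S[OF u] cc_powr(2)[OF t] by (simp only: mult.assoc)
   also have "... = ?e * (2 powr (1 / p) * (2 powr (1 / p - 1 / P)) ^ j * S (?u (Suc j)))"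
    unfolding powr_dyadic_quotient[OF Y] by (simp only: mult_ac)
   also have "... <= ?e * (2 * r ^ j * (S (?u (Suc j)) + S (cc ^ j * t)))"
   proof -
    \<comment> \<open>The reason for the factor 2 in \<open>Hs\<close>.\<close>
    have "2 powr (1 / p) <= 2 powr (1 :: real)" using p by (intro powr_mono) auto
    thus ?thesis using r r0 S_nonneg by (intro mult_left_mono mult_mono power_mono) auto
   qed
   finally show ?thesis by (simp only: mult_ac)
  qed
  have "(\<Sum>j. ennreal (z j)) <= (\<Sum>j. ennreal ?e * ennreal (r ^ j * (2 * (S (?u (Suc j)) + S (cc ^ j * t)))))"
   using zle r0 S_nonneg by (intro suminf_le allI) (auto simp: ennreal_mult[symmetric] intro!: ennreal_leI)
  also have "... = ennreal ?e * Hs r t" unfolding Hs_def by simp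
  finally show "(\<Sum>j. ennreal (z j)) <= ennreal (?e * h)" unfolding h(1) using h(2) by (simp add: ennreal_mult)
 qed (use h in simp)
 finally show ?thesis .
qed

text \<open>The same with growing scales, where the layers have measure at most 2^(j+1) t^a. Every
  non-zero value is reached, since the distribution function is finite at positive levels.\<close>

lemma upper_low:
 assumes t: "0 < t" and P: "1 <= P" and r: "2 powr (1 / P - 1 / p) <= r" and h: "Hs r t = ennreal h" "0 <= h"
 shows "(\<integral>\<^sup>+x. ennreal (abs (g x) powr P) * ind {x. \<not> T t < abs (g x)} x \<partial>M)
  <= ennreal (((t powr a) powr (1 / P - 1 / p) * h) powr P)"
proof -
 let ?u = "%j. cc ^ j * t" and ?Y = "t powr a" and ?e = "(t powr a) powr (1 / P - 1 / p)"
 have u: "0 < ?u j" for j using t cc(1) by simp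
 have Y: "0 < ?Y" using t by simp
 have r0: "0 <= r" by (rule order_trans[OF powr_ge_zero r])
 define z where "z j = T (?u j) * (2 ^ Suc j * ?Y) powr (1 / P)" for j
 have z0: "0 <= z j" for j unfolding z_def using T_nonneg by simp
 have zP: "z j powr P = T (?u j) powr P * (2 ^ Suc j * ?Y)" for j
  unfolding z_def powr_mult[of "T (?u j)"] using P Y by (simp add: powr_powr)
 have "(\<integral>\<^sup>+x. ennreal (abs (g x) powr P) * ind {x. \<not> T t < abs (g x)} x \<partial>M) <= (\<Sum>j. ennreal (T (?u j) powr P * (2 ^ Suc j * ?Y)))"
 proof (rule level_integral_le[where u="%j. T (?u (Suc j))" and N="{}"])
  fix x assume x: "x : {x. \<not> T t < abs (g x)}" "x : space M" "g x ~= 0"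
  have "EX j. T (?u j) < abs (g x)"
  proof -
   \<comment> \<open>Half the value leaves room for a strict inequality after
     \<open>T (?u j) <= l\<close>.\<close>
   define l where "l = abs (g x) / 2"
   have l: "0 < l" "l < abs (g x)" using x by (auto simp: l_def)
   obtain j where "G / l powr p / ?Y < 2 ^ j" using real_arch_pow[of 2 "G / l powr p / ?Y"] by auto
   hence "G / l powr p <= 2 ^ j * ?Y" by (simp only: pos_divide_less_eq[OF Y] less_imp_le)
   hence "dst l <= ennreal (?u j powr a)"
    unfolding cc_powr(1)[OF t] by (intro order_trans[OF dst_finite[OF l(1)]] ennreal_leI)
   hence "T (?u j) <= l" using T_le_iff[OF u, of l j] l by simp
   thus ?thesis using l(2) by (intro exI[of _ j]) simp
  qed
  hence ex0: "T (?u (LEAST j. T (?u j) < abs (g x))) < abs (g x)" by (rule LeastI_ex)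
  define k where "k = (LEAST j. T (?u j) < abs (g x))"
  note ex = ex0[folded k_def]
  have "k ~= 0"
  proof
   assume "k = 0"
   with ex x(1) show False by simp
  qed
  then obtain j where j: "k = Suc j" by (cases k) auto
  have "\<not> T (?u j) < abs (g x)" using not_less_Least[of j "%j. T (?u j) < abs (g x)"] j unfolding k_def[symmetric] by simp
  moreover have "T (?u (Suc j)) < abs (g x)" using ex unfolding j .
  ultimately show "EX j. T (?u (Suc j)) < abs (g x) & abs (g x) <= T (?u j)" by (auto simp only: not_less)
 next
  show "dst (T (?u (Suc j))) <= ennreal (2 ^ Suc j * ?Y)" for j using dst_T[OF u[of "Suc j"]] unfolding cc_powr(1)[OF t] .
 qed (use P T_nonneg in auto)
 also have "... = (\<Sum>j. ennreal (z j powr P))" unfolding zP ..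
 also have "... <= ennreal ((?e * h) powr P)"
 proof (rule suminf_powr_le[OF P z0])
  have zle: "z j <= ?e * (r ^ j * (2 * (S (inverse (cc ^ Suc j) * t) + S (?u j))))" for j
  proof -
   have "z j = S (?u j) * ((2 ^ j * ?Y) powr (- (1 / p)) * (2 ^ Suc j * ?Y) powr (1 / P))"
    unfolding z_def T_S[OF u] cc_powr(1)[OF t] by (simp only: mult.assoc)
   also have "... = ?e * (2 powr (1 / P) * (2 powr (1 / P - 1 / p)) ^ j * S (?u j))"
    unfolding powr_dyadic_product[OF Y] by (simp only: mult_ac)
   also have "... <= ?e * (2 * r ^ j * (S (inverse (cc ^ Suc j) * t) + S (?u j)))"
   proof -
    have "2 powr (1 / P) <= 2 powr (1 :: real)" using P by (intro powr_mono) auto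
    thus ?thesis using r r0 S_nonneg by (intro mult_left_mono mult_mono power_mono) auto
   qed
   finally show ?thesis by (simp only: mult_ac)
  qed
  have "(\<Sum>j. ennreal (z j)) <= (\<Sum>j. ennreal ?e * ennreal (r ^ j * (2 * (S (inverse (cc ^ Suc j) * t) + S (?u j)))))"
   using zle r0 S_nonneg by (intro suminf_le allI) (auto simp: ennreal_mult[symmetric] intro!: ennreal_leI)
  also have "... = ennreal ?e * Hs r t" unfolding Hs_def by simp
  finally show "(\<Sum>j. ennreal (z j)) <= ennreal (?e * h)" unfolding h(1) using h(2) by (simp add: ennreal_mult)
 qed (use h in simp)
 finally show ?thesis .
qed

text \<open>For the exponent infinity no summation is required: the term with j = 0 already contains
  \<open>S t\<close>.\<close>

lemma upper_bounded:
 assumes t: "0 < t" and r: "0 <= r" and h: "Hs r t = ennreal h" "0 <= h" and x: "\<not> T t < abs (g x)"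
 shows "abs (g x) <= (t powr a) powr (- (1 / p)) * h"
proof -
 have "ennreal (r ^ 0 * (2 * (S (inverse (cc ^ Suc 0) * t) + S (cc ^ 0 * t)))) <= ennreal h"
  unfolding h(1)[symmetric] Hs_def by (rule ennreal_term_le_suminf[of "%j. ennreal (r ^ j * (2 * (S (inverse (cc ^ Suc j) * t) + S (cc ^ j * t))))" 0])
 hence "r ^ 0 * (2 * (S (inverse (cc ^ Suc 0) * t) + S (cc ^ 0 * t))) <= h" using h(2) by (subst (asm) ennreal_le_iff)
 hence "S t <= h" using S_nonneg[of t] S_nonneg[of "inverse (cc ^ Suc 0) * t"] by simp
 hence "S t * (t powr a) powr (- (1 / p)) <= h * (t powr a) powr (- (1 / p))" by (intro mult_right_mono) auto
 thus ?thesis using x T_S[OF t] by (simp add: mult.commute)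
qed

lemma S_integral: "(\<integral>\<^sup>+t. ennreal (S t powr p) * ennreal (1 / t) * ind {0<..} t \<partial>lborel) <= ennreal (G / a)"
proof -
 have "(\<integral>\<^sup>+t. ennreal (S t powr p) * ennreal (1 / t) * ind {0<..} t \<partial>lborel)
  = (\<integral>\<^sup>+t. ennreal (1 / a) * (wt a t * ennreal (T t powr p)) \<partial>lborel)"
 proof (rule nn_integral_cong)
  fix t :: real
  show "ennreal (S t powr p) * ennreal (1 / t) * ind {0<..} t = ennreal (1 / a) * (wt a t * ennreal (T t powr p))"
  proof (cases "0 < t")
   case True
   have "S t powr p = t powr a * T t powr p" unfolding S_def powr_mult using p by (simp add: powr_powr)
   hence "S t powr p * (1 / t) = (1 / a) * (a * t powr (a - 1) * T t powr p)" using True a by (simp add: powr_diff)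
   moreover have "0 <= S t powr p" "0 <= T t powr p" "0 <= a * t powr (a - 1)" using a by auto
   ultimately show ?thesis using True a by (simp add: wt_def ennreal_mult[symmetric] del: ennreal_mult)
  qed (simp add: wt_def)
 qed
 also have "... = ennreal (1 / a) * (\<integral>\<^sup>+t. wt a t * ennreal (T t powr p) \<partial>lborel)" by (rule nn_integral_cmult) measurable
 also have "... <= ennreal (1 / a) * ennreal G" by (intro mult_left_mono T_integral) simp
 also have "... = ennreal (G / a)" using a G(2) by (simp add: ennreal_mult[symmetric])
 finally show ?thesis .
qed

text \<open>Hardy's inequality in dyadic form: by dilation invariance of dt/t all scales of
  \<open>S\<close> have the same integral, and the weights \<open>\<rho> ^ j\<close> sum.\<close>

lemma Hs_integral:
 assumes r: "0 < r" and rho: "0 < \<rho>" "\<rho> < 1" and C: "0 < C"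
  and H: "!!y. (!!j. 0 <= y j) ==> ennpowr (\<Sum>j. ennreal (r ^ j * y j)) p <= ennreal C * (\<Sum>j. ennreal (\<rho> ^ j * y j powr p))"
 shows "(\<integral>\<^sup>+t. ennpowr (Hs r t) p * ennreal (1 / t) * ind {0<..} t \<partial>lborel) <= ennreal (C * (4 powr p * (1 / (1 - \<rho>))) * (2 * (G / a)))"
proof -
 let ?D = "%t. ennreal (1 / t) * ind {0<..} t"
 let ?f = "%j t. ennreal (S (inverse (cc ^ Suc j) * t) powr p)" and ?g = "%j t. ennreal (S (cc ^ j * t) powr p)"
 have pt: "ennpowr (Hs r t) p <= ennreal C * (\<Sum>j. ennreal (\<rho> ^ j * 4 powr p) * (?f j t + ?g j t))" for t
 proof -
  have "ennpowr (Hs r t) p <= ennreal C * (\<Sum>j. ennreal (\<rho> ^ j * (2 * (S (inverse (cc ^ Suc j) * t) + S (cc ^ j * t))) powr p))"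
   unfolding Hs_def by (rule H) (use S_nonneg in simp)
  also have "... <= ennreal C * (\<Sum>j. ennreal (\<rho> ^ j * 4 powr p) * (?f j t + ?g j t))"
  proof (intro mult_left_mono suminf_le allI)
   fix j
   let ?x = "S (inverse (cc ^ Suc j) * t)" and ?y = "S (cc ^ j * t)"
   have "(2 * (?x + ?y)) powr p = 2 powr p * (?x + ?y) powr p" by (rule powr_mult)
   also have "... <= 2 powr p * (2 powr (p - 1) * (?x powr p + ?y powr p))"
    by (intro mult_left_mono powr_add_le p S_nonneg) auto
   also have "... <= 2 powr p * (2 powr p * (?x powr p + ?y powr p))"
    by (intro mult_left_mono mult_right_mono powr_mono) auto
   also have "... = (2 * 2) powr p * (?x powr p + ?y powr p)" unfolding powr_mult by (simp only: mult.assoc)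
   finally have "(2 * (?x + ?y)) powr p <= 4 powr p * (?x powr p + ?y powr p)" by simp
   hence "\<rho> ^ j * (2 * (?x + ?y)) powr p <= (\<rho> ^ j * 4 powr p) * (?x powr p + ?y powr p)"
    using rho unfolding mult.assoc by (intro mult_left_mono) auto
   hence "ennreal (\<rho> ^ j * (2 * (?x + ?y)) powr p) <= ennreal ((\<rho> ^ j * 4 powr p) * (?x powr p + ?y powr p))" by (rule ennreal_leI)
   also have "... = ennreal (\<rho> ^ j * 4 powr p) * (?f j t + ?g j t)"
    using rho by (subst ennreal_mult) (auto simp: ennreal_plus)
   finally show "ennreal (\<rho> ^ j * (2 * (?x + ?y)) powr p) <= ennreal (\<rho> ^ j * 4 powr p) * (?f j t + ?g j t)" .
  qed auto
  finally show ?thesis .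
 qed
 have I1: "(\<integral>\<^sup>+t. ?f j t * ?D t \<partial>lborel) <= ennreal (G / a)" for j
  using nn_integral_scale[of "%t. ennreal (S t powr p)" "inverse (cc ^ Suc j)"] S_integral cc(1) by (simp add: mult.assoc)
 have I2: "(\<integral>\<^sup>+t. ?g j t * ?D t \<partial>lborel) <= ennreal (G / a)" for j
  using nn_integral_scale[of "%t. ennreal (S t powr p)" "cc ^ j"] S_integral cc(1) by (simp add: mult.assoc)
 have "(\<integral>\<^sup>+t. ennpowr (Hs r t) p * ennreal (1 / t) * ind {0<..} t \<partial>lborel)
  <= (\<integral>\<^sup>+t. ennreal C * (\<Sum>j. ennreal (\<rho> ^ j * 4 powr p) * (?f j t * ?D t + ?g j t * ?D t)) \<partial>lborel)"
 proof (rule nn_integral_mono)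
  fix t
  have "ennpowr (Hs r t) p * ?D t <= (ennreal C * (\<Sum>j. ennreal (\<rho> ^ j * 4 powr p) * (?f j t + ?g j t))) * ?D t"
   by (intro mult_right_mono pt) simp
  also have "... = ennreal C * (\<Sum>j. (ennreal (\<rho> ^ j * 4 powr p) * (?f j t + ?g j t)) * ?D t)"
   by (simp only: ennreal_suminf_multc mult.assoc[of "ennreal C"])
  finally show "ennpowr (Hs r t) p * ennreal (1 / t) * ind {0<..} t
   <= ennreal C * (\<Sum>j. ennreal (\<rho> ^ j * 4 powr p) * (?f j t * ?D t + ?g j t * ?D t))" by (simp only: mult.assoc distrib_right)
 qed
 also have "... = ennreal C * (\<integral>\<^sup>+t. (\<Sum>j. ennreal (\<rho> ^ j * 4 powr p) * (?f j t * ?D t + ?g j t * ?D t)) \<partial>lborel)"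
  by (rule nn_integral_cmult) measurable
 also have "(\<integral>\<^sup>+t. (\<Sum>j. ennreal (\<rho> ^ j * 4 powr p) * (?f j t * ?D t + ?g j t * ?D t)) \<partial>lborel)
  = (\<Sum>j. \<integral>\<^sup>+t. ennreal (\<rho> ^ j * 4 powr p) * (?f j t * ?D t + ?g j t * ?D t) \<partial>lborel)"
  by (rule nn_integral_suminf) measurable
 also have "... <= (\<Sum>j. ennreal (\<rho> ^ j * 4 powr p) * ennreal (2 * (G / a)))"
 proof (intro suminf_le allI)
  fix j
  have "(\<integral>\<^sup>+t. ennreal (\<rho> ^ j * 4 powr p) * (?f j t * ?D t + ?g j t * ?D t) \<partial>lborel)
   = ennreal (\<rho> ^ j * 4 powr p) * ((\<integral>\<^sup>+t. ?f j t * ?D t \<partial>lborel) + (\<integral>\<^sup>+t. ?g j t * ?D t \<partial>lborel))"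
   by (subst nn_integral_cmult, measurable) (subst nn_integral_add, measurable)
  also have "... <= ennreal (\<rho> ^ j * 4 powr p) * (ennreal (G / a) + ennreal (G / a))" by (intro mult_left_mono add_mono I1 I2) simp
  also have "ennreal (G / a) + ennreal (G / a) = ennreal (2 * (G / a))" using G(2) a by (simp add: ennreal_plus[symmetric] del: ennreal_plus)
  finally show "(\<integral>\<^sup>+t. ennreal (\<rho> ^ j * 4 powr p) * (?f j t * ?D t + ?g j t * ?D t) \<partial>lborel) <= ennreal (\<rho> ^ j * 4 powr p) * ennreal (2 * (G / a))" .
 qed auto
 also have "... = (\<Sum>j. ennreal (\<rho> ^ j * 4 powr p)) * ennreal (2 * (G / a))" by (rule ennreal_suminf_multc)
 also have "(\<Sum>j. ennreal (\<rho> ^ j * 4 powr p)) = ennreal (4 powr p * (1 / (1 - \<rho>)))"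
 proof -
  have s: "summable (%j. \<rho> ^ j)" by (rule summable_geometric) (use rho in simp)
  have "(\<Sum>j. ennreal (\<rho> ^ j * 4 powr p)) = ennreal (\<Sum>j. \<rho> ^ j * 4 powr p)"
   by (rule suminf_ennreal2[OF _ summable_mult2[OF s]]) (use rho in simp)
  also have "(\<Sum>j. \<rho> ^ j * 4 powr p) = (\<Sum>j. \<rho> ^ j) * 4 powr p" by (rule suminf_mult2[OF s, symmetric])
  also have "(\<Sum>j. \<rho> ^ j) = 1 / (1 - \<rho>)" by (rule suminf_geometric) (use rho in simp)
  finally show ?thesis by (simp only: mult.commute)
 qed
 finally show ?thesis using C rho a G(2) by (simp add: ennreal_mult[symmetric] mult.assoc mult_left_mono)
qed

end

section \<open>Sobolev spaces and gradients\<close>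

lemma edge_eq_segment: "edge w i = closed_segment (pw w (q 5)) (pw w (q i))"
proof -
 let ?c = "1 / 3 ^ length w :: real"
 have lin: "linear (%x :: real \<times> real. ?c *\<^sub>R x)" by (intro bounded_linear.linear bounded_linear_intros)
 have eq: "pw w ` A = (%x. pw w 0 + x) ` ((%x. ?c *\<^sub>R x) ` A)" for A
  unfolding image_image by (rule image_cong[OF refl], rule psi_word_affine)
 show ?thesis
  unfolding edge_segment eq closed_segment_linear_image[OF lin, symmetric] closed_segment_translation[symmetric]
  by (simp only: psi_word_affine[symmetric])
qed

text \<open>A segment determines its pair of end points, so an adjacent pair comes from the name of
  an edge up to order.\<close>

lemma adjacentE:
 assumes "adjacent n u v"
 obtains w i where "(w, i) : earcs n" "closed_segment u v = edge w i"
  "(u = pw w (q 5) & v = pw w (q i)) \<or> (u = pw w (q i) & v = pw w (q 5))"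
proof -
 have "closed_segment u v : edges n" using assms by (simp add: adjacent_def)
 then obtain w i where wi: "(w, i) : earcs n" "closed_segment u v = edge w i" by (rule edgesE)
 have "{u, v} = {pw w (q 5), pw w (q i)}" using wi(2) unfolding edge_eq_segment closed_segment_eq .
 hence "(u = pw w (q 5) & v = pw w (q i)) \<or> (u = pw w (q i) & v = pw w (q 5))"
  by (simp only: doubleton_eq_iff)
 with wi show thesis by (rule that)
qed

lemma earcs_orient: "(w, i) : earcs n ==> vdist (q 5) (pw w (q i)) - vdist (q 5) (pw w (q 5)) = esgn w i / 3 ^ n"
 by (rule vdist_orient) (simp_all add: earcs_iff)

lemma esgn_cases: obtains "esgn w i = 1" | "esgn w i = -1" by (cases "i = entry 5 w") (auto simp: esgn_def)

lemma edge_adjacent: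
 assumes e: "(w, i) : earcs n"
 shows "adjacent n (pw w (q 5)) (pw w (q i))" "adjacent n (pw w (q i)) (pw w (q 5))"
proof -
 have "closed_segment (pw w (q 5)) (pw w (q i)) : edges n" using edgesI[OF e] unfolding edge_eq_segment .
 moreover have "pw w (q 5) : V n" "pw w (q i) : V n" using e by (auto simp: earcs_iff intro!: psi_word_in_V)
 ultimately show "adjacent n (pw w (q 5)) (pw w (q i))" "adjacent n (pw w (q i)) (pw w (q 5))"
  unfolding adjacent_def by (simp_all only: closed_segment_commute[of "pw w (q i)"] simp_thms)
qed

text \<open>By \<open>earcs_orient\<close> the sign of the difference of the distances to
  \<open>q 5\<close> is \<open>esgn\<close>, so the orientation of adjacent pairs becomes the sign
  in \<open>lgrad\<close>.\<close>

lemma is_gradient_iff: "is_gradient f g \<longleftrightarrow> lgrad f g & integrable vnu g"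
proof
 assume L: "is_gradient f g"
 hence int: "integrable vnu g" and
  I: "!!n u v. adjacent n u v ==> vdist (q 5) u < vdist (q 5) v ==> f v - f u = (LINT x:closed_segment u v|vnu. g x)"
  unfolding is_gradient_def by blast+
 have "lgrad f g" unfolding lgrad_def
 proof (intro conjI allI impI)
  show "g : borel_measurable vnu" using int by simp
  fix n w i assume e: "(w, i) : earcs n"
  show "set_integrable vnu (edge w i) g"
   unfolding set_integrable_def by (rule integrable_mult_indicator[OF edge_vnu[OF e] int])
  note o = earcs_orient[OF e]
  show "incr f w i = esgn w i * (LINT x:edge w i|vnu. g x)"
  proof (rule esgn_cases[of w i])
   assume s: "esgn w i = 1"
   have "(0 :: real) < 1 / 3 ^ n" by simp
   hence "vdist (q 5) (pw w (q 5)) < vdist (q 5) (pw w (q i))" using o unfolding s by linarith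
   from I[OF edge_adjacent(1)[OF e] this] show ?thesis unfolding s incr_def edge_eq_segment by simp
  next
   assume s: "esgn w i = -1"
   have "(0 :: real) < 1 / 3 ^ n" by simp
   hence "vdist (q 5) (pw w (q i)) < vdist (q 5) (pw w (q 5))" using o unfolding s minus_divide_left[symmetric] by linarith
   from I[OF edge_adjacent(2)[OF e] this] show ?thesis
    unfolding s incr_def edge_eq_segment closed_segment_commute[of "pw w (q i)"] by simp
  qed
 qed
 with int show "lgrad f g & integrable vnu g" by simp
next
 assume L: "lgrad f g & integrable vnu g"
 show "is_gradient f g" unfolding is_gradient_def
 proof (intro conjI allI impI)
  show "integrable vnu g" using L by simp
  fix n u v assume a: "adjacent n u v & vdist (q 5) u < vdist (q 5) v"
  obtain w i where wi: "(w, i) : earcs n" "closed_segment u v = edge w i"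
   and uv: "(u = pw w (q 5) & v = pw w (q i)) \<or> (u = pw w (q i) & v = pw w (q 5))"
   by (rule adjacentE[OF conjunct1[OF a]])
  note o = earcs_orient[OF wi(1)]
  have pos: "(0 :: real) < 1 / 3 ^ n" by simp
  have inc: "f (pw w (q i)) - f (pw w (q 5)) = esgn w i * (LINT x:edge w i|vnu. g x)"
   using lgradD(3)[OF conjunct1[OF L] wi(1)] unfolding incr_def .
  from uv show "f v - f u = (LINT x:closed_segment u v|vnu. g x)"
  proof
   assume uv: "u = pw w (q 5) & v = pw w (q i)"
   have "esgn w i = 1"
   proof (rule esgn_cases[of w i])
    assume "esgn w i = -1"
    thus ?thesis using o a pos uv by (simp add: minus_divide_left[symmetric])
   qed
   thus ?thesis unfolding wi(2) using inc uv by simp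
  next
   assume uv: "u = pw w (q i) & v = pw w (q 5)"
   have "esgn w i = -1"
   proof (rule esgn_cases[of w i])
    assume "esgn w i = 1"
    thus ?thesis using o a pos uv by simp
   qed
   thus ?thesis unfolding wi(2) using inc uv by simp
  qed
 qed
qed

lemma sobolev_seminorm_1_eq:
 assumes fg: "lgrad f g" and int: "integrable vnu g" shows "sobolev_seminorm_1 f = (\<integral>\<^sup>+x. ennreal \<bar>g x\<bar> \<partial>vnu)"
 unfolding sobolev_seminorm_1_def
proof (rule the_equality)
 show "EX g'. is_gradient f g' & (\<integral>\<^sup>+x. ennreal \<bar>g x\<bar> \<partial>vnu) = (\<integral>\<^sup>+x. ennreal \<bar>g' x\<bar> \<partial>vnu)"
  using fg int by (intro exI[of _ g]) (simp add: is_gradient_iff)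
 fix l assume "EX g'. is_gradient f g' & l = (\<integral>\<^sup>+x. ennreal \<bar>g' x\<bar> \<partial>vnu)"
 then obtain g' where g': "lgrad f g'" "l = (\<integral>\<^sup>+x. ennreal \<bar>g' x\<bar> \<partial>vnu)" by (auto simp: is_gradient_iff)
 show "l = (\<integral>\<^sup>+x. ennreal \<bar>g x\<bar> \<partial>vnu)"
  unfolding g'(2) by (rule nn_integral_cong_AE, use lgrad_unique[OF g'(1) fg] in eventually_elim) simp
qed

lemma integrable_vnu_iff: "g : borel_measurable vnu ==> integrable vnu g \<longleftrightarrow> (\<integral>\<^sup>+x. ennreal \<bar>g x\<bar> \<partial>vnu) < \<top>"
 by (simp add: integrable_iff_bounded)

text \<open>For s >= 0 a bound on the P-norm of the gradient, in one predicate for finite and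
  infinite exponents so that both ends of the couple are treated alike.\<close>

definition gbound :: "ereal => (real \<times> real => real) => real => bool" where
 "gbound P g s \<longleftrightarrow> (if P = \<infinity> then AE x in vnu. \<bar>g x\<bar> <= s
  else (\<integral>\<^sup>+x. ennreal (abs (g x) powr real_of_ereal P) \<partial>vnu) <= ennreal (s powr real_of_ereal P))"

lemma sobolev_inf_bound:
 assumes s: "sobolev_seminorm_inf f <= ennreal s" "0 <= s" and xy: "x : K" "y : K"
 shows "abs (f x - f y) <= s * vdist x y"
proof (cases "x = y")
 case True
 have "0 <= vdist x y" using order_trans[OF zero_le_dist dist_le_vdist[OF xy]] .
 thus ?thesis using True s(2) by simp
next
 case False
 hence "0 < dist x y" by simp
 hence pos: "0 < vdist x y" using dist_le_vdist[OF xy] by linarith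
 have "(case (x, y) of (x, y) => ennreal (abs (f x - f y) / vdist x y)) <= sobolev_seminorm_inf f"
  unfolding sobolev_seminorm_inf_def by (rule SUP_upper) (use False xy in simp)
 hence "ennreal (abs (f x - f y) / vdist x y) <= ennreal s" using s(1) by simp
 hence "abs (f x - f y) / vdist x y <= s" using s(2) by (subst (asm) ennreal_le_iff)
 thus ?thesis using pos by (simp add: divide_le_eq)
qed

lemma lipschitz_continuous:
 assumes L: "!!x y. x : K ==> y : K ==> \<bar>f x - f y\<bar> <= L * vdist x y" and L0: "0 <= L"
 shows "continuous_on K (f :: real \<times> real => real)"
proof (rule lipschitz_on_continuous_on[where L="L * 10"], rule lipschitz_onI)
 fix x y assume xy: "x : K" "y : K"
 have "abs (f x - f y) <= L * (10 * dist x y)" by (intro order_trans[OF L[OF xy]] mult_left_mono vdist_le_dist xy L0)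
 thus "dist (f x) (f y) <= L * 10 * dist x y" by (simp add: dist_real_def)
qed (use L0 in simp)

text \<open>From functions to gradients: by definition for the exponent 1, by the Lipschitz bound on
  edges for infinity, by the energies in between. With \<open>gradient_W1\<close> it replaces all
  three kinds of spaces by Lebesgue spaces on the skeleton.\<close>

lemma W1_gradient:
 assumes P: "1 <= P" shows "\<exists>C>0. ALL f s. f : W1 P --> 0 <= s --> W1_seminorm P f <= ennreal s -->
  continuous_on K f & (EX g. lgrad f g & gbound P g (C * s))"
proof -
 consider "P = 1" | "P = \<infinity>" | p where "P = ereal p" "1 < p" using P by (cases P) (auto simp: one_ereal_def less_le)
 thus ?thesis
 proof cases
  case 1
  show ?thesis
  proof (intro exI[of _ 1] conjI allI impI)
   fix f s assume f: "f : W1 P" and s: "0 <= s" "W1_seminorm P f <= ennreal s"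
   from f show "continuous_on K f" by (simp add: 1 W1_def sobolev_1_def)
   from f obtain g where g: "lgrad f g" "integrable vnu g" by (auto simp: 1 W1_def sobolev_1_def is_gradient_iff)
   have "(\<integral>\<^sup>+x. ennreal \<bar>g x\<bar> \<partial>vnu) <= ennreal s" using s(2) sobolev_seminorm_1_eq[OF g] by (simp add: 1 W1_seminorm_def)
   hence "gbound P g (1 * s)" using s(1) by (simp add: gbound_def 1)
   with g(1) show "EX g. lgrad f g & gbound P g (1 * s)" by blast
  qed simp
 next
  case 2
  show ?thesis
  proof (intro exI[of _ 1] conjI allI impI)
   fix f s assume f: "f : W1 P" and s: "0 <= s" "W1_seminorm P f <= ennreal s"
   have lip: "abs (f x - f y) <= s * vdist x y" if "x : K" "y : K" for x y
    by (rule sobolev_inf_bound[OF _ s(1) that]) (use s(2) in \<open>simp add: 2 W1_seminorm_def\<close>)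
   show "continuous_on K f" by (rule lipschitz_continuous[OF lip s(1)])
   have "abs (incr f w i) <= s / 3 ^ n" if e: "(w, i) : earcs n" for n w i
   proof -
    have wi: "w : words n" "i : {1..4}" using e by (auto simp: earcs_iff)
    hence "pw w (q i) : K" "pw w (q 5) : K" by (auto intro!: psi_word_vicsek q_vicsek)
    from lip[OF this] show ?thesis unfolding incr_def vdist_edge[OF wi] by simp
   qed
   then obtain g where "lgrad f g" "AE x in vnu. \<bar>g x\<bar> <= s" by (rule lipschitz_gradient)
   hence "lgrad f g & gbound P g (1 * s)" by (simp add: gbound_def 2)
   thus "EX g. lgrad f g & gbound P g (1 * s)" by blast
  qed simp
 next
  case 3
  obtain C where C: "0 < C" "ALL f s n. continuous_on K f --> 0 <= s --> sobolev_seminorm_p p f <= ennreal s -->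
   energy p (incr f) n <= C * s powr p" using sobolev_lower[OF 3(2)] by blast
  have P1: "P ~= 1" "P ~= \<infinity>" using 3 by (auto simp: one_ereal_def)
  show ?thesis
  proof (intro exI[of _ "C powr (1 / p)"] conjI allI impI)
   show "0 < C powr (1 / p)" using C(1) by simp
   fix f s assume f: "f : W1 P" and s: "0 <= s" "W1_seminorm P f <= ennreal s"
   from f show cont: "continuous_on K f" using P1 by (simp add: W1_def sobolev_p_def)
   have "sobolev_seminorm_p p f <= ennreal s" using s(2) P1 3(1) by (simp add: W1_seminorm_def)
   hence "energy p (incr f) n <= C * s powr p" for n using C(2) cont s(1) by blast
   then obtain g where g: "lgrad f g" "(\<integral>\<^sup>+x. ennreal (abs (g x) powr p) \<partial>vnu) <= ennreal (C * s powr p)"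
    by (rule energy_gradient[OF 3(2)])
   have "(C powr (1 / p) * s) powr p = C * s powr p" using C(1) 3(2) by (simp add: powr_mult powr_powr)
   hence "lgrad f g & gbound P g (C powr (1 / p) * s)" using g P1 3(1) by (simp add: gbound_def)
   thus "EX g. lgrad f g & gbound P g (C powr (1 / p) * s)" by blast
  qed
 qed
qed

lemma continuous_Lp_vicsek:
 assumes f: "continuous_on K f" and p: "1 < p" shows "f : Lp_vicsek p"
proof -
 have m [measurable]: "f : borel_measurable vmu" by (rule measurable_continuous_vmu[OF f])
 have "compact (f ` K)" by (rule compact_continuous_image[OF f compact_vicsek])
 hence "bounded (f ` K)" by (rule compact_imp_bounded)
 then obtain B where B: "ALL x:K. \<bar>f x\<bar> <= B" unfolding bounded_iff by auto
 interpret prob_space vmu by (rule prob_vmu)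
 have "integrable vmu (%x. \<bar>f x\<bar> powr p)"
 proof (rule integrable_const_bound[where B="B powr p"])
  show "AE x in vmu. norm (abs (f x) powr p) <= B powr p" using AE_space
  proof eventually_elim
   case (elim x)
   hence "abs (f x) <= B" using B by (simp add: space_vmu)
   thus ?case using p by (simp add: powr_mono2)
  qed
 qed measurable
 thus ?thesis using m by (simp add: Lp_vicsek_def)
qed

text \<open>The converse passage: the gradient bounds the energies, or the increments along edges
  for the exponent infinity. Membership in L^p is automatic for continuous functions on a compact
  set.\<close>

lemma gradient_W1:
 assumes P: "1 <= P" shows "\<exists>C>0. ALL f g s. continuous_on K f --> lgrad f g --> 0 <= s --> gbound P g s -->
  f : W1 P & W1_seminorm P f <= ennreal (C * s)"
proof -
 consider "P = 1" | "P = \<infinity>" | p where "P = ereal p" "1 < p" using P by (cases P) (auto simp: one_ereal_def less_le)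
 thus ?thesis
 proof cases
  case 1
  show ?thesis
  proof (intro exI[of _ 1] conjI allI impI)
   fix f g s assume f: "continuous_on K f" and fg: "lgrad f g" and s: "0 <= s" "gbound P g s"
   have le: "(\<integral>\<^sup>+x. ennreal \<bar>g x\<bar> \<partial>vnu) <= ennreal s" using s by (simp add: gbound_def 1)
   have int: "integrable vnu g" using le_less_trans[OF le ennreal_less_top] integrable_vnu_iff[OF lgradD(1)[OF fg]] by simp
   show "f : W1 P" using f fg int by (auto simp: 1 W1_def sobolev_1_def is_gradient_iff)
   show "W1_seminorm P f <= ennreal (1 * s)" using le sobolev_seminorm_1_eq[OF fg int] by (simp add: 1 W1_seminorm_def)
  qed simp
 next
  case 2
  show ?thesis
  proof (intro exI[of _ 1] conjI allI impI)
   fix f g s assume f: "continuous_on K f" and fg: "lgrad f g" and s: "0 <= s" "gbound P g s"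
   have L: "AE x in vnu. \<bar>g x\<bar> <= s" using s by (simp add: gbound_def 2)
   have inc: "abs (f (pw w (q i)) - f (pw w (q 5))) <= s / 3 ^ n" if "w : words n" "i : {1..4}" for n w i
    using lgrad_bounded[OF fg L, of w i n] that by (simp add: earcs_iff incr_def)
   have lip: "abs (f x - f y) <= s * vdist x y" if "x : K" "y : K" for x y
    by (rule vdist_vertices_le[OF f inc that])
   have "EX L. ALL x:K. ALL y:K. \<bar>f x - f y\<bar> <= L * vdist x y" by (intro exI[of _ s] ballI lip)
   thus "f : W1 P" by (simp add: 2 W1_def sobolev_inf_def)
   have "sobolev_seminorm_inf f <= ennreal s" unfolding sobolev_seminorm_inf_def
   proof (rule SUP_least)
    fix z assume "z : {(x, y). x : K & y : K & x ~= y}"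
    then obtain x y where z: "z = (x, y)" "x : K" "y : K" "x ~= y" by (cases z) simp
    have "0 < dist x y" using z(4) by simp
    hence pos: "0 < vdist x y" using dist_le_vdist[OF z(2,3)] by linarith
    have "abs (f x - f y) / vdist x y <= s" using lip[OF z(2,3)] pos by (simp add: divide_le_eq)
    thus "(case z of (x, y) => ennreal (abs (f x - f y) / vdist x y)) <= ennreal s"
     unfolding z(1) prod.case by (rule ennreal_leI)
   qed
   thus "W1_seminorm P f <= ennreal (1 * s)" by (simp add: 2 W1_seminorm_def)
  qed simp
 next
  case 3
  obtain C where C: "0 < C" "ALL f E. continuous_on K f --> (ALL n. energy p (incr f) n <= E) -->
   sobolev_seminorm_p p f <= ennreal (C * E powr (1/p))" using sobolev_upper[OF 3(2)] by blast
  have P1: "P ~= 1" "P ~= \<infinity>" using 3 by (auto simp: one_ereal_def)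
  show ?thesis
  proof (intro exI[of _ C] conjI allI impI)
   show "0 < C" by (rule C(1))
   fix f g s assume f: "continuous_on K f" and fg: "lgrad f g" and s: "0 <= s" "gbound P g s"
   have "(\<integral>\<^sup>+x. ennreal (abs (g x) powr p) \<partial>vnu) <= ennreal (s powr p)" using s(2) P1 3(1) by (simp add: gbound_def)
   hence "energy p (incr f) n <= s powr p" for n by (rule lgrad_energy[OF 3(2) fg]) simp
   hence "sobolev_seminorm_p p f <= ennreal (C * (s powr p) powr (1/p))" using C(2) f by blast
   also have "(s powr p) powr (1/p) = s" using s(1) 3(2) by (simp add: powr_powr)
   finally have le: "sobolev_seminorm_p p f <= ennreal (C * s)" .
   hence "sobolev_seminorm_p p f < \<top>" by (rule le_less_trans) simp
   thus "f : W1 P" using f continuous_Lp_vicsek[OF f 3(2)] P1 3(1) by (simp add: W1_def sobolev_p_def)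
   show "W1_seminorm P f <= ennreal (C * s)" using le P1 3(1) by (simp add: W1_seminorm_def)
  qed
 qed
qed

section \<open>Powers, finiteness of seminorms and the weak type bound\<close>

lemma ennpowr_cmult:
 assumes c: "0 < c" shows "ennpowr (ennreal c * x) a = ennreal (c powr a) * ennpowr x a"
proof (cases x)
 case (real y)
 hence "ennreal c * x = ennreal (c * y)" using c by (simp add: ennreal_mult)
 hence "ennpowr (ennreal c * x) a = ennpowr (ennreal (c * y)) a" by (simp only:)
 also have "... = ennreal (c powr a * y powr a)" using real c by (simp add: ennpowr_def powr_mult)
 also have "... = ennreal (c powr a) * ennpowr x a" using real by (simp add: ennpowr_def ennreal_mult)
 finally show ?thesis .
next
 case top
 thus ?thesis using c by (simp add: ennpowr_def ennreal_mult_top)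
qed

lemma ennpowr_mono: "x <= y ==> 0 <= a ==> ennpowr x a <= ennpowr y a"
proof (cases y)
 case (real z)
 assume "x <= y" "0 <= a"
 thus ?thesis using ennpowr_le[of x z a] real by (simp add: ennpowr_def)
qed (simp add: ennpowr_def)

definition einv :: "ereal => real" where
 "einv P = (if P = \<infinity> then 0 else 1 / real_of_ereal P)"

lemma einv_bounds: assumes "1 <= P" shows "0 <= einv P" "einv P <= 1"
 using assms by (cases P; simp add: einv_def one_ereal_def)+

lemma W1_finite:
 assumes P: "1 <= P" and f: "f : W1 P" shows "W1_seminorm P f < \<top>"
proof -
 consider "P = 1" | "P = \<infinity>" | p where "P = ereal p" "1 < p" using P by (cases P) (auto simp: one_ereal_def less_le)
 thus ?thesis
 proof cases
  case 1
  from f obtain g where g: "lgrad f g" "integrable vnu g" by (auto simp: 1 W1_def sobolev_1_def is_gradient_iff)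
  thus ?thesis using sobolev_seminorm_1_eq[OF g] integrable_vnu_iff[OF lgradD(1)[OF g(1)]] by (simp add: 1 W1_seminorm_def)
 next
  case 2
  from f obtain L where L: "ALL x:K. ALL y:K. \<bar>f x - f y\<bar> <= L * vdist x y" by (auto simp: 2 W1_def sobolev_inf_def)
  have "sobolev_seminorm_inf f <= ennreal L" unfolding sobolev_seminorm_inf_def
  proof (rule SUP_least)
   fix z assume "z : {(x, y). x : K & y : K & x ~= y}"
   then obtain x y where z: "z = (x, y)" "x : K" "y : K" "x ~= y" by (cases z) simp
   have "0 < dist x y" using z(4) by simp
   hence pos: "0 < vdist x y" using dist_le_vdist[OF z(2,3)] by linarith
   have "abs (f x - f y) / vdist x y <= L" using L z(2,3) pos by (simp add: divide_le_eq)
   thus "(case z of (x, y) => ennreal (abs (f x - f y) / vdist x y)) <= ennreal L"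
    unfolding z(1) prod.case by (rule ennreal_leI)
  qed
  thus ?thesis using le_less_trans[OF _ ennreal_less_top] by (simp add: 2 W1_seminorm_def)
 next
  case 3
  thus ?thesis using f by (simp add: W1_def W1_seminorm_def sobolev_p_def one_ereal_def)
 qed
qed

text \<open>Chebyshev's inequality solved for the level; for the exponent infinity a level above
  \<open>s\<close> is exceeded only on a null set.\<close>

lemma weak_bound:
 assumes P: "1 <= P" and g [measurable]: "g : borel_measurable vnu" and b: "gbound P g s" and s: "0 <= s"
  and l: "0 < l" and Y: "0 < Y" "ennreal Y < emeasure vnu {x : space vnu. l < abs (g x)}"
 shows "l <= s * Y powr (- einv P)"
proof (cases "P = \<infinity>")
 case True
 have "\<not> s < l"
 proof
  assume sl: "s < l"
  have "AE x in vnu. \<bar>g x\<bar> <= s" using b True by (simp add: gbound_def)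
  hence "AE x in vnu. \<not> l < abs (g x)" by eventually_elim (use sl in simp)
  hence "emeasure vnu {x : space vnu. l < abs (g x)} = 0" by (subst (asm) AE_iff_measurable[OF _ refl]) auto
  thus False using Y by simp
 qed
 thus ?thesis using True Y by (simp add: einv_def)
next
 case False
 then obtain r where r: "P = ereal r" "1 <= r" using P by (cases P) (auto simp: one_ereal_def)
 have "ennreal (l powr r * Y) = ennreal (l powr r) * ennreal Y" using Y by (simp add: ennreal_mult)
 also have "... <= ennreal (l powr r) * emeasure vnu {x : space vnu. l < abs (g x)}" using Y by (intro mult_left_mono) auto
 also have "... = (\<integral>\<^sup>+x. ennreal (l powr r) * ind {x : space vnu. l < abs (g x)} x \<partial>vnu)"
  by (rule nn_integral_cmult_indicator[symmetric]) measurable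
 also have "... <= (\<integral>\<^sup>+x. ennreal (abs (g x) powr r) \<partial>vnu)"
  by (rule nn_integral_mono) (use l r in \<open>auto simp: indicator_def intro!: ennreal_leI powr_mono2\<close>)
 also have "... <= ennreal (s powr r)" using b r False by (simp add: gbound_def)
 finally have "l powr r * Y <= s powr r" by (subst (asm) ennreal_le_iff) auto
 hence "(l powr r * Y) powr (1 / r) <= (s powr r) powr (1 / r)" using Y r by (intro powr_mono2) auto
 hence "l * Y powr (1 / r) <= s" using l r s by (simp add: powr_mult powr_powr)
 hence "l * Y powr (1 / r) * Y powr (- (1 / r)) <= s * Y powr (- (1 / r))" by (intro mult_right_mono) auto
 moreover have "Y powr (1 / r) * Y powr (- (1 / r)) = 1" using Y by (simp add: powr_add[symmetric])
 ultimately show ?thesis using r by (simp add: einv_def mult.assoc)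
qed

section \<open>Interpolation\<close>

locale interpolation_exponents =
 fixes p1 p \<theta> :: real and p2 :: ereal
 assumes p1: "1 <= p1" and p1p: "p1 < p" and pp2: "ereal p < p2" and \<theta>0: "0 < \<theta>" and \<theta>1: "\<theta> < 1"
  and exponents: "1 / ereal p = ereal (1 - \<theta>) / ereal p1 + ereal \<theta> / p2"
begin

text \<open>Chosen so that t^(a/p1) and t^(a/p2) differ by exactly the factor \<open>t\<close> that
  weights the second seminorm in the K-functional.\<close>

definition a :: real where "a = 1 / (1 / p1 - einv p2)"

lemma p: "1 < p" using p1 p1p by simp

lemma P2: "1 <= p2" "p2 = \<infinity> \<or> (EX r. p2 = ereal r & p < r)" using pp2 p by (cases p2; auto simp: one_ereal_def)+

lemma einv_p2: "0 <= einv p2" "einv p2 < 1 / p" "einv p2 < 1 / p1" "1 / p < 1 / p1"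
proof -
 show "0 <= einv p2" by (rule einv_bounds[OF P2(1)])
 show 1: "einv p2 < 1 / p" using P2(2) p by (auto simp: einv_def intro!: divide_strict_left_mono)
 show 2: "1 / p < 1 / p1" using p1 p1p by (intro divide_strict_left_mono) auto
 show "einv p2 < 1 / p1" using 1 2 by simp
qed

lemma exponents_real: "1 / p = (1 - \<theta>) / p1 + \<theta> * einv p2" using P2(2)
proof
 assume "p2 = \<infinity>"
 thus ?thesis using exponents p p1 by (simp add: einv_def one_ereal_def)
next
 assume "EX r. p2 = ereal r & p < r"
 then obtain r where r: "p2 = ereal r" "p < r" by blast
 thus ?thesis using exponents p p1 by (simp add: einv_def one_ereal_def)
qed

lemma a: "0 < a" "a * (1 / p1 - einv p2) = 1" using einv_p2(3) by (simp_all add: a_def)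

lemma theta: "a * (1 / p1 - 1 / p) = \<theta>" "a * (einv p2 - 1 / p) = \<theta> - 1"
proof -
 have "1 / p1 - 1 / p = \<theta> * (1 / p1 - einv p2)" unfolding exponents_real by (simp add: diff_divide_distrib right_diff_distrib)
 hence "a * (1 / p1 - 1 / p) = \<theta> * (a * (1 / p1 - einv p2))" by simp
 thus 1: "a * (1 / p1 - 1 / p) = \<theta>" unfolding a(2) by simp
 have "a * (einv p2 - 1 / p) = a * (1 / p1 - 1 / p) - a * (1 / p1 - einv p2)" by (simp add: right_diff_distrib)
 thus "a * (einv p2 - 1 / p) = \<theta> - 1" unfolding 1 a(2) .
qed

abbreviation "Kf \<equiv> K_functional (W1 (ereal p1)) (W1_seminorm (ereal p1)) (W1 p2) (W1_seminorm p2)"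
abbreviation "intp \<equiv> interp_seminorm (W1 (ereal p1)) (W1_seminorm (ereal p1)) (W1 p2) (W1_seminorm p2) \<theta> p"
abbreviation "Xsum \<equiv> sum_space (W1 (ereal p1)) (W1 p2)"

lemma P1: "1 <= ereal p1" "1 <= ereal p" "ereal p1 ~= \<infinity>" "ereal p ~= \<infinity>" using p1 p by (simp_all add: one_ereal_def)

text \<open>The gradient is cut at its rearrangement \<open>L.T t\<close>. The parts have norms at
  most t^\<theta> h and t^(\<theta> - 1) h with h = \<open>L.Hs r t\<close>, so t^(-\<theta>) K(f,
  t) is at most a constant times h, and Hardy's inequality integrates this.\<close>

lemma interpolation_upper:
 "\<exists>C>0. ALL f s. f : W1 (ereal p) --> 0 <= s --> W1_seminorm (ereal p) f <= ennreal s --> f : Xsum & intp f <= ennreal (C * s)"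
proof -
 obtain Cg where Cg: "0 < Cg" "ALL f s. f : W1 (ereal p) --> 0 <= s --> W1_seminorm (ereal p) f <= ennreal s -->
  continuous_on K f & (EX g. lgrad f g & gbound (ereal p) g (Cg * s))" using W1_gradient[OF P1(2)] by blast
 obtain C0 where C0: "0 < C0" "ALL f g s. continuous_on K f --> lgrad f g --> 0 <= s --> gbound (ereal p1) g s -->
  f : W1 (ereal p1) & W1_seminorm (ereal p1) f <= ennreal (C0 * s)" using gradient_W1[OF P1(1)] by blast
 obtain C2 where C2: "0 < C2" "ALL f g s. continuous_on K f --> lgrad f g --> 0 <= s --> gbound p2 g s -->
  f : W1 p2 & W1_seminorm p2 f <= ennreal (C2 * s)" using gradient_W1[OF P2(1)] by blast
 \<comment> \<open>Both powers are below 1 because p1 < p < p2; one \<open>r\<close> has to dominate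
   the ratios for the smaller and for the larger scales.\<close>
 define r where "r = max ((2 :: real) powr (1 / p - 1 / p1)) (2 powr (einv p2 - 1 / p))"
 have neg: "(2 :: real) powr x < 1" if "x < 0" for x using powr_less_mono[of x 0 "2 :: real"] that by simp
 have r: "0 < r" "r < 1" "(2 :: real) powr (1 / p - 1 / p1) <= r" "(2 :: real) powr (einv p2 - 1 / p) <= r"
  unfolding r_def using neg einv_p2 by (auto simp: less_max_iff_disj)
 obtain C1 \<rho> where C1: "0 < C1" "0 < \<rho>" "\<rho> < 1"
  "!!y. (!!j. 0 <= y j) ==> ennpowr (\<Sum>j. ennreal (r ^ j * y j)) p <= ennreal C1 * (\<Sum>j. ennreal (\<rho> ^ j * y j powr p))"
  using geometric_suminf_powr[OF p r(1,2)] by blast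
 define Q where "Q = C1 * (4 powr p * (1 / (1 - \<rho>))) * (2 / a)"
 have Q: "0 < Q" using C1 a(1) by (simp add: Q_def)
 define c where "c = C0 + C2"
 have c: "0 < c" using C0(1) C2(1) by (simp add: c_def)
 have main: "f : Xsum & intp f <= ennreal ((c * Q powr (1 / p) * Cg) * s)"
  if f: "f : W1 (ereal p)" and s: "0 <= s" "W1_seminorm (ereal p) f <= ennreal s" for f s
 proof -
  have cont: "continuous_on K f" using Cg(2) f s by blast
  obtain g where fg: "lgrad f g" and gb: "gbound (ereal p) g (Cg * s)" using Cg(2) f s by blast
  define G where "G = (Cg * s) powr p"
  have G: "(\<integral>\<^sup>+x. ennreal (abs (g x) powr p) \<partial>vnu) <= ennreal G" "0 <= G" using gb by (simp_all add: gbound_def G_def)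
  note gm [measurable] = lgradD(1)[OF fg]
  interpret L: level_sets_finite vnu g a p G
   by (intro level_sets_finite.intro level_sets.intro sigma_finite_vnu level_sets_axioms.intro level_sets_finite_axioms.intro gm a(1) p G)
  have decomp: "EX f0 f1. f0 : W1 (ereal p1) & f1 : W1 p2 & f = (%x. f0 x + f1 x) \<and>
    W1_seminorm (ereal p1) f0 <= ennreal (C0 * (t powr \<theta> * h)) & W1_seminorm p2 f1 <= ennreal (C2 * (t powr (\<theta> - 1) * h))"
   if t: "0 < t" and h: "L.Hs r t = ennreal h" "0 <= h" for t h
  proof -
   define A where "A = {x. L.T t < abs (g x)}"
   define ga where "ga x = (if L.T t < abs (g x) then g x else 0)" for x
   define gb where "gb x = g x - ga x" for x
   have gam [measurable]: "ga : borel_measurable vnu" unfolding ga_def[abs_def] by measurable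
   have gap: "abs (ga x) powr P = abs (g x) powr P * ind {x. L.T t < abs (g x)} x" if "0 < P" for P x
    using that by (simp add: ga_def indicator_def)
   have gbp: "abs (gb x) powr P = abs (g x) powr P * ind {x. \<not> L.T t < abs (g x)} x" if "0 < P" for P x
    using that by (simp add: gb_def ga_def indicator_def)
   have "(\<integral>\<^sup>+x. ennreal (abs (ga x) powr p) \<partial>vnu) <= (\<integral>\<^sup>+x. ennreal (abs (g x) powr p) \<partial>vnu)"
    by (rule nn_integral_mono) (use p in \<open>simp add: ga_def\<close>)
   hence "(\<integral>\<^sup>+x. ennreal (abs (ga x) powr p) \<partial>vnu) <= ennreal G" using G(1) by (rule order_trans)
   \<comment> \<open>The large part is lifted in L^p with p > 1, where the lifting is continuous,
     although its norm is measured with exponent \<open>p1\<close>, possibly 1. The small part is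
     then the gradient of the difference.\<close>
   then obtain f0 where f0: "continuous_on K f0" "lgrad f0 ga" by (rule lgrad_lift[OF p gam _ G(2)])
   define f1 where "f1 x = f x - f0 x" for x
   have f1: "continuous_on K f1" "lgrad f1 gb"
    unfolding f1_def[abs_def] gb_def[abs_def] by (intro continuous_on_diff cont f0(1), rule lgrad_diff[OF fg f0(2)])
   have Yt: "(t powr a) powr x = t powr (a * x)" for x by (rule powr_powr)
   have b0: "gbound (ereal p1) ga (t powr \<theta> * h)"
   proof -
    have "(\<integral>\<^sup>+x. ennreal (abs (ga x) powr p1) \<partial>vnu) = (\<integral>\<^sup>+x. ennreal (abs (g x) powr p1) * ind {x. L.T t < abs (g x)} x \<partial>vnu)"
     by (rule nn_integral_cong) (use p1 in \<open>simp add: gap indicator_def\<close>)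
    also have "... <= ennreal (((t powr a) powr (1 / p1 - 1 / p) * h) powr p1)" by (rule L.upper_high[OF t p1 r(3) h])
    finally show ?thesis unfolding Yt theta by (simp add: gbound_def)
   qed
   have b1: "gbound p2 gb (t powr (\<theta> - 1) * h)" using P2(2)
   proof
    assume P: "p2 = \<infinity>"
    have "abs (gb x) <= t powr (\<theta> - 1) * h" for x
    proof (cases "L.T t < abs (g x)")
     case True
     thus ?thesis using h(2) by (simp add: gb_def ga_def)
    next
     case False
     have "abs (g x) <= (t powr a) powr (- (1 / p)) * h" by (rule L.upper_bounded[OF t less_imp_le[OF r(1)] h False])
     also have "(t powr a) powr (- (1 / p)) = t powr (\<theta> - 1)" unfolding Yt theta(2)[symmetric] using P by (simp add: einv_def)
     finally show ?thesis using False by (simp add: gb_def ga_def)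
    qed
    thus ?thesis using P by (simp add: gbound_def)
   next
    assume "EX r. p2 = ereal r & p < r"
    then obtain q where q: "p2 = ereal q" "p < q" by blast
    have q1: "1 <= q" using q(2) p by simp
    have e: "einv p2 = 1 / q" using q by (simp add: einv_def)
    have "(\<integral>\<^sup>+x. ennreal (abs (gb x) powr q) \<partial>vnu) = (\<integral>\<^sup>+x. ennreal (abs (g x) powr q) * ind {x. \<not> L.T t < abs (g x)} x \<partial>vnu)"
     by (rule nn_integral_cong) (use q1 in \<open>simp add: gbp indicator_def\<close>)
    also have "... <= ennreal (((t powr a) powr (1 / q - 1 / p) * h) powr q)" by (rule L.upper_low[OF t q1 r(4)[unfolded e] h])
    finally show ?thesis unfolding Yt e[symmetric] theta using q by (simp add: gbound_def)
   qed
   have n0: "f0 : W1 (ereal p1) & W1_seminorm (ereal p1) f0 <= ennreal (C0 * (t powr \<theta> * h))"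
    by (rule C0(2)[rule_format, OF f0 _ b0]) (use h(2) in simp)
   have n1: "f1 : W1 p2 & W1_seminorm p2 f1 <= ennreal (C2 * (t powr (\<theta> - 1) * h))"
    by (rule C2(2)[rule_format, OF f1 _ b1]) (use h(2) in simp)
   show ?thesis by (rule exI[of _ f0], rule exI[of _ f1]) (use n0 n1 in \<open>simp add: f1_def\<close>)
  qed
  have Kle: "ennreal (t powr (- \<theta>)) * Kf f t <= ennreal c * L.Hs r t" if t: "0 < t" for t
  proof (cases "L.Hs r t")
   case top
   thus ?thesis using c by (simp add: ennreal_mult_top)
  next
   case (real h)
   obtain f0 f1 where d: "f0 : W1 (ereal p1)" "f1 : W1 p2" "f = (%x. f0 x + f1 x)"
    "W1_seminorm (ereal p1) f0 <= ennreal (C0 * (t powr \<theta> * h))" "W1_seminorm p2 f1 <= ennreal (C2 * (t powr (\<theta> - 1) * h))"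
    using decomp[OF t real(2,1)] by blast
   have tt: "t * t powr (\<theta> - 1) = t powr \<theta>" using t by (simp add: powr_diff)
   have "Kf f t <= W1_seminorm (ereal p1) f0 + ennreal t * W1_seminorm p2 f1"
    unfolding K_functional_def by (rule Inf_lower) (use d in blast)
   also have "... <= ennreal (C0 * (t powr \<theta> * h)) + ennreal t * ennreal (C2 * (t powr (\<theta> - 1) * h))"
    by (intro add_mono mult_left_mono d) simp
   also have "... = ennreal (C0 * (t powr \<theta> * h) + C2 * ((t * t powr (\<theta> - 1)) * h))"
    using C0(1) C2(1) t real(1) by (simp add: ennreal_mult[symmetric] ennreal_plus[symmetric] mult_ac del: ennreal_plus)
   also have "... = ennreal (t powr \<theta> * (c * h))" unfolding tt by (rule arg_cong[where f=ennreal]) (simp add: c_def algebra_simps)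
   finally have "ennreal (t powr (- \<theta>)) * Kf f t <= ennreal (t powr (- \<theta>)) * ennreal (t powr \<theta> * (c * h))" by (rule mult_left_mono) simp
   also have "... = ennreal ((t powr (- \<theta>) * t powr \<theta>) * (c * h))" using c real(1) by (simp add: ennreal_mult[symmetric] mult.assoc)
   also have "t powr (- \<theta>) * t powr \<theta> = 1" using t by (simp add: powr_add[symmetric])
   finally show ?thesis using real c by (simp add: ennreal_mult)
  qed
  let ?I = "\<integral>\<^sup>+t. ennpowr (L.Hs r t) p * ennreal (1 / t) * ind {0<..} t \<partial>lborel"
  have I: "?I <= ennreal (Q * G)"
  proof -
   have "Q * G = C1 * (4 powr p * (1 / (1 - \<rho>))) * (2 * (G / a))" by (simp add: Q_def)
   thus ?thesis using L.Hs_integral[OF r(1) C1(2,3,1,4)] by (simp only:)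
  qed
  \<comment> \<open>Finiteness of the integral provides one such \<open>t\<close>, and the
    decomposition there puts \<open>f\<close> into the sum space.\<close>
  have "\<exists>t>0. L.Hs r t ~= \<top>"
  proof (rule ccontr)
   assume no: "\<not> ?thesis"
   have "(\<integral>\<^sup>+t. \<top> * ind {0<..<1 :: real} t \<partial>lborel) <= ?I"
   proof (rule nn_integral_mono)
    fix t :: real
    show "\<top> * ind {0<..<1} t <= ennpowr (L.Hs r t) p * ennreal (1 / t) * ind {0<..} t"
    proof (cases "0 < t & t < 1")
     case True
     hence "L.Hs r t = \<top>" using no by blast
     thus ?thesis using True by (simp add: ennpowr_def ennreal_top_mult)
    qed (auto simp: indicator_def)
   qed
   moreover have "(\<integral>\<^sup>+t. \<top> * ind {0<..<1 :: real} t \<partial>lborel) = \<top>"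
    by (subst nn_integral_cmult_indicator) (auto simp: ennreal_top_mult)
   ultimately show False using le_less_trans[OF I ennreal_less_top] by (auto simp: top_unique)
  qed
  then obtain t0 where t0: "0 < t0" "L.Hs r t0 ~= \<top>" by blast
  then obtain h where h: "L.Hs r t0 = ennreal h" "0 <= h" by (cases "L.Hs r t0") auto
  have fs: "f : Xsum" unfolding sum_space_def using decomp[OF t0(1) h] by blast
  have "(\<integral>\<^sup>+t. ennpowr (ennreal (t powr (- \<theta>)) * Kf f t) p * ennreal (1 / t) * ind {0<..} t \<partial>lborel)
   <= (\<integral>\<^sup>+t. ennreal (c powr p) * (ennpowr (L.Hs r t) p * ennreal (1 / t) * ind {0<..} t) \<partial>lborel)"
  proof (rule nn_integral_mono)
   fix t :: real
   show "ennpowr (ennreal (t powr (- \<theta>)) * Kf f t) p * ennreal (1 / t) * ind {0<..} t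
    <= ennreal (c powr p) * (ennpowr (L.Hs r t) p * ennreal (1 / t) * ind {0<..} t)"
   proof (cases "0 < t")
    case True
    have "ennpowr (ennreal (t powr (- \<theta>)) * Kf f t) p <= ennpowr (ennreal c * L.Hs r t) p"
     by (rule ennpowr_mono[OF Kle[OF True]]) (use p in simp)
    hence "ennpowr (ennreal (t powr (- \<theta>)) * Kf f t) p <= ennreal (c powr p) * ennpowr (L.Hs r t) p" unfolding ennpowr_cmult[OF c] .
    thus ?thesis unfolding mult.assoc[symmetric] by (intro mult_right_mono) auto
   qed simp
  qed
  also have "... <= ennreal (c powr p) * ?I" by (rule nn_integral_cmult_le) (use c in simp)
  also have "... <= ennreal (c powr p) * ennreal (Q * G)" by (intro mult_left_mono I) simp
  also have "... = ennreal (c powr p * (Q * G))" using Q G(2) by (simp add: ennreal_mult)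
  finally have "intp f <= ennreal ((c powr p * (Q * G)) powr (1 / p))"
   unfolding interp_seminorm_def by (rule ennpowr_le) (use p Q G(2) in auto)
  also have "(c powr p * (Q * G)) powr (1 / p) = (c * Q powr (1 / p) * Cg) * s"
   unfolding G_def using p c Cg(1) s(1) by (simp add: powr_mult powr_powr)
  finally show ?thesis using fs by blast
 qed
 show ?thesis by (rule exI[of _ "c * Q powr (1 / p) * Cg"]) (use main c Q Cg(1) in auto)
qed

text \<open>For any splitting of \<open>f\<close> the gradients add almost everywhere, so where the
  sum exceeds \<open>l\<close> one of them exceeds l/2. The weak type bounds show that the
  rearrangement at t^a is at most a constant times t^(-a/p1) K(f, t), and the layer-cake formula
  integrates this.\<close>

lemma interpolation_lower:
 "\<exists>C>0. ALL f s. f : Xsum --> 0 <= s --> intp f <= ennreal s --> f : W1 (ereal p) & W1_seminorm (ereal p) f <= ennreal (C * s)"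
proof -
 obtain Cw where Cw: "0 < Cw" "ALL f g s. continuous_on K f --> lgrad f g --> 0 <= s --> gbound (ereal p) g s -->
  f : W1 (ereal p) & W1_seminorm (ereal p) f <= ennreal (Cw * s)" using gradient_W1[OF P1(2)] by blast
 obtain C0 where C0: "0 < C0" "ALL f s. f : W1 (ereal p1) --> 0 <= s --> W1_seminorm (ereal p1) f <= ennreal s -->
  continuous_on K f & (EX g. lgrad f g & gbound (ereal p1) g (C0 * s))" using W1_gradient[OF P1(1)] by blast
 obtain C2 where C2: "0 < C2" "ALL f s. f : W1 p2 --> 0 <= s --> W1_seminorm p2 f <= ennreal s -->
  continuous_on K f & (EX g. lgrad f g & gbound p2 g (C2 * s))" using W1_gradient[OF P2(1)] by blast
 \<comment> \<open>One factor 2 comes from halving the level, the other from halving the measure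
   t^a.\<close>
 define D where "D = 4 * (C0 + C2)"
 have D: "0 < D" using C0(1) C2(1) by (simp add: D_def)
 have main: "f : W1 (ereal p) & W1_seminorm (ereal p) f <= ennreal ((Cw * (a * D powr p) powr (1 / p)) * s)"
  if f: "f : Xsum" and s: "0 <= s" "intp f <= ennreal s" for f s
 proof -
  have grads: "EX s0 s1 g0 g1. W1_seminorm (ereal p1) h0 = ennreal s0 & W1_seminorm p2 h1 = ennreal s1 & 0 <= s0 & 0 <= s1 \<and>
    continuous_on K h0 & continuous_on K h1 & lgrad h0 g0 & lgrad h1 g1 & gbound (ereal p1) g0 (C0 * s0) & gbound p2 g1 (C2 * s1)"
   if h: "h0 : W1 (ereal p1)" "h1 : W1 p2" for h0 h1
  proof -
   obtain s0 where s0: "W1_seminorm (ereal p1) h0 = ennreal s0" "0 <= s0"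
    using W1_finite[OF P1(1) h(1)] by (cases "W1_seminorm (ereal p1) h0") auto
   obtain s1 where s1: "W1_seminorm p2 h1 = ennreal s1" "0 <= s1"
    using W1_finite[OF P2(1) h(2)] by (cases "W1_seminorm p2 h1") auto
   have "continuous_on K h0 & (EX g. lgrad h0 g & gbound (ereal p1) g (C0 * s0))"
    using C0(2)[rule_format, OF h(1) s0(2)] s0(1) by simp
   moreover have "continuous_on K h1 & (EX g. lgrad h1 g & gbound p2 g (C2 * s1))"
    using C2(2)[rule_format, OF h(2) s1(2)] s1(1) by simp
   ultimately show ?thesis using s0 s1 by blast
  qed
  obtain k0 k1 where k: "k0 : W1 (ereal p1)" "k1 : W1 p2" "f = (%x. k0 x + k1 x)"
   using f unfolding sum_space_def by blast
  obtain g0 g1 where gk: "continuous_on K k0" "continuous_on K k1" "lgrad k0 g0" "lgrad k1 g1" using grads[OF k(1,2)] by blast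
  define g where "g x = g0 x + g1 x" for x
  have fg: "lgrad f g" unfolding k(3) g_def[abs_def] by (rule lgrad_add[OF gk(3,4)])
  have cont: "continuous_on K f" unfolding k(3) by (rule continuous_on_add[OF gk(1,2)])
  note gm [measurable] = lgradD(1)[OF fg]
  interpret L: level_sets vnu g a p by (intro level_sets.intro sigma_finite_vnu level_sets_axioms.intro gm a(1) p)
  have key: "ennreal l <= ennreal (D * t powr (- (a / p1))) * Kf f t"
   if t: "0 < t" and l: "0 < l" and dl: "ennreal (t powr a) < L.dst l" for t l
  proof -
   let ?E = "D * t powr (- (a / p1))"
   have E: "0 < ?E" using D t by simp
   have "ennreal (l / ?E) <= Kf f t" unfolding K_functional_def
   proof (rule Inf_greatest)
    fix z assume "z : {W1_seminorm (ereal p1) f0 + ennreal t * W1_seminorm p2 f1 | f0 f1.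
      f0 : W1 (ereal p1) & f1 : W1 p2 & f = (%x. f0 x + f1 x)}"
    then obtain h0 h1 where z: "z = W1_seminorm (ereal p1) h0 + ennreal t * W1_seminorm p2 h1"
     and h: "h0 : W1 (ereal p1)" "h1 : W1 p2" "f = (%x. h0 x + h1 x)" by blast
    obtain s0 s1 u0 u1 where u: "W1_seminorm (ereal p1) h0 = ennreal s0" "W1_seminorm p2 h1 = ennreal s1" "0 <= s0" "0 <= s1"
     "lgrad h0 u0" "lgrad h1 u1" "gbound (ereal p1) u0 (C0 * s0)" "gbound p2 u1 (C2 * s1)" using grads[OF h(1,2)] by blast
    note [measurable] = lgradD(1)[OF u(5)] lgradD(1)[OF u(6)]
    have "lgrad f (%x. u0 x + u1 x)" unfolding h(3) by (rule lgrad_add[OF u(5,6)])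
    from lgrad_unique[OF fg this] have ae: "AE x in vnu. g x = u0 x + u1 x" .
    let ?A0 = "{x : space vnu. l / 2 < abs (u0 x)}" and ?A1 = "{x : space vnu. l / 2 < abs (u1 x)}"
    have "L.dst l <= emeasure vnu (?A0 Un ?A1)" unfolding L.dst_eq
    proof (rule emeasure_mono_AE)
     show "AE x in vnu. x : {x : space vnu. l < abs (g x)} --> x : ?A0 Un ?A1" using ae
     proof eventually_elim
      case (elim x)
      have "abs (g x) <= abs (u0 x) + abs (u1 x)" unfolding elim by (rule abs_triangle_ineq)
      hence "l < abs (g x) ==> l / 2 < abs (u0 x) \<or> l / 2 < abs (u1 x)" by linarith
      thus ?case by blast
     qed
    qed measurable
    also have "... <= emeasure vnu ?A0 + emeasure vnu ?A1" by (rule emeasure_subadditive) measurable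
    finally have lt: "ennreal (t powr a) < emeasure vnu ?A0 + emeasure vnu ?A1" using dl by (rule less_le_trans[rotated])
    define Y where "Y = t powr a / 2"
    have Y: "0 < Y" "ennreal Y + ennreal Y = ennreal (t powr a)"
     using t by (simp_all add: Y_def ennreal_plus[symmetric] del: ennreal_plus)
    have or: "ennreal Y < emeasure vnu ?A0 \<or> ennreal Y < emeasure vnu ?A1"
    proof (rule ccontr)
     assume "\<not> ?thesis"
     hence "emeasure vnu ?A0 + emeasure vnu ?A1 <= ennreal Y + ennreal Y" by (intro add_mono) (auto simp: not_less)
     thus False using lt unfolding Y(2) by simp
    qed
    have half: "Y powr (- b) <= 2 * t powr (- (a * b))" if b: "0 <= b" "b <= 1" for b
    proof -
     have "Y powr (- b) = 2 powr b * t powr (- (a * b))" unfolding Y_def powr_divide using t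
      by (simp add: powr_powr powr_minus field_simps)
     also have "2 powr b <= 2 powr (1 :: real)" using b by (intro powr_mono) auto
     finally show ?thesis by (simp add: mult_right_mono)
    qed
    \<comment> \<open>By the choice of \<open>a\<close> the weak bound for the second part carries
      exactly the factor \<open>t\<close> of the K-functional.\<close>
    have tp: "t powr (- (a * einv p2)) = t powr (- (a / p1)) * t"
    proof -
     have e: "- (a * einv p2) = - (a / p1) + 1" using a(2) by (simp add: right_diff_distrib)
     show ?thesis unfolding e powr_add using t by simp
    qed
    have l2: "0 < l / 2" using l by simp
    have nn: "0 <= C0 * s0" "0 <= C2 * s1" using C0(1) C2(1) u(3,4) by simp_all
    have "l <= ?E * (s0 + t * s1)" using or
    proof
     assume "ennreal Y < emeasure vnu ?A0"
     hence "l / 2 <= (C0 * s0) * Y powr (- einv (ereal p1))"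
      by (intro weak_bound[OF P1(1) _ u(7) nn(1) l2 Y(1)]) measurable
     also have "... <= (C0 * s0) * (2 * t powr (- (a * einv (ereal p1))))" by (intro mult_left_mono half einv_bounds P1 nn)
     also have "... = 2 * t powr (- (a / p1)) * (C0 * s0)" by (simp add: einv_def)
     also have "... <= 2 * t powr (- (a / p1)) * ((C0 + C2) * (s0 + t * s1))"
      using C0(1) C2(1) u(3,4) t by (intro mult_left_mono mult_mono) auto
     finally have "l / 2 <= 2 * t powr (- (a / p1)) * ((C0 + C2) * (s0 + t * s1))" .
     moreover have "?E * (s0 + t * s1) = 2 * (2 * t powr (- (a / p1)) * ((C0 + C2) * (s0 + t * s1)))"
      unfolding D_def by (simp add: algebra_simps)
     ultimately show ?thesis by linarith
    next
     assume "ennreal Y < emeasure vnu ?A1"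
     hence "l / 2 <= (C2 * s1) * Y powr (- einv p2)" by (intro weak_bound[OF P2(1) _ u(8) nn(2) l2 Y(1)]) measurable
     also have "... <= (C2 * s1) * (2 * t powr (- (a * einv p2)))" by (intro mult_left_mono half einv_bounds P2 nn)
     also have "... = 2 * t powr (- (a / p1)) * (C2 * (t * s1))" unfolding tp by simp
     also have "... <= 2 * t powr (- (a / p1)) * ((C0 + C2) * (s0 + t * s1))"
      using C0(1) C2(1) u(3,4) t by (intro mult_left_mono mult_mono) auto
     finally have "l / 2 <= 2 * t powr (- (a / p1)) * ((C0 + C2) * (s0 + t * s1))" .
     moreover have "?E * (s0 + t * s1) = 2 * (2 * t powr (- (a / p1)) * ((C0 + C2) * (s0 + t * s1)))"
      unfolding D_def by (simp add: algebra_simps)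
     ultimately show ?thesis by linarith
    qed
    hence "l / ?E <= s0 + t * s1" using E by (simp add: divide_le_eq mult.commute)
    hence "ennreal (l / ?E) <= ennreal (s0 + t * s1)" by (rule ennreal_leI)
    also have "... = z" unfolding z u(1,2) using u(3,4) t by (simp add: ennreal_mult)
    finally show "ennreal (l / ?E) <= z" .
   qed
   hence "ennreal ?E * ennreal (l / ?E) <= ennreal ?E * Kf f t" by (rule mult_left_mono) simp
   moreover have "ennreal ?E * ennreal (l / ?E) = ennreal l"
   proof -
    have "ennreal ?E * ennreal (l / ?E) = ennreal (?E * (l / ?E))" using E l by (intro ennreal_mult[symmetric]) auto
    also have "?E * (l / ?E) = l" using E by (metis less_irrefl nonzero_mult_div_cancel_left times_divide_eq_right)
    finally show ?thesis .
   qed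
   ultimately show ?thesis by simp
  qed
  let ?J = "%t. ennpowr (ennreal (t powr (- \<theta>)) * Kf f t) p * ennreal (1 / t) * ind {0<..} t"
  have I: "(\<integral>\<^sup>+t. ?J t \<partial>lborel) <= ennreal (s powr p)"
   using ennpowr_leD[of "\<integral>\<^sup>+t. ?J t \<partial>lborel" "1 / p" s] s p unfolding interp_seminorm_def by simp
  have "(\<integral>\<^sup>+x. ennreal (abs (g x) powr p) \<partial>vnu) <= (\<integral>\<^sup>+t. wt a t * ennpowr (ennreal (D * t powr (- (a / p1))) * Kf f t) p \<partial>lborel)"
   by (rule L.interpolation_lower[OF key])
  also have "... = (\<integral>\<^sup>+t. ennreal (a * D powr p) * ?J t \<partial>lborel)"
  proof (rule nn_integral_cong)
   fix t :: real
   show "wt a t * ennpowr (ennreal (D * t powr (- (a / p1))) * Kf f t) p = ennreal (a * D powr p) * ?J t"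
   proof (cases "0 < t")
    case True
    let ?c = "D * t powr (- (a / p))"
    have c: "0 < ?c" using D True by simp
    \<comment> \<open>The factor t^(-a/p), raised to the power p, combines with the density in
      \<open>wt a t\<close> to 1/t; t^(-\<theta>) is the weight of the interpolation
      seminorm.\<close>
    have e: "- (a / p1) = - (a / p) + - \<theta>" using theta(1) by (simp add: right_diff_distrib)
    have "ennreal (D * t powr (- (a / p1))) = ennreal ?c * ennreal (t powr (- \<theta>))"
     unfolding e powr_add using D by (simp add: ennreal_mult[symmetric] mult.assoc)
    hence 1: "ennpowr (ennreal (D * t powr (- (a / p1))) * Kf f t) p = ennreal (?c powr p) * ennpowr (ennreal (t powr (- \<theta>)) * Kf f t) p"
     by (simp only: mult.assoc ennpowr_cmult[OF c])
    have "a * t powr (a - 1) * ?c powr p = a * D powr p * (1 / t)"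
    proof -
     have "?c powr p = D powr p * t powr (- a)" unfolding powr_mult using p by (simp add: powr_powr)
     moreover have "t powr (a - 1) * t powr (- a) = 1 / t"
     proof -
      have "t powr (a - 1) * t powr (- a) = t powr ((a - 1) + - a)" by (rule powr_add[symmetric])
      also have "(a - 1) + - a = -1" by simp
      also have "t powr -1 = 1 / t" using True by (simp add: powr_minus_divide)
      finally show ?thesis .
     qed
     ultimately show ?thesis by (simp add: mult_ac)
    qed
    hence 2: "ennreal (a * t powr (a - 1)) * ennreal (?c powr p) = ennreal (a * D powr p) * ennreal (1 / t)"
     using a(1) D True by (simp add: ennreal_mult[symmetric])
    have "wt a t * ennpowr (ennreal (D * t powr (- (a / p1))) * Kf f t) p
     = (ennreal (a * t powr (a - 1)) * ennreal (?c powr p)) * ennpowr (ennreal (t powr (- \<theta>)) * Kf f t) p"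
     unfolding 1 using True by (simp add: wt_def mult.assoc)
    also have "... = ennreal (a * D powr p) * ?J t" unfolding 2 using True by (simp add: mult_ac)
    finally show ?thesis .
   qed (simp add: wt_def)
  qed
  also have "... <= ennreal (a * D powr p) * (\<integral>\<^sup>+t. ?J t \<partial>lborel)" by (rule nn_integral_cmult_le) (use a(1) D in simp)
  also have "... <= ennreal (a * D powr p) * ennreal (s powr p)" by (intro mult_left_mono I) simp
  also have "... = ennreal ((a * D powr p) * s powr p)" using a(1) by (simp add: ennreal_mult)
  also have "(a * D powr p) * s powr p = ((a * D powr p) powr (1 / p) * s) powr p"
  proof -
   have "((a * D powr p) powr (1 / p)) powr p = a * D powr p" using a(1) p by (simp add: powr_powr)
   thus ?thesis unfolding powr_mult[of "(a * D powr p) powr (1 / p)"] by simp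
  qed
  finally have "gbound (ereal p) g ((a * D powr p) powr (1 / p) * s)" by (simp add: gbound_def)
  moreover have "0 <= (a * D powr p) powr (1 / p) * s" using s(1) by simp
  ultimately have "f : W1 (ereal p) & W1_seminorm (ereal p) f <= ennreal (Cw * ((a * D powr p) powr (1 / p) * s))"
   using Cw(2) cont fg by blast
  thus ?thesis by (simp only: mult.assoc)
 qed
 show ?thesis by (rule exI[of _ "Cw * (a * D powr p) powr (1 / p)"]) (use main Cw(1) a(1) D in auto)
qed

lemma equal_spaces:
 "equal_seminormed_spaces (W1 (ereal p)) (W1_seminorm (ereal p))
  (interp_space (W1 (ereal p1)) (W1_seminorm (ereal p1)) (W1 p2) (W1_seminorm p2) \<theta> p) intp"
proof -
 obtain C where C: "0 < C" "ALL f s. f : W1 (ereal p) --> 0 <= s --> W1_seminorm (ereal p) f <= ennreal s --> f : Xsum & intp f <= ennreal (C * s)"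
  using interpolation_upper by blast
 obtain C' where C': "0 < C'" "ALL f s. f : Xsum --> 0 <= s --> intp f <= ennreal s --> f : W1 (ereal p) & W1_seminorm (ereal p) f <= ennreal (C' * s)"
  using interpolation_lower by blast
 have up: "f : Xsum & intp f < \<top> & intp f <= ennreal C * W1_seminorm (ereal p) f" if f: "f : W1 (ereal p)" for f
 proof -
  obtain s where s: "W1_seminorm (ereal p) f = ennreal s" "0 <= s"
   using W1_finite[OF P1(2) f] by (cases "W1_seminorm (ereal p) f") auto
  have *: "f : Xsum & intp f <= ennreal (C * s)" using C(2) f s by simp
  moreover have "intp f < \<top>" by (rule le_less_trans[OF conjunct2[OF *] ennreal_less_top])
  ultimately show ?thesis using C(1) s by (simp add: ennreal_mult)
 qed
 have low: "f : W1 (ereal p) & W1_seminorm (ereal p) f <= ennreal C' * intp f" if f: "f : Xsum" "intp f < \<top>" for f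
 proof -
  obtain s where s: "intp f = ennreal s" "0 <= s" using f(2) by (cases "intp f") auto
  have "f : W1 (ereal p) & W1_seminorm (ereal p) f <= ennreal (C' * s)" using C'(2) f s by simp
  thus ?thesis using C'(1) s by (simp add: ennreal_mult)
 qed
 have mx: "ennreal C * x <= ennreal (max C C') * x" "ennreal C' * x <= ennreal (max C C') * x" for x
  by (intro mult_right_mono ennreal_leI; simp)+
 show ?thesis unfolding equal_seminormed_spaces_def interp_space_def
 proof (intro conjI exI[of _ "max C C'"] ballI)
  show "W1 (ereal p) = {f : Xsum. intp f < \<top>}" using up low by blast
  show "0 < max C C'" using C(1) by simp
  fix f assume f: "f : W1 (ereal p)"
  show "W1_seminorm (ereal p) f <= ennreal (max C C') * intp f"
   using order_trans[OF conjunct2[OF low] mx(2)] up[OF f] by blast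
  show "intp f <= ennreal (max C C') * W1_seminorm (ereal p) f"
   using order_trans[OF conjunct2[OF conjunct2[OF up[OF f]]] mx(1)] .
 qed
qed

end

theorem theorem5p9:
  fixes p1 p \<theta> :: real and p2 :: ereal
  assumes "1 \<le> p1" and "p1 < p" and "ereal p < p2"
    and "0 < \<theta>" and "\<theta> < 1"
    and "1 / ereal p = ereal (1 - \<theta>) / ereal p1 + ereal \<theta> / p2"
  shows "equal_seminormed_spaces
           (W1 (ereal p)) (W1_seminorm (ereal p))
           (interp_space (W1 (ereal p1)) (W1_seminorm (ereal p1)) (W1 p2) (W1_seminorm p2) \<theta> p)
           (interp_seminorm (W1 (ereal p1)) (W1_seminorm (ereal p1)) (W1 p2) (W1_seminorm p2) \<theta> p)"
  by (rule interpolation_exponents.equal_spaces, rule interpolation_exponents.intro) (fact assms)+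

end
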